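(* Let $k$ be a field and let $$A=k\langle X,Y\rangle/(X^a,\ XY-qYX,\ Y^b)$$ be a quantum complete intersection with $a,b\ge2$ and $q\in k$ nonzero and not a root of unity in $k$. Then for $n\in\mathbb{Z}$, $$\dim_k\widehat{\mathrm{HH}}^n(A,A)=\begin{cases}1 & \text{if } n=0\\ 2 & \text{if } n=1\\ 1 & \text{if } n=2\\ 0 & \text{if } n\neq0,1,2.\end{cases}$$
   Context: $A^e=A\otimes_kA^{op}$ is the enveloping algebra, which is selfinjective here; a bimodule $B$ is a left $A^e$-module via $(\lambda\otimes\lambda')b=\lambda b\lambda'$. A complete resolution of $A$ over $A^e$ is an acyclic complex $\mathbb{T}$ of finitely generated projective left $A^e$-modules, indexed by $\mathbb{Z}$, such that $\mathrm{Hom}_{A^e}(\mathbb{T},A^e)$ is acyclic and such that there are a projective resolution $\mathbb{P}$ of $A$ and a chain map $f\colon\mathbb{T}\to\mathbb{P}$ with $f_n$ bijective for $n\ge 0$. For $n\in\mathbb{Z}$ and a bimodule $B$, Tate-Hochschild cohomology is $\widehat{\mathrm{HH}}^n(A,B)=\widehat{\mathrm{Ext}}^n_{A^e}(A,B)=H^n(\mathrm{Hom}_{A^e}(\mathbb{T},B))$. *)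

theory Defs
  imports "Jordan_Normal_Form.Missing_VectorSpace" "HOL-Algebra.QuotRing"
begin

text \<open>
  An algebra over a field \<open>K\<close> is a record of type \<open>('k, 'a) module\<close>: its ring fields give the
  (not necessarily commutative) ring, its \<open>smult\<close> field the scalar multiplication by \<open>K\<close>.
  A left module over a ring with elements of type \<open>'r\<close> is a record of type \<open>('r, 'm) module\<close>
  whose \<open>mult\<close> and \<open>one\<close> fields play no role. The library locale \<^locale>\<open>module\<close> covers
  commutative rings only.
\<close>

locale left_module = R?: ring R + M?: abelian_group M
  for R :: "('r, 'z) ring_scheme" (structure) and M :: "('r, 'm, 'y) module_scheme" (structure) +
  assumes smult_closed:
      "\<lbrakk>r \<in> carrier R; x \<in> carrier M\<rbrakk> \<Longrightarrow> r \<odot>\<^bsub>M\<^esub> x \<in> carrier M"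
    and smult_l_distr:
      "\<lbrakk>r \<in> carrier R; s \<in> carrier R; x \<in> carrier M\<rbrakk> \<Longrightarrow>
        (r \<oplus> s) \<odot>\<^bsub>M\<^esub> x = r \<odot>\<^bsub>M\<^esub> x \<oplus>\<^bsub>M\<^esub> s \<odot>\<^bsub>M\<^esub> x"
    and smult_r_distr:
      "\<lbrakk>r \<in> carrier R; x \<in> carrier M; y \<in> carrier M\<rbrakk> \<Longrightarrow>
        r \<odot>\<^bsub>M\<^esub> (x \<oplus>\<^bsub>M\<^esub> y) = r \<odot>\<^bsub>M\<^esub> x \<oplus>\<^bsub>M\<^esub> r \<odot>\<^bsub>M\<^esub> y"
    and smult_assoc:
      "\<lbrakk>r \<in> carrier R; s \<in> carrier R; x \<in> carrier M\<rbrakk> \<Longrightarrow>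
        (r \<otimes> s) \<odot>\<^bsub>M\<^esub> x = r \<odot>\<^bsub>M\<^esub> (s \<odot>\<^bsub>M\<^esub> x)"
    and smult_one:
      "x \<in> carrier M \<Longrightarrow> \<one> \<odot>\<^bsub>M\<^esub> x = x"

definition regular_module :: "('a, 'z) ring_scheme \<Rightarrow> ('a, 'a) module" where
  "regular_module R = \<lparr>carrier = carrier R, mult = mult R, one = one R,
     zero = zero R, add = add R, smult = mult R\<rparr>"

definition supp :: "('r, 'z) ring_scheme \<Rightarrow> ('i \<Rightarrow> 'r) \<Rightarrow> 'i set" where
  "supp R f = {i. f i \<noteq> \<zero>\<^bsub>R\<^esub>}"

text \<open>The free left module on \<open>I\<close>: finitely supported families of elements of \<open>R\<close>, extended
  by zero outside \<open>I\<close>.\<close>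

definition free_module :: "('r, 'z) ring_scheme \<Rightarrow> 'i set \<Rightarrow> ('r, 'i \<Rightarrow> 'r) module" where
  "free_module R I = \<lparr>carrier = {f. range f \<subseteq> carrier R \<and> supp R f \<subseteq> I \<and> finite (supp R f)},
     mult = undefined, one = undefined,
     zero = (\<lambda>i. \<zero>\<^bsub>R\<^esub>), add = (\<lambda>f g i. f i \<oplus>\<^bsub>R\<^esub> g i), smult = (\<lambda>r f i. r \<otimes>\<^bsub>R\<^esub> f i)\<rparr>"

text \<open>For an ideal of an algebra this is \<open>R Quot I\<close> with the induced scalar multiplication;
  for a submodule of a module it is the quotient module.\<close>

definition quot_module :: "('k, 'a) module \<Rightarrow> 'a set \<Rightarrow> ('k, 'a set) module" where
  "quot_module M N = \<lparr>carrier = carrier (M Quot N), mult = mult (M Quot N), one = one (M Quot N),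
     zero = zero (M Quot N), add = add (M Quot N),
     smult = (\<lambda>c X. \<Union>x\<in>X. N +>\<^bsub>M\<^esub> (c \<odot>\<^bsub>M\<^esub> x))\<rparr>"


section \<open>Algebras\<close>

definition basis_elt :: "('k, 'z) ring_scheme \<Rightarrow> 'i \<Rightarrow> 'i \<Rightarrow> 'k" where
  "basis_elt K i = (\<lambda>j. if j = i then \<one>\<^bsub>K\<^esub> else \<zero>\<^bsub>K\<^esub>)"

definition monoid_algebra ::
    "('k, 'z) ring_scheme \<Rightarrow> ('i, 'y) monoid_scheme \<Rightarrow> ('k, 'i \<Rightarrow> 'k) module" where
  "monoid_algebra K G = (free_module K (carrier G))
     \<lparr>mult := (\<lambda>f g z. \<Oplus>\<^bsub>K\<^esub>p\<in>{p \<in> supp K f \<times> supp K g. fst p \<otimes>\<^bsub>G\<^esub> snd p = z}. f (fst p) \<otimes>\<^bsub>K\<^esub> g (snd p)),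
      one := basis_elt K \<one>\<^bsub>G\<^esub>\<rparr>"

definition free_monoid :: "'x list monoid" where
  "free_monoid = \<lparr>carrier = UNIV, mult = (@), one = []\<rparr>"

definition free_algebra :: "('k, 'z) ring_scheme \<Rightarrow> ('k, 'x list \<Rightarrow> 'k) module" where
  "free_algebra K = monoid_algebra K free_monoid"

datatype qci_var = Var_X | Var_Y

definition qci ::
    "('k, 'z) ring_scheme \<Rightarrow> nat \<Rightarrow> nat \<Rightarrow> 'k \<Rightarrow> ('k, (qci_var list \<Rightarrow> 'k) set) module" where
  "qci K a b q =
    (let F = free_algebra K; X = basis_elt K [Var_X]; Y = basis_elt K [Var_Y]
     in quot_module F
          (Idl\<^bsub>F\<^esub> {X [^]\<^bsub>F\<^esub> a, (X \<otimes>\<^bsub>F\<^esub> Y) \<ominus>\<^bsub>F\<^esub> (q \<odot>\<^bsub>F\<^esub> (Y \<otimes>\<^bsub>F\<^esub> X)), Y [^]\<^bsub>F\<^esub> b}))"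

definition opposite_algebra :: "('k, 'a) module \<Rightarrow> ('k, 'a) module" where
  "opposite_algebra A = A\<lparr>mult := (\<lambda>x y. y \<otimes>\<^bsub>A\<^esub> x)\<rparr>"

text \<open>
  The tensor product over \<open>K\<close> of two algebras, as the quotient of the free \<open>K\<close>-module on
  \<open>carrier A \<times> carrier B\<close> by the bilinearity relations. Here that free module carries the
  product \<open>(x, y) (x', y') = (x x', y y')\<close>; multiplying a relation by a pair gives a relation
  again, so the ideal generated by the relations is just their linear span.
\<close>

definition tensor_relations ::
    "('k, 'z) ring_scheme \<Rightarrow> ('k, 'a) module \<Rightarrow> ('k, 'b) module \<Rightarrow> ('a \<times> 'b \<Rightarrow> 'k) set" where
  "tensor_relations K A B =
    (let F = monoid_algebra K (A \<times>\<times> B); t = (\<lambda>x y. basis_elt K (x, y))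
     in {t (x \<oplus>\<^bsub>A\<^esub> x') y \<ominus>\<^bsub>F\<^esub> (t x y \<oplus>\<^bsub>F\<^esub> t x' y) | x x' y.
           x \<in> carrier A \<and> x' \<in> carrier A \<and> y \<in> carrier B} \<union>
        {t x (y \<oplus>\<^bsub>B\<^esub> y') \<ominus>\<^bsub>F\<^esub> (t x y \<oplus>\<^bsub>F\<^esub> t x y') | x y y'.
           x \<in> carrier A \<and> y \<in> carrier B \<and> y' \<in> carrier B} \<union>
        {t (c \<odot>\<^bsub>A\<^esub> x) y \<ominus>\<^bsub>F\<^esub> (c \<odot>\<^bsub>F\<^esub> t x y) | c x y.
           c \<in> carrier K \<and> x \<in> carrier A \<and> y \<in> carrier B} \<union>
        {t x (c \<odot>\<^bsub>B\<^esub> y) \<ominus>\<^bsub>F\<^esub> (c \<odot>\<^bsub>F\<^esub> t x y) | c x y.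
           c \<in> carrier K \<and> x \<in> carrier A \<and> y \<in> carrier B})"

definition tensor_algebra ::
    "('k, 'z) ring_scheme \<Rightarrow> ('k, 'a) module \<Rightarrow> ('k, 'b) module \<Rightarrow> ('k, ('a \<times> 'b \<Rightarrow> 'k) set) module" where
  "tensor_algebra K A B =
    (let F = monoid_algebra K (A \<times>\<times> B) in quot_module F (Idl\<^bsub>F\<^esub> (tensor_relations K A B)))"

definition enveloping_algebra ::
    "('k, 'z) ring_scheme \<Rightarrow> ('k, 'a) module \<Rightarrow> ('k, ('a \<times> 'a \<Rightarrow> 'k) set) module" where
  "enveloping_algebra K A = tensor_algebra K A (opposite_algebra A)"

text \<open>\<open>A\<close> as a bimodule over itself, that is, as a left module over its enveloping algebra: the
  class of \<open>\<Sum> c\<^sub>i (\<lambda>\<^sub>i, \<lambda>\<^sub>i')\<close> sends \<open>x\<close> to \<open>\<Sum> c\<^sub>i (\<lambda>\<^sub>i x \<lambda>\<^sub>i')\<close>, which does not depend on the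
  representative; the products are those of \<open>A\<close>, not of its opposite.\<close>

definition regular_bimodule ::
    "('k, 'z) ring_scheme \<Rightarrow> ('k, 'a) module \<Rightarrow> (('a \<times> 'a \<Rightarrow> 'k) set, 'a) module" where
  "regular_bimodule K A = \<lparr>carrier = carrier A, mult = mult A, one = one A,
     zero = zero A, add = add A,
     smult = (\<lambda>u x. the_elem ((\<lambda>f. \<Oplus>\<^bsub>A\<^esub>p\<in>supp K f. f p \<odot>\<^bsub>A\<^esub> (fst p \<otimes>\<^bsub>A\<^esub> x \<otimes>\<^bsub>A\<^esub> snd p)) ` u))\<rparr>"


section \<open>Complete resolutions\<close>

definition fin_gen_module :: "('r, 'z) ring_scheme \<Rightarrow> ('r, 'm) module \<Rightarrow> bool" where
  "fin_gen_module R M \<longleftrightarrow> (\<exists>S. finite S \<and> S \<subseteq> carrier M \<and>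
     carrier M = {\<Oplus>\<^bsub>M\<^esub>s\<in>S. c s \<odot>\<^bsub>M\<^esub> s | c. c \<in> S \<rightarrow> carrier R})"

text \<open>Projective: a direct summand of a free module. A projective \<open>M\<close> is a direct summand of
  the free module on the set \<open>carrier M\<close>, so index sets of type \<open>'m set\<close> suffice.\<close>

definition projective_module :: "('r, 'z) ring_scheme \<Rightarrow> ('r, 'm) module \<Rightarrow> bool" where
  "projective_module R M \<longleftrightarrow> left_module R M \<and>
     (\<exists>(I :: 'm set) s p. s \<in> module_hom R M (free_module R I) \<and>
        p \<in> module_hom R (free_module R I) M \<and> (\<forall>x\<in>carrier M. p (s x) = x))"

text \<open>Complexes are indexed by the integers, with differentials \<open>d n\<close> from degree \<open>n\<close> to
  degree \<open>n - 1\<close>.\<close>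

definition module_complex ::
    "('r, 'z) ring_scheme \<Rightarrow> (int \<Rightarrow> ('r, 'm) module) \<Rightarrow> (int \<Rightarrow> 'm \<Rightarrow> 'm) \<Rightarrow> bool" where
  "module_complex R C d \<longleftrightarrow>
     (\<forall>n. left_module R (C n)) \<and>
     (\<forall>n. d n \<in> module_hom R (C n) (C (n - 1))) \<and>
     (\<forall>n. \<forall>x\<in>carrier (C (n + 1)). d n (d (n + 1) x) = \<zero>\<^bsub>C (n - 1)\<^esub>)"

definition exact_at :: "(int \<Rightarrow> ('r, 'm) module) \<Rightarrow> (int \<Rightarrow> 'm \<Rightarrow> 'm) \<Rightarrow> int \<Rightarrow> bool" where
  "exact_at C d n \<longleftrightarrow>
     d (n + 1) ` carrier (C (n + 1)) = {x \<in> carrier (C n). d n x = \<zero>\<^bsub>C (n - 1)\<^esub>}"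

text \<open>Restricting to extensional functions makes equality of homomorphisms coincide with
  equality on the carrier.\<close>

definition Hom_set ::
    "('r, 'z) ring_scheme \<Rightarrow> ('r, 'm) module \<Rightarrow> ('r, 'n) module \<Rightarrow> ('m \<Rightarrow> 'n) set" where
  "Hom_set R M N = module_hom R M N \<inter> extensional (carrier M)"

definition Hom_cocycles :: "('r, 'z) ring_scheme \<Rightarrow> (int \<Rightarrow> ('r, 'm) module) \<Rightarrow>
    (int \<Rightarrow> 'm \<Rightarrow> 'm) \<Rightarrow> ('r, 'n) module \<Rightarrow> int \<Rightarrow> ('m \<Rightarrow> 'n) set" where
  "Hom_cocycles R C d N n =
     {f \<in> Hom_set R (C n) N. \<forall>x\<in>carrier (C (n + 1)). f (d (n + 1) x) = \<zero>\<^bsub>N\<^esub>}"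

definition Hom_coboundaries :: "('r, 'z) ring_scheme \<Rightarrow> (int \<Rightarrow> ('r, 'm) module) \<Rightarrow>
    (int \<Rightarrow> 'm \<Rightarrow> 'm) \<Rightarrow> ('r, 'n) module \<Rightarrow> int \<Rightarrow> ('m \<Rightarrow> 'n) set" where
  "Hom_coboundaries R C d N n =
     (\<lambda>g. compose (carrier (C n)) g (d n)) ` Hom_set R (C (n - 1)) N"

definition projective_resolution :: "('r, 'z) ring_scheme \<Rightarrow> ('r, 'n) module \<Rightarrow>
    (int \<Rightarrow> ('r, 'm) module) \<Rightarrow> (int \<Rightarrow> 'm \<Rightarrow> 'm) \<Rightarrow> ('m \<Rightarrow> 'n) \<Rightarrow> bool" where
  "projective_resolution R M P d \<epsilon> \<longleftrightarrow>
     module_complex R P d \<and>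
     (\<forall>n. projective_module R (P n)) \<and>
     (\<forall>n<0. carrier (P n) = {\<zero>\<^bsub>P n\<^esub>}) \<and>
     \<epsilon> \<in> module_hom R (P 0) M \<and>
     \<epsilon> ` carrier (P 0) = carrier M \<and>
     d 1 ` carrier (P 1) = {x \<in> carrier (P 0). \<epsilon> x = \<zero>\<^bsub>M\<^esub>} \<and>
     (\<forall>n\<ge>1. exact_at P d n)"

text \<open>Taking the elements of \<open>P\<close> from the same type as those of \<open>T\<close> loses nothing, since
  \<open>P n\<close> is isomorphic to \<open>T n\<close> for \<open>n \<ge> 0\<close> and zero for \<open>n < 0\<close>.\<close>

definition complete_resolution :: "('r, 'z) ring_scheme \<Rightarrow> ('r, 'n) module \<Rightarrow>
    (int \<Rightarrow> ('r, 'm) module) \<Rightarrow> (int \<Rightarrow> 'm \<Rightarrow> 'm) \<Rightarrow> bool" where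
  "complete_resolution R M T d \<longleftrightarrow>
     module_complex R T d \<and>
     (\<forall>n. projective_module R (T n) \<and> fin_gen_module R (T n)) \<and>
     (\<forall>n. exact_at T d n) \<and>
     (\<forall>n. Hom_coboundaries R T d (regular_module R) n = Hom_cocycles R T d (regular_module R) n) \<and>
     (\<exists>(P :: int \<Rightarrow> ('r, 'm) module) e \<epsilon> f.
        projective_resolution R M P e \<epsilon> \<and>
        (\<forall>n. f n \<in> module_hom R (T n) (P n)) \<and>
        (\<forall>n. \<forall>x\<in>carrier (T n). f (n - 1) (d n x) = e n (f n x)) \<and>
        (\<forall>n\<ge>0. bij_betw (f n) (carrier (T n)) (carrier (P n))))"


section \<open>Tate cohomology\<close>

text \<open>\<open>Hom\<^sub>R(M, N)\<close> as a vector space over the ground field of the algebra \<open>R\<close>, which acts on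
  \<open>N\<close> through \<open>c \<mapsto> c \<cdot> 1\<close>.\<close>

definition Hom_space ::
    "('k, 'r) module \<Rightarrow> ('r, 'm) module \<Rightarrow> ('r, 'n) module \<Rightarrow> ('k, 'm \<Rightarrow> 'n) module" where
  "Hom_space R M N = \<lparr>carrier = Hom_set R M N, mult = undefined, one = undefined,
     zero = (\<lambda>x\<in>carrier M. \<zero>\<^bsub>N\<^esub>),
     add = (\<lambda>f g. \<lambda>x\<in>carrier M. f x \<oplus>\<^bsub>N\<^esub> g x),
     smult = (\<lambda>c f. \<lambda>x\<in>carrier M. (c \<odot>\<^bsub>R\<^esub> \<one>\<^bsub>R\<^esub>) \<odot>\<^bsub>N\<^esub> f x)\<rparr>"

text \<open>The cohomology \<open>H\<^sup>n(Hom\<^sub>R(T, N))\<close>.\<close>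

definition Hom_cohomology :: "('k, 'r) module \<Rightarrow> (int \<Rightarrow> ('r, 'm) module) \<Rightarrow>
    (int \<Rightarrow> 'm \<Rightarrow> 'm) \<Rightarrow> ('r, 'n) module \<Rightarrow> int \<Rightarrow> ('k, ('m \<Rightarrow> 'n) set) module" where
  "Hom_cohomology R T d N n =
     quot_module ((Hom_space R (T n) N)\<lparr>carrier := Hom_cocycles R T d N n\<rparr>)
       (Hom_coboundaries R T d N n)"

text \<open>The Tate-Hochschild cohomology of \<open>A\<close> with coefficients in the left module \<open>B\<close> over the
  enveloping algebra, computed from a complete resolution \<open>(T, d)\<close> of \<open>A\<close>.\<close>

definition tate_hochschild :: "('k, 'z) ring_scheme \<Rightarrow> ('k, 'a) module \<Rightarrow>
    (int \<Rightarrow> (('a \<times> 'a \<Rightarrow> 'k) set, 'm) module) \<Rightarrow> (int \<Rightarrow> 'm \<Rightarrow> 'm) \<Rightarrow>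
    (('a \<times> 'a \<Rightarrow> 'k) set, 'n) module \<Rightarrow> int \<Rightarrow> ('k, ('m \<Rightarrow> 'n) set) module" where
  "tate_hochschild K A T d B n = Hom_cohomology (enveloping_algebra K A) T d B n"

text \<open>Since \<open>vectorspace.dim\<close> is only meaningful in finite dimension, finiteness is part of
  the definition.\<close>

definition has_dimension :: "('k, 'z) ring_scheme \<Rightarrow> ('k, 'v) module \<Rightarrow> nat \<Rightarrow> bool" where
  "has_dimension K V m \<longleftrightarrow>
     vectorspace K V \<and> vectorspace.fin_dim K V \<and> vectorspace.dim K V = m"

end

theory Submission imports "HOL-Algebra.Multiplicative_Group" Defs begin

text \<open>Write \<open>R\<close> for the enveloping algebra. Since \<open>Hom (T, F)\<close> is acyclic for every free \<open>F\<close> of finite rank,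
  dimension shifting along any acyclic complex \<open>C\<close> of such modules that augments to \<open>A\<close> in degree \<open>0\<close>
  identifies the cohomology of \<open>Hom (T, A)\<close> in degree \<open>n\<close> with the homology in degree \<open>- n - 1\<close> of the
  invariants of \<open>C\<close>, the elements on which \<open>x\<close> and \<open>y\<close> act in the same way from both sides; no
  comparison of \<open>T\<close> with \<open>C\<close> is needed. For \<open>C\<close> take the total complex of a bicomplex of free modules of
  rank one at the positions of the first and of the third quadrant, whose rows and columns alternate
  between a twisted commutator \<open>X - c X'\<close> and its complementary factor in \<open>X^n - (c X')^n\<close>; the quadrants
  are joined by a multiple of the Casimir element. The invariants of \<open>R\<close> have coordinates indexed by the
  monomials of \<open>A\<close>, on which every differential is a shift followed by multiplication with scalars. As \<open>q\<close>
  is not a root of unity, the homology is spanned by the four positions where these scalars vanish: one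
  in degree \<open>-1\<close>, two in degree \<open>-2\<close> and one in degree \<open>-3\<close>.\<close>

section \<open>Monoid algebras and their quotients\<close>

text \<open>Since \<open>T\<close> is arbitrary, everything is fed into the functor Hom(T, -):
  projectivity of the \<open>T n\<close> provides lifts, acyclicity of the duals provides
  primitives, and the syzygies of the explicit complex carry the rest of the computation. The twists
  come from q-commutation. A homogeneous element of degree f in y passes one of degree e in x at the
  cost of q^(e f), so row \<open>j\<close> must carry the power of q given by the internal degree of
  the j-th generator over k[y]/(y^b), and similarly for columns. The invariants have one coordinate
  for each monomial because A is a Frobenius algebra: the socle coefficient of the left tensor
  factor determines an invariant, and its values may be prescribed. A differential shifts these
  coordinates with the scalar u - v or u^(n-1) + ... + v^(n-1), where u and v are powers of q. If
  the exponents differ, the scalar is invertible, as q has infinite order. If they agree, the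
  difference is 0, whereas the long sum is n times a power of q, which may or may not vanish in K.
  The argument never decides which: homology arises only where the exponents agree in both
  directions, and there the long differentials already vanish because they shift out of
  range.\<close>

lemma (in abelian_group) minus_eq_zeroD: "x \<in> carrier G \<Longrightarrow> y \<in> carrier G \<Longrightarrow> x \<ominus> y = \<zero> \<Longrightarrow> x = y"
  using minus_equality[of x "\<ominus> y"] by (simp add: minus_eq)

lemma (in abelian_monoid) finsum_reindex_fibres:
  assumes "finite A" and "f \<in> A \<rightarrow> carrier G"
  shows "(\<Oplus>z\<in>m ` A. \<Oplus>p\<in>{p \<in> A. m p = z}. f p) = (\<Oplus>p\<in>A. f p)"
proof -
  have "(\<Oplus>p\<in>(\<Union>z\<in>m ` A. {p \<in> A. m p = z}). f p) = (\<Oplus>z\<in>m ` A. \<Oplus>p\<in>{p \<in> A. m p = z}. f p)"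
    by (rule add.finprod_UN_disjoint) (use assms in \<open>auto simp: pairwise_def disjnt_def\<close>)
  moreover have "(\<Union>z\<in>m ` A. {p \<in> A. m p = z}) = A" by auto
  ultimately show ?thesis by simp
qed

lemma (in abelian_monoid) finsum_cartesian:
  assumes "finite A" "finite B" and "\<And>x y. x \<in> A \<Longrightarrow> y \<in> B \<Longrightarrow> f x y \<in> carrier G"
  shows "(\<Oplus>p\<in>A \<times> B. f (fst p) (snd p)) = (\<Oplus>x\<in>A. \<Oplus>y\<in>B. f x y)"
proof -
  have "(\<Oplus>p\<in>(\<Union>x\<in>A. {x} \<times> B). f (fst p) (snd p)) = (\<Oplus>x\<in>A. \<Oplus>p\<in>{x} \<times> B. f (fst p) (snd p))"
    by (rule add.finprod_UN_disjoint) (use assms in \<open>auto simp: pairwise_def disjnt_def\<close>)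
  moreover have "(\<Union>x\<in>A. {x} \<times> B) = A \<times> B" by auto
  moreover have row: "(\<Oplus>p\<in>{x} \<times> B. f (fst p) (snd p)) = (\<Oplus>y\<in>B. f x y)" if "x \<in> A" for x
  proof -
    have "{x} \<times> B = Pair x ` B" by auto
    have "(\<Oplus>p\<in>Pair x ` B. f (fst p) (snd p)) = (\<Oplus>y\<in>B. f (fst (x, y)) (snd (x, y)))"
      by (rule finsum_reindex) (use assms that in \<open>auto simp: inj_on_def\<close>)
    then show ?thesis using \<open>{x} \<times> B = Pair x ` B\<close> by simp
  qed
  moreover have "(\<Oplus>x\<in>A. \<Oplus>p\<in>{x} \<times> B. f (fst p) (snd p)) = (\<Oplus>x\<in>A. \<Oplus>y\<in>B. f x y)"
    by (rule finsum_cong'[OF refl _ row]) (use assms in auto)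
  ultimately show ?thesis by simp
qed

section \<open>Monoid algebras, studied through linear functionals\<close>

locale monoid_alg = K?: field K + G?: monoid G
  for K :: "('k, 'z) ring_scheme" (structure) and G :: "('g, 'y) monoid_scheme" (structure)
begin

abbreviation F where "F \<equiv> monoid_algebra K G"
abbreviation bas where "bas \<equiv> basis_elt K"

lemma F_carrier: "f \<in> carrier F \<longleftrightarrow> range f \<subseteq> carrier K \<and> supp K f \<subseteq> carrier G \<and> finite (supp K f)"
  by (simp add: monoid_algebra_def free_module_def)

lemma F_simps:
  "zero F = (\<lambda>i. \<zero>)" "add F f g = (\<lambda>i. f i \<oplus> g i)"
  "smult F c f = (\<lambda>i. c \<otimes> f i)" "one F = bas \<one>\<^bsub>G\<^esub>"
  "mult F f g = (\<lambda>z. \<Oplus>p\<in>{p \<in> supp K f \<times> supp K g. fst p \<otimes>\<^bsub>G\<^esub> snd p = z}. f (fst p) \<otimes> g (snd p))"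
  by (simp_all add: monoid_algebra_def free_module_def)

lemma F_val [simp]: "f \<in> carrier F \<Longrightarrow> f g \<in> carrier K"
  by (auto simp: F_carrier)

lemma F_supp: assumes "f \<in> carrier F" shows "supp K f \<subseteq> carrier G" "finite (supp K f)"
  using assms by (auto simp: F_carrier)

lemma F_outside: "f \<in> carrier F \<Longrightarrow> g \<notin> supp K f \<Longrightarrow> f g = \<zero>"
  by (auto simp: supp_def)

lemma F_suppD: "f \<in> carrier F \<Longrightarrow> g \<in> supp K f \<Longrightarrow> g \<in> carrier G"
  using F_supp(1) by blast

lemma term_closed: "f \<in> carrier F \<Longrightarrow> \<beta> \<in> carrier G \<rightarrow> carrier K \<Longrightarrow> g \<in> carrier G \<Longrightarrow> f g \<otimes> \<beta> g \<in> carrier K"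
  by (auto intro!: K.m_closed)

text \<open>The linear extension of a function on the monoid. Products in a monoid algebra are sums
  over the fibres of the multiplication and awkward to rearrange; identities are therefore checked
  after pairing with every \<open>\<beta>\<close>.\<close>

definition ev :: "('g \<Rightarrow> 'k) \<Rightarrow> ('g \<Rightarrow> 'k) \<Rightarrow> 'k" where
  "ev \<beta> f = (\<Oplus>g\<in>supp K f. f g \<otimes> \<beta> g)"

lemma ev_superset:
  assumes "f \<in> carrier F" "\<beta> \<in> carrier G \<rightarrow> carrier K" "finite B" "supp K f \<subseteq> B" "B \<subseteq> carrier G"
  shows "ev \<beta> f = (\<Oplus>g\<in>B. f g \<otimes> \<beta> g)"
  unfolding ev_def
  by (rule K.add.finprod_mono_neutral_cong_left)
     (use assms in \<open>auto simp: F_outside subset_iff Pi_iff\<close>)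

lemma ev_closed [simp]: "f \<in> carrier F \<Longrightarrow> \<beta> \<in> carrier G \<rightarrow> carrier K \<Longrightarrow> ev \<beta> f \<in> carrier K"
  unfolding ev_def by (rule K.finsum_closed) (auto intro: term_closed F_suppD)

lemma ev_cong: "f \<in> carrier F \<Longrightarrow> \<gamma> \<in> carrier G \<rightarrow> carrier K \<Longrightarrow>
   (\<And>g. g \<in> carrier G \<Longrightarrow> \<beta> g = \<gamma> g) \<Longrightarrow> ev \<beta> f = ev \<gamma> f"
  unfolding ev_def by (rule K.finsum_cong') (auto intro: term_closed F_suppD dest: F_suppD)

lemma bas_closed [simp]: "g \<in> carrier G \<Longrightarrow> bas g \<in> carrier F"
  by (auto simp: F_carrier basis_elt_def supp_def)

lemma zero_closed [simp]: "(\<lambda>i. \<zero>) \<in> carrier F"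
  by (auto simp: F_carrier supp_def)

lemma add_closed [simp]: assumes "f \<in> carrier F" "g \<in> carrier F" shows "f \<oplus>\<^bsub>F\<^esub> g \<in> carrier F"
proof -
  have "supp K (\<lambda>i. f i \<oplus> g i) \<subseteq> supp K f \<union> supp K g" by (auto simp: supp_def)
  then show ?thesis using assms F_val[OF assms(1)] F_val[OF assms(2)] unfolding F_carrier F_simps
    by (auto intro: finite_subset)
qed

lemma smult_closed [simp]: assumes "c \<in> carrier K" "f \<in> carrier F" shows "c \<odot>\<^bsub>F\<^esub> f \<in> carrier F"
proof -
  have "supp K (\<lambda>i. c \<otimes> f i) \<subseteq> supp K f" using assms by (auto simp: supp_def)
  then show ?thesis using assms F_val[OF assms(2)] unfolding F_carrier F_simps
    by (auto intro: finite_subset)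
qed

lemma ev_zero [simp]: "ev \<beta> (\<lambda>i. \<zero>) = \<zero>"
  unfolding ev_def by (simp add: supp_def)

lemma ev_bas [simp]: assumes "g \<in> carrier G" "\<beta> \<in> carrier G \<rightarrow> carrier K" shows "ev \<beta> (bas g) = \<beta> g"
proof -
  have "ev \<beta> (bas g) = (\<Oplus>h\<in>{g}. bas g h \<otimes> \<beta> h)"
    by (rule ev_superset[OF bas_closed]) (use assms in \<open>auto simp: supp_def basis_elt_def\<close>)
  also have "\<dots> = \<beta> g" using assms by (auto simp: basis_elt_def Pi_iff K.finsum_insert)
  finally show ?thesis .
qed

lemma ev_add [simp]:
  assumes "f \<in> carrier F" "h \<in> carrier F" "\<beta> \<in> carrier G \<rightarrow> carrier K"
  shows "ev \<beta> (f \<oplus>\<^bsub>F\<^esub> h) = ev \<beta> f \<oplus> ev \<beta> h"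
proof -
  let ?B = "supp K f \<union> supp K h"
  have B: "finite ?B" "?B \<subseteq> carrier G" using assms(1,2) by (auto simp: F_carrier)
  have s: "supp K (f \<oplus>\<^bsub>F\<^esub> h) \<subseteq> ?B" by (auto simp: supp_def F_simps)
  have "ev \<beta> (f \<oplus>\<^bsub>F\<^esub> h) = (\<Oplus>g\<in>?B. (f \<oplus>\<^bsub>F\<^esub> h) g \<otimes> \<beta> g)"
    by (rule ev_superset) (use assms B s in auto)
  also have "\<dots> = (\<Oplus>g\<in>?B. f g \<otimes> \<beta> g \<oplus> h g \<otimes> \<beta> g)"
    by (rule K.finsum_cong') (use assms B in \<open>auto simp: F_simps K.l_distr Pi_iff subset_iff\<close>)
  also have "\<dots> = (\<Oplus>g\<in>?B. f g \<otimes> \<beta> g) \<oplus> (\<Oplus>g\<in>?B. h g \<otimes> \<beta> g)"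
    by (rule K.finsum_addf) (use assms B in \<open>auto simp: Pi_iff subset_iff\<close>)
  also have "(\<Oplus>g\<in>?B. f g \<otimes> \<beta> g) = ev \<beta> f"
    by (rule ev_superset[symmetric]) (use assms B in auto)
  also have "(\<Oplus>g\<in>?B. h g \<otimes> \<beta> g) = ev \<beta> h"
    by (rule ev_superset[symmetric]) (use assms B in auto)
  finally show ?thesis .
qed

lemma ev_smult [simp]:
  assumes "f \<in> carrier F" "c \<in> carrier K" "\<beta> \<in> carrier G \<rightarrow> carrier K"
  shows "ev \<beta> (c \<odot>\<^bsub>F\<^esub> f) = c \<otimes> ev \<beta> f"
proof -
  let ?B = "supp K f"
  have B: "finite ?B" "?B \<subseteq> carrier G" using assms(1) by (auto simp: F_carrier)
  have s: "supp K (c \<odot>\<^bsub>F\<^esub> f) \<subseteq> ?B" using assms by (auto simp: supp_def F_simps)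
  have "ev \<beta> (c \<odot>\<^bsub>F\<^esub> f) = (\<Oplus>g\<in>?B. (c \<odot>\<^bsub>F\<^esub> f) g \<otimes> \<beta> g)"
    by (rule ev_superset) (use assms B s in auto)
  also have "\<dots> = (\<Oplus>g\<in>?B. c \<otimes> (f g \<otimes> \<beta> g))"
    by (rule K.finsum_cong') (use assms B in \<open>auto simp: F_simps K.m_assoc Pi_iff subset_iff\<close>)
  also have "\<dots> = c \<otimes> ev \<beta> f" unfolding ev_def
    by (rule K.finsum_rdistr[symmetric]) (use assms B in \<open>auto simp: Pi_iff subset_iff\<close>)
  finally show ?thesis .
qed

lemma mult_closed [simp]: assumes "f \<in> carrier F" "h \<in> carrier F" shows "f \<otimes>\<^bsub>F\<^esub> h \<in> carrier F"
proof -
  let ?B = "(\<lambda>p. fst p \<otimes>\<^bsub>G\<^esub> snd p) ` (supp K f \<times> supp K h)"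
  have "(f \<otimes>\<^bsub>F\<^esub> h) z = \<zero>" if "z \<notin> ?B" for z
  proof -
    have e: "{p \<in> supp K f \<times> supp K h. fst p \<otimes>\<^bsub>G\<^esub> snd p = z} = {}" using that by force
    show ?thesis unfolding F_simps e by simp
  qed
  then have "supp K (f \<otimes>\<^bsub>F\<^esub> h) \<subseteq> ?B" by (auto simp: supp_def)
  moreover have "finite ?B" "?B \<subseteq> carrier G" using assms F_supp(2)[OF assms(1)] F_supp(2)[OF assms(2)]
    by (auto intro!: G.m_closed dest: F_suppD)
  moreover have "(f \<otimes>\<^bsub>F\<^esub> h) z \<in> carrier K" for z unfolding F_simps
    by (intro K.finsum_closed) (use assms in auto)
  ultimately show ?thesis unfolding F_carrier 
    by (auto dest: finite_subset)
qed

text \<open>Regrouping the fibre sums into one sum over pairs turns the evaluation of a product into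
  an iterated evaluation. The ring laws below reduce to this formula and to the laws of the
  monoid.\<close>

lemma ev_mult:
  assumes f: "f \<in> carrier F" and h: "h \<in> carrier F" and b: "\<beta> \<in> carrier G \<rightarrow> carrier K"
  shows "ev \<beta> (f \<otimes>\<^bsub>F\<^esub> h) = ev (\<lambda>u. ev (\<lambda>v. \<beta> (u \<otimes>\<^bsub>G\<^esub> v)) h) f"
proof -
  let ?P = "supp K f \<times> supp K h"
  let ?m = "\<lambda>p. fst p \<otimes>\<^bsub>G\<^esub> snd p"
  let ?w = "\<lambda>p. f (fst p) \<otimes> h (snd p)"
  have fin: "finite ?P" and sub: "?P \<subseteq> carrier G \<times> carrier G" using F_supp[OF f] F_supp[OF h] by auto
  have wc: "?w p \<in> carrier K" for p using f h by simp
  have mc: "?m p \<in> carrier G" if "p \<in> ?P" for p using that sub by auto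
  have wmc: "?w p \<otimes> \<beta> (?m p) \<in> carrier K" if "p \<in> ?P" for p
    using wc[of p] funcset_mem[OF b mc[OF that]] by (rule K.m_closed)
  have z0: "(f \<otimes>\<^bsub>F\<^esub> h) z = \<zero>" if "z \<notin> ?m ` ?P" for z
  proof -
    have e: "{p \<in> ?P. ?m p = z} = {}" using that by force
    show ?thesis unfolding F_simps e by simp
  qed
  have "ev \<beta> (f \<otimes>\<^bsub>F\<^esub> h) = (\<Oplus>z\<in>?m ` ?P. (f \<otimes>\<^bsub>F\<^esub> h) z \<otimes> \<beta> z)"
  proof (rule ev_superset[OF mult_closed[OF f h] b])
    show "finite (?m ` ?P)" using fin by simp
    show "supp K (f \<otimes>\<^bsub>F\<^esub> h) \<subseteq> ?m ` ?P" using z0 unfolding supp_def by blast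
    show "?m ` ?P \<subseteq> carrier G" using mc by blast
  qed
  also have "\<dots> = (\<Oplus>z\<in>?m ` ?P. \<Oplus>p\<in>{p \<in> ?P. ?m p = z}. ?w p \<otimes> \<beta> (?m p))"
  proof (rule K.finsum_cong')
    show "(\<lambda>z. \<Oplus>p\<in>{p \<in> ?P. ?m p = z}. ?w p \<otimes> \<beta> (?m p)) \<in> ?m ` ?P \<rightarrow> carrier K"
      by (intro Pi_I K.finsum_closed) (simp add: wmc del: mem_Times_iff mem_Sigma_iff)
    fix z assume z: "z \<in> ?m ` ?P"
    then have zc: "\<beta> z \<in> carrier K" using mc b by blast
    have "(f \<otimes>\<^bsub>F\<^esub> h) z \<otimes> \<beta> z = (\<Oplus>p\<in>{p \<in> ?P. ?m p = z}. ?w p \<otimes> \<beta> z)"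
      unfolding F_simps by (rule K.finsum_ldistr) (use fin zc wc in auto)
    also have "\<dots> = (\<Oplus>p\<in>{p \<in> ?P. ?m p = z}. ?w p \<otimes> \<beta> (?m p))"
      by (rule K.finsum_cong') (use zc wc in auto)
    finally show "(f \<otimes>\<^bsub>F\<^esub> h) z \<otimes> \<beta> z = \<dots>" .
  qed simp
  also have "\<dots> = (\<Oplus>p\<in>?P. ?w p \<otimes> \<beta> (?m p))"
    by (rule K.finsum_reindex_fibres[OF fin]) (rule Pi_I, rule wmc)
  also have "\<dots> = (\<Oplus>u\<in>supp K f. \<Oplus>v\<in>supp K h. f u \<otimes> h v \<otimes> \<beta> (u \<otimes>\<^bsub>G\<^esub> v))"
    by (rule K.finsum_cartesian[of _ _ "\<lambda>u v. f u \<otimes> h v \<otimes> \<beta> (u \<otimes>\<^bsub>G\<^esub> v)"])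
       (use f h b fin F_supp[OF f] F_supp[OF h] in \<open>auto simp: Pi_iff subset_iff\<close>)
  also have "\<dots> = ev (\<lambda>u. ev (\<lambda>v. \<beta> (u \<otimes>\<^bsub>G\<^esub> v)) h) f"
  proof -
    have "(\<Oplus>v\<in>supp K h. f u \<otimes> h v \<otimes> \<beta> (u \<otimes>\<^bsub>G\<^esub> v)) = f u \<otimes> ev (\<lambda>v. \<beta> (u \<otimes>\<^bsub>G\<^esub> v)) h"
      if u: "u \<in> supp K f" for u
    proof -
      have uc: "u \<in> carrier G" using u F_supp(1)[OF f] by auto
      have "(\<Oplus>v\<in>supp K h. f u \<otimes> h v \<otimes> \<beta> (u \<otimes>\<^bsub>G\<^esub> v))
          = (\<Oplus>v\<in>supp K h. f u \<otimes> (h v \<otimes> \<beta> (u \<otimes>\<^bsub>G\<^esub> v)))"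
        by (rule K.finsum_cong')
           (use f h b uc F_supp(1)[OF h] in \<open>auto simp: K.m_assoc Pi_iff subset_iff\<close>)
      also have "\<dots> = f u \<otimes> ev (\<lambda>v. \<beta> (u \<otimes>\<^bsub>G\<^esub> v)) h" unfolding ev_def
        by (rule K.finsum_rdistr[symmetric])
           (use f h b uc F_supp[OF h] in \<open>auto simp: Pi_iff subset_iff\<close>)
      finally show ?thesis .
    qed
    then show ?thesis unfolding ev_def[of _ f]
      by (intro K.finsum_cong')
         (use f h b F_supp(1)[OF f] in \<open>auto simp: Pi_iff subset_iff intro!: K.m_closed ev_closed\<close>)
  qed
  finally show ?thesis .
qed

text \<open>The functional of the indicator function \<open>bas z\<close> reads off the coefficient
  at \<open>z\<close>, so the pairing separates elements.\<close>

lemma F_eqI: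
  assumes f: "f \<in> carrier F" and g: "g \<in> carrier F"
    and e: "\<And>\<beta>. \<beta> \<in> carrier G \<rightarrow> carrier K \<Longrightarrow> ev \<beta> f = ev \<beta> g"
  shows "f = g"
proof
  fix z
  have val: "ev (bas z) h = h z" if h: "h \<in> carrier F" and z: "z \<in> carrier G" for h
  proof -
    have "ev (bas z) h = (\<Oplus>g\<in>supp K h \<union> {z}. h g \<otimes> bas z g)"
      by (rule ev_superset) (use h z F_supp[OF h] in \<open>auto simp: basis_elt_def F_outside\<close>)
    also have "\<dots> = (\<Oplus>g\<in>{z}. h g \<otimes> bas z g)"
      by (rule K.add.finprod_mono_neutral_cong_right) (use h z F_supp[OF h] in \<open>auto simp: basis_elt_def F_outside\<close>)
    also have "\<dots> = h z" using h by (simp add: basis_elt_def)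
    finally show ?thesis .
  qed
  show "f z = g z"
  proof (cases "z \<in> carrier G")
    case True
    then show ?thesis using e[of "bas z"] val[OF f] val[OF g] by (auto simp: basis_elt_def)
  next
    case False
    then have "z \<notin> supp K f" "z \<notin> supp K g" using F_suppD f g by blast+
    then show ?thesis using F_outside[OF f, of z] F_outside[OF g, of z] by simp
  qed
qed

lemma F_minus: assumes f: "f \<in> carrier F" shows "\<exists>g\<in>carrier F. g \<oplus>\<^bsub>F\<^esub> f = \<zero>\<^bsub>F\<^esub>"
proof -
  have "(\<ominus> \<one>) \<odot>\<^bsub>F\<^esub> f \<oplus>\<^bsub>F\<^esub> f = \<zero>\<^bsub>F\<^esub>"
    using f by (auto simp: F_simps fun_eq_iff K.l_minus K.l_neg)
  then show ?thesis using f by (meson K.a_inv_closed K.one_closed smult_closed)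
qed

lemma F_ring: "ring F"
proof (rule ringI)
  show "abelian_group F"
  proof (rule abelian_groupI)
    show "\<zero>\<^bsub>F\<^esub> \<in> carrier F" by (simp add: F_simps)
    show "\<exists>y\<in>carrier F. y \<oplus>\<^bsub>F\<^esub> x = \<zero>\<^bsub>F\<^esub>" if "x \<in> carrier F" for x using F_minus that by auto
    show "x \<oplus>\<^bsub>F\<^esub> y \<in> carrier F" if "x \<in> carrier F" "y \<in> carrier F" for x y
      using that by (rule add_closed)
  qed (simp_all add: F_simps(1,2) fun_eq_iff K.a_ac)
  have pi: "(\<lambda>u. ev (\<lambda>v. \<beta> (u \<otimes>\<^bsub>G\<^esub> v)) h) \<in> carrier G \<rightarrow> carrier K"
    if "h \<in> carrier F" "\<beta> \<in> carrier G \<rightarrow> carrier K" for h \<beta>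
    using that by (auto intro!: ev_closed simp: Pi_iff)
  show "monoid F"
  proof (rule monoidI)
    show one: "\<one>\<^bsub>F\<^esub> \<in> carrier F" by (simp add: F_simps(4))
    fix x assume x: "x \<in> carrier F"
    show "\<one>\<^bsub>F\<^esub> \<otimes>\<^bsub>F\<^esub> x = x"
    proof (rule F_eqI)
      fix \<beta> :: "'g \<Rightarrow> 'k" assume b: "\<beta> \<in> carrier G \<rightarrow> carrier K"
      show "ev \<beta> (\<one>\<^bsub>F\<^esub> \<otimes>\<^bsub>F\<^esub> x) = ev \<beta> x"
        using x b one pi[OF x b]
        by (simp add: ev_mult) (simp add: F_simps(4), rule ev_cong, auto)
    qed (use x one in auto)
    show "x \<otimes>\<^bsub>F\<^esub> \<one>\<^bsub>F\<^esub> = x"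
    proof (rule F_eqI)
      fix \<beta> :: "'g \<Rightarrow> 'k" assume b: "\<beta> \<in> carrier G \<rightarrow> carrier K"
      have "ev (\<lambda>u. ev (\<lambda>v. \<beta> (u \<otimes>\<^bsub>G\<^esub> v)) \<one>\<^bsub>F\<^esub>) x = ev \<beta> x"
        by (rule ev_cong) (use x b in \<open>auto simp: F_simps(4) Pi_iff\<close>)
      then show "ev \<beta> (x \<otimes>\<^bsub>F\<^esub> \<one>\<^bsub>F\<^esub>) = ev \<beta> x" using x b one by (simp add: ev_mult)
    qed (use x one in auto)
    fix y z assume y: "y \<in> carrier F" and z: "z \<in> carrier F"
    show "x \<otimes>\<^bsub>F\<^esub> y \<otimes>\<^bsub>F\<^esub> z = x \<otimes>\<^bsub>F\<^esub> (y \<otimes>\<^bsub>F\<^esub> z)"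
    proof (rule F_eqI)
      fix \<beta> :: "'g \<Rightarrow> 'k" assume b: "\<beta> \<in> carrier G \<rightarrow> carrier K"
      have b2: "(\<lambda>v. \<beta> (u \<otimes>\<^bsub>G\<^esub> v)) \<in> carrier G \<rightarrow> carrier K" if "u \<in> carrier G" for u
        using b that by auto
      have "ev \<beta> (x \<otimes>\<^bsub>F\<^esub> y \<otimes>\<^bsub>F\<^esub> z) = ev (\<lambda>u. ev (\<lambda>v. ev (\<lambda>w. \<beta> (u \<otimes>\<^bsub>G\<^esub> v \<otimes>\<^bsub>G\<^esub> w)) z) y) x"
        using x y z b pi[OF z b] by (simp add: ev_mult)
      also have "\<dots> = ev (\<lambda>u. ev (\<lambda>w. \<beta> (u \<otimes>\<^bsub>G\<^esub> w)) (y \<otimes>\<^bsub>F\<^esub> z)) x"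
      proof (rule ev_cong[OF x pi[OF mult_closed[OF y z] b]])
        fix u assume u: "u \<in> carrier G"
        have "ev (\<lambda>w. \<beta> (u \<otimes>\<^bsub>G\<^esub> w)) (y \<otimes>\<^bsub>F\<^esub> z) = ev (\<lambda>v. ev (\<lambda>w. \<beta> (u \<otimes>\<^bsub>G\<^esub> (v \<otimes>\<^bsub>G\<^esub> w))) z) y"
          using y z b2[OF u] by (simp add: ev_mult)
        also have "\<dots> = ev (\<lambda>v. ev (\<lambda>w. \<beta> (u \<otimes>\<^bsub>G\<^esub> v \<otimes>\<^bsub>G\<^esub> w)) z) y"
        proof (rule ev_cong[OF y])
          show "(\<lambda>v. ev (\<lambda>w. \<beta> (u \<otimes>\<^bsub>G\<^esub> v \<otimes>\<^bsub>G\<^esub> w)) z) \<in> carrier G \<rightarrow> carrier K"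
            using z u b by (auto intro!: ev_closed simp: Pi_iff)
          fix v assume v: "v \<in> carrier G"
          show "ev (\<lambda>w. \<beta> (u \<otimes>\<^bsub>G\<^esub> (v \<otimes>\<^bsub>G\<^esub> w))) z = ev (\<lambda>w. \<beta> (u \<otimes>\<^bsub>G\<^esub> v \<otimes>\<^bsub>G\<^esub> w)) z"
            by (rule ev_cong[OF z]) (use u v b in \<open>auto simp: Pi_iff G.m_assoc\<close>)
        qed
        finally show "ev (\<lambda>v. ev (\<lambda>w. \<beta> (u \<otimes>\<^bsub>G\<^esub> v \<otimes>\<^bsub>G\<^esub> w)) z) y = ev (\<lambda>w. \<beta> (u \<otimes>\<^bsub>G\<^esub> w)) (y \<otimes>\<^bsub>F\<^esub> z)" ..
      qed
      also have "\<dots> = ev \<beta> (x \<otimes>\<^bsub>F\<^esub> (y \<otimes>\<^bsub>F\<^esub> z))" using x y z b by (simp add: ev_mult)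
      finally show "ev \<beta> (x \<otimes>\<^bsub>F\<^esub> y \<otimes>\<^bsub>F\<^esub> z) = ev \<beta> (x \<otimes>\<^bsub>F\<^esub> (y \<otimes>\<^bsub>F\<^esub> z))" .
    qed (use x y z in auto)
  qed auto
  have ac: "(\<lambda>u. f u \<oplus> g u) \<in> carrier G \<rightarrow> carrier K"
    if "f \<in> carrier G \<rightarrow> carrier K" "g \<in> carrier G \<rightarrow> carrier K" for f g using that by auto
  fix x y z assume x: "x \<in> carrier F" and y: "y \<in> carrier F" and z: "z \<in> carrier F"
  show "(x \<oplus>\<^bsub>F\<^esub> y) \<otimes>\<^bsub>F\<^esub> z = x \<otimes>\<^bsub>F\<^esub> z \<oplus>\<^bsub>F\<^esub> y \<otimes>\<^bsub>F\<^esub> z"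
  proof (rule F_eqI)
    fix \<beta> :: "'g \<Rightarrow> 'k" assume b: "\<beta> \<in> carrier G \<rightarrow> carrier K"
    show "ev \<beta> ((x \<oplus>\<^bsub>F\<^esub> y) \<otimes>\<^bsub>F\<^esub> z) = ev \<beta> (x \<otimes>\<^bsub>F\<^esub> z \<oplus>\<^bsub>F\<^esub> y \<otimes>\<^bsub>F\<^esub> z)"
      using x y z b pi[OF z b] by (simp add: ev_mult)
  qed (use x y z in auto)
  show "z \<otimes>\<^bsub>F\<^esub> (x \<oplus>\<^bsub>F\<^esub> y) = z \<otimes>\<^bsub>F\<^esub> x \<oplus>\<^bsub>F\<^esub> z \<otimes>\<^bsub>F\<^esub> y"
  proof (rule F_eqI)
    fix \<beta> :: "'g \<Rightarrow> 'k" assume b: "\<beta> \<in> carrier G \<rightarrow> carrier K"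
    have "ev \<beta> (z \<otimes>\<^bsub>F\<^esub> (x \<oplus>\<^bsub>F\<^esub> y))
        = ev (\<lambda>u. ev (\<lambda>v. \<beta> (u \<otimes>\<^bsub>G\<^esub> v)) x \<oplus> ev (\<lambda>v. \<beta> (u \<otimes>\<^bsub>G\<^esub> v)) y) z"
      using x y z b by (simp add: ev_mult) (rule ev_cong[OF z], use pi in \<open>auto intro!: ev_add simp: Pi_iff\<close>)
    also have "\<dots> = ev \<beta> (z \<otimes>\<^bsub>F\<^esub> x) \<oplus> ev \<beta> (z \<otimes>\<^bsub>F\<^esub> y)"
    proof -
      have "ev (\<lambda>u. f u \<oplus> g u) z = ev f z \<oplus> ev g z"
        if "f \<in> carrier G \<rightarrow> carrier K" "g \<in> carrier G \<rightarrow> carrier K" for f g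
      proof -
        have "ev (\<lambda>u. f u \<oplus> g u) z = (\<Oplus>u\<in>supp K z. z u \<otimes> f u \<oplus> z u \<otimes> g u)"
          unfolding ev_def by (rule K.finsum_cong')
            (use that z F_supp(1)[OF z] in \<open>auto simp: K.r_distr Pi_iff subset_iff\<close>)
        also have "\<dots> = ev f z \<oplus> ev g z" unfolding ev_def
          by (rule K.finsum_addf) (use that z F_supp(1)[OF z] in \<open>auto simp: Pi_iff subset_iff\<close>)
        finally show ?thesis .
      qed
      then show ?thesis using x y z b pi by (simp add: ev_mult)
    qed
    finally show "ev \<beta> (z \<otimes>\<^bsub>F\<^esub> (x \<oplus>\<^bsub>F\<^esub> y)) = ev \<beta> (z \<otimes>\<^bsub>F\<^esub> x \<oplus>\<^bsub>F\<^esub> z \<otimes>\<^bsub>F\<^esub> y)"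
      using x y z b by simp
  qed (use x y z in auto)
qed

end

section \<open>Algebras over a field, linear coordinates and bases\<close>

locale kalgebra = K?: field K + A?: ring A
  for K :: "('k, 'z) ring_scheme" (structure) and A :: "('k, 'a) module" (structure) +
  assumes sc_closed [simp, intro]: "\<lbrakk>c \<in> carrier K; x \<in> carrier A\<rbrakk> \<Longrightarrow> c \<odot>\<^bsub>A\<^esub> x \<in> carrier A"
    and sc_ladd: "\<lbrakk>c \<in> carrier K; d \<in> carrier K; x \<in> carrier A\<rbrakk> \<Longrightarrow> (c \<oplus>\<^bsub>K\<^esub> d) \<odot>\<^bsub>A\<^esub> x = c \<odot>\<^bsub>A\<^esub> x \<oplus>\<^bsub>A\<^esub> d \<odot>\<^bsub>A\<^esub> x"
    and sc_radd: "\<lbrakk>c \<in> carrier K; x \<in> carrier A; y \<in> carrier A\<rbrakk> \<Longrightarrow> c \<odot>\<^bsub>A\<^esub> (x \<oplus>\<^bsub>A\<^esub> y) = c \<odot>\<^bsub>A\<^esub> x \<oplus>\<^bsub>A\<^esub> c \<odot>\<^bsub>A\<^esub> y"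
    and sc_assoc: "\<lbrakk>c \<in> carrier K; d \<in> carrier K; x \<in> carrier A\<rbrakk> \<Longrightarrow> (c \<otimes>\<^bsub>K\<^esub> d) \<odot>\<^bsub>A\<^esub> x = c \<odot>\<^bsub>A\<^esub> (d \<odot>\<^bsub>A\<^esub> x)"
    and sc_one [simp]: "x \<in> carrier A \<Longrightarrow> \<one>\<^bsub>K\<^esub> \<odot>\<^bsub>A\<^esub> x = x"
    and sc_lmult: "\<lbrakk>c \<in> carrier K; x \<in> carrier A; y \<in> carrier A\<rbrakk> \<Longrightarrow> (c \<odot>\<^bsub>A\<^esub> x) \<otimes>\<^bsub>A\<^esub> y = c \<odot>\<^bsub>A\<^esub> (x \<otimes>\<^bsub>A\<^esub> y)"
    and sc_rmult: "\<lbrakk>c \<in> carrier K; x \<in> carrier A; y \<in> carrier A\<rbrakk> \<Longrightarrow> x \<otimes>\<^bsub>A\<^esub> (c \<odot>\<^bsub>A\<^esub> y) = c \<odot>\<^bsub>A\<^esub> (x \<otimes>\<^bsub>A\<^esub> y)"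
begin

lemma module_KA: "module K A"
  by (rule moduleI) (auto simp: sc_ladd sc_radd sc_assoc K.is_cring A.is_abelian_group)

lemma sc_lzero [simp]: "x \<in> carrier A \<Longrightarrow> \<zero> \<odot>\<^bsub>A\<^esub> x = \<zero>\<^bsub>A\<^esub>"
  by (rule module.smult_l_null[OF module_KA])

lemma sc_rzero [simp]: "c \<in> carrier K \<Longrightarrow> c \<odot>\<^bsub>A\<^esub> \<zero>\<^bsub>A\<^esub> = \<zero>\<^bsub>A\<^esub>"
  by (rule module.smult_r_null[OF module_KA])

definition lin :: "('a \<Rightarrow> 'k) \<Rightarrow> bool" where
  "lin \<chi> \<longleftrightarrow> \<chi> \<in> carrier A \<rightarrow> carrier K \<and>
     (\<forall>x\<in>carrier A. \<forall>y\<in>carrier A. \<chi> (x \<oplus>\<^bsub>A\<^esub> y) = \<chi> x \<oplus> \<chi> y) \<and>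
     (\<forall>c\<in>carrier K. \<forall>x\<in>carrier A. \<chi> (c \<odot>\<^bsub>A\<^esub> x) = c \<otimes> \<chi> x)"

lemma linD:
  assumes "lin \<chi>"
  shows "x \<in> carrier A \<Longrightarrow> \<chi> x \<in> carrier K"
    "x \<in> carrier A \<Longrightarrow> y \<in> carrier A \<Longrightarrow> \<chi> (x \<oplus>\<^bsub>A\<^esub> y) = \<chi> x \<oplus> \<chi> y"
    "c \<in> carrier K \<Longrightarrow> x \<in> carrier A \<Longrightarrow> \<chi> (c \<odot>\<^bsub>A\<^esub> x) = c \<otimes> \<chi> x"
    "\<chi> \<zero>\<^bsub>A\<^esub> = \<zero>"
proof -
  show z: "x \<in> carrier A \<Longrightarrow> \<chi> x \<in> carrier K"
    "x \<in> carrier A \<Longrightarrow> y \<in> carrier A \<Longrightarrow> \<chi> (x \<oplus>\<^bsub>A\<^esub> y) = \<chi> x \<oplus> \<chi> y"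
    "c \<in> carrier K \<Longrightarrow> x \<in> carrier A \<Longrightarrow> \<chi> (c \<odot>\<^bsub>A\<^esub> x) = c \<otimes> \<chi> x" for x y c
    using assms by (auto simp: lin_def)
  show "\<chi> \<zero>\<^bsub>A\<^esub> = \<zero>" using z(3)[of "\<zero>" "\<zero>\<^bsub>A\<^esub>"] z(1)[of "\<zero>\<^bsub>A\<^esub>"] by simp
qed

lemma lin_finsum:
  assumes "lin \<chi>" "f \<in> B \<rightarrow> carrier A"
  shows "\<chi> (\<Oplus>\<^bsub>A\<^esub>p\<in>B. f p) = (\<Oplus>p\<in>B. \<chi> (f p))"
  using assms(2)
proof (induction B rule: infinite_finite_induct)
  case (insert p B)
  then have "f p \<in> carrier A" "f \<in> B \<rightarrow> carrier A" by auto
  moreover have "(\<lambda>p. \<chi> (f p)) \<in> B \<rightarrow> carrier K" "\<chi> (f p) \<in> carrier K"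
    using calculation linD(1)[OF assms(1)] by (auto simp: Pi_iff)
  ultimately show ?case using insert by (simp add: A.finsum_insert K.finsum_insert linD[OF assms(1)])
qed (auto simp: linD[OF assms(1)])

end

text \<open>A finite family with a dual system of linear coordinates, so that independence is built
  in. The predicate \<open>expands\<close> singles out the span; since it is closed under the linear
  operations, spanning can later be proved on generators alone.\<close>

locale coord_basis = kalgebra K A
  for K :: "('k, 'z) ring_scheme" (structure) and A :: "('k, 'a) module" (structure) +
  fixes I :: "'i set" and \<chi> :: "'i \<Rightarrow> 'a \<Rightarrow> 'k" and m :: "'i \<Rightarrow> 'a"
  assumes finI: "finite I" and lin: "p \<in> I \<Longrightarrow> lin (\<chi> p)"
    and mc: "p \<in> I \<Longrightarrow> m p \<in> carrier A"
    and dual: "\<lbrakk>p \<in> I; r \<in> I\<rbrakk> \<Longrightarrow> \<chi> p (m r) = (if p = r then \<one>\<^bsub>K\<^esub> else \<zero>\<^bsub>K\<^esub>)"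
begin

definition comb :: "('i \<Rightarrow> 'k) \<Rightarrow> 'a" where "comb c = (\<Oplus>\<^bsub>A\<^esub>p\<in>I. c p \<odot>\<^bsub>A\<^esub> m p)"
definition expands :: "'a \<Rightarrow> bool" where "expands x \<longleftrightarrow> x \<in> carrier A \<and> comb (\<lambda>p. \<chi> p x) = x"

lemma \<chi>_closed: "p \<in> I \<Longrightarrow> x \<in> carrier A \<Longrightarrow> \<chi> p x \<in> carrier K"
  by (rule linD(1)[OF lin])

lemma comb_closed: "c \<in> I \<rightarrow> carrier K \<Longrightarrow> comb c \<in> carrier A"
  unfolding comb_def by (rule A.finsum_closed) (auto intro!: sc_closed mc)

lemma comb_cong: "c' \<in> I \<rightarrow> carrier K \<Longrightarrow> (\<And>p. p \<in> I \<Longrightarrow> c p = c' p) \<Longrightarrow> comb c = comb c'"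
  unfolding comb_def by (rule A.finsum_cong') (auto intro!: sc_closed mc)

lemma \<chi>_comb: assumes c: "c \<in> I \<rightarrow> carrier K" and p: "p \<in> I" shows "\<chi> p (comb c) = c p"
proof -
  have "\<chi> p (comb c) = (\<Oplus>r\<in>I. \<chi> p (c r \<odot>\<^bsub>A\<^esub> m r))" unfolding comb_def
    by (rule lin_finsum[OF lin[OF p]]) (use c mc in auto)
  also have "\<dots> = (\<Oplus>r\<in>I. if p = r then c r else \<zero>)"
    by (rule K.finsum_cong') (use c mc p in \<open>auto simp: linD(3)[OF lin[OF p]] dual Pi_iff\<close>)
  also have "\<dots> = c p" by (rule K.finsum_singleton) (use p c finI in auto)
  finally show ?thesis .
qed

lemma expands_zero: "expands \<zero>\<^bsub>A\<^esub>"
proof -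
  have "comb (\<lambda>p. \<chi> p \<zero>\<^bsub>A\<^esub>) = (\<Oplus>\<^bsub>A\<^esub>p\<in>I. \<zero>\<^bsub>A\<^esub>)" unfolding comb_def
    by (rule A.finsum_cong') (auto simp: linD(4)[OF lin] mc)
  then show ?thesis by (simp add: expands_def)
qed

lemma expands_add: assumes "expands x" "expands y" shows "expands (x \<oplus>\<^bsub>A\<^esub> y)"
proof -
  have xy: "x \<in> carrier A" "y \<in> carrier A" using assms by (auto simp: expands_def)
  have "comb (\<lambda>p. \<chi> p (x \<oplus>\<^bsub>A\<^esub> y)) = (\<Oplus>\<^bsub>A\<^esub>p\<in>I. \<chi> p x \<odot>\<^bsub>A\<^esub> m p \<oplus>\<^bsub>A\<^esub> \<chi> p y \<odot>\<^bsub>A\<^esub> m p)" unfolding comb_def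
    by (rule A.finsum_cong') (use xy in \<open>auto simp: linD(2)[OF lin] sc_ladd \<chi>_closed mc\<close>)
  also have "\<dots> = comb (\<lambda>p. \<chi> p x) \<oplus>\<^bsub>A\<^esub> comb (\<lambda>p. \<chi> p y)" unfolding comb_def
    by (rule A.finsum_addf) (use xy in \<open>auto simp: \<chi>_closed mc\<close>)
  finally show ?thesis using assms xy by (simp add: expands_def)
qed

lemma expands_smult: assumes "expands x" "c \<in> carrier K" shows "expands (c \<odot>\<^bsub>A\<^esub> x)"
proof -
  have x: "x \<in> carrier A" using assms by (auto simp: expands_def)
  have fs: "c \<odot>\<^bsub>A\<^esub> (\<Oplus>\<^bsub>A\<^esub>p\<in>B. f p) = (\<Oplus>\<^bsub>A\<^esub>p\<in>B. c \<odot>\<^bsub>A\<^esub> f p)" if "f \<in> B \<rightarrow> carrier A" for f and B :: "'i set"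
    using that
  proof (induction B rule: infinite_finite_induct)
    case (insert p B)
    then have "f p \<in> carrier A" "f \<in> B \<rightarrow> carrier A" "(\<lambda>p. c \<odot>\<^bsub>A\<^esub> f p) \<in> B \<rightarrow> carrier A" using assms(2) by auto
    then show ?case using insert assms(2) by (simp add: A.finsum_insert sc_radd)
  qed (use assms(2) in auto)
  have "comb (\<lambda>p. \<chi> p (c \<odot>\<^bsub>A\<^esub> x)) = (\<Oplus>\<^bsub>A\<^esub>p\<in>I. c \<odot>\<^bsub>A\<^esub> (\<chi> p x \<odot>\<^bsub>A\<^esub> m p))" unfolding comb_def
    by (rule A.finsum_cong') (use x assms(2) in \<open>auto simp: linD(3)[OF lin] sc_assoc \<chi>_closed mc\<close>)
  also have "\<dots> = c \<odot>\<^bsub>A\<^esub> comb (\<lambda>p. \<chi> p x)" unfolding comb_def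
    by (rule fs[symmetric]) (use x in \<open>auto simp: \<chi>_closed mc\<close>)
  finally show ?thesis using assms x by (simp add: expands_def)
qed

lemma expands_m: assumes r: "r \<in> I" shows "expands (m r)"
proof -
  have "comb (\<lambda>p. \<chi> p (m r)) = (\<Oplus>\<^bsub>A\<^esub>p\<in>I. if r = p then m p else \<zero>\<^bsub>A\<^esub>)" unfolding comb_def
    by (rule A.finsum_cong') (use r in \<open>auto simp: dual mc\<close>)
  also have "\<dots> = m r" by (rule A.finsum_singleton) (use r finI mc in auto)
  finally show ?thesis using r by (simp add: expands_def mc)
qed

end

locale basis_algebra = coord_basis +
  assumes expand: "x \<in> carrier A \<Longrightarrow> expands x"
begin

lemma coord_eqI:
  assumes "x \<in> carrier A" "y \<in> carrier A" "\<And>p. p \<in> I \<Longrightarrow> \<chi> p x = \<chi> p y" shows "x = y"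
proof -
  have "comb (\<lambda>p. \<chi> p x) = comb (\<lambda>p. \<chi> p y)"
    by (rule comb_cong) (use assms \<chi>_closed in auto)
  then show ?thesis using assms(1,2)[THEN expand] by (simp add: expands_def)
qed

lemma coord_exists:
  assumes "\<And>p. p \<in> I \<Longrightarrow> c p \<in> carrier K"
  obtains x where "x \<in> carrier A" "\<And>p. p \<in> I \<Longrightarrow> \<chi> p x = c p"
  using comb_closed[of c] \<chi>_comb[of c] assms that by blast

end

context monoid_alg
begin

lemma bas_mult: assumes "u \<in> carrier G" "v \<in> carrier G" shows "bas u \<otimes>\<^bsub>F\<^esub> bas v = bas (u \<otimes>\<^bsub>G\<^esub> v)"
proof (rule F_eqI)
  fix \<beta> :: "'g \<Rightarrow> 'k" assume b: "\<beta> \<in> carrier G \<rightarrow> carrier K"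
  show "ev \<beta> (bas u \<otimes>\<^bsub>F\<^esub> bas v) = ev \<beta> (bas (u \<otimes>\<^bsub>G\<^esub> v))"
    using assms b by (simp add: ev_mult Pi_iff)
qed (use assms in auto)

lemma ev_swap:
  assumes f: "f \<in> carrier F" and h: "h \<in> carrier F"
    and g: "\<And>u v. u \<in> carrier G \<Longrightarrow> v \<in> carrier G \<Longrightarrow> \<gamma> u v \<in> carrier K"
  shows "ev (\<lambda>u. ev (\<lambda>v. \<gamma> u v) h) f = ev (\<lambda>v. ev (\<lambda>u. \<gamma> u v) f) h"
proof -
  let ?t = "\<lambda>u v. f u \<otimes> (h v \<otimes> \<gamma> u v)"
  have tc: "?t u v \<in> carrier K" if "u \<in> supp K f" "v \<in> supp K h" for u v
    using that f h g F_suppD by auto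
  have "ev (\<lambda>u. ev (\<lambda>v. \<gamma> u v) h) f = (\<Oplus>u\<in>supp K f. \<Oplus>v\<in>supp K h. ?t u v)"
    unfolding ev_def by (rule K.finsum_cong'[OF refl])
      (auto intro!: K.finsum_closed K.finsum_rdistr F_supp tc simp: f h g F_suppD[OF f] F_suppD[OF h])
  also have "\<dots> = (\<Oplus>v\<in>supp K h. \<Oplus>u\<in>supp K f. ?t u v)"
    by (rule K.finsum_finsum_swap) (use F_supp(2) f h tc in auto)
  also have "\<dots> = (\<Oplus>v\<in>supp K h. \<Oplus>u\<in>supp K f. h v \<otimes> (f u \<otimes> \<gamma> u v))"
    by (intro K.finsum_cong' refl Pi_I K.finsum_closed)
       (auto simp: f h g F_suppD[OF f] F_suppD[OF h] K.m_lcomm)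
  also have "\<dots> = ev (\<lambda>v. ev (\<lambda>u. \<gamma> u v) f) h"
    unfolding ev_def by (rule K.finsum_cong'[OF refl])
      (auto intro!: K.finsum_closed K.finsum_rdistr[symmetric] F_supp simp: f h g F_suppD[OF f] F_suppD[OF h])
  finally show ?thesis .
qed

lemma ev_null: "f \<in> carrier F \<Longrightarrow> ev (\<lambda>_. \<zero>) f = \<zero>"
proof -
  assume f: "f \<in> carrier F"
  have "ev (\<lambda>_. \<zero>) f = (\<Oplus>u\<in>supp K f. \<zero>)"
    unfolding ev_def by (rule K.finsum_cong') (use f in auto)
  then show ?thesis by simp
qed

lemma ev_uminus:
  assumes "f \<in> carrier F" "\<beta> \<in> carrier G \<rightarrow> carrier K" shows "ev \<beta> (\<ominus>\<^bsub>F\<^esub> f) = \<ominus> ev \<beta> f"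
proof -
  interpret F: ring F by (rule F_ring)
  have "ev \<beta> (\<ominus>\<^bsub>F\<^esub> f) \<oplus> ev \<beta> f = ev \<beta> (\<ominus>\<^bsub>F\<^esub> f \<oplus>\<^bsub>F\<^esub> f)" using assms by simp
  also have "\<dots> = \<zero>" using assms by (simp only: F.l_neg) (simp add: F_simps(1))
  finally show ?thesis using assms by (simp add: K.minus_equality)
qed

lemma ev_minus:
  "f \<in> carrier F \<Longrightarrow> h \<in> carrier F \<Longrightarrow> \<beta> \<in> carrier G \<rightarrow> carrier K \<Longrightarrow> ev \<beta> (f \<ominus>\<^bsub>F\<^esub> h) = ev \<beta> f \<ominus> ev \<beta> h"
  using abelian_group.a_inv_closed[OF ring.is_abelian_group[OF F_ring]] by (simp add: a_minus_def ev_uminus)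

text \<open>The elements killed by all two-sided translates of \<open>\<beta>\<close> form a
  two-sided ideal, so only the translates of the generators have to be tested. This is how
  functionals descend to quotients given by generators and relations, in place of a normal form
  argument.\<close>

lemma ev_ideal:
  assumes S: "S \<subseteq> carrier F" and b: "\<beta> \<in> carrier G \<rightarrow> carrier K"
    and S0: "\<And>u v s. u \<in> carrier G \<Longrightarrow> v \<in> carrier G \<Longrightarrow> s \<in> S \<Longrightarrow> ev (\<lambda>g. \<beta> (u \<otimes>\<^bsub>G\<^esub> g \<otimes>\<^bsub>G\<^esub> v)) s = \<zero>"
    and f: "f \<in> Idl\<^bsub>F\<^esub> S"
  shows "ev \<beta> f = \<zero>"
proof -
  interpret F: ring F by (rule F_ring)
  let ?b = "\<lambda>u v g. \<beta> (u \<otimes>\<^bsub>G\<^esub> g \<otimes>\<^bsub>G\<^esub> v)"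
  have bc: "?b u v \<in> carrier G \<rightarrow> carrier K" if "u \<in> carrier G" "v \<in> carrier G" for u v
    using b that by auto
  define J where "J = {f \<in> carrier F. \<forall>u\<in>carrier G. \<forall>v\<in>carrier G. ev (?b u v) f = \<zero>}"
  have "ideal J F"
  proof (rule idealI[OF F_ring])
    show "subgroup J (add_monoid F)"
    proof (rule F.add.subgroupI)
      show "J \<noteq> {}" using F.zero_closed by (auto simp: J_def F_simps(1))
    qed (auto simp: J_def ev_uminus bc simp flip: a_inv_def)
    fix s x assume s: "s \<in> J" and x: "x \<in> carrier F"
    then have sF: "s \<in> carrier F" by (simp add: J_def)
    show "x \<otimes>\<^bsub>F\<^esub> s \<in> J" unfolding J_def
    proof (safe)
      fix u v assume uv: "u \<in> carrier G" "v \<in> carrier G"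
      have "ev (?b u v) (x \<otimes>\<^bsub>F\<^esub> s) = ev (\<lambda>w. ev (\<lambda>g. ?b u v (w \<otimes>\<^bsub>G\<^esub> g)) s) x"
        by (rule ev_mult[OF x sF bc[OF uv]])
      also have "\<dots> = ev (\<lambda>_. \<zero>) x"
      proof (rule ev_cong[OF x])
        fix w assume w: "w \<in> carrier G"
        have "ev (\<lambda>g. ?b u v (w \<otimes>\<^bsub>G\<^esub> g)) s = ev (?b (u \<otimes>\<^bsub>G\<^esub> w) v) s"
          by (rule ev_cong[OF sF]) (use uv w b in \<open>auto simp: G.m_assoc\<close>)
        then show "ev (\<lambda>g. ?b u v (w \<otimes>\<^bsub>G\<^esub> g)) s = \<zero>" using s uv w by (simp add: J_def)
      qed simp
      finally show "ev (?b u v) (x \<otimes>\<^bsub>F\<^esub> s) = \<zero>" using ev_null[OF x] by simp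
    qed (use x sF in auto)
    show "s \<otimes>\<^bsub>F\<^esub> x \<in> J" unfolding J_def
    proof (safe)
      fix u v assume uv: "u \<in> carrier G" "v \<in> carrier G"
      have "ev (?b u v) (s \<otimes>\<^bsub>F\<^esub> x) = ev (\<lambda>g. ev (\<lambda>w. ?b u v (g \<otimes>\<^bsub>G\<^esub> w)) x) s"
        by (rule ev_mult[OF sF x bc[OF uv]])
      \<comment> \<open>The right factor is moved outside by exchanging the two evaluations, so that
        the vanishing of the translates on \<open>s\<close> applies to the inner one.\<close>
      also have "\<dots> = ev (\<lambda>w. ev (\<lambda>g. ?b u v (g \<otimes>\<^bsub>G\<^esub> w)) s) x"
        by (rule ev_swap[OF sF x]) (use b uv in auto)
      also have "\<dots> = ev (\<lambda>_. \<zero>) x"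
      proof (rule ev_cong[OF x])
        fix w assume w: "w \<in> carrier G"
        have "ev (\<lambda>g. ?b u v (g \<otimes>\<^bsub>G\<^esub> w)) s = ev (?b u (w \<otimes>\<^bsub>G\<^esub> v)) s"
          by (rule ev_cong[OF sF]) (use uv w b in \<open>auto simp: G.m_assoc\<close>)
        then show "ev (\<lambda>g. ?b u v (g \<otimes>\<^bsub>G\<^esub> w)) s = \<zero>" using s uv w by (simp add: J_def)
      qed simp
      finally show "ev (?b u v) (s \<otimes>\<^bsub>F\<^esub> x) = \<zero>" using ev_null[OF x] by simp
    qed (use x sF in auto)
  qed
  moreover have "S \<subseteq> J" using S S0 by (auto simp: J_def)
  ultimately have "Idl\<^bsub>F\<^esub> S \<subseteq> J" by (rule F.genideal_minimal)
  then have "f \<in> J" using f by auto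
  then have "ev (?b \<one>\<^bsub>G\<^esub> \<one>\<^bsub>G\<^esub>) f = \<zero>" and fF: "f \<in> carrier F" by (auto simp: J_def)
  moreover have "ev (?b \<one>\<^bsub>G\<^esub> \<one>\<^bsub>G\<^esub>) f = ev \<beta> f" by (rule ev_cong[OF fF b]) simp
  ultimately show ?thesis by simp
qed

lemma F_induct [consumes 1, case_names zero add]:
  assumes f: "f \<in> carrier F" and z: "P \<zero>\<^bsub>F\<^esub>"
    and s: "\<And>c g h. c \<in> carrier K \<Longrightarrow> g \<in> carrier G \<Longrightarrow> h \<in> carrier F \<Longrightarrow> P h \<Longrightarrow> P (c \<odot>\<^bsub>F\<^esub> bas g \<oplus>\<^bsub>F\<^esub> h)"
  shows "P f"
  using f
proof (induction "card (supp K f)" arbitrary: f)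
  case 0
  then have "supp K f = {}" using F_supp(2) by auto
  then have "f = \<zero>\<^bsub>F\<^esub>" by (auto simp: supp_def F_simps(1))
  then show ?case using z by simp
next
  case (Suc n)
  then obtain g where g: "g \<in> supp K f" by (metis card.empty equals0I nat.distinct(1))
  have fin: "finite (supp K f)" using F_supp(2)[OF Suc.prems] .
  define h where "h = f(g := \<zero>)"
  have sh: "supp K h = supp K f - {g}" by (auto simp: h_def supp_def)
  have hF: "h \<in> carrier F" unfolding F_carrier sh
    using F_suppD[OF Suc.prems] fin F_val[OF Suc.prems] by (auto simp: h_def)
  have "f = f g \<odot>\<^bsub>F\<^esub> bas g \<oplus>\<^bsub>F\<^esub> h"
    using F_val[OF Suc.prems] by (auto simp: F_simps(2,3) h_def basis_elt_def fun_eq_iff)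
  moreover have "P h" by (rule Suc.hyps(1)[OF _ hF]) (use Suc.hyps(2) sh g fin in auto)
  ultimately show ?case using s[of "f g" g h] F_val[OF Suc.prems] F_suppD[OF Suc.prems g] hF by simp
qed

end

section \<open>Quotients of monoid algebras and functionals on them\<close>

locale quot_alg = monoid_alg K G for K :: "('k, 'z) ring_scheme" (structure) and G :: "('g, 'y) monoid_scheme" (structure) +
  fixes J :: "('g \<Rightarrow> 'k) set"
  assumes J: "ideal J F"
begin

abbreviation Q where "Q \<equiv> quot_module F J"
definition cls :: "('g \<Rightarrow> 'k) \<Rightarrow> ('g \<Rightarrow> 'k) set" where "cls f = J +>\<^bsub>F\<^esub> f"

lemma Q_simps: "carrier Q = carrier (F Quot J)" "mult Q = mult (F Quot J)" "one Q = one (F Quot J)"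
  "zero Q = zero (F Quot J)" "add Q = add (F Quot J)"
  by (simp_all add: quot_module_def)

lemma Q_ring: "ring Q"
proof -
  interpret QR: ring "F Quot J" by (rule ideal.quotient_is_ring[OF J])
  show ?thesis
  proof (rule ringI)
    show "abelian_group Q" by (rule abelian_groupI) (auto simp: Q_simps QR.a_ac intro: QR.l_neg QR.a_inv_closed)
    show "monoid Q" by (rule monoidI) (auto simp: Q_simps QR.m_assoc)
  qed (auto simp: Q_simps QR.l_distr QR.r_distr)
qed

lemma cls_closed [simp]: "f \<in> carrier F \<Longrightarrow> cls f \<in> carrier Q"
  using ring_hom_closed[OF ideal.rcos_ring_hom[OF J]] by (simp add: cls_def Q_simps)

lemma cls_add: "f \<in> carrier F \<Longrightarrow> g \<in> carrier F \<Longrightarrow> cls (f \<oplus>\<^bsub>F\<^esub> g) = cls f \<oplus>\<^bsub>Q\<^esub> cls g"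
  using ring_hom_add[OF ideal.rcos_ring_hom[OF J]] by (simp add: cls_def Q_simps)

lemma cls_mult: "f \<in> carrier F \<Longrightarrow> g \<in> carrier F \<Longrightarrow> cls (f \<otimes>\<^bsub>F\<^esub> g) = cls f \<otimes>\<^bsub>Q\<^esub> cls g"
  using ring_hom_mult[OF ideal.rcos_ring_hom[OF J]] by (simp add: cls_def Q_simps)

lemma cls_one: "cls (bas \<one>\<^bsub>G\<^esub>) = \<one>\<^bsub>Q\<^esub>"
  using ring_hom_one[OF ideal.rcos_ring_hom[OF J]] by (simp add: cls_def Q_simps F_simps(4))

lemma cls_J: "f \<in> J \<Longrightarrow> cls f = \<zero>\<^bsub>Q\<^esub>"
proof -
  interpret F: ring F by (rule F_ring)
  assume "f \<in> J"
  then show ?thesis using F.a_rcos_zero[OF J] by (simp add: cls_def Q_simps FactRing_def)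
qed

lemma cls_zero: "cls \<zero>\<^bsub>F\<^esub> = \<zero>\<^bsub>Q\<^esub>"
  by (rule cls_J) (rule additive_subgroup.zero_closed[OF ideal.axioms(1)[OF J]])

lemma cls_surj: "x \<in> carrier Q \<Longrightarrow> \<exists>f\<in>carrier F. x = cls f"
  by (auto simp: Q_simps cls_def FactRing_def A_RCOSETS_def' )

lemma mem_cls: assumes "f \<in> carrier F" "g \<in> cls f" shows "g \<in> carrier F" "\<exists>j\<in>J. g = j \<oplus>\<^bsub>F\<^esub> f"
proof -
  show *: "\<exists>j\<in>J. g = j \<oplus>\<^bsub>F\<^esub> f" using assms by (auto simp: cls_def a_r_coset_def')
  have "J \<subseteq> carrier F" using ideal.axioms(1)[OF J] by (rule additive_subgroup.a_subset)
  then show "g \<in> carrier F" using * assms(1) by auto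
qed

lemma self_mem_cls: assumes "f \<in> carrier F" shows "f \<in> cls f"
proof -
  interpret F: ring F by (rule F_ring)
  have "\<zero>\<^bsub>F\<^esub> \<in> J" by (rule additive_subgroup.zero_closed[OF ideal.axioms(1)[OF J]])
  moreover have "f = \<zero>\<^bsub>F\<^esub> \<oplus>\<^bsub>F\<^esub> f" using assms by simp
  ultimately show ?thesis unfolding cls_def a_r_coset_def' by blast
qed

lemma cls_eqD: assumes "f \<in> carrier F" "g \<in> carrier F" "cls f = cls g" shows "f \<ominus>\<^bsub>F\<^esub> g \<in> J"
proof -
  interpret F: ring F by (rule F_ring)
  show ?thesis using F.quotient_eq_iff_same_a_r_cos[OF J assms(1,2)] assms(3) by (simp add: cls_def)
qed

text \<open>A scalar acts as a multiple of the identity, here from the left and below from the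
  right. Hence the scalar multiplication of the quotient, defined as a union over representatives,
  depends only on the class and is compatible with products.\<close>

lemma smult_as_mult: assumes "c \<in> carrier K" "f \<in> carrier F"
  shows "c \<odot>\<^bsub>F\<^esub> f = (c \<odot>\<^bsub>F\<^esub> bas \<one>\<^bsub>G\<^esub>) \<otimes>\<^bsub>F\<^esub> f"
proof (rule F_eqI)
  fix \<beta> :: "'g \<Rightarrow> 'k" assume b: "\<beta> \<in> carrier G \<rightarrow> carrier K"
  have "(\<lambda>u. ev (\<lambda>v. \<beta> (u \<otimes>\<^bsub>G\<^esub> v)) f) \<in> carrier G \<rightarrow> carrier K"
    by (intro Pi_I ev_closed) (use assms b in auto)
  moreover have "ev (\<lambda>v. \<beta> (\<one>\<^bsub>G\<^esub> \<otimes>\<^bsub>G\<^esub> v)) f = ev \<beta> f" by (rule ev_cong) (use assms b in auto)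
  ultimately show "ev \<beta> (c \<odot>\<^bsub>F\<^esub> f) = ev \<beta> ((c \<odot>\<^bsub>F\<^esub> bas \<one>\<^bsub>G\<^esub>) \<otimes>\<^bsub>F\<^esub> f)"
    using assms b by (simp add: ev_mult)
qed (use assms in auto)

lemma smult_as_mult_r: assumes "c \<in> carrier K" "f \<in> carrier F"
  shows "c \<odot>\<^bsub>F\<^esub> f = f \<otimes>\<^bsub>F\<^esub> (c \<odot>\<^bsub>F\<^esub> bas \<one>\<^bsub>G\<^esub>)"
proof (rule F_eqI)
  fix \<beta> :: "'g \<Rightarrow> 'k" assume b: "\<beta> \<in> carrier G \<rightarrow> carrier K"
  have pc: "\<And>u. u \<in> carrier G \<Longrightarrow> (\<lambda>v. \<beta> (u \<otimes>\<^bsub>G\<^esub> v)) \<in> carrier G \<rightarrow> carrier K" using b by auto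
  have "ev \<beta> (f \<otimes>\<^bsub>F\<^esub> (c \<odot>\<^bsub>F\<^esub> bas \<one>\<^bsub>G\<^esub>)) = ev (\<lambda>u. ev (\<lambda>v. \<beta> (u \<otimes>\<^bsub>G\<^esub> v)) (c \<odot>\<^bsub>F\<^esub> bas \<one>\<^bsub>G\<^esub>)) f"
    using assms b by (simp add: ev_mult)
  also have "\<dots> = ev (\<lambda>u. c \<otimes> \<beta> u) f"
    by (rule ev_cong) (use assms b pc in auto)
  also have "\<dots> = c \<otimes> ev \<beta> f" unfolding ev_def
  proof (subst K.finsum_rdistr)
    show "(\<Oplus>g\<in>supp K f. f g \<otimes> (c \<otimes> \<beta> g)) = (\<Oplus>i\<in>supp K f. c \<otimes> (f i \<otimes> \<beta> i))"
      by (rule K.finsum_cong') (use assms b F_suppD[OF assms(2)] in \<open>auto simp: K.m_lcomm Pi_iff\<close>)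
  qed (use assms b F_supp(2)[OF assms(2)] F_suppD[OF assms(2)] in \<open>auto simp: Pi_iff\<close>)
  finally show "ev \<beta> (c \<odot>\<^bsub>F\<^esub> f) = ev \<beta> (f \<otimes>\<^bsub>F\<^esub> (c \<odot>\<^bsub>F\<^esub> bas \<one>\<^bsub>G\<^esub>))" using assms b by simp
qed (use assms in auto)

lemma cls_smult: assumes c: "c \<in> carrier K" and f: "f \<in> carrier F" shows "c \<odot>\<^bsub>Q\<^esub> cls f = cls (c \<odot>\<^bsub>F\<^esub> f)"
proof -
  have *: "cls (c \<odot>\<^bsub>F\<^esub> g) = cls (c \<odot>\<^bsub>F\<^esub> f)" if g: "g \<in> cls f" for g
  proof -
    interpret Q: ring Q by (rule Q_ring)
    obtain j where j: "j \<in> J" "g = j \<oplus>\<^bsub>F\<^esub> f" using mem_cls(2)[OF f g] by blast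
    have jF: "j \<in> carrier F" using j(1) additive_subgroup.a_subset[OF ideal.axioms(1)[OF J]] by auto
    have "cls g = cls f" using j jF f cls_J[of j] by (simp add: cls_add)
    then have "cls ((c \<odot>\<^bsub>F\<^esub> bas \<one>\<^bsub>G\<^esub>) \<otimes>\<^bsub>F\<^esub> g) = cls ((c \<odot>\<^bsub>F\<^esub> bas \<one>\<^bsub>G\<^esub>) \<otimes>\<^bsub>F\<^esub> f)"
      using c f mem_cls(1)[OF f g] by (simp add: cls_mult)
    then show ?thesis by (simp only: smult_as_mult[OF c f] smult_as_mult[OF c mem_cls(1)[OF f g]])
  qed
  have "c \<odot>\<^bsub>Q\<^esub> cls f = (\<Union>x\<in>cls f. cls (c \<odot>\<^bsub>F\<^esub> x))" by (simp add: quot_module_def cls_def)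
  also have "\<dots> = (\<Union>x\<in>cls f. cls (c \<odot>\<^bsub>F\<^esub> f))" by (rule SUP_cong[OF refl *])
  also have "\<dots> = cls (c \<odot>\<^bsub>F\<^esub> f)" using self_mem_cls[OF f] by blast
  finally show ?thesis .
qed

lemma Q_kalgebra: "kalgebra K Q"
proof -
  interpret Q: ring Q by (rule Q_ring)
  let ?i = "\<lambda>c. cls (c \<odot>\<^bsub>F\<^esub> bas \<one>\<^bsub>G\<^esub>)"
  have ic: "?i c \<in> carrier Q" if "c \<in> carrier K" for c using that by simp
  have sm: "c \<odot>\<^bsub>Q\<^esub> x = ?i c \<otimes>\<^bsub>Q\<^esub> x" "c \<odot>\<^bsub>Q\<^esub> x = x \<otimes>\<^bsub>Q\<^esub> ?i c" if "c \<in> carrier K" "x \<in> carrier Q" for c x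
  proof -
    obtain f where f: "f \<in> carrier F" "x = cls f" using cls_surj \<open>x \<in> carrier Q\<close> by blast
    show "c \<odot>\<^bsub>Q\<^esub> x = ?i c \<otimes>\<^bsub>Q\<^esub> x"
      using that f smult_as_mult[OF \<open>c \<in> carrier K\<close> f(1)] by (simp add: cls_smult flip: cls_mult)
    show "c \<odot>\<^bsub>Q\<^esub> x = x \<otimes>\<^bsub>Q\<^esub> ?i c"
      using that f smult_as_mult_r[OF \<open>c \<in> carrier K\<close> f(1)] by (simp add: cls_smult flip: cls_mult)
  qed
  have ia: "?i (c \<oplus> d) = ?i c \<oplus>\<^bsub>Q\<^esub> ?i d" if "c \<in> carrier K" "d \<in> carrier K" for c d
  proof -
    have "(c \<oplus> d) \<odot>\<^bsub>F\<^esub> bas \<one>\<^bsub>G\<^esub> = c \<odot>\<^bsub>F\<^esub> bas \<one>\<^bsub>G\<^esub> \<oplus>\<^bsub>F\<^esub> d \<odot>\<^bsub>F\<^esub> bas \<one>\<^bsub>G\<^esub>"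
      using that by (auto simp: F_simps(2,3) fun_eq_iff basis_elt_def)
    then show ?thesis using that by (simp add: cls_add)
  qed
  have im: "?i (c \<otimes> d) = ?i c \<otimes>\<^bsub>Q\<^esub> ?i d" if "c \<in> carrier K" "d \<in> carrier K" for c d
  proof -
    have "(c \<otimes> d) \<odot>\<^bsub>F\<^esub> bas \<one>\<^bsub>G\<^esub> = c \<odot>\<^bsub>F\<^esub> (d \<odot>\<^bsub>F\<^esub> bas \<one>\<^bsub>G\<^esub>)"
      using that by (auto simp: F_simps(3) fun_eq_iff basis_elt_def)
    then show ?thesis using that smult_as_mult[of c "d \<odot>\<^bsub>F\<^esub> bas \<one>\<^bsub>G\<^esub>"] by (simp add: cls_mult)
  qed
  have i1: "?i \<one> = \<one>\<^bsub>Q\<^esub>"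
  proof -
    have "\<one> \<odot>\<^bsub>F\<^esub> bas \<one>\<^bsub>G\<^esub> = bas \<one>\<^bsub>G\<^esub>" by (auto simp: F_simps(3) fun_eq_iff basis_elt_def)
    then show ?thesis by (simp add: cls_one)
  qed
  show ?thesis
  proof (unfold_locales)
    show "\<And>c x. c \<in> carrier K \<Longrightarrow> x \<in> carrier Q \<Longrightarrow> c \<odot>\<^bsub>Q\<^esub> x \<in> carrier Q" by (simp only: sm(1) ic Q.m_closed)
    show "c \<odot>\<^bsub>Q\<^esub> x \<otimes>\<^bsub>Q\<^esub> y = c \<odot>\<^bsub>Q\<^esub> (x \<otimes>\<^bsub>Q\<^esub> y)" if "c \<in> carrier K" "x \<in> carrier Q" "y \<in> carrier Q" for c x y
      using that by (simp only: sm(1) ic Q.m_closed Q.m_assoc)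
    show "x \<otimes>\<^bsub>Q\<^esub> (c \<odot>\<^bsub>Q\<^esub> y) = c \<odot>\<^bsub>Q\<^esub> (x \<otimes>\<^bsub>Q\<^esub> y)" if "c \<in> carrier K" "x \<in> carrier Q" "y \<in> carrier Q" for c x y
      using that by (simp only: sm(2) ic Q.m_closed Q.m_assoc)
    show "(c \<oplus> d) \<odot>\<^bsub>Q\<^esub> x = c \<odot>\<^bsub>Q\<^esub> x \<oplus>\<^bsub>Q\<^esub> d \<odot>\<^bsub>Q\<^esub> x" if "c \<in> carrier K" "d \<in> carrier K" "x \<in> carrier Q" for c d x
      using that by (simp only: sm(1) K.a_closed ia ic Q.l_distr)
    show "c \<odot>\<^bsub>Q\<^esub> (x \<oplus>\<^bsub>Q\<^esub> y) = c \<odot>\<^bsub>Q\<^esub> x \<oplus>\<^bsub>Q\<^esub> c \<odot>\<^bsub>Q\<^esub> y" if "c \<in> carrier K" "x \<in> carrier Q" "y \<in> carrier Q" for c x y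
      using that by (simp only: sm(1) Q.a_closed ic Q.r_distr)
    show "(c \<otimes> d) \<odot>\<^bsub>Q\<^esub> x = c \<odot>\<^bsub>Q\<^esub> (d \<odot>\<^bsub>Q\<^esub> x)" if "c \<in> carrier K" "d \<in> carrier K" "x \<in> carrier Q" for c d x
      using that by (simp only: sm(1) K.m_closed im ic Q.m_assoc Q.m_closed)
    show "\<one> \<odot>\<^bsub>Q\<^esub> x = x" if "x \<in> carrier Q" for x
      using that by (simp only: sm(1) K.one_closed i1 Q.l_one)
  qed
qed

lemma Q_induct [consumes 1, case_names zero add]:
  assumes x: "x \<in> carrier Q" and z: "P \<zero>\<^bsub>Q\<^esub>"
    and s: "\<And>c g y. c \<in> carrier K \<Longrightarrow> g \<in> carrier G \<Longrightarrow> y \<in> carrier Q \<Longrightarrow> P y \<Longrightarrow> P (c \<odot>\<^bsub>Q\<^esub> cls (bas g) \<oplus>\<^bsub>Q\<^esub> y)"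
  shows "P x"
proof -
  obtain f where f: "f \<in> carrier F" "x = cls f" using cls_surj x by blast
  from f(1) have "P (cls f)"
  proof (induction f rule: F_induct)
    case zero
    then show ?case using z by (simp add: cls_zero)
  next
    case (add c g h)
    then show ?case using s[of c g "cls h"] by (simp add: cls_add cls_smult)
  qed
  then show ?thesis using f by simp
qed

text \<open>The value on a chosen representative. It agrees with the value on every other one as
  soon as \<open>\<beta>\<close> vanishes on the ideal.\<close>

definition funl :: "('g \<Rightarrow> 'k) \<Rightarrow> ('g \<Rightarrow> 'k) set \<Rightarrow> 'k" where
  "funl \<beta> x = ev \<beta> (SOME f. f \<in> carrier F \<and> cls f = x)"

lemma funl_cls:
  assumes b: "\<beta> \<in> carrier G \<rightarrow> carrier K" and b0: "\<And>f. f \<in> J \<Longrightarrow> ev \<beta> f = \<zero>" and f: "f \<in> carrier F"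
  shows "funl \<beta> (cls f) = ev \<beta> f"
proof -
  define g where "g = (SOME g. g \<in> carrier F \<and> cls g = cls f)"
  have g: "g \<in> carrier F" "cls g = cls f" using someI_ex[of "\<lambda>g. g \<in> carrier F \<and> cls g = cls f"] f by (auto simp: g_def)
  have "ev \<beta> (g \<ominus>\<^bsub>F\<^esub> f) = \<zero>" by (rule b0[OF cls_eqD[OF g(1) f g(2)]])
  then show ?thesis using b f g by (auto simp: funl_def ev_minus g_def[symmetric] intro: K.minus_eq_zeroD)
qed

lemma funl_lin:
  assumes b: "\<beta> \<in> carrier G \<rightarrow> carrier K" and b0: "\<And>f. f \<in> J \<Longrightarrow> ev \<beta> f = \<zero>"
  shows "kalgebra.lin K Q (funl \<beta>)"
  unfolding kalgebra.lin_def[OF Q_kalgebra]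
proof (intro conjI ballI)
  show "funl \<beta> \<in> carrier Q \<rightarrow> carrier K"
    using b by (auto dest!: cls_surj simp: funl_cls[OF b b0])
  fix x assume "x \<in> carrier Q"
  then obtain f where f: "f \<in> carrier F" "x = cls f" using cls_surj by blast
  show "funl \<beta> (x \<oplus>\<^bsub>Q\<^esub> y) = funl \<beta> x \<oplus> funl \<beta> y" if y: "y \<in> carrier Q" for y
  proof -
    obtain g where g: "g \<in> carrier F" "y = cls g" using cls_surj[OF y] by blast
    show ?thesis using f g b by (simp add: funl_cls[OF b b0] flip: cls_add)
  qed
next
  fix c x assume c: "c \<in> carrier K" and "x \<in> carrier Q"
  then obtain f where f: "f \<in> carrier F" "x = cls f" using cls_surj by blast
  show "funl \<beta> (c \<odot>\<^bsub>Q\<^esub> x) = c \<otimes> funl \<beta> x"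
    using f c b by (simp add: funl_cls[OF b b0] cls_smult)
qed

end

section \<open>A basis of the quantum complete intersection\<close>

lemma qci_unfold: "qci K a b q =
    (let F = monoid_algebra K free_monoid; X = basis_elt K [Var_X]; Y = basis_elt K [Var_Y]
     in quot_module F
          (Idl\<^bsub>F\<^esub> {X [^]\<^bsub>F\<^esub> a, (X \<otimes>\<^bsub>F\<^esub> Y) \<ominus>\<^bsub>F\<^esub> (q \<odot>\<^bsub>F\<^esub> (Y \<otimes>\<^bsub>F\<^esub> X)), Y [^]\<^bsub>F\<^esub> b}))"
  by (simp add: qci_def free_algebra_def)

text \<open>A word \<open>w\<close> with \<open>i\<close> letters \<open>x\<close> and \<open>j\<close> letters \<open>y\<close> represents \<open>q^(xy_pairs w)\<close> times the monomial \<open>y^j x^i\<close>.\<close>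

fun xy_pairs :: "qci_var list \<Rightarrow> nat" where
  "xy_pairs [] = 0"
| "xy_pairs (Var_X # w) = count_list w Var_Y + xy_pairs w"
| "xy_pairs (Var_Y # w) = xy_pairs w"

text \<open>The last term counts the pairs with the letter x in \<open>u\<close> and the letter y in
  \<open>v\<close>. It produces all powers of q in the multiplication rules for coordinates.\<close>

lemma xy_pairs_append:
  "xy_pairs (u @ v) = xy_pairs u + xy_pairs v + count_list u Var_X * count_list v Var_Y"
  by (induction u rule: xy_pairs.induct) (auto simp: algebra_simps)

lemma count_list_replicate': "count_list (replicate n x) y = (if x = y then n else 0)"
  by (induction n) auto

locale qci_alg = K?: field K for K :: "('k, 'z) ring_scheme" (structure) +
  fixes a b :: nat and q :: 'k
  assumes qK: "q \<in> carrier K"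
begin

sublocale monoid_alg K "free_monoid :: qci_var list monoid"
  by (intro monoid_alg.intro K.field_axioms monoidI) (auto simp: free_monoid_def)

lemma fm: "carrier free_monoid = UNIV" "u \<otimes>\<^bsub>free_monoid\<^esub> v = u @ v" "\<one>\<^bsub>free_monoid\<^esub> = []"
  by (auto simp: free_monoid_def)

definition rels where "rels = {bas (replicate a Var_X), bas [Var_X, Var_Y] \<ominus>\<^bsub>F\<^esub> (q \<odot>\<^bsub>F\<^esub> bas [Var_Y, Var_X]), bas (replicate b Var_Y)}"
definition J where "J = Idl\<^bsub>F\<^esub> rels"

lemma bas_mult': "bas u \<otimes>\<^bsub>F\<^esub> bas v = bas (u @ v)" by (simp add: bas_mult fm)
lemma bas_c [simp]: "bas (w :: qci_var list) \<in> carrier F" by (simp add: fm)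

lemma bas_pow: "bas [v] [^]\<^bsub>F\<^esub> (n::nat) = bas (replicate n v)"
proof (induction n)
  case 0 then show ?case by (simp add: F_simps(4) fm)
next
  case (Suc n) then show ?case by (simp add: bas_mult' replicate_append_same)
qed

lemma rels_sub: "rels \<subseteq> carrier F"
proof -
  interpret F: ring F by (rule F_ring)
  show ?thesis using qK by (auto simp: rels_def fm intro!: F.minus_closed bas_closed)
qed

lemma J_ideal: "ideal J F"
  unfolding J_def by (rule ring.genideal_ideal[OF F_ring rels_sub])

sublocale quot_alg K "free_monoid :: qci_var list monoid" J
  by (intro quot_alg.intro quot_alg_axioms.intro monoid_alg_axioms J_ideal)

lemma qci_eq: "qci K a b q = Q"
  unfolding qci_unfold Let_def J_def rels_def by (simp add: bas_mult' bas_pow)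

sublocale A: kalgebra K Q by (rule Q_kalgebra)

text \<open>The coefficient of \<open>y^j x^i\<close> in the sorted form of a word. Because it
  descends to the quotient, the monomials are independent without any confluence argument.\<close>

definition kap :: "nat \<Rightarrow> nat \<Rightarrow> qci_var list \<Rightarrow> 'k" where
  "kap i j w = (if count_list w Var_X = i \<and> count_list w Var_Y = j then q [^] xy_pairs w else \<zero>)"

lemma kap_c: "kap i j \<in> carrier free_monoid \<rightarrow> carrier K" using qK by (auto simp: kap_def)

text \<open>Exchanging adjacent letters x y changes \<open>xy_pairs\<close> by one, which the factor
  q of the relation balances. A word containing \<open>a\<close> letters x or \<open>b\<close>
  letters y has letter counts different from \<open>i < a\<close> and \<open>j < b\<close>, so its
  value is zero; all this persists inside a longer word.\<close>

lemma kap_J: assumes "i < a" "j < b" "f \<in> J" shows "ev (kap i j) f = \<zero>"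
proof (rule ev_ideal[OF rels_sub kap_c])
  show "f \<in> Idl\<^bsub>F\<^esub> rels" using assms by (simp add: J_def)
  fix u v s assume s: "s \<in> rels"
  let ?\<gamma> = "\<lambda>g. kap i j (u \<otimes>\<^bsub>free_monoid\<^esub> g \<otimes>\<^bsub>free_monoid\<^esub> v)"
  have c: "?\<gamma> \<in> carrier free_monoid \<rightarrow> carrier K" using kap_c by (auto simp: fm)
  have e: "ev ?\<gamma> (bas w) = kap i j (u @ w @ v)" for w using ev_bas[OF _ c, of w] by (simp add: fm)
  have "ev ?\<gamma> (bas [Var_X, Var_Y] \<ominus>\<^bsub>F\<^esub> (q \<odot>\<^bsub>F\<^esub> bas [Var_Y, Var_X]))
      = kap i j (u @ [Var_X, Var_Y] @ v) \<ominus> q \<otimes> kap i j (u @ [Var_Y, Var_X] @ v)"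
    using c qK by (simp add: ev_minus e del: append.simps)
  also have "\<dots> = \<zero>"
    using qK by (auto simp: kap_def xy_pairs_append algebra_simps nat_pow_Suc2[symmetric] K.m_comm a_minus_def K.r_neg
        simp flip: nat_pow_Suc)
  finally show "ev ?\<gamma> s = \<zero>"
    using s assms by (auto simp: rels_def e) (auto simp: kap_def count_list_replicate')
qed

definition coA :: "nat \<Rightarrow> nat \<Rightarrow> (qci_var list \<Rightarrow> 'k) set \<Rightarrow> 'k" where "coA i j = funl (kap i j)"

lemma coA_lin: "i < a \<Longrightarrow> j < b \<Longrightarrow> A.lin (coA i j)"
  unfolding coA_def using kap_J by (intro funl_lin kap_c) auto

lemma coA_cls: "i < a \<Longrightarrow> j < b \<Longrightarrow> f \<in> carrier F \<Longrightarrow> coA i j (cls f) = ev (kap i j) f"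
  unfolding coA_def using kap_J by (intro funl_cls kap_c) auto

definition x where "x = cls (bas [Var_X])"
definition y where "y = cls (bas [Var_Y])"

lemma xy_c [simp]: "x \<in> carrier Q" "y \<in> carrier Q" by (auto simp: x_def y_def fm)

text \<open>If the word functional absorbs a suffix \<open>w\<close> at the cost of a scalar, then
  so does the coordinate on the quotient. The rules for right multiplication by x and by y are the
  single-letter cases; the scalar counts the pairs that the new letter creates, and it is zero when
  the index would become negative.\<close>

lemma coA_right:
  assumes ij: "i < a" "j < b" and s: "s \<in> carrier Q" and g: "\<And>u. kap i j (u @ w) = c \<otimes> kap i' j' u"
    and ij': "i' < a" "j' < b" and c: "c \<in> carrier K"
  shows "coA i j (s \<otimes>\<^bsub>Q\<^esub> cls (bas w)) = c \<otimes> coA i' j' s"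
proof -
  obtain f where f: "f \<in> carrier F" "s = cls f" using cls_surj[OF s] by blast
  have kc: "\<And>u. (\<lambda>v. kap i j (u @ v)) \<in> carrier free_monoid \<rightarrow> carrier K" using kap_c by (auto simp: fm)
  have "coA i j (s \<otimes>\<^bsub>Q\<^esub> cls (bas w)) = ev (kap i j) (f \<otimes>\<^bsub>F\<^esub> bas w)"
    using f ij by (simp add: coA_cls flip: cls_mult)
  also have "\<dots> = ev (\<lambda>u. kap i j (u @ w)) f"
    using f kap_c kc by (simp add: ev_mult fm)
  also have "\<dots> = ev (kap i' j') (c \<odot>\<^bsub>F\<^esub> f)"
  proof -
    have "ev (\<lambda>u. kap i j (u @ w)) f = (\<Oplus>u\<in>supp K f. c \<otimes> (f u \<otimes> kap i' j' u))"
      unfolding ev_def by (rule K.finsum_cong') (use f c kap_c in \<open>auto simp: g fm Pi_iff K.m_lcomm\<close>)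
    also have "\<dots> = c \<otimes> ev (kap i' j') f"
      unfolding ev_def by (rule K.finsum_rdistr[symmetric])
        (use f c kap_c F_supp(2)[OF f(1)] in \<open>auto simp: fm Pi_iff\<close>)
    finally show ?thesis using f c kap_c by simp
  qed
  also have "\<dots> = c \<otimes> coA i' j' s" using f c kap_c ij' by (simp add: coA_cls)
  finally show ?thesis .
qed

lemma coA_left:
  assumes ij: "i < a" "j < b" and s: "s \<in> carrier Q" and g: "\<And>u. kap i j (w @ u) = c \<otimes> kap i' j' u"
    and ij': "i' < a" "j' < b" and c: "c \<in> carrier K"
  shows "coA i j (cls (bas w) \<otimes>\<^bsub>Q\<^esub> s) = c \<otimes> coA i' j' s"
proof -
  obtain f where f: "f \<in> carrier F" "s = cls f" using cls_surj[OF s] by blast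
  have kc: "(\<lambda>u. ev (\<lambda>v. kap i j (u @ v)) f) \<in> carrier free_monoid \<rightarrow> carrier K"
    by (intro Pi_I ev_closed) (use f kap_c in \<open>auto simp: fm\<close>)
  have "coA i j (cls (bas w) \<otimes>\<^bsub>Q\<^esub> s) = ev (kap i j) (bas w \<otimes>\<^bsub>F\<^esub> f)"
    using f ij by (simp add: coA_cls flip: cls_mult)
  also have "\<dots> = ev (\<lambda>u. kap i j (w @ u)) f"
    using f kap_c kc by (simp add: ev_mult fm)
  also have "\<dots> = ev (kap i' j') (c \<odot>\<^bsub>F\<^esub> f)"
  proof -
    have "ev (\<lambda>u. kap i j (w @ u)) f = (\<Oplus>u\<in>supp K f. c \<otimes> (f u \<otimes> kap i' j' u))"
      unfolding ev_def by (rule K.finsum_cong') (use f c kap_c in \<open>auto simp: g fm Pi_iff K.m_lcomm\<close>)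
    also have "\<dots> = c \<otimes> ev (kap i' j') f"
      unfolding ev_def by (rule K.finsum_rdistr[symmetric])
        (use f c kap_c F_supp(2)[OF f(1)] in \<open>auto simp: fm Pi_iff\<close>)
    finally show ?thesis using f c kap_c by simp
  qed
  also have "\<dots> = c \<otimes> coA i' j' s" using f c kap_c ij' by (simp add: coA_cls)
  finally show ?thesis .
qed

lemma coA_x_right:
  assumes ij: "i < a" "j < b" and s: "s \<in> carrier Q"
  shows "coA i j (s \<otimes>\<^bsub>Q\<^esub> x) = (if i = 0 then \<zero> else coA (i - 1) (j) s)"
proof (cases "i = 0")
  case True
  then have "\<And>u. kap i j (u @ [Var_X]) = \<zero> \<otimes> kap i j u"
    using qK by (auto simp: kap_def)
  from coA_right[OF ij s this ij] show ?thesis using True A.linD(1)[OF coA_lin[OF ij] s] by (simp add: x_def)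
next
  case False
  then have ij': "i - 1 < a" "j < b" using ij by auto
  have "\<And>u. kap i j (u @ [Var_X]) = \<one> \<otimes> kap (i - 1) (j) u"
    using qK False by (auto simp: kap_def xy_pairs_append K.nat_pow_mult ac_simps)
  from coA_right[OF ij s this ij'] show ?thesis
    using False qK A.linD(1)[OF coA_lin[OF ij'] s] by (simp add: x_def)
qed

lemma coA_y_right:
  assumes ij: "i < a" "j < b" and s: "s \<in> carrier Q"
  shows "coA i j (s \<otimes>\<^bsub>Q\<^esub> y) = (if j = 0 then \<zero> else q [^] i \<otimes> coA (i) (j - 1) s)"
proof (cases "j = 0")
  case True
  then have "\<And>u. kap i j (u @ [Var_Y]) = \<zero> \<otimes> kap i j u"
    using qK by (auto simp: kap_def)
  from coA_right[OF ij s this ij] show ?thesis using True A.linD(1)[OF coA_lin[OF ij] s] by (simp add: y_def)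
next
  case False
  then have ij': "i < a" "j - 1 < b" using ij by auto
  have "\<And>u. kap i j (u @ [Var_Y]) = q [^] i \<otimes> kap (i) (j - 1) u"
    using qK False by (auto simp: kap_def xy_pairs_append K.nat_pow_mult ac_simps)
  from coA_right[OF ij s this ij'] show ?thesis
    using False qK A.linD(1)[OF coA_lin[OF ij'] s] by (simp add: y_def)
qed

lemma coA_x_left:
  assumes ij: "i < a" "j < b" and s: "s \<in> carrier Q"
  shows "coA i j (x \<otimes>\<^bsub>Q\<^esub> s) = (if i = 0 then \<zero> else q [^] j \<otimes> coA (i - 1) (j) s)"
proof (cases "i = 0")
  case True
  then have "\<And>u. kap i j ([Var_X] @ u) = \<zero> \<otimes> kap i j u"
    using qK by (auto simp: kap_def)
  from coA_left[OF ij s this ij] show ?thesis using True A.linD(1)[OF coA_lin[OF ij] s] by (simp add: x_def)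
next
  case False
  then have ij': "i - 1 < a" "j < b" using ij by auto
  have "\<And>u. kap i j ([Var_X] @ u) = q [^] j \<otimes> kap (i - 1) (j) u"
    using qK False by (auto simp: kap_def xy_pairs_append K.nat_pow_mult ac_simps)
  from coA_left[OF ij s this ij'] show ?thesis
    using False qK A.linD(1)[OF coA_lin[OF ij'] s] by (simp add: x_def)
qed

lemma coA_y_left:
  assumes ij: "i < a" "j < b" and s: "s \<in> carrier Q"
  shows "coA i j (y \<otimes>\<^bsub>Q\<^esub> s) = (if j = 0 then \<zero> else coA (i) (j - 1) s)"
proof (cases "j = 0")
  case True
  then have "\<And>u. kap i j ([Var_Y] @ u) = \<zero> \<otimes> kap i j u"
    using qK by (auto simp: kap_def)
  from coA_left[OF ij s this ij] show ?thesis using True A.linD(1)[OF coA_lin[OF ij] s] by (simp add: y_def)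
next
  case False
  then have ij': "i < a" "j - 1 < b" using ij by auto
  have "\<And>u. kap i j ([Var_Y] @ u) = \<one> \<otimes> kap (i) (j - 1) u"
    using qK False by (auto simp: kap_def xy_pairs_append K.nat_pow_mult ac_simps)
  from coA_left[OF ij s this ij'] show ?thesis
    using False qK A.linD(1)[OF coA_lin[OF ij'] s] by (simp add: y_def)
qed

definition mon :: "nat \<Rightarrow> nat \<Rightarrow> (qci_var list \<Rightarrow> 'k) set" where
  "mon i j = cls (bas (replicate j Var_Y @ replicate i Var_X))"

lemma mon_c [simp]: "mon i j \<in> carrier Q" by (auto simp: mon_def)

lemma coA_mon: assumes "i < a" "j < b" shows "coA i j (mon i' j') = (if i' = i \<and> j' = j then \<one> else \<zero>)"
proof -
  have "xy_pairs (replicate n Var_Y) = 0" "xy_pairs (replicate n Var_X) = 0" for n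
    by (induction n) (auto simp: count_list_replicate')
  then show ?thesis using assms kap_c
    by (auto simp: mon_def coA_cls fm kap_def xy_pairs_append count_list_replicate')
qed

lemma xy_comm: "x \<otimes>\<^bsub>Q\<^esub> y = q \<odot>\<^bsub>Q\<^esub> (y \<otimes>\<^bsub>Q\<^esub> x)"
proof -
  interpret F: ring F by (rule F_ring)
  have "bas [Var_X, Var_Y] \<ominus>\<^bsub>F\<^esub> (q \<odot>\<^bsub>F\<^esub> bas [Var_Y, Var_X]) \<in> J"
    unfolding J_def using F.genideal_self[OF rels_sub] by (auto simp: rels_def)
  then have "cls (bas [Var_X, Var_Y] \<ominus>\<^bsub>F\<^esub> (q \<odot>\<^bsub>F\<^esub> bas [Var_Y, Var_X])) = \<zero>\<^bsub>Q\<^esub>" by (rule cls_J)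
  moreover have "bas [Var_X, Var_Y] = (bas [Var_X, Var_Y] \<ominus>\<^bsub>F\<^esub> (q \<odot>\<^bsub>F\<^esub> bas [Var_Y, Var_X])) \<oplus>\<^bsub>F\<^esub> (q \<odot>\<^bsub>F\<^esub> bas [Var_Y, Var_X])"
    using qK by (simp add: a_minus_def F.a_assoc F.l_neg)
  ultimately have "cls (bas [Var_X, Var_Y]) = q \<odot>\<^bsub>Q\<^esub> cls (bas [Var_Y, Var_X])"
    using qK by (metis (no_types, lifting) A.l_zero F.minus_closed bas_c cls_add cls_closed cls_smult smult_closed)
  then show ?thesis by (simp add: x_def y_def bas_mult' flip: cls_mult)
qed

lemma y_mon: "y \<otimes>\<^bsub>Q\<^esub> mon i j = mon i (Suc j)"
  by (simp add: y_def mon_def bas_mult' flip: cls_mult)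

lemma x_mon: "x \<otimes>\<^bsub>Q\<^esub> mon i j = q [^] j \<odot>\<^bsub>Q\<^esub> mon (Suc i) j"
proof (induction j)
  case 0
  have "x \<otimes>\<^bsub>Q\<^esub> mon i 0 = mon (Suc i) 0" by (simp add: x_def mon_def bas_mult' flip: cls_mult)
  then show ?case by simp
next
  case (Suc j)
  have "x \<otimes>\<^bsub>Q\<^esub> mon i (Suc j) = (x \<otimes>\<^bsub>Q\<^esub> y) \<otimes>\<^bsub>Q\<^esub> mon i j" by (simp add: A.m_assoc flip: y_mon)
  also have "\<dots> = q \<odot>\<^bsub>Q\<^esub> (y \<otimes>\<^bsub>Q\<^esub> (x \<otimes>\<^bsub>Q\<^esub> mon i j))" using qK by (simp add: xy_comm A.sc_lmult A.m_assoc)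
  also have "\<dots> = q [^] Suc j \<odot>\<^bsub>Q\<^esub> mon (Suc i) (Suc j)"
    using qK by (simp add: Suc A.sc_rmult y_mon K.m_comm flip: A.sc_assoc)
  finally show ?case .
qed

lemma word_mon: "cls (bas w) = q [^] xy_pairs w \<odot>\<^bsub>Q\<^esub> mon (count_list w Var_X) (count_list w Var_Y)"
proof (induction w rule: xy_pairs.induct)
  case 1 then show ?case by (simp add: mon_def)
next
  case (2 w)
  have "cls (bas (Var_X # w)) = x \<otimes>\<^bsub>Q\<^esub> cls (bas w)" by (simp add: x_def bas_mult' flip: cls_mult)
  then show ?case using 2 qK by (simp add: A.sc_rmult x_mon K.nat_pow_mult add.commute flip: A.sc_assoc)
next
  case (3 w)
  have "cls (bas (Var_Y # w)) = y \<otimes>\<^bsub>Q\<^esub> cls (bas w)" by (simp add: y_def bas_mult' flip: cls_mult)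
  then show ?case using 3 qK by (simp add: A.sc_rmult y_mon)
qed

lemma mon_zero: assumes "i \<ge> a \<or> j \<ge> b" shows "mon i j = \<zero>\<^bsub>Q\<^esub>"
proof -
  interpret F: ring F by (rule F_ring)
  have 0: "cls (bas (replicate a Var_X)) = \<zero>\<^bsub>Q\<^esub>" "cls (bas (replicate b Var_Y)) = \<zero>\<^bsub>Q\<^esub>"
    using F.genideal_self[OF rels_sub] unfolding J_def[symmetric] by (auto simp: rels_def intro!: cls_J)
  show ?thesis
  proof (cases "i \<ge> a")
    case True
    then have "replicate j Var_Y @ replicate i Var_X = (replicate j Var_Y @ replicate (i - a) Var_X) @ replicate a Var_X"
      using replicate_add[of "i - a" a Var_X] by simp
    then have "mon i j = cls (bas (replicate j Var_Y @ replicate (i - a) Var_X)) \<otimes>\<^bsub>Q\<^esub> cls (bas (replicate a Var_X))"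
      unfolding mon_def by (simp only: bas_mult' bas_c flip: cls_mult)
    then show ?thesis by (simp add: 0)
  next
    case False
    then have "j \<ge> b" using assms by simp
    then have "replicate j Var_Y @ replicate i Var_X = replicate b Var_Y @ (replicate (j - b) Var_Y @ replicate i Var_X)"
      using replicate_add[of b "j - b" Var_Y] by simp
    then have "mon i j = cls (bas (replicate b Var_Y)) \<otimes>\<^bsub>Q\<^esub> cls (bas (replicate (j - b) Var_Y @ replicate i Var_X))"
      unfolding mon_def by (simp only: bas_mult' bas_c flip: cls_mult)
    then show ?thesis by (simp add: 0)
  qed
qed

text \<open>Independence is contained in the duality of \<open>coA\<close> and \<open>mon\<close>.
  Spanning is checked on words only: sorting a word gives a scalar multiple of a monomial, which is
  either in range or zero.\<close>

sublocale AB: basis_algebra K Q "{..<a} \<times> {..<b}" "\<lambda>p. coA (fst p) (snd p)" "\<lambda>p. mon (fst p) (snd p)"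
proof -
  interpret C: coord_basis K Q "{..<a} \<times> {..<b}" "\<lambda>p. coA (fst p) (snd p)" "\<lambda>p. mon (fst p) (snd p)"
  proof unfold_locales
    show "finite ({..<a} \<times> {..<b})" by simp
    fix p assume p: "p \<in> {..<a} \<times> {..<b}"
    show "A.lin (coA (fst p) (snd p))" by (rule coA_lin) (use p in auto)
    show "mon (fst p) (snd p) \<in> carrier Q" by simp
    fix r assume "r \<in> {..<a} \<times> {..<b}"
    show "coA (fst p) (snd p) (mon (fst r) (snd r)) = (if p = r then \<one> else \<zero>)"
      using p by (subst coA_mon) (auto simp: prod_eq_iff)
  qed
  show "basis_algebra K Q ({..<a} \<times> {..<b}) (\<lambda>p. coA (fst p) (snd p)) (\<lambda>p. mon (fst p) (snd p))"
  proof unfold_locales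
    fix z assume "z \<in> carrier Q"
    then show "C.expands z"
    proof (induction z rule: Q_induct)
      case zero show ?case by (rule C.expands_zero)
    next
      case (add c g s)
      have "C.expands (mon i j)" for i j
      proof (cases "i < a \<and> j < b")
        case True then show ?thesis using C.expands_m[of "(i, j)"] by simp
      next
        case False
        then have "mon i j = \<zero>\<^bsub>Q\<^esub>" by (intro mon_zero) auto
        then show ?thesis using C.expands_zero by simp
      qed
      then have "C.expands (cls (bas g))" unfolding word_mon using qK by (intro C.expands_smult) auto
      then show ?case using add by (intro C.expands_add C.expands_smult)
    qed
  qed
qed

end

section \<open>The enveloping algebra\<close>

lemma (in basis_algebra) basis_induct [consumes 1, case_names zero add]:
  assumes x: "x \<in> carrier A" and z: "P \<zero>\<^bsub>A\<^esub>"
    and s: "\<And>c p y. c \<in> carrier K \<Longrightarrow> p \<in> I \<Longrightarrow> y \<in> carrier A \<Longrightarrow> P y \<Longrightarrow> P (c \<odot>\<^bsub>A\<^esub> m p \<oplus>\<^bsub>A\<^esub> y)"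
  shows "P x"
proof -
  have "P (\<Oplus>\<^bsub>A\<^esub>p\<in>B. \<chi> p x \<odot>\<^bsub>A\<^esub> m p)" if "B \<subseteq> I" for B
    using finite_subset[OF that finI] that
  proof (induction B rule: finite_induct)
    case (insert p B)
    have f: "(\<lambda>p. \<chi> p x \<odot>\<^bsub>A\<^esub> m p) \<in> insert p B \<rightarrow> carrier A"
      using insert.prems x by (auto intro!: sc_closed mc \<chi>_closed)
    then have "(\<Oplus>\<^bsub>A\<^esub>p\<in>insert p B. \<chi> p x \<odot>\<^bsub>A\<^esub> m p) = \<chi> p x \<odot>\<^bsub>A\<^esub> m p \<oplus>\<^bsub>A\<^esub> (\<Oplus>\<^bsub>A\<^esub>p\<in>B. \<chi> p x \<odot>\<^bsub>A\<^esub> m p)"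
      using insert by (intro A.finsum_insert) auto
    then show ?case using s[of "\<chi> p x" p "\<Oplus>\<^bsub>A\<^esub>p\<in>B. \<chi> p x \<odot>\<^bsub>A\<^esub> m p"] insert f x \<chi>_closed[of p x]
      by (auto intro!: A.finsum_closed)
  qed (use z in simp)
  from this[of I] show ?thesis using expand[OF x] by (simp add: expands_def comb_def)
qed

locale enveloping = basis_algebra K A I \<chi> m
  for K :: "('k, 'z) ring_scheme" (structure) and A :: "('k, 'a) module" (structure)
    and I :: "'i set" and \<chi> m
begin

lemma op_simps [simp]: "carrier (opposite_algebra A) = carrier A" "mult (opposite_algebra A) = (\<lambda>x y. y \<otimes>\<^bsub>A\<^esub> x)"
  "one (opposite_algebra A) = one A" "add (opposite_algebra A) = add A" "smult (opposite_algebra A) = smult A"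
  by (simp_all add: opposite_algebra_def)

abbreviation G where "G \<equiv> A \<times>\<times> opposite_algebra A"

lemma G_monoid: "monoid G"
proof -
  have "monoid (opposite_algebra A)" by (rule monoidI) (auto simp: op_simps A.m_assoc)
  then show ?thesis by (intro DirProd_monoid A.monoid_axioms)
qed

sublocale monoid_alg K G
  by (intro monoid_alg.intro K.field_axioms G_monoid)

lemma G_simps [simp]: "carrier G = carrier A \<times> carrier A" "\<one>\<^bsub>G\<^esub> = (\<one>\<^bsub>A\<^esub>, \<one>\<^bsub>A\<^esub>)"
  "(s, t) \<otimes>\<^bsub>G\<^esub> (s', t') = (s \<otimes>\<^bsub>A\<^esub> s', t' \<otimes>\<^bsub>A\<^esub> t)"
  by (simp_all add: DirProd_def op_simps)

definition bilin :: "('a \<times> 'a \<Rightarrow> 'k) \<Rightarrow> bool" where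
  "bilin \<beta> \<longleftrightarrow> (\<forall>t\<in>carrier A. lin (\<lambda>s. \<beta> (s, t))) \<and> (\<forall>s\<in>carrier A. lin (\<lambda>t. \<beta> (s, t)))"

lemma bilinD:
  assumes "bilin \<beta>" and "s \<in> carrier A" "t \<in> carrier A"
  shows "\<beta> (s, t) \<in> carrier K"
    "s' \<in> carrier A \<Longrightarrow> \<beta> (s \<oplus>\<^bsub>A\<^esub> s', t) = \<beta> (s, t) \<oplus> \<beta> (s', t)"
    "t' \<in> carrier A \<Longrightarrow> \<beta> (s, t \<oplus>\<^bsub>A\<^esub> t') = \<beta> (s, t) \<oplus> \<beta> (s, t')"
    "c \<in> carrier K \<Longrightarrow> \<beta> (c \<odot>\<^bsub>A\<^esub> s, t) = c \<otimes> \<beta> (s, t)"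
    "c \<in> carrier K \<Longrightarrow> \<beta> (s, c \<odot>\<^bsub>A\<^esub> t) = c \<otimes> \<beta> (s, t)"
  using assms by (auto simp: bilin_def lin_def)

lemma bilin_c: "bilin \<beta> \<Longrightarrow> \<beta> \<in> carrier G \<rightarrow> carrier K"
  using bilinD(1) by auto

lemma bilin_c' [simp]: "bilin \<beta> \<Longrightarrow> \<beta> \<in> carrier A \<times> carrier A \<rightarrow> carrier K"
  using bilinD(1) by auto

lemma bilin_shift:
  assumes b: "bilin \<beta>" and c: "s0 \<in> carrier A" "t0 \<in> carrier A" "s1 \<in> carrier A" "t1 \<in> carrier A"
  shows "bilin (\<lambda>p. \<beta> (s0 \<otimes>\<^bsub>A\<^esub> fst p \<otimes>\<^bsub>A\<^esub> s1, t0 \<otimes>\<^bsub>A\<^esub> snd p \<otimes>\<^bsub>A\<^esub> t1))"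
  unfolding bilin_def lin_def
  using c by (auto simp: bilinD[OF b] A.l_distr A.r_distr sc_lmult sc_rmult)

definition J where "J = Idl\<^bsub>F\<^esub> (tensor_relations K A (opposite_algebra A))"

lemma rels_c: "tensor_relations K A (opposite_algebra A) \<subseteq> carrier F"
proof -
  interpret F: ring F by (rule F_ring)
  show ?thesis unfolding tensor_relations_def Let_def op_simps
    by (auto intro!: F.minus_closed add_closed smult_closed bas_closed)
qed

lemma J_ideal: "ideal J F" unfolding J_def by (rule ring.genideal_ideal[OF F_ring rels_c])

sublocale quot_alg K G J by (intro quot_alg.intro quot_alg_axioms.intro monoid_alg_axioms J_ideal)

lemma env_eq: "enveloping_algebra K A = Q"
  by (simp add: enveloping_algebra_def tensor_algebra_def J_def Let_def)

sublocale R: kalgebra K Q by (rule Q_kalgebra)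

text \<open>Translating a bilinear function by elements of the monoid of pairs gives a bilinear
  function again, so \<open>ev_ideal\<close> asks only that bilinear functions vanish on the
  defining relations.\<close>

lemma bilin_J: assumes b: "bilin \<beta>" and f: "f \<in> J" shows "ev \<beta> f = \<zero>"
proof (rule ev_ideal[OF rels_c bilin_c[OF b] _ f[unfolded J_def]])
  fix u v r assume u: "u \<in> carrier G" and v: "v \<in> carrier G" and r: "r \<in> tensor_relations K A (opposite_algebra A)"
  define \<gamma> where "\<gamma> = (\<lambda>p. \<beta> (fst u \<otimes>\<^bsub>A\<^esub> fst p \<otimes>\<^bsub>A\<^esub> fst v, snd v \<otimes>\<^bsub>A\<^esub> snd p \<otimes>\<^bsub>A\<^esub> snd u))"
  have g: "bilin \<gamma>" unfolding \<gamma>_def by (rule bilin_shift[OF b]) (use u v in auto)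
  note gc = bilin_c[OF g]
  have rF: "r \<in> carrier F" using r rels_c by auto
  have "ev (\<lambda>g. \<beta> (u \<otimes>\<^bsub>G\<^esub> g \<otimes>\<^bsub>G\<^esub> v)) r = ev \<gamma> r"
    by (rule ev_cong[OF rF gc]) (use u v in \<open>auto simp: \<gamma>_def A.m_assoc\<close>)
  also have "\<dots> = \<zero>"
    using r unfolding tensor_relations_def Let_def op_simps
    by (auto simp: ev_minus g bilinD[OF g] K.minus_eq K.r_neg)
  finally show "ev (\<lambda>g. \<beta> (u \<otimes>\<^bsub>G\<^esub> g \<otimes>\<^bsub>G\<^esub> v)) r = \<zero>" .
qed

definition tens where "tens s t = cls (bas (s, t))"

lemma tens_c [simp]: "s \<in> carrier A \<Longrightarrow> t \<in> carrier A \<Longrightarrow> tens s t \<in> carrier Q"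
  by (simp add: tens_def)

lemma tens_mult: "\<lbrakk>s \<in> carrier A; t \<in> carrier A; s' \<in> carrier A; t' \<in> carrier A\<rbrakk> \<Longrightarrow>
    tens s t \<otimes>\<^bsub>Q\<^esub> tens s' t' = tens (s \<otimes>\<^bsub>A\<^esub> s') (t' \<otimes>\<^bsub>A\<^esub> t)"
  by (simp add: tens_def bas_mult flip: cls_mult)

lemma cls_rel: assumes "f \<ominus>\<^bsub>F\<^esub> g \<in> tensor_relations K A (opposite_algebra A)" "f \<in> carrier F" "g \<in> carrier F"
  shows "cls f = cls g"
proof -
  interpret F: ring F by (rule F_ring)
  have "f \<ominus>\<^bsub>F\<^esub> g \<in> J" unfolding J_def using F.genideal_self[OF rels_c] assms(1) by auto
  then have "cls (f \<ominus>\<^bsub>F\<^esub> g) = \<zero>\<^bsub>Q\<^esub>" by (rule cls_J)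
  moreover have "f = (f \<ominus>\<^bsub>F\<^esub> g) \<oplus>\<^bsub>F\<^esub> g" using assms by (simp add: a_minus_def F.a_assoc F.l_neg)
  ultimately show ?thesis using assms by (metis F.minus_closed R.l_zero cls_add cls_closed)
qed

lemma tens_bilin:
  assumes "s \<in> carrier A" "t \<in> carrier A"
  shows "s' \<in> carrier A \<Longrightarrow> tens (s \<oplus>\<^bsub>A\<^esub> s') t = tens s t \<oplus>\<^bsub>Q\<^esub> tens s' t"
    "t' \<in> carrier A \<Longrightarrow> tens s (t \<oplus>\<^bsub>A\<^esub> t') = tens s t \<oplus>\<^bsub>Q\<^esub> tens s t'"
    "c \<in> carrier K \<Longrightarrow> tens (c \<odot>\<^bsub>A\<^esub> s) t = c \<odot>\<^bsub>Q\<^esub> tens s t"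
    "c \<in> carrier K \<Longrightarrow> tens s (c \<odot>\<^bsub>A\<^esub> t) = c \<odot>\<^bsub>Q\<^esub> tens s t"
proof -
  note r = tensor_relations_def[of K A "opposite_algebra A", unfolded Let_def op_simps]
  show "tens (s \<oplus>\<^bsub>A\<^esub> s') t = tens s t \<oplus>\<^bsub>Q\<^esub> tens s' t" if "s' \<in> carrier A"
  proof -
    have "bas (s \<oplus>\<^bsub>A\<^esub> s', t) \<ominus>\<^bsub>F\<^esub> (bas (s, t) \<oplus>\<^bsub>F\<^esub> bas (s', t)) \<in> tensor_relations K A (opposite_algebra A)"
      unfolding r using that assms by blast
    from cls_rel[OF this] that assms show ?thesis by (simp add: tens_def cls_add)
  qed
  show "tens s (t \<oplus>\<^bsub>A\<^esub> t') = tens s t \<oplus>\<^bsub>Q\<^esub> tens s t'" if "t' \<in> carrier A"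
  proof -
    have "bas (s, t \<oplus>\<^bsub>A\<^esub> t') \<ominus>\<^bsub>F\<^esub> (bas (s, t) \<oplus>\<^bsub>F\<^esub> bas (s, t')) \<in> tensor_relations K A (opposite_algebra A)"
      unfolding r using that assms by blast
    from cls_rel[OF this] that assms show ?thesis by (simp add: tens_def cls_add)
  qed
  show "tens (c \<odot>\<^bsub>A\<^esub> s) t = c \<odot>\<^bsub>Q\<^esub> tens s t" if "c \<in> carrier K"
  proof -
    have "bas (c \<odot>\<^bsub>A\<^esub> s, t) \<ominus>\<^bsub>F\<^esub> (c \<odot>\<^bsub>F\<^esub> bas (s, t)) \<in> tensor_relations K A (opposite_algebra A)"
      unfolding r using that assms by blast
    from cls_rel[OF this] that assms show ?thesis by (simp add: tens_def cls_smult)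
  qed
  show "tens s (c \<odot>\<^bsub>A\<^esub> t) = c \<odot>\<^bsub>Q\<^esub> tens s t" if "c \<in> carrier K"
  proof -
    have "bas (s, c \<odot>\<^bsub>A\<^esub> t) \<ominus>\<^bsub>F\<^esub> (c \<odot>\<^bsub>F\<^esub> bas (s, t)) \<in> tensor_relations K A (opposite_algebra A)"
      unfolding r using that assms by blast
    from cls_rel[OF this] that assms show ?thesis by (simp add: tens_def cls_smult)
  qed
qed

lemma bil_cls: "bilin \<beta> \<Longrightarrow> f \<in> carrier F \<Longrightarrow> funl \<beta> (cls f) = ev \<beta> f"
  using bilin_c bilin_J by (intro funl_cls) auto

lemma bil_tens: "bilin \<beta> \<Longrightarrow> s \<in> carrier A \<Longrightarrow> t \<in> carrier A \<Longrightarrow> funl \<beta> (tens s t) = \<beta> (s, t)"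
  using bilin_c by (simp add: tens_def bil_cls)

lemma bil_lin: "bilin \<beta> \<Longrightarrow> R.lin (funl \<beta>)"
  using bilin_c bilin_J by (intro funl_lin) auto

lemma R_induct [consumes 1, case_names zero add]:
  assumes x: "x \<in> carrier Q" and z: "P \<zero>\<^bsub>Q\<^esub>"
    and s: "\<And>c s t y. c \<in> carrier K \<Longrightarrow> s \<in> carrier A \<Longrightarrow> t \<in> carrier A \<Longrightarrow> y \<in> carrier Q \<Longrightarrow> P y \<Longrightarrow> P (c \<odot>\<^bsub>Q\<^esub> tens s t \<oplus>\<^bsub>Q\<^esub> y)"
  shows "P x"
  using x
proof (induction x rule: Q_induct)
  case (add c g y)
  then show ?case using s[of c "fst g" "snd g" y] by (auto simp: tens_def)
qed (use z in simp)

lemma lin_cong_tens: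
  assumes f: "R.lin \<phi>" and g: "R.lin \<psi>" and e: "\<And>s t. s \<in> carrier A \<Longrightarrow> t \<in> carrier A \<Longrightarrow> \<phi> (tens s t) = \<psi> (tens s t)"
    and r: "r \<in> carrier Q"
  shows "\<phi> r = \<psi> r"
  using r by (induction r rule: R_induct) (auto simp: R.linD[OF f] R.linD[OF g] e)

lemma lin_mult: assumes f: "R.lin \<phi>" and z: "z \<in> carrier Q"
  shows "R.lin (\<lambda>r. \<phi> (r \<otimes>\<^bsub>Q\<^esub> z))" "R.lin (\<lambda>r. \<phi> (z \<otimes>\<^bsub>Q\<^esub> r))"
  using z by (auto simp: R.lin_def R.l_distr R.r_distr R.sc_lmult R.sc_rmult R.linD[OF f])

lemma lin_scale: assumes f: "R.lin \<phi>" and c: "c \<in> carrier K" shows "R.lin (\<lambda>r. c \<otimes> \<phi> r)"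
  using c by (auto simp: R.lin_def R.linD[OF f] K.r_distr K.m_lcomm)

lemma lin_null: "R.lin (\<lambda>r. \<zero>)" by (auto simp: R.lin_def)

definition chi2 :: "'i \<times> 'i \<Rightarrow> ('a \<times> 'a \<Rightarrow> 'k) set \<Rightarrow> 'k" where
  "chi2 pr = funl (\<lambda>st. \<chi> (fst pr) (fst st) \<otimes> \<chi> (snd pr) (snd st))"

lemma chi2_bil: "p \<in> I \<Longrightarrow> r \<in> I \<Longrightarrow> bilin (\<lambda>st. \<chi> p (fst st) \<otimes> \<chi> r (snd st))"
  by (auto simp: bilin_def lin_def linD[OF lin] K.l_distr K.r_distr K.m_assoc K.m_lcomm)

lemma chi2_lin: "p \<in> I \<Longrightarrow> r \<in> I \<Longrightarrow> R.lin (chi2 (p, r))"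
  unfolding chi2_def using bil_lin[OF chi2_bil] by simp

lemma chi2_tens: "\<lbrakk>p \<in> I; r \<in> I; s \<in> carrier A; t \<in> carrier A\<rbrakk> \<Longrightarrow> chi2 (p, r) (tens s t) = \<chi> p s \<otimes> \<chi> r t"
  unfolding chi2_def using bil_tens[OF chi2_bil] by simp

text \<open>The products of coordinates are dual to the tensors of basis elements. For spanning,
  bilinearity lets one factor be expanded at a time, and pure tensors generate the algebra
  linearly.\<close>

sublocale RB: basis_algebra K Q "I \<times> I" chi2 "\<lambda>pr. tens (m (fst pr)) (m (snd pr))"
proof -
  interpret C: coord_basis K Q "I \<times> I" chi2 "\<lambda>pr. tens (m (fst pr)) (m (snd pr))"
  proof unfold_locales
    show "finite (I \<times> I)" using finI by simp
    fix pr assume p: "pr \<in> I \<times> I"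
    then show "R.lin (chi2 pr)" using chi2_lin by auto
    show "tens (m (fst pr)) (m (snd pr)) \<in> carrier Q" using p mc by auto
    fix pr' assume "pr' \<in> I \<times> I"
    then show "chi2 pr (tens (m (fst pr')) (m (snd pr'))) = (if pr = pr' then \<one> else \<zero>)"
      using p chi2_tens[of "fst pr" "snd pr"] mc by (auto simp: dual prod_eq_iff)
  qed
  show "basis_algebra K Q (I \<times> I) chi2 (\<lambda>pr. tens (m (fst pr)) (m (snd pr)))"
  proof unfold_locales
    fix z assume "z \<in> carrier Q"
    have mm: "C.expands (tens (m p) (m r))" if "p \<in> I" "r \<in> I" for p r
      using C.expands_m[of "(p, r)"] that by simp
    have z0: "tens \<zero>\<^bsub>A\<^esub> t = \<zero>\<^bsub>Q\<^esub>" "tens t \<zero>\<^bsub>A\<^esub> = \<zero>\<^bsub>Q\<^esub>" if "t \<in> carrier A" for t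
      using tens_bilin(3)[of "\<zero>\<^bsub>A\<^esub>" t "\<zero>"] tens_bilin(4)[of t "\<zero>\<^bsub>A\<^esub>" "\<zero>"] that by simp_all
    have mt: "C.expands (tens (m p) t)" if p: "p \<in> I" and t: "t \<in> carrier A" for p t
      using t
    proof (induction t rule: basis_induct)
      case zero
      then show ?case using z0(2)[OF mc[OF p]] C.expands_zero by simp
    next
      case (add c r y)
      then show ?case using mc p mm by (simp add: tens_bilin C.expands_add C.expands_smult)
    qed
    have tt: "C.expands (tens s t)" if s: "s \<in> carrier A" and t: "t \<in> carrier A" for s t
      using s
    proof (induction s rule: basis_induct)
      case zero
      then show ?case using z0(1)[OF t] C.expands_zero by simp
    next
      case (add c r y)
      then show ?case using mc t mt by (simp add: tens_bilin C.expands_add C.expands_smult)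
    qed
    from \<open>z \<in> carrier Q\<close> show "C.expands z"
    proof (induction z rule: R_induct)
      case zero show ?case by (rule C.expands_zero)
    next
      case (add c s t y)
      then show ?case using tt by (intro C.expands_add C.expands_smult) auto
    qed
  qed
qed

text \<open>The sum that occurs in the definition of the regular bimodule, taken on a single
  representative.\<close>

definition act :: "('a \<times> 'a \<Rightarrow> 'k) \<Rightarrow> 'a \<Rightarrow> 'a" where
  "act f x = (\<Oplus>\<^bsub>A\<^esub>p\<in>supp K f. f p \<odot>\<^bsub>A\<^esub> (fst p \<otimes>\<^bsub>A\<^esub> x \<otimes>\<^bsub>A\<^esub> snd p))"

lemma act_c: "f \<in> carrier F \<Longrightarrow> x \<in> carrier A \<Longrightarrow> act f x \<in> carrier A"
  unfolding act_def by (rule A.finsum_closed) (use F_suppD in \<open>auto intro!: sc_closed A.m_closed\<close>)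

lemma act_bil: assumes "x \<in> carrier A" "lin \<phi>" shows "bilin (\<lambda>p. \<phi> (fst p \<otimes>\<^bsub>A\<^esub> x \<otimes>\<^bsub>A\<^esub> snd p))"
  using assms(1) by (auto simp: bilin_def lin_def linD[OF assms(2)] A.l_distr A.r_distr sc_lmult sc_rmult)

lemma lin_act:
  assumes f: "f \<in> carrier F" and x: "x \<in> carrier A" and p: "lin \<phi>"
  shows "\<phi> (act f x) = ev (\<lambda>p. \<phi> (fst p \<otimes>\<^bsub>A\<^esub> x \<otimes>\<^bsub>A\<^esub> snd p)) f"
proof -
  have c: "fst p \<otimes>\<^bsub>A\<^esub> x \<otimes>\<^bsub>A\<^esub> snd p \<in> carrier A" if "p \<in> supp K f" for p
    using F_suppD[OF f that] x by auto
  have "\<phi> (act f x) = (\<Oplus>p\<in>supp K f. \<phi> (f p \<odot>\<^bsub>A\<^esub> (fst p \<otimes>\<^bsub>A\<^esub> x \<otimes>\<^bsub>A\<^esub> snd p)))"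
    unfolding act_def by (rule lin_finsum[OF p]) (intro Pi_I sc_closed F_val[OF f] c)
  also have "\<dots> = ev (\<lambda>p. \<phi> (fst p \<otimes>\<^bsub>A\<^esub> x \<otimes>\<^bsub>A\<^esub> snd p)) f"
    unfolding ev_def
  proof (rule K.finsum_cong'[OF refl])
    show "\<phi> (f i \<odot>\<^bsub>A\<^esub> (fst i \<otimes>\<^bsub>A\<^esub> x \<otimes>\<^bsub>A\<^esub> snd i)) = f i \<otimes> \<phi> (fst i \<otimes>\<^bsub>A\<^esub> x \<otimes>\<^bsub>A\<^esub> snd i)"
      if "i \<in> supp K f" for i by (rule linD(3)[OF p F_val[OF f] c[OF that]])
    show "(\<lambda>i. f i \<otimes> \<phi> (fst i \<otimes>\<^bsub>A\<^esub> x \<otimes>\<^bsub>A\<^esub> snd i)) \<in> supp K f \<rightarrow> carrier K"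
      by (intro Pi_I K.m_closed F_val[OF f] linD(1)[OF p] c)
  qed
  finally show ?thesis .
qed

text \<open>Equality in the algebra is tested on coordinates, and each coordinate of the action is
  the evaluation of a bilinear function, hence depends only on the class. This gives
  \<open>the_elem\<close> in the bimodule structure its meaning.\<close>

lemma act_coset:
  assumes f: "f \<in> carrier F" and g: "g \<in> carrier F" and e: "cls g = cls f" and x: "x \<in> carrier A"
  shows "act g x = act f x"
proof (rule coord_eqI[OF act_c[OF g x] act_c[OF f x]])
  fix p assume p: "p \<in> I"
  note b = act_bil[OF x lin[OF p]]
  show "\<chi> p (act g x) = \<chi> p (act f x)"
    using bil_cls[OF b f] bil_cls[OF b g] e by (simp add: lin_act[OF f x lin[OF p]] lin_act[OF g x lin[OF p]])
qed

abbreviation M where "M \<equiv> regular_bimodule K A"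

lemma M_simps: "carrier M = carrier A" "zero M = zero A" "add M = add A"
  by (simp_all add: regular_bimodule_def)

lemma smult_cls: assumes f: "f \<in> carrier F" and x: "x \<in> carrier A" shows "cls f \<odot>\<^bsub>M\<^esub> x = act f x"
proof -
  have *: "act g x = act f x" if g: "g \<in> cls f" for g
  proof (rule act_coset[OF f mem_cls(1)[OF f g] _ x])
    obtain j where j: "j \<in> J" "g = j \<oplus>\<^bsub>F\<^esub> f" using mem_cls(2)[OF f g] by blast
    have jF: "j \<in> carrier F" using j(1) additive_subgroup.a_subset[OF ideal.axioms(1)[OF J]] by auto
    show "cls g = cls f" using j jF f cls_J[of j] by (simp add: cls_add)
  qed
  have "(\<lambda>f. act f x) ` cls f = (\<lambda>_. act f x) ` cls f" by (rule image_cong[OF refl *])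
  then have "(\<lambda>f. act f x) ` cls f = {act f x}" using self_mem_cls[OF f] by blast
  then show ?thesis by (simp add: regular_bimodule_def act_def)
qed

lemma smult_tens:
  assumes "s \<in> carrier A" "t \<in> carrier A" "x \<in> carrier A" shows "tens s t \<odot>\<^bsub>M\<^esub> x = s \<otimes>\<^bsub>A\<^esub> x \<otimes>\<^bsub>A\<^esub> t"
proof -
  have e: "supp K (bas (s, t)) = {(s, t)}" by (auto simp: supp_def basis_elt_def)
  have "act (bas (s, t)) x = s \<otimes>\<^bsub>A\<^esub> x \<otimes>\<^bsub>A\<^esub> t"
    unfolding act_def e using assms by (simp add: A.finsum_insert basis_elt_def)
  then show ?thesis using assms by (simp add: tens_def smult_cls)
qed

end

section \<open>An acyclic bicomplex\<close>

lemma (in monoid) nat_pow_commute: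
  assumes "x \<in> carrier G" "z \<in> carrier G" "x \<otimes> z = z \<otimes> x"
  shows "x [^] (n::nat) \<otimes> z = z \<otimes> x [^] n"
proof (induction n)
  case (Suc n)
  have "x [^] Suc n \<otimes> z = (x [^] n \<otimes> z) \<otimes> x" using assms by (simp add: m_assoc)
  then show ?case using Suc assms by (simp add: m_assoc)
qed (use assms in simp)

section \<open>Homogeneous sums and their complementary factors\<close>

context kalgebra
begin

lemma sc_minus: "c \<in> carrier K \<Longrightarrow> x \<in> carrier A \<Longrightarrow> (\<ominus> c) \<odot>\<^bsub>A\<^esub> x = \<ominus>\<^bsub>A\<^esub> (c \<odot>\<^bsub>A\<^esub> x)"
  by (rule module.smult_l_minus[OF module_KA])

text \<open>The sum of \<open>c^t X'^t X^(e-t)\<close> over \<open>t \<le> e\<close>. For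
  \<open>e = 1\<close> with \<open>- c\<close> in place of \<open>c\<close> it is the twisted
  commutator \<open>X - c X'\<close>, for \<open>e = n - 1\<close> its complementary factor, so both
  kinds of differential share one shape and one set of commutation rules.\<close>

fun hom_sum :: "'a \<Rightarrow> 'a \<Rightarrow> nat \<Rightarrow> 'k \<Rightarrow> 'a" where
  "hom_sum X X' 0 c = \<one>\<^bsub>A\<^esub>"
| "hom_sum X X' (Suc e) c = hom_sum X X' e c \<otimes>\<^bsub>A\<^esub> X \<oplus>\<^bsub>A\<^esub> c [^] Suc e \<odot>\<^bsub>A\<^esub> X' [^]\<^bsub>A\<^esub> Suc e"

lemma hom_sum_closed [simp]:
  "\<lbrakk>X \<in> carrier A; X' \<in> carrier A; c \<in> carrier K\<rbrakk> \<Longrightarrow> hom_sum X X' e c \<in> carrier A"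
  by (induction e) auto

lemma hom_sum_1: "\<lbrakk>X \<in> carrier A; X' \<in> carrier A; c \<in> carrier K\<rbrakk> \<Longrightarrow> hom_sum X X' 1 (\<ominus> c) = X \<ominus>\<^bsub>A\<^esub> c \<odot>\<^bsub>A\<^esub> X'"
  by (simp add: sc_minus A.minus_eq)

lemma hom_sum_telescope:
  assumes X: "X \<in> carrier A" "X' \<in> carrier A" and c: "c \<in> carrier K" and comm: "X \<otimes>\<^bsub>A\<^esub> X' = X' \<otimes>\<^bsub>A\<^esub> X"
  shows "hom_sum X X' e c \<otimes>\<^bsub>A\<^esub> (X \<ominus>\<^bsub>A\<^esub> c \<odot>\<^bsub>A\<^esub> X') = X [^]\<^bsub>A\<^esub> Suc e \<ominus>\<^bsub>A\<^esub> c [^] Suc e \<odot>\<^bsub>A\<^esub> X' [^]\<^bsub>A\<^esub> Suc e"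
proof (induction e)
  case 0 then show ?case using X c by simp
next
  case (Suc e)
  let ?D = "X \<ominus>\<^bsub>A\<^esub> c \<odot>\<^bsub>A\<^esub> X'" and ?P = "X' [^]\<^bsub>A\<^esub> Suc e" and ?c = "c [^] Suc e"
  have cl: "?D \<in> carrier A" "?P \<in> carrier A" "?c \<in> carrier K" using X c by auto
  have XD: "X \<otimes>\<^bsub>A\<^esub> ?D = ?D \<otimes>\<^bsub>A\<^esub> X"
    using X c comm by (simp add: A.minus_eq A.r_distr A.l_distr sc_lmult sc_rmult A.r_minus A.l_minus)
  have PX: "?P \<otimes>\<^bsub>A\<^esub> X = X \<otimes>\<^bsub>A\<^esub> ?P"
    by (rule A.nat_pow_commute) (use X comm in auto)
  have "hom_sum X X' (Suc e) c \<otimes>\<^bsub>A\<^esub> ?D = (hom_sum X X' e c \<otimes>\<^bsub>A\<^esub> ?D) \<otimes>\<^bsub>A\<^esub> X \<oplus>\<^bsub>A\<^esub> ?c \<odot>\<^bsub>A\<^esub> (?P \<otimes>\<^bsub>A\<^esub> ?D)"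
    using X c cl XD by (simp add: A.l_distr A.m_assoc sc_lmult del: A.nat_pow_Suc)
  also have "\<dots> = (X [^]\<^bsub>A\<^esub> Suc (Suc e) \<ominus>\<^bsub>A\<^esub> ?c \<odot>\<^bsub>A\<^esub> (?P \<otimes>\<^bsub>A\<^esub> X)) \<oplus>\<^bsub>A\<^esub> (?c \<odot>\<^bsub>A\<^esub> (?P \<otimes>\<^bsub>A\<^esub> X) \<ominus>\<^bsub>A\<^esub> (c [^] Suc (Suc e)) \<odot>\<^bsub>A\<^esub> X' [^]\<^bsub>A\<^esub> Suc (Suc e))"
  proof -
    have "(hom_sum X X' e c \<otimes>\<^bsub>A\<^esub> ?D) \<otimes>\<^bsub>A\<^esub> X = X [^]\<^bsub>A\<^esub> Suc (Suc e) \<ominus>\<^bsub>A\<^esub> ?c \<odot>\<^bsub>A\<^esub> (?P \<otimes>\<^bsub>A\<^esub> X)"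
      unfolding Suc using X c cl(2,3) by (simp add: A.minus_eq A.l_distr A.l_minus sc_lmult)
    moreover have "?c \<odot>\<^bsub>A\<^esub> (?P \<otimes>\<^bsub>A\<^esub> ?D) = ?c \<odot>\<^bsub>A\<^esub> (?P \<otimes>\<^bsub>A\<^esub> X) \<ominus>\<^bsub>A\<^esub> (c [^] Suc (Suc e)) \<odot>\<^bsub>A\<^esub> X' [^]\<^bsub>A\<^esub> Suc (Suc e)"
    proof -
      have "?c \<odot>\<^bsub>A\<^esub> (?P \<otimes>\<^bsub>A\<^esub> ?D) = ?c \<odot>\<^bsub>A\<^esub> (?P \<otimes>\<^bsub>A\<^esub> X \<oplus>\<^bsub>A\<^esub> (\<ominus> c) \<odot>\<^bsub>A\<^esub> (?P \<otimes>\<^bsub>A\<^esub> X'))"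
        using X c cl(2,3) by (simp only: A.minus_eq sc_minus[symmetric] A.r_distr sc_rmult sc_closed K.a_inv_closed)
      also have "\<dots> = ?c \<odot>\<^bsub>A\<^esub> (?P \<otimes>\<^bsub>A\<^esub> X) \<oplus>\<^bsub>A\<^esub> (?c \<otimes> (\<ominus> c)) \<odot>\<^bsub>A\<^esub> (?P \<otimes>\<^bsub>A\<^esub> X')"
        using X c cl(2,3) by (simp only: sc_radd sc_assoc sc_closed K.a_inv_closed A.m_closed)
      also have "?c \<otimes> (\<ominus> c) = \<ominus> (c [^] Suc (Suc e))" using c by (simp add: K.r_minus)
      finally show ?thesis using X c by (simp add: sc_minus A.minus_eq)
    qed
    ultimately show ?thesis by simp
  qed
  also have "\<dots> = X [^]\<^bsub>A\<^esub> Suc (Suc e) \<ominus>\<^bsub>A\<^esub> c [^] Suc (Suc e) \<odot>\<^bsub>A\<^esub> X' [^]\<^bsub>A\<^esub> Suc (Suc e)"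
  proof -
    have *: "(u \<ominus>\<^bsub>A\<^esub> v) \<oplus>\<^bsub>A\<^esub> (v \<ominus>\<^bsub>A\<^esub> w) = u \<ominus>\<^bsub>A\<^esub> w" if "u \<in> carrier A" "v \<in> carrier A" "w \<in> carrier A" for u v w
    proof -
      have "(u \<ominus>\<^bsub>A\<^esub> v) \<oplus>\<^bsub>A\<^esub> (v \<ominus>\<^bsub>A\<^esub> w) = u \<oplus>\<^bsub>A\<^esub> ((\<ominus>\<^bsub>A\<^esub> v \<oplus>\<^bsub>A\<^esub> v) \<oplus>\<^bsub>A\<^esub> \<ominus>\<^bsub>A\<^esub> w)"
        using that by (simp only: A.minus_eq A.a_assoc A.a_inv_closed A.a_closed)
      then show ?thesis using that by (simp add: A.l_neg A.minus_eq)
    qed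
    show ?thesis by (rule *) (use X c cl in auto)
  qed
  finally show ?case .
qed

lemma hom_sum_commute:
  assumes X: "X \<in> carrier A" "X' \<in> carrier A" "Z \<in> carrier A" and c: "c \<in> carrier K"
    and comm: "X \<otimes>\<^bsub>A\<^esub> Z = Z \<otimes>\<^bsub>A\<^esub> X" "X' \<otimes>\<^bsub>A\<^esub> Z = Z \<otimes>\<^bsub>A\<^esub> X'"
  shows "hom_sum X X' e c \<otimes>\<^bsub>A\<^esub> Z = Z \<otimes>\<^bsub>A\<^esub> hom_sum X X' e c"
proof (induction e)
  case (Suc e)
  have p: "X' [^]\<^bsub>A\<^esub> n \<otimes>\<^bsub>A\<^esub> Z = Z \<otimes>\<^bsub>A\<^esub> X' [^]\<^bsub>A\<^esub> n" for n :: nat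
    by (rule A.nat_pow_commute) (use X comm in auto)
  have "hom_sum X X' e c \<otimes>\<^bsub>A\<^esub> X \<otimes>\<^bsub>A\<^esub> Z = (hom_sum X X' e c \<otimes>\<^bsub>A\<^esub> Z) \<otimes>\<^bsub>A\<^esub> X" using X c comm by (simp add: A.m_assoc)
  then show ?case using Suc X c p[of "Suc e"]
    by (simp add: A.l_distr A.r_distr sc_lmult sc_rmult A.m_assoc del: A.nat_pow_Suc K.nat_pow_Suc)
qed (use X in simp)

end

text \<open>Models \<open>V\<close> as truncated polynomials in \<open>X\<close> of length
  \<open>n\<close> with coefficients in \<open>S\<close>, on which \<open>X'\<close> acts
  coefficientwise; \<open>cp i\<close> reads off the i-th coefficient. The structure is used twice,
  for \<open>X\<close> on the whole ring and for \<open>Y\<close> on the part free of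
  \<open>X\<close>, which is why \<open>V\<close> is a subset and not the carrier.\<close>

locale shift_pair = kalgebra K R
  for K :: "('k, 'z) ring_scheme" (structure) and R :: "('k, 'r) module" (structure) +
  fixes V S :: "'r set" and X X' :: 'r and n :: nat and cp :: "nat \<Rightarrow> 'r \<Rightarrow> 'r"
  assumes V_sub: "V \<subseteq> carrier R" and S_sub: "S \<subseteq> V" and n1: "1 \<le> n"
    and Xc [simp]: "X \<in> carrier R" and X'c [simp]: "X' \<in> carrier R" and XX': "X \<otimes>\<^bsub>R\<^esub> X' = X' \<otimes>\<^bsub>R\<^esub> X"
    and X'n: "X' [^]\<^bsub>R\<^esub> n = \<zero>\<^bsub>R\<^esub>"
    and V_add: "\<lbrakk>u \<in> V; v \<in> V\<rbrakk> \<Longrightarrow> u \<oplus>\<^bsub>R\<^esub> v \<in> V" and V_sc: "\<lbrakk>c \<in> carrier K; v \<in> V\<rbrakk> \<Longrightarrow> c \<odot>\<^bsub>R\<^esub> v \<in> V"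
    and V_X: "v \<in> V \<Longrightarrow> v \<otimes>\<^bsub>R\<^esub> X \<in> V" and V_X': "v \<in> V \<Longrightarrow> v \<otimes>\<^bsub>R\<^esub> X' \<in> V"
    and S_sc: "\<lbrakk>c \<in> carrier K; v \<in> S\<rbrakk> \<Longrightarrow> c \<odot>\<^bsub>R\<^esub> v \<in> S" and S_X': "v \<in> S \<Longrightarrow> v \<otimes>\<^bsub>R\<^esub> X' \<in> S"
    and cp_S: "\<lbrakk>i < n; v \<in> V\<rbrakk> \<Longrightarrow> cp i v \<in> S"
    and cp_ext: "\<lbrakk>u \<in> V; v \<in> V; \<And>i. i < n \<Longrightarrow> cp i u = cp i v\<rbrakk> \<Longrightarrow> u = v"
    and cp_add: "\<lbrakk>i < n; u \<in> V; v \<in> V\<rbrakk> \<Longrightarrow> cp i (u \<oplus>\<^bsub>R\<^esub> v) = cp i u \<oplus>\<^bsub>R\<^esub> cp i v"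
    and cp_sc: "\<lbrakk>i < n; c \<in> carrier K; v \<in> V\<rbrakk> \<Longrightarrow> cp i (c \<odot>\<^bsub>R\<^esub> v) = c \<odot>\<^bsub>R\<^esub> cp i v"
    and cp_X: "\<lbrakk>i < n; v \<in> V\<rbrakk> \<Longrightarrow> cp i (v \<otimes>\<^bsub>R\<^esub> X) = (if i = 0 then \<zero>\<^bsub>R\<^esub> else cp (i - 1) v)"
    and cp_X': "\<lbrakk>i < n; v \<in> V\<rbrakk> \<Longrightarrow> cp i (v \<otimes>\<^bsub>R\<^esub> X') = cp i v \<otimes>\<^bsub>R\<^esub> X'"
    and cp_on_S: "\<lbrakk>i < n; s \<in> S\<rbrakk> \<Longrightarrow> cp i s = (if i = 0 then s else \<zero>\<^bsub>R\<^esub>)"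
begin

text \<open>The complementary factors of \<open>X^n - (c X')^n\<close>, which acts as zero.\<close>

definition D where "D c = X \<ominus>\<^bsub>R\<^esub> c \<odot>\<^bsub>R\<^esub> X'"
definition N where "N c = hom_sum X X' (n - 1) c"

lemma Vc [simp]: "v \<in> V \<Longrightarrow> v \<in> carrier R" and Sc [simp]: "v \<in> S \<Longrightarrow> v \<in> carrier R" and SV [simp]: "v \<in> S \<Longrightarrow> v \<in> V"
  using V_sub S_sub by auto

lemma Dc [simp]: "c \<in> carrier K \<Longrightarrow> D c \<in> carrier R" and Nc [simp]: "c \<in> carrier K \<Longrightarrow> N c \<in> carrier R"
  by (simp_all add: D_def N_def)

lemma V_minus: "u \<in> V \<Longrightarrow> v \<in> V \<Longrightarrow> u \<ominus>\<^bsub>R\<^esub> v \<in> V"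
  using V_add[of u "(\<ominus> \<one>) \<odot>\<^bsub>R\<^esub> v"] V_sc[of "\<ominus> \<one>" v] by (simp add: sc_minus A.minus_eq)

lemma V_zero: "v \<in> V \<Longrightarrow> \<zero>\<^bsub>R\<^esub> \<in> V"
  using V_sc[of "\<zero>" v] by simp

lemma V_D: "v \<in> V \<Longrightarrow> c \<in> carrier K \<Longrightarrow> v \<otimes>\<^bsub>R\<^esub> D c \<in> V"
  using V_minus[OF V_X, of v "c \<odot>\<^bsub>R\<^esub> (v \<otimes>\<^bsub>R\<^esub> X')"] V_sc[OF _ V_X', of c v]
  by (simp add: D_def A.minus_eq A.r_distr A.r_minus sc_rmult)

lemma V_X'_pow: "v \<in> V \<Longrightarrow> v \<otimes>\<^bsub>R\<^esub> X' [^]\<^bsub>R\<^esub> (e::nat) \<in> V" and S_X'_pow: "v \<in> S \<Longrightarrow> v \<otimes>\<^bsub>R\<^esub> X' [^]\<^bsub>R\<^esub> (e::nat) \<in> S"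
  by (induction e) (auto simp: V_X' S_X' simp flip: A.m_assoc)

lemma V_X_pow: "v \<in> V \<Longrightarrow> v \<otimes>\<^bsub>R\<^esub> X [^]\<^bsub>R\<^esub> (e::nat) \<in> V"
  by (induction e) (auto simp: V_X simp flip: A.m_assoc)

lemma V_hom_sum: "v \<in> V \<Longrightarrow> c \<in> carrier K \<Longrightarrow> v \<otimes>\<^bsub>R\<^esub> hom_sum X X' e c \<in> V"
proof (induction e)
  case (Suc e)
  have "v \<otimes>\<^bsub>R\<^esub> hom_sum X X' (Suc e) c = v \<otimes>\<^bsub>R\<^esub> hom_sum X X' e c \<otimes>\<^bsub>R\<^esub> X \<oplus>\<^bsub>R\<^esub> c [^] Suc e \<odot>\<^bsub>R\<^esub> (v \<otimes>\<^bsub>R\<^esub> X' [^]\<^bsub>R\<^esub> Suc e)"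
    using Suc by (simp add: A.r_distr A.m_assoc sc_rmult del: A.nat_pow_Suc K.nat_pow_Suc)
  then show ?case using Suc V_X'_pow[of v "Suc e"] by (simp only: V_add V_X V_sc K.nat_pow_closed)
qed auto

lemma cp_X_pow: "i < n \<Longrightarrow> v \<in> V \<Longrightarrow> cp i (v \<otimes>\<^bsub>R\<^esub> X [^]\<^bsub>R\<^esub> (e::nat)) = (if i < e then \<zero>\<^bsub>R\<^esub> else cp (i - e) v)"
proof (induction e arbitrary: i)
  case (Suc e)
  have "v \<otimes>\<^bsub>R\<^esub> X [^]\<^bsub>R\<^esub> Suc e = (v \<otimes>\<^bsub>R\<^esub> X [^]\<^bsub>R\<^esub> e) \<otimes>\<^bsub>R\<^esub> X" using Suc.prems by (simp add: A.m_assoc)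
  then show ?case using Suc.prems Suc.IH[of "i - 1"] by (auto simp: cp_X V_X_pow)
qed simp

lemma cp_zero: "i < n \<Longrightarrow> v \<in> V \<Longrightarrow> cp i \<zero>\<^bsub>R\<^esub> = \<zero>\<^bsub>R\<^esub>"
  using cp_sc[of i "\<zero>" v] cp_S[of i v] by simp

lemma X_n: assumes v: "v \<in> V" shows "v \<otimes>\<^bsub>R\<^esub> X [^]\<^bsub>R\<^esub> n = \<zero>\<^bsub>R\<^esub>"
  by (rule cp_ext[OF V_X_pow[OF v] V_zero[OF v]]) (simp add: cp_X_pow v cp_zero[OF _ v])

lemma ND: assumes v: "v \<in> V" and c: "c \<in> carrier K" shows "v \<otimes>\<^bsub>R\<^esub> N c \<otimes>\<^bsub>R\<^esub> D c = \<zero>\<^bsub>R\<^esub>" "v \<otimes>\<^bsub>R\<^esub> D c \<otimes>\<^bsub>R\<^esub> N c = \<zero>\<^bsub>R\<^esub>"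
proof -
  have "N c \<otimes>\<^bsub>R\<^esub> D c = X [^]\<^bsub>R\<^esub> n \<ominus>\<^bsub>R\<^esub> c [^] n \<odot>\<^bsub>R\<^esub> X' [^]\<^bsub>R\<^esub> n"
    using hom_sum_telescope[OF Xc X'c c XX', of "n - 1"] n1 by (simp add: N_def D_def del: A.nat_pow_Suc K.nat_pow_Suc)
  also have "X [^]\<^bsub>R\<^esub> n \<ominus>\<^bsub>R\<^esub> c [^] n \<odot>\<^bsub>R\<^esub> X' [^]\<^bsub>R\<^esub> n = X [^]\<^bsub>R\<^esub> n" using c by (simp add: X'n A.minus_eq)
  finally have e: "N c \<otimes>\<^bsub>R\<^esub> D c = X [^]\<^bsub>R\<^esub> n" .
  then show "v \<otimes>\<^bsub>R\<^esub> N c \<otimes>\<^bsub>R\<^esub> D c = \<zero>\<^bsub>R\<^esub>" using v c X_n[OF v] by (simp add: A.m_assoc)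
  have "D c \<otimes>\<^bsub>R\<^esub> N c = N c \<otimes>\<^bsub>R\<^esub> D c" unfolding N_def
    by (rule hom_sum_commute[symmetric])
       (use c XX' in \<open>auto simp: D_def A.minus_eq A.l_distr A.r_distr A.l_minus A.r_minus sc_lmult sc_rmult\<close>)
  then show "v \<otimes>\<^bsub>R\<^esub> D c \<otimes>\<^bsub>R\<^esub> N c = \<zero>\<^bsub>R\<^esub>" using e v c X_n[OF v] by (simp add: A.m_assoc)
qed

lemma cp_hom_sum:
  assumes s: "s \<in> S" and c: "c \<in> carrier K"
  shows "i < n \<Longrightarrow> cp i (s \<otimes>\<^bsub>R\<^esub> hom_sum X X' e c) = (if i \<le> e then c [^] (e - i) \<odot>\<^bsub>R\<^esub> (s \<otimes>\<^bsub>R\<^esub> X' [^]\<^bsub>R\<^esub> (e - i)) else \<zero>\<^bsub>R\<^esub>)"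
proof (induction e arbitrary: i)
  case 0 then show ?case using s cp_on_S by auto
next
  case (Suc e)
  have eq: "s \<otimes>\<^bsub>R\<^esub> hom_sum X X' (Suc e) c = (s \<otimes>\<^bsub>R\<^esub> hom_sum X X' e c) \<otimes>\<^bsub>R\<^esub> X \<oplus>\<^bsub>R\<^esub> c [^] Suc e \<odot>\<^bsub>R\<^esub> (s \<otimes>\<^bsub>R\<^esub> X' [^]\<^bsub>R\<^esub> Suc e)"
    using s c by (simp add: A.r_distr A.m_assoc sc_rmult del: A.nat_pow_Suc K.nat_pow_Suc)
  have "cp i (s \<otimes>\<^bsub>R\<^esub> hom_sum X X' (Suc e) c) = (if i = 0 then \<zero>\<^bsub>R\<^esub> else cp (i - 1) (s \<otimes>\<^bsub>R\<^esub> hom_sum X X' e c))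
      \<oplus>\<^bsub>R\<^esub> c [^] Suc e \<odot>\<^bsub>R\<^esub> (if i = 0 then s \<otimes>\<^bsub>R\<^esub> X' [^]\<^bsub>R\<^esub> Suc e else \<zero>\<^bsub>R\<^esub>)"
    unfolding eq using s c Suc.prems S_X'_pow[OF s, of "Suc e"]
    by (simp add: cp_add cp_sc cp_X V_hom_sum V_X V_sc V_X'_pow cp_on_S del: A.nat_pow_Suc K.nat_pow_Suc)
  then show ?case using Suc.prems Suc.IH[of "i - 1"] s c by (cases "i = 0") (auto simp del: A.nat_pow_Suc K.nat_pow_Suc)
qed

lemma cp_N: "\<lbrakk>s \<in> S; c \<in> carrier K; i < n\<rbrakk> \<Longrightarrow> cp i (s \<otimes>\<^bsub>R\<^esub> N c) = c [^] (n - 1 - i) \<odot>\<^bsub>R\<^esub> (s \<otimes>\<^bsub>R\<^esub> X' [^]\<^bsub>R\<^esub> (n - 1 - i))"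
proof -
  assume a: "s \<in> S" "c \<in> carrier K" "i < n"
  then have "i \<le> n - 1" by linarith
  then show ?thesis using a unfolding N_def by (simp add: cp_hom_sum)
qed

text \<open>The leading coefficient of \<open>s N\<close> is \<open>s\<close> itself.\<close>

lemma S_N_zero: assumes "s \<in> S" "c \<in> carrier K" "s \<otimes>\<^bsub>R\<^esub> N c = \<zero>\<^bsub>R\<^esub>" shows "s = \<zero>\<^bsub>R\<^esub>"
  using cp_N[OF assms(1,2), of "n - 1"] n1 assms cp_zero[of "n - 1" s] by simp

text \<open>Comparing coefficients in \<open>v X = c v X'\<close> expresses each coefficient by the
  next higher one. So \<open>v\<close> is determined by its leading coefficient \<open>s\<close>,
  and the coefficients obtained are those of \<open>s N\<close>.\<close>

lemma ker_D: assumes v: "v \<in> V" and c: "c \<in> carrier K" and 0: "v \<otimes>\<^bsub>R\<^esub> D c = \<zero>\<^bsub>R\<^esub>"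
  shows "\<exists>s\<in>S. v = s \<otimes>\<^bsub>R\<^esub> N c"
proof -
  have vX: "v \<otimes>\<^bsub>R\<^esub> X = c \<odot>\<^bsub>R\<^esub> (v \<otimes>\<^bsub>R\<^esub> X')"
    by (rule A.minus_eq_zeroD) (use v c 0 in \<open>auto simp: D_def A.minus_eq A.r_distr A.r_minus sc_rmult\<close>)
  have step: "cp (i - 1) v = c \<odot>\<^bsub>R\<^esub> (cp i v \<otimes>\<^bsub>R\<^esub> X')" if "0 < i" "i < n" for i
    using cp_X[of i v] arg_cong[OF vX, of "cp i"] that v c by (simp add: cp_sc cp_X' V_X')
  have t: "cp (n - 1 - t) v = c [^] t \<odot>\<^bsub>R\<^esub> (cp (n - 1) v \<otimes>\<^bsub>R\<^esub> X' [^]\<^bsub>R\<^esub> t)" if "t < n" for t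
    using that
  proof (induction t)
    case 0 then show ?case using cp_S[of "n - 1" v] v by simp
  next
    case (Suc t)
    have "cp (n - 1 - Suc t) v = c \<odot>\<^bsub>R\<^esub> (cp (n - 1 - t) v \<otimes>\<^bsub>R\<^esub> X')" using step[of "n - 1 - t"] Suc.prems by simp
    also have "\<dots> = c \<odot>\<^bsub>R\<^esub> (c [^] t \<odot>\<^bsub>R\<^esub> (cp (n - 1) v \<otimes>\<^bsub>R\<^esub> X' [^]\<^bsub>R\<^esub> t \<otimes>\<^bsub>R\<^esub> X'))"
      using Suc cp_S[of "n - 1" v] v c by (simp add: sc_lmult)
    finally show ?case using cp_S[of "n - 1" v] Suc.prems v c by (simp add: K.m_comm A.m_assoc flip: sc_assoc)
  qed
  have s: "cp (n - 1) v \<in> S" using cp_S n1 v by simp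
  have "v = cp (n - 1) v \<otimes>\<^bsub>R\<^esub> N c"
  proof (rule cp_ext[OF v])
    show "cp (n - 1) v \<otimes>\<^bsub>R\<^esub> N c \<in> V" unfolding N_def by (rule V_hom_sum) (use s c in auto)
    show "cp i v = cp i (cp (n - 1) v \<otimes>\<^bsub>R\<^esub> N c)" if "i < n" for i
      using t[of "n - 1 - i"] that cp_N[OF s c that] by (simp del: One_nat_def)
  qed
  then show ?thesis using s by blast
qed

text \<open>Division with remainder by the monic linear factor \<open>X - c X'\<close>; the
  remainder is a constant, that is, an element of \<open>S\<close>.\<close>

lemma mod_D: assumes v: "v \<in> V" and c: "c \<in> carrier K"
  shows "\<exists>s\<in>S. \<exists>w\<in>V. v = s \<oplus>\<^bsub>R\<^esub> w \<otimes>\<^bsub>R\<^esub> D c"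
proof -
  have "\<exists>s\<in>S. \<exists>w\<in>V. v = s \<oplus>\<^bsub>R\<^esub> w \<otimes>\<^bsub>R\<^esub> D c" if "v \<in> V" "\<And>i. e < i \<Longrightarrow> i < n \<Longrightarrow> cp i v = \<zero>\<^bsub>R\<^esub>" for e v
    using that
  proof (induction e arbitrary: v)
    case 0
    have s: "cp 0 v \<in> S" using cp_S n1 0 by simp
    have "v = cp 0 v"
    proof (rule cp_ext[OF 0(1)])
      show "cp i v = cp i (cp 0 v)" if "i < n" for i using cp_on_S[OF that s] 0 that by auto
    qed (use s in simp)
    then have "v = cp 0 v \<oplus>\<^bsub>R\<^esub> \<zero>\<^bsub>R\<^esub> \<otimes>\<^bsub>R\<^esub> D c" using 0(1) c by simp
    then show ?case using s V_zero[OF 0(1)] by blast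
  next
    case (Suc e)
    show ?case
    proof (cases "Suc e < n")
      case False
      then show ?thesis using Suc.IH[OF Suc.prems(1)] by simp
    next
      case True
      define t where "t = cp (Suc e) v"
      have t: "t \<in> S" unfolding t_def by (rule cp_S[OF True Suc.prems(1)])
      \<comment> \<open>Subtracting \<open>w0 D\<close> cancels the coefficient \<open>t\<close> in
        degree \<open>e + 1\<close>; the term coming from \<open>X'\<close> stays in degree
        \<open>e\<close>, so no higher coefficient reappears.\<close>
      define w0 where "w0 = t \<otimes>\<^bsub>R\<^esub> X [^]\<^bsub>R\<^esub> e"
      have w0: "w0 \<in> V" unfolding w0_def using t by (simp add: V_X_pow)
      have cw0: "cp i w0 = (if i = e then t else \<zero>\<^bsub>R\<^esub>)" if "i < n" for i
        unfolding w0_def using cp_X_pow[OF that, of t e] cp_on_S[of "i - e" t] t that by auto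
      define v' where "v' = v \<ominus>\<^bsub>R\<^esub> w0 \<otimes>\<^bsub>R\<^esub> D c"
      have v': "v' \<in> V" unfolding v'_def by (intro V_minus V_D Suc.prems(1) w0 c)
      have vv: "v = v' \<oplus>\<^bsub>R\<^esub> w0 \<otimes>\<^bsub>R\<^esub> D c" using v' w0 c Suc.prems(1)
        by (simp add: v'_def A.minus_eq A.a_assoc A.l_neg)
      have w0D: "w0 \<otimes>\<^bsub>R\<^esub> D c = w0 \<otimes>\<^bsub>R\<^esub> X \<oplus>\<^bsub>R\<^esub> (\<ominus> c) \<odot>\<^bsub>R\<^esub> (w0 \<otimes>\<^bsub>R\<^esub> X')"
        using w0 c by (simp add: D_def A.minus_eq A.r_distr A.r_minus sc_rmult sc_minus)
      have "cp i v' = \<zero>\<^bsub>R\<^esub>" if i: "e < i" "i < n" for i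
      proof -
        have "cp i (w0 \<otimes>\<^bsub>R\<^esub> D c) = (if i = Suc e then t else \<zero>\<^bsub>R\<^esub>)"
          unfolding w0D using i w0 c t by (auto simp: cp_add cp_sc cp_X cp_X' V_X V_X' V_sc cw0)
        moreover have "cp i v = cp i v' \<oplus>\<^bsub>R\<^esub> cp i (w0 \<otimes>\<^bsub>R\<^esub> D c)"
          using arg_cong[OF vv, of "cp i"] i v' w0 c by (simp add: cp_add V_D)
        ultimately show ?thesis using i Suc.prems(2)[of i] cp_S[OF i(2) v'] t
          by (cases "i = Suc e") (auto simp: t_def A.add.l_cancel_one)
      qed
      from Suc.IH[OF v' this] obtain s w where sw: "s \<in> S" "w \<in> V" "v' = s \<oplus>\<^bsub>R\<^esub> w \<otimes>\<^bsub>R\<^esub> D c" by blast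
      have "v = s \<oplus>\<^bsub>R\<^esub> (w \<oplus>\<^bsub>R\<^esub> w0) \<otimes>\<^bsub>R\<^esub> D c" using vv sw w0 c by (simp add: A.l_distr A.a_assoc)
      then show ?thesis using sw V_add[OF sw(2) w0] by blast
    qed
  qed
  from this[of v n] v show ?thesis by simp
qed

text \<open>Uniqueness of the remainder: multiplied by \<open>N\<close>, the right hand side
  vanishes, and \<open>N\<close> is injective on \<open>S\<close>.\<close>

lemma S_inter_VD: assumes "s \<in> S" "w \<in> V" "c \<in> carrier K" "s = w \<otimes>\<^bsub>R\<^esub> D c" shows "s = \<zero>\<^bsub>R\<^esub>"
  using S_N_zero[OF assms(1,3)] ND(2)[OF assms(2,3)] assms(4) by simp

text \<open>Only the remainder of \<open>v\<close> modulo \<open>D\<close> contributes to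
  \<open>v N\<close>, and \<open>N\<close> detects it.\<close>

lemma ker_N: assumes v: "v \<in> V" and c: "c \<in> carrier K" and 0: "v \<otimes>\<^bsub>R\<^esub> N c = \<zero>\<^bsub>R\<^esub>"
  shows "\<exists>w\<in>V. v = w \<otimes>\<^bsub>R\<^esub> D c"
proof -
  obtain s w where sw: "s \<in> S" "w \<in> V" "v = s \<oplus>\<^bsub>R\<^esub> w \<otimes>\<^bsub>R\<^esub> D c" using mod_D[OF v c] by blast
  have "s \<otimes>\<^bsub>R\<^esub> N c = \<zero>\<^bsub>R\<^esub>" using 0 sw c ND(2)[OF sw(2) c] by (simp add: A.l_distr)
  then have "s = \<zero>\<^bsub>R\<^esub>" by (rule S_N_zero[OF sw(1) c])
  then show ?thesis using sw c by auto
qed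

end

section \<open>Diagram chases in a bicomplex whose differentials are right multiplications\<close>

locale bicomplex = R?: ring R for R :: "('r, 'z) ring_scheme" (structure) +
  fixes V :: "int \<Rightarrow> int \<Rightarrow> 'r set" and dx dy :: "int \<Rightarrow> int \<Rightarrow> 'r"
  assumes V_sub: "V i j \<subseteq> carrier R"
    and V_add: "\<lbrakk>u \<in> V i j; v \<in> V i j\<rbrakk> \<Longrightarrow> u \<oplus> v \<in> V i j"
    and V_neg: "u \<in> V i j \<Longrightarrow> \<ominus> u \<in> V i j"
    and dxc [simp]: "dx i j \<in> carrier R" and dyc [simp]: "dy i j \<in> carrier R"
    and V_dx: "z \<in> V i j \<Longrightarrow> z \<otimes> dx i j \<in> V (i - 1) j"
    and V_dy: "z \<in> V i j \<Longrightarrow> z \<otimes> dy i j \<in> V i (j - 1)"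
    and dxdx: "z \<in> V i j \<Longrightarrow> z \<otimes> dx i j \<otimes> dx (i - 1) j = \<zero>"
    and dydy: "z \<in> V i j \<Longrightarrow> z \<otimes> dy i j \<otimes> dy i (j - 1) = \<zero>"
    and anti: "z \<in> V i j \<Longrightarrow> z \<otimes> dx i j \<otimes> dy (i - 1) j \<oplus> z \<otimes> dy i j \<otimes> dx i (j - 1) = \<zero>"
begin

lemma Vc [simp]: "v \<in> V i j \<Longrightarrow> v \<in> carrier R" using V_sub by auto

lemma V_minus: "u \<in> V i j \<Longrightarrow> v \<in> V i j \<Longrightarrow> u \<ominus> v \<in> V i j"
  by (simp add: minus_eq V_add V_neg)

lemma anti': "z \<in> V i j \<Longrightarrow> z \<otimes> dx i j \<otimes> dy (i - 1) j = \<ominus> (z \<otimes> dy i j \<otimes> dx i (j - 1))"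
  using anti[of z i j] minus_equality[of "z \<otimes> dx i j \<otimes> dy (i - 1) j" "z \<otimes> dy i j \<otimes> dx i (j - 1)"] by simp

lemma dydy': "z \<in> V i j \<Longrightarrow> j' = j - 1 \<Longrightarrow> z \<otimes> dy i j \<otimes> dy i j' = \<zero>"
  using dydy by simp

text \<open>In the first quadrant a cycle \<open>z\<close> of total degree \<open>n\<close> is written as a boundary starting from
  the column \<open>i = 0\<close>, where the columns are exact modulo the images of the rows, and then moving
  along the antidiagonal by exactness of the rows.\<close>

lemma first_quadrant_exact:
  fixes n :: int
  assumes n: "1 \<le> n"
    and rows: "\<And>i j z. \<lbrakk>1 \<le> i; 0 \<le> j; z \<in> V i j; z \<otimes> dx i j = \<zero>\<rbrakk> \<Longrightarrow> \<exists>w\<in>V (i + 1) j. z = w \<otimes> dx (i + 1) j"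
    and column: "\<And>j z u. \<lbrakk>1 \<le> j; z \<in> V 0 j; u \<in> V 1 (j - 1); z \<otimes> dy 0 j = u \<otimes> dx 1 (j - 1)\<rbrakk> \<Longrightarrow>
        \<exists>w\<in>V 0 (j + 1). \<exists>w'\<in>V 1 j. z = w' \<otimes> dx 1 j \<oplus> w \<otimes> dy 0 (j + 1)"
    and z: "\<And>i. 0 \<le> i \<Longrightarrow> i \<le> n \<Longrightarrow> z i \<in> V i (n - i)"
    and cyc: "\<And>i. 0 \<le> i \<Longrightarrow> i < n \<Longrightarrow> z (i + 1) \<otimes> dx (i + 1) (n - 1 - i) \<oplus> z i \<otimes> dy i (n - i) = \<zero>"
  shows "\<exists>w. (\<forall>i. 0 \<le> i \<and> i \<le> n + 1 \<longrightarrow> w i \<in> V i (n + 1 - i)) \<and>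
     (\<forall>i. 0 \<le> i \<and> i \<le> n \<longrightarrow> z i = w (i + 1) \<otimes> dx (i + 1) (n - i) \<oplus> w i \<otimes> dy i (n + 1 - i))"
proof -
  have "int m \<le> n \<Longrightarrow> \<exists>w. (\<forall>i. 0 \<le> i \<and> i \<le> int m + 1 \<longrightarrow> w i \<in> V i (n + 1 - i)) \<and>
     (\<forall>i. 0 \<le> i \<and> i \<le> int m \<longrightarrow> z i = w (i + 1) \<otimes> dx (i + 1) (n - i) \<oplus> w i \<otimes> dy i (n + 1 - i))" for m
  proof (induction m)
    case 0
    have z0: "z 0 \<in> V 0 n" and z1: "z 1 \<in> V 1 (n - 1)" using z[of 0] z[of 1] n by auto
    have "z 0 \<otimes> dy 0 n = (\<ominus> z 1) \<otimes> dx 1 (n - 1)"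
      using cyc[of 0] n z0 z1 minus_equality[of "z 0 \<otimes> dy 0 n" "z 1 \<otimes> dx 1 (n - 1)"]
      by (simp add: l_minus a_comm)
    from column[OF n z0 V_neg[OF z1] this] obtain w w' where
      w: "w \<in> V 0 (n + 1)" "w' \<in> V 1 n" "z 0 = w' \<otimes> dx 1 n \<oplus> w \<otimes> dy 0 (n + 1)" by blast
    define f where "f i = (if i = 0 then w else w')" for i :: int
    have "f i \<in> V i (n + 1 - i)" if "0 \<le> i \<and> i \<le> 1" for i
    proof -
      have "i = 0 \<or> i = 1" using that by linarith
      then show ?thesis using w by (auto simp: f_def)
    qed
    then show ?case using w by (intro exI[of _ f]) (auto simp: f_def)
  next
    case (Suc m)
    define k where "k = int m + 1"
    have k: "1 \<le> k" "k \<le> n" using Suc.prems by (auto simp: k_def)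
    obtain w where w: "\<And>i. 0 \<le> i \<Longrightarrow> i \<le> k \<Longrightarrow> w i \<in> V i (n + 1 - i)"
      "\<And>i. 0 \<le> i \<Longrightarrow> i \<le> k - 1 \<Longrightarrow> z i = w (i + 1) \<otimes> dx (i + 1) (n - i) \<oplus> w i \<otimes> dy i (n + 1 - i)"
      using Suc.IH Suc.prems by (auto simp: k_def)
    have zk: "z k \<in> V k (n - k)" using z k by simp
    have wk: "w k \<in> V k (n + 1 - k)" and wk1: "w (k - 1) \<in> V (k - 1) (n + 2 - k)"
      using w(1)[of k] w(1)[of "k - 1"] k by (auto simp: algebra_simps)
    have wky: "w k \<otimes> dy k (n + 1 - k) \<in> V k (n - k)" using V_dy[OF wk] by (simp add: algebra_simps)
    \<comment> \<open>What is left of \<open>z k\<close> after the vertical part forced by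
      \<open>w k\<close>. The cycle condition at position \<open>k - 1\<close>, together with
      anticommutativity, makes it a row cycle.\<close>
    define u where "u = z k \<ominus> w k \<otimes> dy k (n + 1 - k)"
    have u: "u \<in> V k (n - k)" unfolding u_def by (rule V_minus[OF zk wky])
    have zk1: "z (k - 1) = w k \<otimes> dx k (n + 1 - k) \<oplus> w (k - 1) \<otimes> dy (k - 1) (n + 2 - k)"
      using w(2)[of "k - 1"] k by (simp add: algebra_simps)
    have d0: "w (k - 1) \<otimes> dy (k - 1) (n + 2 - k) \<otimes> dy (k - 1) (n + 1 - k) = \<zero>"
      using dydy[OF wk1] by (simp add: algebra_simps)
    have an: "w k \<otimes> dx k (n + 1 - k) \<otimes> dy (k - 1) (n + 1 - k) = \<ominus> (w k \<otimes> dy k (n + 1 - k) \<otimes> dx k (n - k))"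
      using anti'[OF wk] by (simp add: algebra_simps)
    have "z k \<otimes> dx k (n - k) \<oplus> z (k - 1) \<otimes> dy (k - 1) (n + 1 - k) = \<zero>"
      using cyc[of "k - 1"] k by (simp add: algebra_simps)
    then have "z k \<otimes> dx k (n - k) \<oplus> \<ominus> (w k \<otimes> dy k (n + 1 - k) \<otimes> dx k (n - k)) = \<zero>"
      unfolding zk1 using wk wk1 by (simp add: l_distr an d0)
    then have "u \<otimes> dx k (n - k) = \<zero>" unfolding u_def using zk wk by (simp add: minus_eq l_distr l_minus)
    from rows[OF k(1) _ u this] k obtain w' where w': "w' \<in> V (k + 1) (n - k)" "u = w' \<otimes> dx (k + 1) (n - k)" by auto
    have zkk: "z k = w' \<otimes> dx (k + 1) (n - k) \<oplus> w k \<otimes> dy k (n + 1 - k)"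
      using zk wky w'(2)[symmetric] unfolding u_def by (simp add: minus_eq a_assoc l_neg)
    define f where "f i = (if i = k + 1 then w' else w i)" for i
    have "f i \<in> V i (n + 1 - i)" if "0 \<le> i \<and> i \<le> int (Suc m) + 1" for i
      using that w(1)[of i] w'(1) by (auto simp: f_def k_def algebra_simps)
    moreover have "z i = f (i + 1) \<otimes> dx (i + 1) (n - i) \<oplus> f i \<otimes> dy i (n + 1 - i)" if "0 \<le> i \<and> i \<le> int (Suc m)" for i
    proof (cases "i = k")
      case True then show ?thesis using zkk k by (simp add: f_def)
    next
      case False
      then have "i \<le> k - 1" using that by (auto simp: k_def)
      then show ?thesis using w(2)[of i] that by (simp add: f_def)
    qed
    ultimately show ?case by blast
  qed
  from this[of "nat n"] n show ?thesis by simp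
qed

text \<open>In the third quadrant the chase runs in the opposite direction and ends in the column
  \<open>i = -1\<close>.\<close>

lemma third_quadrant_exact:
  fixes n :: int
  assumes n: "2 \<le> n"
    and rows: "\<And>i j z. \<lbrakk>i \<le> -2; j \<le> -1; z \<in> V i j; z \<otimes> dx i j = \<zero>\<rbrakk> \<Longrightarrow> \<exists>w\<in>V (i + 1) j. z = w \<otimes> dx (i + 1) j"
    and column: "\<And>j z. \<lbrakk>j \<le> -2; z \<in> V (-1) j; z \<otimes> dx (-1) j = \<zero>; z \<otimes> dy (-1) j = \<zero>\<rbrakk> \<Longrightarrow>
        \<exists>w\<in>V (-1) (j + 1). w \<otimes> dx (-1) (j + 1) = \<zero> \<and> z = w \<otimes> dy (-1) (j + 1)"
    and z: "\<And>i. - n \<le> i \<Longrightarrow> i \<le> -1 \<Longrightarrow> z i \<in> V i (- n - 1 - i)"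
    and cyc: "\<And>i. - n \<le> i \<Longrightarrow> i \<le> -2 \<Longrightarrow> z (i + 1) \<otimes> dx (i + 1) (- n - 2 - i) \<oplus> z i \<otimes> dy i (- n - 1 - i) = \<zero>"
    and cyc_first: "z (- n) \<otimes> dx (- n) (-1) = \<zero>" and cyc_last: "z (-1) \<otimes> dy (-1) (- n) = \<zero>"
  shows "\<exists>w. (\<forall>i. - n + 1 \<le> i \<and> i \<le> -1 \<longrightarrow> w i \<in> V i (- n - i)) \<and>
     z (- n) = w (- n + 1) \<otimes> dx (- n + 1) (-1) \<and> z (-1) = w (-1) \<otimes> dy (-1) (- n + 1) \<and>
     (\<forall>i. - n + 1 \<le> i \<and> i \<le> -2 \<longrightarrow> z i = w (i + 1) \<otimes> dx (i + 1) (- n - 1 - i) \<oplus> w i \<otimes> dy i (- n - i))"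
proof -
  have "int m \<le> n - 2 \<Longrightarrow> \<exists>w. (\<forall>i. - n + 1 \<le> i \<and> i \<le> - n + 1 + int m \<longrightarrow> w i \<in> V i (- n - i)) \<and>
     z (- n) = w (- n + 1) \<otimes> dx (- n + 1) (-1) \<and>
     (\<forall>i. - n + 1 \<le> i \<and> i \<le> - n + int m \<longrightarrow> z i = w (i + 1) \<otimes> dx (i + 1) (- n - 1 - i) \<oplus> w i \<otimes> dy i (- n - i))" for m
  proof (induction m)
    case 0
    have z0: "z (- n) \<in> V (- n) (-1)" using z[of "- n"] n by auto
    from rows[OF _ _ z0 cyc_first] n obtain w where w: "w \<in> V (- n + 1) (-1)" "z (- n) = w \<otimes> dx (- n + 1) (-1)" by auto
    then show ?case by (intro exI[of _ "\<lambda>_. w"]) (auto dest: order_antisym)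
  next
    case (Suc m)
    define k where "k = - n + 1 + int m"
    have k: "- n + 1 \<le> k" "k \<le> -2" using Suc.prems by (auto simp: k_def)
    obtain w where w: "\<And>i. - n + 1 \<le> i \<Longrightarrow> i \<le> k \<Longrightarrow> w i \<in> V i (- n - i)"
      "z (- n) = w (- n + 1) \<otimes> dx (- n + 1) (-1)"
      "\<And>i. - n + 1 \<le> i \<Longrightarrow> i \<le> k - 1 \<Longrightarrow> z i = w (i + 1) \<otimes> dx (i + 1) (- n - 1 - i) \<oplus> w i \<otimes> dy i (- n - i)"
      using Suc.IH Suc.prems by (auto simp: k_def)
    have zk: "z k \<in> V k (- n - 1 - k)" using z k by simp
    have wk: "w k \<in> V k (- n - k)" using w(1)[of k] k by auto
    have wky: "w k \<otimes> dy k (- n - k) \<in> V k (- n - 1 - k)" using V_dy[OF wk] by (simp add: algebra_simps)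
    define u where "u = z k \<ominus> w k \<otimes> dy k (- n - k)"
    have u: "u \<in> V k (- n - 1 - k)" unfolding u_def by (rule V_minus[OF zk wky])
    have an: "w k \<otimes> dx k (- n - k) \<otimes> dy (k - 1) (- n - k) = \<ominus> (w k \<otimes> dy k (- n - k) \<otimes> dx k (- n - 1 - k))"
      using anti'[OF wk] by (simp add: algebra_simps)
    have e: "- n - 2 - (k - 1) = - n - 1 - k" "- n - 1 - (k - 1) = - n - k" "k - 1 + 1 = k" by auto
    have c: "z k \<otimes> dx k (- n - 1 - k) \<oplus> z (k - 1) \<otimes> dy (k - 1) (- n - k) = \<zero>"
      using cyc[of "k - 1", unfolded e] k by simp
    have "z (k - 1) \<otimes> dy (k - 1) (- n - k) = w k \<otimes> dx k (- n - k) \<otimes> dy (k - 1) (- n - k)"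
    proof (cases "k = - n + 1")
      case True
      then show ?thesis using w(2) by simp
    next
      case False
      then have kk: "- n + 1 \<le> k - 1" using k by simp
      have wk1: "w (k - 1) \<in> V (k - 1) (- n - k + 1)" using w(1)[OF kk] by (simp add: algebra_simps)
      have d0: "w (k - 1) \<otimes> dy (k - 1) (- n - k + 1) \<otimes> dy (k - 1) (- n - k) = \<zero>"
        by (rule dydy'[OF wk1]) simp
      have "z (k - 1) = w k \<otimes> dx k (- n - k) \<oplus> w (k - 1) \<otimes> dy (k - 1) (- n - k + 1)"
        using w(3)[OF kk] by (simp add: algebra_simps)
      then show ?thesis using wk wk1 d0 by (simp add: l_distr)
    qed
    then have "z k \<otimes> dx k (- n - 1 - k) \<oplus> \<ominus> (w k \<otimes> dy k (- n - k) \<otimes> dx k (- n - 1 - k)) = \<zero>"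
      using c an by simp
    then have "u \<otimes> dx k (- n - 1 - k) = \<zero>" unfolding u_def using zk wk by (simp add: minus_eq l_distr l_minus)
    from rows[OF k(2) _ u this] k obtain w' where
      w': "w' \<in> V (k + 1) (- n - 1 - k)" "u = w' \<otimes> dx (k + 1) (- n - 1 - k)" by auto
    have zkk: "z k = w' \<otimes> dx (k + 1) (- n - 1 - k) \<oplus> w k \<otimes> dy k (- n - k)"
      using zk wky w'(2)[symmetric] unfolding u_def by (simp add: minus_eq a_assoc l_neg)
    define f where "f i = (if i = k + 1 then w' else w i)" for i
    have "f i \<in> V i (- n - i)" if i: "- n + 1 \<le> i \<and> i \<le> - n + 1 + int (Suc m)" for i
    proof (cases "i = k + 1")
      case True
      then have e: "- n - i = - n - 1 - k" by simp
      show ?thesis unfolding e unfolding f_def True using w'(1) by simp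
    next
      case False
      then have "i \<le> k" using i by (auto simp: k_def)
      then show ?thesis using w(1)[of i] i False by (simp add: f_def)
    qed
    moreover have "z i = f (i + 1) \<otimes> dx (i + 1) (- n - 1 - i) \<oplus> f i \<otimes> dy i (- n - i)"
      if "- n + 1 \<le> i \<and> i \<le> - n + int (Suc m)" for i
    proof (cases "i = k")
      case True then show ?thesis using zkk k by (simp add: f_def)
    next
      case False
      then have "i \<le> k - 1" using that by (auto simp: k_def)
      then show ?thesis using w(3)[of i] that by (simp add: f_def)
    qed
    moreover have "z (- n) = f (- n + 1) \<otimes> dx (- n + 1) (-1)" using w(2) k by (simp add: f_def)
    ultimately show ?case by blast
  qed
  from this[of "nat (n - 2)"] n obtain w where
    w: "\<And>i. - n + 1 \<le> i \<Longrightarrow> i \<le> -1 \<Longrightarrow> w i \<in> V i (- n - i)" "z (- n) = w (- n + 1) \<otimes> dx (- n + 1) (-1)"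
      "\<And>i. - n + 1 \<le> i \<Longrightarrow> i \<le> -2 \<Longrightarrow> z i = w (i + 1) \<otimes> dx (i + 1) (- n - 1 - i) \<oplus> w i \<otimes> dy i (- n - i)"
    by auto
  have z1: "z (-1) \<in> V (-1) (- n)" using z[of "-1"] n by simp
  have w1: "w (-1) \<in> V (-1) (- n + 1)" using w(1)[of "-1"] n by simp
  have w1y: "w (-1) \<otimes> dy (-1) (- n + 1) \<in> V (-1) (- n)" using V_dy[OF w1] by simp
  define u where "u = z (-1) \<ominus> w (-1) \<otimes> dy (-1) (- n + 1)"
  have u: "u \<in> V (-1) (- n)" unfolding u_def by (rule V_minus[OF z1 w1y])
  have an: "w (-1) \<otimes> dx (-1) (- n + 1) \<otimes> dy (-2) (- n + 1) = \<ominus> (w (-1) \<otimes> dy (-1) (- n + 1) \<otimes> dx (-1) (- n))"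
    using anti'[OF w1] by simp
  have "z (-2) \<otimes> dy (-2) (- n + 1) = w (-1) \<otimes> dx (-1) (- n + 1) \<otimes> dy (-2) (- n + 1)"
  proof (cases "n = 2")
    case True
    then show ?thesis using w(2) by simp
  next
    case False
    then have nn: "- n + 1 \<le> -2" using n by simp
    have w2: "w (-2) \<in> V (-2) (- n + 2)" using w(1)[OF nn] by (simp add: algebra_simps)
    have d0: "w (-2) \<otimes> dy (-2) (- n + 2) \<otimes> dy (-2) (- n + 1) = \<zero>"
      using dydy[OF w2] by (simp add: algebra_simps)
    have "z (-2) = w (-1) \<otimes> dx (-1) (- n + 1) \<oplus> w (-2) \<otimes> dy (-2) (- n + 2)"
      using w(3)[OF nn] by (simp add: algebra_simps)
    then show ?thesis using w1 w2 d0 by (simp add: l_distr)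
  qed
  moreover have "z (-1) \<otimes> dx (-1) (- n) \<oplus> z (-2) \<otimes> dy (-2) (- n + 1) = \<zero>"
    using cyc[of "-2"] n by (simp add: algebra_simps)
  ultimately have "u \<otimes> dx (-1) (- n) = \<zero>" unfolding u_def using an z1 w1 by (simp add: minus_eq l_distr l_minus)
  moreover have "u \<otimes> dy (-1) (- n) = \<zero>"
    unfolding u_def using cyc_last dydy[OF w1] z1 w1 by (simp add: minus_eq l_distr l_minus)
  \<comment> \<open>The correction \<open>w'\<close> is taken in the kernel of the row differential,
    so adding it to \<open>w (-1)\<close> repairs the last equation without disturbing the one at
    position -2.\<close>
  ultimately obtain w' where w': "w' \<in> V (-1) (- n + 1)" "w' \<otimes> dx (-1) (- n + 1) = \<zero>" "u = w' \<otimes> dy (-1) (- n + 1)"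
    using column[OF _ u] n by auto
  have zz: "z (-1) = (w (-1) \<oplus> w') \<otimes> dy (-1) (- n + 1)"
    using z1 w1 w'(1) w'(3)[symmetric] unfolding u_def by (simp add: l_distr minus_eq a_lcomm r_neg)
  have xx: "(w (-1) \<oplus> w') \<otimes> dx (-1) (- n + 1) = w (-1) \<otimes> dx (-1) (- n + 1)"
    using w1 w' by (simp add: l_distr)
  define f where "f i = (if i = -1 then w (-1) \<oplus> w' else w i)" for i
  have "f i \<in> V i (- n - i)" if "- n + 1 \<le> i \<and> i \<le> -1" for i
    using w(1)[of i] that V_add[OF w1 w'(1)] by (auto simp: f_def)
  moreover have "f (i + 1) \<otimes> dx (i + 1) (- n - 1 - i) = w (i + 1) \<otimes> dx (i + 1) (- n - 1 - i)" for i
  proof (cases "i = -2")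
    case True
    show ?thesis unfolding True f_def using xx by simp
  qed (simp add: f_def)
  moreover from this[of "- n"] have "z (- n) = f (- n + 1) \<otimes> dx (- n + 1) (-1)" using w(2) by simp
  moreover have "f i = w i" if "i \<le> -2" for i using that by (simp add: f_def)
  ultimately show ?thesis using w(3) zz by (intro exI[of _ f]) (auto simp: f_def)
qed

end

text \<open>\<open>dg n i\<close> is the internal degree of the \<open>i\<close>-th generator in the minimal complete resolution over a
  truncated polynomial ring of length \<open>n\<close>, and \<open>stp n i\<close> the degree of the differential there.\<close>

definition dg :: "nat \<Rightarrow> int \<Rightarrow> int" where "dg n i = int n * (i div 2) + i mod 2"
definition stp :: "nat \<Rightarrow> int \<Rightarrow> nat" where "stp n i = (if odd i then 1 else n - 1)"

lemma dg_step: "1 \<le> n \<Longrightarrow> dg n i = dg n (i - 1) + int (stp n i)"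
proof -
  assume n: "1 \<le> n"
  show ?thesis
  proof (cases "odd i")
    case True
    then obtain t where "i = 2 * t + 1" by (elim oddE)
    then show ?thesis by (simp add: dg_def stp_def)
  next
    case False
    then obtain t where t: "i = 2 * t" using evenE by blast
    have d: "(2 * t - 1) div 2 = t - 1" "(2 * t - 1) mod 2 = 1" by presburger+
    show ?thesis unfolding t dg_def stp_def d using n by (simp add: right_diff_distrib of_nat_diff)
  qed
qed

lemma dg_0 [simp]: "dg n 0 = 0" by (simp add: dg_def)

context kalgebra
begin

lemma hom_sum_nilp:
  assumes X: "X \<in> carrier A" "X' \<in> carrier A" and c: "c \<in> carrier K" and comm: "X \<otimes>\<^bsub>A\<^esub> X' = X' \<otimes>\<^bsub>A\<^esub> X"
    and n: "1 \<le> n" "X [^]\<^bsub>A\<^esub> (n::nat) = \<zero>\<^bsub>A\<^esub>" "X' [^]\<^bsub>A\<^esub> n = \<zero>\<^bsub>A\<^esub>"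
  shows "hom_sum X X' (n - 1) c \<otimes>\<^bsub>A\<^esub> hom_sum X X' 1 (\<ominus> c) = \<zero>\<^bsub>A\<^esub>"
    "hom_sum X X' 1 (\<ominus> c) \<otimes>\<^bsub>A\<^esub> hom_sum X X' (n - 1) c = \<zero>\<^bsub>A\<^esub>"
proof -
  note e = hom_sum_1[OF X c]
  show 1: "hom_sum X X' (n - 1) c \<otimes>\<^bsub>A\<^esub> hom_sum X X' 1 (\<ominus> c) = \<zero>\<^bsub>A\<^esub>"
    unfolding e using hom_sum_telescope[OF X c comm, of "n - 1"] n c
    by (simp add: A.minus_eq del: A.nat_pow_Suc K.nat_pow_Suc)
  have "hom_sum X X' (n - 1) c \<otimes>\<^bsub>A\<^esub> hom_sum X X' 1 (\<ominus> c) = hom_sum X X' 1 (\<ominus> c) \<otimes>\<^bsub>A\<^esub> hom_sum X X' (n - 1) c"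
    unfolding e by (rule hom_sum_commute)
       (use X c comm in \<open>auto simp: A.minus_eq A.l_distr A.r_distr A.l_minus A.r_minus sc_lmult sc_rmult\<close>)
  then show "hom_sum X X' 1 (\<ominus> c) \<otimes>\<^bsub>A\<^esub> hom_sum X X' (n - 1) c = \<zero>\<^bsub>A\<^esub>" using 1 by metis
qed

end

text \<open>\<open>X, Y, X', Y'\<close> stand for \<open>x \<otimes> 1, y \<otimes> 1, 1 \<otimes> x, 1 \<otimes> y\<close>, and \<open>co i j k l\<close> is the coordinate at
  \<open>y^j x^i \<otimes> y^l x^k\<close>.\<close>

locale qring = kalgebra K R
  for K :: "('k, 'z) ring_scheme" (structure) and R :: "('k, 'r) module" (structure) +
  fixes a b :: nat and q :: 'k and X Y X' Y' :: 'r and co :: "nat \<Rightarrow> nat \<Rightarrow> nat \<Rightarrow> nat \<Rightarrow> 'r \<Rightarrow> 'k"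
  assumes a2: "2 \<le> a" and b2: "2 \<le> b" and qK [simp]: "q \<in> carrier K" and q0: "q \<noteq> \<zero>\<^bsub>K\<^esub>"
    and gens [simp]: "X \<in> carrier R" "Y \<in> carrier R" "X' \<in> carrier R" "Y' \<in> carrier R"
    and co_lin: "\<lbrakk>i < a; j < b; k < a; l < b\<rbrakk> \<Longrightarrow> lin (co i j k l)"
    and co_ext: "\<lbrakk>r \<in> carrier R; s \<in> carrier R; \<And>i j k l. \<lbrakk>i < a; j < b; k < a; l < b\<rbrakk> \<Longrightarrow> co i j k l r = co i j k l s\<rbrakk> \<Longrightarrow> r = s"
    and co_ex: "(\<And>i j k l. \<lbrakk>i < a; j < b; k < a; l < b\<rbrakk> \<Longrightarrow> c i j k l \<in> carrier K) \<Longrightarrow>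
        \<exists>r\<in>carrier R. \<forall>i j k l. i < a \<longrightarrow> j < b \<longrightarrow> k < a \<longrightarrow> l < b \<longrightarrow> co i j k l r = c i j k l"
    and co_rX: "\<lbrakk>i < a; j < b; k < a; l < b; r \<in> carrier R\<rbrakk> \<Longrightarrow> co i j k l (r \<otimes>\<^bsub>R\<^esub> X) = (if i = 0 then \<zero>\<^bsub>K\<^esub> else co (i - 1) j k l r)"
    and co_rX': "\<lbrakk>i < a; j < b; k < a; l < b; r \<in> carrier R\<rbrakk> \<Longrightarrow> co i j k l (r \<otimes>\<^bsub>R\<^esub> X') = (if k = 0 then \<zero>\<^bsub>K\<^esub> else q [^]\<^bsub>K\<^esub> l \<otimes>\<^bsub>K\<^esub> co i j (k - 1) l r)"
    and co_rY: "\<lbrakk>i < a; j < b; k < a; l < b; r \<in> carrier R\<rbrakk> \<Longrightarrow> co i j k l (r \<otimes>\<^bsub>R\<^esub> Y) = (if j = 0 then \<zero>\<^bsub>K\<^esub> else q [^]\<^bsub>K\<^esub> i \<otimes>\<^bsub>K\<^esub> co i (j - 1) k l r)"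
    and co_rY': "\<lbrakk>i < a; j < b; k < a; l < b; r \<in> carrier R\<rbrakk> \<Longrightarrow> co i j k l (r \<otimes>\<^bsub>R\<^esub> Y') = (if l = 0 then \<zero>\<^bsub>K\<^esub> else co i j k (l - 1) r)"
    and co_lX: "\<lbrakk>i < a; j < b; k < a; l < b; r \<in> carrier R\<rbrakk> \<Longrightarrow> co i j k l (X \<otimes>\<^bsub>R\<^esub> r) = (if i = 0 then \<zero>\<^bsub>K\<^esub> else q [^]\<^bsub>K\<^esub> j \<otimes>\<^bsub>K\<^esub> co (i - 1) j k l r)"
    and co_lX': "\<lbrakk>i < a; j < b; k < a; l < b; r \<in> carrier R\<rbrakk> \<Longrightarrow> co i j k l (X' \<otimes>\<^bsub>R\<^esub> r) = (if k = 0 then \<zero>\<^bsub>K\<^esub> else co i j (k - 1) l r)"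
    and co_lY: "\<lbrakk>i < a; j < b; k < a; l < b; r \<in> carrier R\<rbrakk> \<Longrightarrow> co i j k l (Y \<otimes>\<^bsub>R\<^esub> r) = (if j = 0 then \<zero>\<^bsub>K\<^esub> else co i (j - 1) k l r)"
    and co_lY': "\<lbrakk>i < a; j < b; k < a; l < b; r \<in> carrier R\<rbrakk> \<Longrightarrow> co i j k l (Y' \<otimes>\<^bsub>R\<^esub> r) = (if l = 0 then \<zero>\<^bsub>K\<^esub> else q [^]\<^bsub>K\<^esub> k \<otimes>\<^bsub>K\<^esub> co i j k (l - 1) r)"
begin

lemma co_c [simp]: "\<lbrakk>i < a; j < b; k < a; l < b; r \<in> carrier R\<rbrakk> \<Longrightarrow> co i j k l r \<in> carrier K"
  using linD(1)[OF co_lin] by blast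
lemma co_add: "\<lbrakk>i < a; j < b; k < a; l < b; r \<in> carrier R; s \<in> carrier R\<rbrakk> \<Longrightarrow> co i j k l (r \<oplus>\<^bsub>R\<^esub> s) = co i j k l r \<oplus> co i j k l s"
  using linD(2)[OF co_lin] by blast
lemma co_sc: "\<lbrakk>i < a; j < b; k < a; l < b; r \<in> carrier R; c \<in> carrier K\<rbrakk> \<Longrightarrow> co i j k l (c \<odot>\<^bsub>R\<^esub> r) = c \<otimes> co i j k l r"
  using linD(3)[OF co_lin] by blast
lemma co_zero: "\<lbrakk>i < a; j < b; k < a; l < b\<rbrakk> \<Longrightarrow> co i j k l \<zero>\<^bsub>R\<^esub> = \<zero>"
  using linD(4)[OF co_lin] by blast

lemma q_pow_pred: "0 < n \<Longrightarrow> c \<in> carrier K \<Longrightarrow> q [^] n \<otimes> c = q \<otimes> (q [^] (n - Suc 0) \<otimes> c)"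
  using K.nat_pow_Suc2[OF qK, of "n - Suc 0"] by (simp add: K.m_assoc)

text \<open>This and the following commutation rules are read off from coordinates: the rules for
  right multiplication are applied to an arbitrary \<open>r\<close>, which is then set to
  one.\<close>

lemma comm_XX': "X \<otimes>\<^bsub>R\<^esub> X' = X' \<otimes>\<^bsub>R\<^esub> X"
proof -
  have "r \<otimes>\<^bsub>R\<^esub> X \<otimes>\<^bsub>R\<^esub> X' = r \<otimes>\<^bsub>R\<^esub> X' \<otimes>\<^bsub>R\<^esub> X" if "r \<in> carrier R" for r
    by (rule co_ext) (use that in \<open>auto simp: co_rX co_rX'\<close>)
  from this[of "\<one>\<^bsub>R\<^esub>"] show ?thesis by simp
qed

lemma comm_YY': "Y \<otimes>\<^bsub>R\<^esub> Y' = Y' \<otimes>\<^bsub>R\<^esub> Y"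
proof -
  have "r \<otimes>\<^bsub>R\<^esub> Y \<otimes>\<^bsub>R\<^esub> Y' = r \<otimes>\<^bsub>R\<^esub> Y' \<otimes>\<^bsub>R\<^esub> Y" if "r \<in> carrier R" for r
    by (rule co_ext) (use that in \<open>auto simp: co_rY co_rY'\<close>)
  from this[of "\<one>\<^bsub>R\<^esub>"] show ?thesis by simp
qed

lemma comm_XY': "X \<otimes>\<^bsub>R\<^esub> Y' = Y' \<otimes>\<^bsub>R\<^esub> X"
proof -
  have "r \<otimes>\<^bsub>R\<^esub> X \<otimes>\<^bsub>R\<^esub> Y' = r \<otimes>\<^bsub>R\<^esub> Y' \<otimes>\<^bsub>R\<^esub> X" if "r \<in> carrier R" for r
    by (rule co_ext) (use that in \<open>auto simp: co_rX co_rY'\<close>)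
  from this[of "\<one>\<^bsub>R\<^esub>"] show ?thesis by simp
qed

lemma comm_X'Y: "X' \<otimes>\<^bsub>R\<^esub> Y = Y \<otimes>\<^bsub>R\<^esub> X'"
proof -
  have "r \<otimes>\<^bsub>R\<^esub> X' \<otimes>\<^bsub>R\<^esub> Y = r \<otimes>\<^bsub>R\<^esub> Y \<otimes>\<^bsub>R\<^esub> X'" if "r \<in> carrier R" for r
    by (rule co_ext) (use that in \<open>auto simp: co_rX' co_rY K.m_lcomm\<close>)
  from this[of "\<one>\<^bsub>R\<^esub>"] show ?thesis by simp
qed

lemma comm_XY: "X \<otimes>\<^bsub>R\<^esub> Y = q \<odot>\<^bsub>R\<^esub> (Y \<otimes>\<^bsub>R\<^esub> X)"
proof -
  have "r \<otimes>\<^bsub>R\<^esub> X \<otimes>\<^bsub>R\<^esub> Y = q \<odot>\<^bsub>R\<^esub> (r \<otimes>\<^bsub>R\<^esub> Y \<otimes>\<^bsub>R\<^esub> X)" if "r \<in> carrier R" for r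
    by (rule co_ext) (use that in \<open>auto simp: co_rX co_rY co_sc q_pow_pred\<close>)
  from this[of "\<one>\<^bsub>R\<^esub>"] show ?thesis by simp
qed

lemma comm_Y'X': "Y' \<otimes>\<^bsub>R\<^esub> X' = q \<odot>\<^bsub>R\<^esub> (X' \<otimes>\<^bsub>R\<^esub> Y')"
proof -
  have "r \<otimes>\<^bsub>R\<^esub> Y' \<otimes>\<^bsub>R\<^esub> X' = q \<odot>\<^bsub>R\<^esub> (r \<otimes>\<^bsub>R\<^esub> X' \<otimes>\<^bsub>R\<^esub> Y')" if "r \<in> carrier R" for r
    by (rule co_ext) (use that in \<open>auto simp: co_rY' co_rX' co_sc q_pow_pred\<close>)
  from this[of "\<one>\<^bsub>R\<^esub>"] show ?thesis by simp
qed

lemma nilp: "X [^]\<^bsub>R\<^esub> a = \<zero>\<^bsub>R\<^esub>" "X' [^]\<^bsub>R\<^esub> a = \<zero>\<^bsub>R\<^esub>" "Y [^]\<^bsub>R\<^esub> b = \<zero>\<^bsub>R\<^esub>" "Y' [^]\<^bsub>R\<^esub> b = \<zero>\<^bsub>R\<^esub>"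
proof -
  have "\<lbrakk>i < a; j < b; k < a; l < b; i < e\<rbrakk> \<Longrightarrow> co i j k l (X [^]\<^bsub>R\<^esub> e) = \<zero>" for i j k l e
    by (induction e arbitrary: i) (auto simp: co_rX)
  then show "X [^]\<^bsub>R\<^esub> a = \<zero>\<^bsub>R\<^esub>" by (intro co_ext) (auto simp: co_zero)
  have "\<lbrakk>i < a; j < b; k < a; l < b; k < e\<rbrakk> \<Longrightarrow> co i j k l (X' [^]\<^bsub>R\<^esub> e) = \<zero>" for i j k l e
    by (induction e arbitrary: k) (auto simp: co_rX')
  then show "X' [^]\<^bsub>R\<^esub> a = \<zero>\<^bsub>R\<^esub>" by (intro co_ext) (auto simp: co_zero)
  have "\<lbrakk>i < a; j < b; k < a; l < b; j < e\<rbrakk> \<Longrightarrow> co i j k l (Y [^]\<^bsub>R\<^esub> e) = \<zero>" for i j k l e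
    by (induction e arbitrary: j) (auto simp: co_rY)
  then show "Y [^]\<^bsub>R\<^esub> b = \<zero>\<^bsub>R\<^esub>" by (intro co_ext) (auto simp: co_zero)
  have "\<lbrakk>i < a; j < b; k < a; l < b; l < e\<rbrakk> \<Longrightarrow> co i j k l (Y' [^]\<^bsub>R\<^esub> e) = \<zero>" for i j k l e
    by (induction e arbitrary: l) (auto simp: co_rY')
  then show "Y' [^]\<^bsub>R\<^esub> b = \<zero>\<^bsub>R\<^esub>" by (intro co_ext) (auto simp: co_zero)
qed

text \<open>On passing \<open>Y\<close>, every \<open>X\<close> yields a factor q and
  \<open>X'\<close> yields none. Scaling the twist by q supplies \<open>X'\<close> with the same
  factor, so the sum moves as a whole and only \<open>q^e\<close> is left over.\<close>

lemma hom_sum_Y: "c \<in> carrier K \<Longrightarrow>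
   hom_sum X X' e (c \<otimes> q) \<otimes>\<^bsub>R\<^esub> Y = q [^] e \<odot>\<^bsub>R\<^esub> (Y \<otimes>\<^bsub>R\<^esub> hom_sum X X' e c)"
proof (induction e)
  case (Suc e)
  have p: "X' [^]\<^bsub>R\<^esub> Suc e \<otimes>\<^bsub>R\<^esub> Y = Y \<otimes>\<^bsub>R\<^esub> X' [^]\<^bsub>R\<^esub> Suc e" by (rule A.nat_pow_commute) (auto simp: comm_X'Y)
  have cq: "(c \<otimes> q) [^] Suc e = q [^] Suc e \<otimes> c [^] Suc e"
    using Suc.prems by (simp only: K.nat_pow_distrib qK K.m_comm K.nat_pow_closed)
  have "hom_sum X X' e (c \<otimes> q) \<otimes>\<^bsub>R\<^esub> X \<otimes>\<^bsub>R\<^esub> Y = q \<odot>\<^bsub>R\<^esub> ((hom_sum X X' e (c \<otimes> q) \<otimes>\<^bsub>R\<^esub> Y) \<otimes>\<^bsub>R\<^esub> X)"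
    using Suc.prems by (simp add: A.m_assoc comm_XY sc_rmult)
  also have "\<dots> = q [^] Suc e \<odot>\<^bsub>R\<^esub> (Y \<otimes>\<^bsub>R\<^esub> (hom_sum X X' e c \<otimes>\<^bsub>R\<^esub> X))"
    using Suc by (simp add: sc_lmult A.m_assoc K.m_comm flip: sc_assoc)
  finally show ?case using Suc.prems p cq
    by (simp add: A.l_distr A.r_distr sc_lmult sc_rmult sc_radd sc_assoc del: A.nat_pow_Suc K.nat_pow_Suc)
qed simp

text \<open>Here \<open>X\<close> commutes and \<open>X'\<close> yields the inverse of q, which the
  scaled twist cancels; no power of q is left over.\<close>

lemma hom_sum_Y': "c \<in> carrier K \<Longrightarrow>
   hom_sum X X' e (c \<otimes> q) \<otimes>\<^bsub>R\<^esub> Y' = Y' \<otimes>\<^bsub>R\<^esub> hom_sum X X' e c"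
proof (induction e)
  case (Suc e)
  have p: "q [^] n \<odot>\<^bsub>R\<^esub> (X' [^]\<^bsub>R\<^esub> n \<otimes>\<^bsub>R\<^esub> Y') = Y' \<otimes>\<^bsub>R\<^esub> X' [^]\<^bsub>R\<^esub> n" for n :: nat
  proof (induction n)
    case (Suc n)
    have "Y' \<otimes>\<^bsub>R\<^esub> X' [^]\<^bsub>R\<^esub> Suc n = q [^] n \<odot>\<^bsub>R\<^esub> (X' [^]\<^bsub>R\<^esub> n \<otimes>\<^bsub>R\<^esub> (Y' \<otimes>\<^bsub>R\<^esub> X'))"
      using Suc by (simp add: A.m_assoc[symmetric] sc_lmult[symmetric])
    then show ?case by (simp add: comm_Y'X' sc_rmult A.m_assoc sc_assoc)
  qed simp
  have cq: "(c \<otimes> q) [^] Suc e = c [^] Suc e \<otimes> q [^] Suc e"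
    using Suc.prems by (simp only: K.nat_pow_distrib qK)
  have "hom_sum X X' e (c \<otimes> q) \<otimes>\<^bsub>R\<^esub> X \<otimes>\<^bsub>R\<^esub> Y' = Y' \<otimes>\<^bsub>R\<^esub> (hom_sum X X' e c \<otimes>\<^bsub>R\<^esub> X)"
    using Suc by (simp add: A.m_assoc comm_XY') (simp add: Suc flip: A.m_assoc)
  then show ?case using Suc.prems p[of "Suc e"] cq
    by (simp add: A.l_distr A.r_distr sc_lmult sc_rmult sc_assoc del: A.nat_pow_Suc K.nat_pow_Suc)
qed simp

lemma hom_sum_Y'_pow: "c \<in> carrier K \<Longrightarrow>
   hom_sum X X' e (c \<otimes> q [^] (f::nat)) \<otimes>\<^bsub>R\<^esub> Y' [^]\<^bsub>R\<^esub> f = Y' [^]\<^bsub>R\<^esub> f \<otimes>\<^bsub>R\<^esub> hom_sum X X' e c"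
proof (induction f arbitrary: c)
  case (Suc f)
  have "hom_sum X X' e (c \<otimes> q [^] Suc f) \<otimes>\<^bsub>R\<^esub> Y' [^]\<^bsub>R\<^esub> Suc f = (hom_sum X X' e ((c \<otimes> q) \<otimes> q [^] f) \<otimes>\<^bsub>R\<^esub> Y' [^]\<^bsub>R\<^esub> f) \<otimes>\<^bsub>R\<^esub> Y'"
    using Suc.prems by (simp add: A.m_assoc K.m_ac)
  also have "\<dots> = Y' [^]\<^bsub>R\<^esub> f \<otimes>\<^bsub>R\<^esub> (hom_sum X X' e (c \<otimes> q) \<otimes>\<^bsub>R\<^esub> Y')"
    using Suc.prems by (simp add: Suc.IH A.m_assoc)
  finally show ?case using Suc.prems by (simp add: hom_sum_Y' A.m_assoc)
qed simp

text \<open>Two homogeneous sums of degrees \<open>e\<close> and \<open>f\<close> q-commute once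
  each twist is scaled by q to the degree of the other. This is the origin of the twists in
  \<open>dx\<close> and \<open>dy\<close>.\<close>

lemma hom_sum_exchange: "c \<in> carrier K \<Longrightarrow> m \<in> carrier K \<Longrightarrow>
   hom_sum X X' e (c \<otimes> q [^] f) \<otimes>\<^bsub>R\<^esub> hom_sum Y Y' f (m \<otimes> q [^] e)
   = q [^] (e * f) \<odot>\<^bsub>R\<^esub> (hom_sum Y Y' f m \<otimes>\<^bsub>R\<^esub> hom_sum X X' e c)"
proof (induction f arbitrary: c)
  case (Suc f)
  let ?m = "m \<otimes> q [^] e" and ?H = "hom_sum X X' e"
  have eq: "c \<otimes> q [^] Suc f = (c \<otimes> q) \<otimes> q [^] f" using Suc.prems by (simp add: K.m_ac)
  have "?H (c \<otimes> q [^] Suc f) \<otimes>\<^bsub>R\<^esub> (hom_sum Y Y' f ?m \<otimes>\<^bsub>R\<^esub> Y)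
      = q [^] (e * f) \<odot>\<^bsub>R\<^esub> (hom_sum Y Y' f m \<otimes>\<^bsub>R\<^esub> (?H (c \<otimes> q) \<otimes>\<^bsub>R\<^esub> Y))"
    unfolding eq using Suc.prems Suc.IH[of "c \<otimes> q"] by (simp add: sc_lmult A.m_assoc flip: A.m_assoc[of "?H _" "hom_sum Y Y' f ?m" Y])
  also have "\<dots> = q [^] (e * Suc f) \<odot>\<^bsub>R\<^esub> (hom_sum Y Y' f m \<otimes>\<^bsub>R\<^esub> Y \<otimes>\<^bsub>R\<^esub> ?H c)"
    using Suc.prems by (simp add: hom_sum_Y sc_rmult A.m_assoc K.nat_pow_mult add.commute flip: sc_assoc)
  finally have 1: "?H (c \<otimes> q [^] Suc f) \<otimes>\<^bsub>R\<^esub> (hom_sum Y Y' f ?m \<otimes>\<^bsub>R\<^esub> Y) = \<dots>" .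
  have mp: "?m [^] Suc f = q [^] (e * Suc f) \<otimes> m [^] Suc f"
    using Suc.prems by (simp only: K.nat_pow_distrib K.nat_pow_closed qK K.nat_pow_pow K.m_comm)
  have 2: "?H (c \<otimes> q [^] Suc f) \<otimes>\<^bsub>R\<^esub> Y' [^]\<^bsub>R\<^esub> Suc f = Y' [^]\<^bsub>R\<^esub> Suc f \<otimes>\<^bsub>R\<^esub> ?H c"
    by (rule hom_sum_Y'_pow[OF Suc.prems(1)])
  show ?case using Suc.prems 1 2 mp
    by (simp add: A.r_distr A.l_distr sc_lmult sc_rmult sc_radd sc_assoc del: A.nat_pow_Suc K.nat_pow_Suc mult_Suc_right)
qed simp

end

section \<open>The differentials of the bicomplex\<close>

context qring
begin

text \<open>Powers of q with integer exponents, taken in the multiplicative group of the field,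
  since exponents of both signs occur.\<close>

definition Qz :: "int \<Rightarrow> 'k" where "Qz n = q [^]\<^bsub>mult_of K\<^esub> n"

lemma q_mult_of: "q \<in> carrier (mult_of K)" using q0 by simp

lemma Qz_mem: "Qz n \<in> carrier (mult_of K)"
  unfolding Qz_def by (rule group.int_pow_closed[OF K.field_mult_group q_mult_of])

lemma Qz_c [simp]: "Qz n \<in> carrier K" and Qz_nz: "Qz n \<noteq> \<zero>"
  using Qz_mem[of n] by auto

lemma Qz_add: "Qz (m + n) = Qz m \<otimes> Qz n"
  unfolding Qz_def using group.int_pow_mult[OF K.field_mult_group q_mult_of] by simp

lemma Qz_0 [simp]: "Qz 0 = \<one>" by (simp add: Qz_def)

lemma Qz_nat: "Qz (int n) = q [^] n"
  unfolding Qz_def by (simp add: int_pow_int nat_pow_mult_of)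

definition sgK :: "int \<Rightarrow> 'k" where "sgK i = (if odd i then \<ominus> \<one> else \<one>)"

lemma sgK_c [simp]: "sgK i \<in> carrier K" by (simp add: sgK_def)
lemma sgK_step: "sgK (i - 1) = \<ominus> sgK i" by (simp add: sgK_def)

text \<open>For odd index the sign in \<open>sgK\<close> produces the commutator, for even index the
  complementary factor. The twist of \<open>dx\<close> is constant along a row and that of
  \<open>dy\<close> along a column, so consecutive differentials are complementary. The scalar in
  front of \<open>dy\<close> absorbs the q-power of \<open>hom_sum_exchange\<close>, and its sign
  makes the squares anticommute.\<close>

definition dx :: "int \<Rightarrow> int \<Rightarrow> 'r" where
  "dx i j = hom_sum X X' (stp a i) (sgK i \<otimes> Qz (dg b j))"
definition dy :: "int \<Rightarrow> int \<Rightarrow> 'r" where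
  "dy i j = (sgK i \<otimes> Qz (dg a i * int (stp b j))) \<odot>\<^bsub>R\<^esub> hom_sum Y Y' (stp b j) (sgK j \<otimes> Qz (- dg a i))"

lemma d_c [simp]: "dx i j \<in> carrier R" "dy i j \<in> carrier R"
  by (simp_all add: dx_def dy_def)

lemma hs_xx: "c \<in> carrier K \<Longrightarrow> hom_sum X X' (stp a i) (sgK i \<otimes> c) \<otimes>\<^bsub>R\<^esub> hom_sum X X' (stp a (i - 1)) (sgK (i - 1) \<otimes> c) = \<zero>\<^bsub>R\<^esub>"
  using hom_sum_nilp[OF gens(1,3) _ comm_XX' _ nilp(1,2), of c] a2
  by (cases "odd i") (auto simp: stp_def sgK_def K.l_minus simp del: hom_sum.simps)

lemma hs_yy: "c \<in> carrier K \<Longrightarrow> hom_sum Y Y' (stp b i) (sgK i \<otimes> c) \<otimes>\<^bsub>R\<^esub> hom_sum Y Y' (stp b (i - 1)) (sgK (i - 1) \<otimes> c) = \<zero>\<^bsub>R\<^esub>"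
  using hom_sum_nilp[OF gens(2,4) _ comm_YY' _ nilp(3,4), of c] b2
  by (cases "odd i") (auto simp: stp_def sgK_def K.l_minus simp del: hom_sum.simps)

lemma dxdx0: "dx i j \<otimes>\<^bsub>R\<^esub> dx (i - 1) j = \<zero>\<^bsub>R\<^esub>"
  unfolding dx_def by (rule hs_xx) simp

lemma dydy0: "dy i j \<otimes>\<^bsub>R\<^esub> dy i (j - 1) = \<zero>\<^bsub>R\<^esub>"
  unfolding dy_def by (simp add: sc_lmult sc_rmult hs_yy del: hom_sum.simps)

lemma dxdy0: "dx i j \<otimes>\<^bsub>R\<^esub> dy (i - 1) j \<oplus>\<^bsub>R\<^esub> dy i j \<otimes>\<^bsub>R\<^esub> dx i (j - 1) = \<zero>\<^bsub>R\<^esub>"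
proof -
  let ?e = "stp a i" and ?f = "stp b j"
  let ?P = "hom_sum X X' ?e (sgK i \<otimes> Qz (dg b (j - 1)))"
  let ?G = "hom_sum Y Y' ?f (sgK j \<otimes> Qz (- dg a i))"
  \<comment> \<open>The internal degree grows from \<open>j - 1\<close> to \<open>j\<close> by
    exactly the degree of the y-differential that is crossed, so the scaled twist demanded by the
    exchange is the twist of the neighbouring row.\<close>
  have e1: "sgK i \<otimes> Qz (dg b j) = (sgK i \<otimes> Qz (dg b (j - 1))) \<otimes> q [^] ?f"
    using dg_step[of b j] b2 by (simp add: Qz_add Qz_nat K.m_assoc)
  have e2: "sgK j \<otimes> Qz (- dg a (i - 1)) = (sgK j \<otimes> Qz (- dg a i)) \<otimes> q [^] ?e"
  proof -
    have "- dg a (i - 1) = - dg a i + int ?e" using dg_step[of a i] a2 by simp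
    then have "Qz (- dg a (i - 1)) = Qz (- dg a i) \<otimes> q [^] ?e" by (simp only: Qz_add Qz_nat)
    then show ?thesis by (simp add: K.m_assoc)
  qed
  \<comment> \<open>The q-power left by the exchange turns the prefactor of column
    \<open>i - 1\<close> into that of column \<open>i\<close>; only the sign then distinguishes the
    two paths.\<close>
  have e3: "Qz (dg a (i - 1) * int ?f) \<otimes> q [^] (?e * ?f) = Qz (dg a i * int ?f)"
    using dg_step[of a i] a2 by (simp add: Qz_add distrib_right flip: Qz_nat)
  have "dx i j \<otimes>\<^bsub>R\<^esub> dy (i - 1) j = (sgK (i - 1) \<otimes> Qz (dg a (i - 1) * int ?f)) \<odot>\<^bsub>R\<^esub> (q [^] (?e * ?f) \<odot>\<^bsub>R\<^esub> (?G \<otimes>\<^bsub>R\<^esub> ?P))"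
    unfolding dx_def dy_def e1 e2 by (simp add: sc_rmult hom_sum_exchange del: hom_sum.simps)
  also have "\<dots> = (sgK (i - 1) \<otimes> Qz (dg a i * int ?f)) \<odot>\<^bsub>R\<^esub> (?G \<otimes>\<^bsub>R\<^esub> ?P)"
    by (simp add: K.m_assoc e3 del: hom_sum.simps flip: sc_assoc)
  also have "\<dots> = \<ominus>\<^bsub>R\<^esub> (dy i j \<otimes>\<^bsub>R\<^esub> dx i (j - 1))"
    unfolding dx_def dy_def by (simp add: sgK_step K.l_minus sc_minus sc_lmult del: hom_sum.simps)
  finally show ?thesis by (simp add: A.l_neg)
qed

sublocale RC: bicomplex R "\<lambda>_ _. carrier R" dx dy
  by unfold_locales (auto simp: A.m_assoc dxdx0 dydy0 dxdy0 simp flip: A.r_distr)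

section \<open>Exactness of rows and columns over the enveloping algebra\<close>

definition Sx where "Sx = {s \<in> carrier R. \<forall>i j k l. 0 < i \<longrightarrow> i < a \<longrightarrow> j < b \<longrightarrow> k < a \<longrightarrow> l < b \<longrightarrow> co i j k l s = \<zero>}"
definition Sy where "Sy = {s \<in> Sx. \<forall>j k l. 0 < j \<longrightarrow> j < b \<longrightarrow> k < a \<longrightarrow> l < b \<longrightarrow> co 0 j k l s = \<zero>}"

text \<open>The n-th coefficient of \<open>r\<close> in the expansion in powers of \<open>X\<close>,
  obtained by prescribing coordinates: the slice at first index \<open>n\<close> is moved to first
  index 0.\<close>

definition cpx where "cpx n r = (SOME s. s \<in> carrier R \<and>
   (\<forall>i j k l. i < a \<longrightarrow> j < b \<longrightarrow> k < a \<longrightarrow> l < b \<longrightarrow> co i j k l s = (if i = 0 then co n j k l r else \<zero>)))"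
definition cpy where "cpy n r = (SOME s. s \<in> carrier R \<and>
   (\<forall>i j k l. i < a \<longrightarrow> j < b \<longrightarrow> k < a \<longrightarrow> l < b \<longrightarrow> co i j k l s = (if i = 0 \<and> j = 0 then co 0 n k l r else \<zero>)))"

lemma cpx: assumes "n < a" "r \<in> carrier R"
  shows "cpx n r \<in> carrier R" "\<lbrakk>i < a; j < b; k < a; l < b\<rbrakk> \<Longrightarrow> co i j k l (cpx n r) = (if i = 0 then co n j k l r else \<zero>)"
proof -
  have E: "\<exists>s\<in>carrier R. (\<forall>i j k l. i < a \<longrightarrow> j < b \<longrightarrow> k < a \<longrightarrow> l < b \<longrightarrow> co i j k l s = (if i = 0 then co n j k l r else \<zero>))"
    by (rule co_ex) (use assms in auto)
  from someI_ex[OF E[unfolded Bex_def]] show "cpx n r \<in> carrier R" "\<lbrakk>i < a; j < b; k < a; l < b\<rbrakk> \<Longrightarrow> co i j k l (cpx n r) = (if i = 0 then co n j k l r else \<zero>)"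
    by (auto simp: cpx_def)
qed

lemma cpy: assumes "n < b" "r \<in> carrier R"
  shows "cpy n r \<in> carrier R" "\<lbrakk>i < a; j < b; k < a; l < b\<rbrakk> \<Longrightarrow> co i j k l (cpy n r) = (if i = 0 \<and> j = 0 then co 0 n k l r else \<zero>)"
proof -
  have E: "\<exists>s\<in>carrier R. (\<forall>i j k l. i < a \<longrightarrow> j < b \<longrightarrow> k < a \<longrightarrow> l < b \<longrightarrow> co i j k l s = (if i = 0 \<and> j = 0 then co 0 n k l r else \<zero>))"
    by (rule co_ex) (use assms a2 in auto)
  from someI_ex[OF E[unfolded Bex_def]] show "cpy n r \<in> carrier R" "\<lbrakk>i < a; j < b; k < a; l < b\<rbrakk> \<Longrightarrow> co i j k l (cpy n r) = (if i = 0 \<and> j = 0 then co 0 n k l r else \<zero>)"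
    by (auto simp: cpy_def)
qed

lemma SxD: "s \<in> Sx \<Longrightarrow> s \<in> carrier R" "\<lbrakk>s \<in> Sx; 0 < i; i < a; j < b; k < a; l < b\<rbrakk> \<Longrightarrow> co i j k l s = \<zero>"
  by (auto simp: Sx_def)
lemma SyD: "s \<in> Sy \<Longrightarrow> s \<in> carrier R" "s \<in> Sy \<Longrightarrow> s \<in> Sx" "\<lbrakk>s \<in> Sy; 0 < j; j < b; k < a; l < b\<rbrakk> \<Longrightarrow> co 0 j k l s = \<zero>"
  by (auto simp: Sy_def Sx_def)

lemma Sx_closed:
  "s \<in> Sx \<Longrightarrow> t \<in> Sx \<Longrightarrow> s \<oplus>\<^bsub>R\<^esub> t \<in> Sx" "c \<in> carrier K \<Longrightarrow> s \<in> Sx \<Longrightarrow> c \<odot>\<^bsub>R\<^esub> s \<in> Sx"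
  "s \<in> Sx \<Longrightarrow> s \<otimes>\<^bsub>R\<^esub> X' \<in> Sx" "s \<in> Sx \<Longrightarrow> s \<otimes>\<^bsub>R\<^esub> Y \<in> Sx" "s \<in> Sx \<Longrightarrow> s \<otimes>\<^bsub>R\<^esub> Y' \<in> Sx"
  by (auto simp: Sx_def co_add co_sc co_rX' co_rY co_rY')

lemma Sy_closed:
  "c \<in> carrier K \<Longrightarrow> s \<in> Sy \<Longrightarrow> c \<odot>\<^bsub>R\<^esub> s \<in> Sy" "s \<in> Sy \<Longrightarrow> s \<otimes>\<^bsub>R\<^esub> X' \<in> Sy" "s \<in> Sy \<Longrightarrow> s \<otimes>\<^bsub>R\<^esub> Y' \<in> Sy"
  using a2 by (auto simp: Sy_def Sx_closed SxD co_sc co_rX' co_rY')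

sublocale HX: shift_pair K R "carrier R" Sx X X' a cpx
proof unfold_locales
  show "1 \<le> a" using a2 by simp
  show "X \<otimes>\<^bsub>R\<^esub> X' = X' \<otimes>\<^bsub>R\<^esub> X" by (rule comm_XX')
  show "X' [^]\<^bsub>R\<^esub> a = \<zero>\<^bsub>R\<^esub>" by (rule nilp)
  show "cpx i v \<in> Sx" if "i < a" "v \<in> carrier R" for i v using cpx[OF that] by (auto simp: Sx_def)
  show "u = v" if "u \<in> carrier R" "v \<in> carrier R" "\<And>i. i < a \<Longrightarrow> cpx i u = cpx i v" for u v
  proof (rule co_ext[OF that(1,2)])
    fix i j k l assume h: "i < a" "j < b" "k < a" "l < b"
    have "co 0 j k l (cpx i u) = co 0 j k l (cpx i v)" using that(3)[OF h(1)] by simp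
    then show "co i j k l u = co i j k l v" using cpx(2)[OF h(1) that(1), of 0 j k l] cpx(2)[OF h(1) that(2), of 0 j k l] h a2 by simp
  qed
  fix i assume i: "i < a"
  show "cpx i (u \<oplus>\<^bsub>R\<^esub> v) = cpx i u \<oplus>\<^bsub>R\<^esub> cpx i v" if "u \<in> carrier R" "v \<in> carrier R" for u v
    by (rule co_ext) (use that i in \<open>auto simp: cpx co_add\<close>)
  show "cpx i (c \<odot>\<^bsub>R\<^esub> v) = c \<odot>\<^bsub>R\<^esub> cpx i v" if "c \<in> carrier K" "v \<in> carrier R" for c v
    by (rule co_ext) (use that i in \<open>auto simp: cpx co_sc\<close>)
  show "cpx i (v \<otimes>\<^bsub>R\<^esub> X) = (if i = 0 then \<zero>\<^bsub>R\<^esub> else cpx (i - 1) v)" if "v \<in> carrier R" for v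
    by (rule co_ext) (use that i in \<open>auto simp: cpx co_rX co_zero\<close>)
  show "cpx i (v \<otimes>\<^bsub>R\<^esub> X') = cpx i v \<otimes>\<^bsub>R\<^esub> X'" if "v \<in> carrier R" for v
    by (rule co_ext) (use that i in \<open>auto simp: cpx co_rX'\<close>)
  show "cpx i s = (if i = 0 then s else \<zero>\<^bsub>R\<^esub>)" if "s \<in> Sx" for s
    by (rule co_ext) (use that i SxD in \<open>auto simp: cpx co_zero\<close>)
qed (auto simp: Sx_closed SxD)

text \<open>Inside \<open>Sx\<close> the same pattern repeats for \<open>Y\<close>, with constants
  \<open>Sy\<close>. It is applied in column 0 only, where the twist is one.\<close>

sublocale HY: shift_pair K R Sx Sy Y Y' b cpy
proof unfold_locales
  show "1 \<le> b" using b2 by simp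
  show "Y \<otimes>\<^bsub>R\<^esub> Y' = Y' \<otimes>\<^bsub>R\<^esub> Y" by (rule comm_YY')
  show "Y' [^]\<^bsub>R\<^esub> b = \<zero>\<^bsub>R\<^esub>" by (rule nilp)
  show "cpy i v \<in> Sy" if "i < b" "v \<in> Sx" for i v
  proof -
    note c = cpy[OF that(1) SxD(1)[OF that(2)]]
    show ?thesis unfolding Sy_def Sx_def mem_Collect_eq
      by (intro conjI allI impI c(1)) (use a2 in \<open>simp_all add: c(2)\<close>)
  qed
  show "u = v" if "u \<in> Sx" "v \<in> Sx" "\<And>i. i < b \<Longrightarrow> cpy i u = cpy i v" for u v
  proof (rule co_ext[OF SxD(1)[OF that(1)] SxD(1)[OF that(2)]])
    fix i j k l assume h: "i < a" "j < b" "k < a" "l < b"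
    have "co 0 0 k l (cpy j u) = co 0 0 k l (cpy j v)" using that(3)[OF h(2)] by simp
    then have "co 0 j k l u = co 0 j k l v" 
      using cpy(2)[OF h(2) SxD(1)[OF that(1)], of 0 0 k l] cpy(2)[OF h(2) SxD(1)[OF that(2)], of 0 0 k l] h a2 b2 by simp
    then show "co i j k l u = co i j k l v" using SxD(2)[OF that(1), of i j k l] SxD(2)[OF that(2), of i j k l] h by (cases "i = 0") auto
  qed
  fix i assume i: "i < b"
  show "cpy i (u \<oplus>\<^bsub>R\<^esub> v) = cpy i u \<oplus>\<^bsub>R\<^esub> cpy i v" if "u \<in> Sx" "v \<in> Sx" for u v
    by (rule co_ext) (use that[THEN SxD(1)] i a2 in \<open>auto simp: cpy co_add\<close>)
  show "cpy i (c \<odot>\<^bsub>R\<^esub> v) = c \<odot>\<^bsub>R\<^esub> cpy i v" if "c \<in> carrier K" "v \<in> Sx" for c v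
    by (rule co_ext) (use that that(2)[THEN SxD(1)] i a2 in \<open>auto simp: cpy co_sc\<close>)
  show "cpy i (v \<otimes>\<^bsub>R\<^esub> Y) = (if i = 0 then \<zero>\<^bsub>R\<^esub> else cpy (i - 1) v)" if "v \<in> Sx" for v
    by (rule co_ext) (use that[THEN SxD(1)] i a2 in \<open>auto simp: cpy co_rY co_zero\<close>)
  show "cpy i (v \<otimes>\<^bsub>R\<^esub> Y') = cpy i v \<otimes>\<^bsub>R\<^esub> Y'" if "v \<in> Sx" for v
    by (rule co_ext) (use that[THEN SxD(1)] i a2 in \<open>auto simp: cpy co_rY'\<close>)
  show "cpy i s = (if i = 0 then s else \<zero>\<^bsub>R\<^esub>)" if "s \<in> Sy" for s
  proof (rule co_ext)
    fix i' j k l assume h: "i' < a" "j < b" "k < a" "l < b"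
    show "co i' j k l (cpy i s) = co i' j k l (if i = 0 then s else \<zero>\<^bsub>R\<^esub>)"
      using cpy(2)[OF i SyD(1)[OF that] h] SxD(2)[OF SyD(2)[OF that], of i' j k l] SyD(3)[OF that, of j k l]
        SyD(3)[OF that, of i k l] h i by (cases "i' = 0"; cases "j = 0"; cases "i = 0") (auto simp: co_zero)
  qed (use that i SyD(1) cpy(1) in auto)
qed (auto simp: Sx_closed Sy_closed SyD SxD)

lemma dx_odd: "odd i \<Longrightarrow> dx i j = HX.D (Qz (dg b j))"
  using hom_sum_1[of X X' "Qz (dg b j)"] by (simp add: dx_def stp_def sgK_def HX.D_def K.l_minus del: hom_sum.simps)

lemma dx_even: "even i \<Longrightarrow> dx i j = HX.N (Qz (dg b j))"
  by (simp add: dx_def stp_def sgK_def HX.N_def)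

lemma dy0_odd: "odd j \<Longrightarrow> dy 0 j = HY.D \<one>"
  using hom_sum_1[of Y Y' "\<one>"] by (simp add: dy_def stp_def sgK_def HY.D_def K.l_minus del: hom_sum.simps)

lemma dy0_even: "even j \<Longrightarrow> dy 0 j = HY.N \<one>"
  by (simp add: dy_def stp_def sgK_def HY.N_def)

text \<open>Along a row the factors \<open>D\<close> and \<open>N\<close> alternate for one fixed
  twist. Neither index is bounded, so chases may pass through auxiliary positions outside the two
  quadrants.\<close>

lemma rows_exact: assumes z: "z \<in> carrier R" "z \<otimes>\<^bsub>R\<^esub> dx i j = \<zero>\<^bsub>R\<^esub>" shows "\<exists>w\<in>carrier R. z = w \<otimes>\<^bsub>R\<^esub> dx (i + 1) j"
proof (cases "odd i")
  case True
  then show ?thesis using HX.ker_D[OF z(1), of "Qz (dg b j)"] z(2) SxD(1) by (auto simp: dx_odd dx_even)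
next
  case False
  then show ?thesis using HX.ker_N[OF z(1), of "Qz (dg b j)"] z(2) by (auto simp: dx_odd dx_even)
qed

lemma Sx_dy: "s \<in> Sx \<Longrightarrow> s \<otimes>\<^bsub>R\<^esub> dy 0 j \<in> Sx"
proof (cases "odd j")
  case True
  assume "s \<in> Sx"
  then show ?thesis using True HY.V_D[of s "\<one>"] by (simp add: dy0_odd)
next
  case False
  assume "s \<in> Sx"
  then show ?thesis using False HY.V_hom_sum[of s "\<one>"] by (simp add: dy0_even HY.N_def)
qed

text \<open>Modulo the image of \<open>dx 1 j\<close> every element has a unique representative in
  \<open>Sx\<close>, and \<open>dy 0 j\<close> preserves \<open>Sx\<close>. Column 0 modulo the rows
  is therefore again a truncated polynomial module, now in \<open>Y\<close>.\<close>

lemma column_exact: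
  assumes z: "z \<in> carrier R" and u: "u \<in> carrier R" and e: "z \<otimes>\<^bsub>R\<^esub> dy 0 j = u \<otimes>\<^bsub>R\<^esub> dx 1 (j - 1)"
  shows "\<exists>w\<in>carrier R. \<exists>w'\<in>carrier R. z = w' \<otimes>\<^bsub>R\<^esub> dx 1 j \<oplus>\<^bsub>R\<^esub> w \<otimes>\<^bsub>R\<^esub> dy 0 (j + 1)"
proof -
  obtain s w0 where s: "s \<in> Sx" "w0 \<in> carrier R" "z = s \<oplus>\<^bsub>R\<^esub> w0 \<otimes>\<^bsub>R\<^esub> dx 1 j"
    using HX.mod_D[OF z, of "Qz (dg b j)"] by (auto simp: dx_odd)
  have sR: "s \<in> carrier R" using s SxD by auto
  have "s \<otimes>\<^bsub>R\<^esub> dy 0 j \<oplus>\<^bsub>R\<^esub> w0 \<otimes>\<^bsub>R\<^esub> dx 1 j \<otimes>\<^bsub>R\<^esub> dy 0 j = u \<otimes>\<^bsub>R\<^esub> dx 1 (j - 1)"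
    using e s sR by (simp add: A.l_distr)
  moreover have "w0 \<otimes>\<^bsub>R\<^esub> dx 1 j \<otimes>\<^bsub>R\<^esub> dy 0 j = \<ominus>\<^bsub>R\<^esub> (w0 \<otimes>\<^bsub>R\<^esub> dy 1 j \<otimes>\<^bsub>R\<^esub> dx 1 (j - 1))"
    using RC.anti'[OF s(2), of 1 j] by simp
  ultimately have "s \<otimes>\<^bsub>R\<^esub> dy 0 j = (u \<oplus>\<^bsub>R\<^esub> w0 \<otimes>\<^bsub>R\<^esub> dy 1 j) \<otimes>\<^bsub>R\<^esub> dx 1 (j - 1)"
    using A.add.inv_solve_right[of "u \<otimes>\<^bsub>R\<^esub> dx 1 (j - 1)" "s \<otimes>\<^bsub>R\<^esub> dy 0 j" "w0 \<otimes>\<^bsub>R\<^esub> dy 1 j \<otimes>\<^bsub>R\<^esub> dx 1 (j - 1)"]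
      s(2) sR u by (simp add: A.l_distr)
  \<comment> \<open>The left side lies in \<open>Sx\<close> and the right side is a multiple of
    \<open>dx 1 (j - 1)\<close>, so the congruence becomes an equation inside
    \<open>Sx\<close>.\<close>
  from HX.S_inter_VD[OF Sx_dy[OF s(1)] _ _ this[unfolded dx_odd[of 1, simplified]]]
  have s0: "s \<otimes>\<^bsub>R\<^esub> dy 0 j = \<zero>\<^bsub>R\<^esub>" using u s(2) by simp
  have "\<exists>w\<in>carrier R. s = w \<otimes>\<^bsub>R\<^esub> dy 0 (j + 1)"
  proof (cases "odd j")
    case True
    then show ?thesis using HY.ker_D[OF s(1), of "\<one>"] s0 SyD(1) by (auto simp: dy0_odd dy0_even)
  next
    case False
    then show ?thesis using HY.ker_N[OF s(1), of "\<one>"] s0 SxD(1) by (auto simp: dy0_odd dy0_even)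
  qed
  then obtain w where "w \<in> carrier R" "s = w \<otimes>\<^bsub>R\<^esub> dy 0 (j + 1)" by blast
  then show ?thesis using s by (intro bexI[of _ w] bexI[of _ w0]) (auto simp: A.a_comm)
qed

text \<open>The element is pulled back along its row to the auxiliary position
  \<open>(0, j)\<close>, where \<open>column_exact\<close> applies; pushing forward again kills the
  component that came from \<open>dx 1 j\<close>.\<close>

lemma column3_exact:
  assumes z: "z \<in> carrier R" and 0: "z \<otimes>\<^bsub>R\<^esub> dx (-1) j = \<zero>\<^bsub>R\<^esub>" "z \<otimes>\<^bsub>R\<^esub> dy (-1) j = \<zero>\<^bsub>R\<^esub>"
  shows "\<exists>w\<in>carrier R. z = w \<otimes>\<^bsub>R\<^esub> dy 0 (j + 1) \<otimes>\<^bsub>R\<^esub> dx 0 j"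
proof -
  obtain w where w: "w \<in> carrier R" "z = w \<otimes>\<^bsub>R\<^esub> dx 0 j" using rows_exact[OF z 0(1)] by auto
  have "w \<otimes>\<^bsub>R\<^esub> dy 0 j \<otimes>\<^bsub>R\<^esub> dx 0 (j - 1) = \<zero>\<^bsub>R\<^esub>"
    using 0(2) RC.anti[OF w(1), of 0 j] w by simp
  then obtain u where u: "u \<in> carrier R" "w \<otimes>\<^bsub>R\<^esub> dy 0 j = u \<otimes>\<^bsub>R\<^esub> dx 1 (j - 1)"
    using rows_exact[of "w \<otimes>\<^bsub>R\<^esub> dy 0 j" 0 "j - 1"] w by auto
  from column_exact[OF w(1) u] obtain v v' where
    v: "v \<in> carrier R" "v' \<in> carrier R" "w = v' \<otimes>\<^bsub>R\<^esub> dx 1 j \<oplus>\<^bsub>R\<^esub> v \<otimes>\<^bsub>R\<^esub> dy 0 (j + 1)" by blast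
  have "z = v \<otimes>\<^bsub>R\<^esub> dy 0 (j + 1) \<otimes>\<^bsub>R\<^esub> dx 0 j"
    using RC.dxdx[OF v(2), of 1 j] v w(2) by (simp add: A.l_distr)
  then show ?thesis using v(1) by blast
qed

text \<open>Anticommutativity trades \<open>dy 0 (j + 1)\<close> followed by \<open>dx 0 j\<close>
  for \<open>dx 0 (j + 1)\<close> followed by \<open>dy (-1) (j + 1)\<close>. The new preimage is a
  row boundary and hence a row cycle, as the chase in the third quadrant demands.\<close>

lemma column3_exact':
  assumes z: "z \<in> carrier R" and 0: "z \<otimes>\<^bsub>R\<^esub> dx (-1) j = \<zero>\<^bsub>R\<^esub>" "z \<otimes>\<^bsub>R\<^esub> dy (-1) j = \<zero>\<^bsub>R\<^esub>"
  shows "\<exists>w\<in>carrier R. w \<otimes>\<^bsub>R\<^esub> dx (-1) (j + 1) = \<zero>\<^bsub>R\<^esub> \<and> z = w \<otimes>\<^bsub>R\<^esub> dy (-1) (j + 1)"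
proof -
  obtain w where w: "w \<in> carrier R" "z = w \<otimes>\<^bsub>R\<^esub> dy 0 (j + 1) \<otimes>\<^bsub>R\<^esub> dx 0 j" using column3_exact[OF assms] by blast
  have "z = (\<ominus>\<^bsub>R\<^esub> (w \<otimes>\<^bsub>R\<^esub> dx 0 (j + 1))) \<otimes>\<^bsub>R\<^esub> dy (-1) (j + 1)"
    using RC.anti'[OF w(1), of 0 "j + 1"] w by (simp add: A.l_minus)
  moreover have "(\<ominus>\<^bsub>R\<^esub> (w \<otimes>\<^bsub>R\<^esub> dx 0 (j + 1))) \<otimes>\<^bsub>R\<^esub> dx (-1) (j + 1) = \<zero>\<^bsub>R\<^esub>"
    using RC.dxdx[OF w(1), of 0 "j + 1"] w by (simp add: A.l_minus)
  ultimately show ?thesis using w(1) by (intro bexI[of _ "\<ominus>\<^bsub>R\<^esub> (w \<otimes>\<^bsub>R\<^esub> dx 0 (j + 1))"]) auto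
qed

end

text \<open>Total degree \<open>n\<close> consists of the positions \<open>(i, jx n i)\<close> with \<open>i \<in> Ix n\<close>: the antidiagonal \<open>i + j = n\<close> of
  the first quadrant or \<open>i + j + 1 = n\<close> of the third.\<close>

definition Ix :: "int \<Rightarrow> int set" where "Ix n = (if 0 \<le> n then {0..n} else {n..-1})"
definition jx :: "int \<Rightarrow> int \<Rightarrow> int" where "jx n i = (if 0 \<le> n then n - i else n - 1 - i)"

lemma finite_Ix [simp]: "finite (Ix n)" by (simp add: Ix_def)

section \<open>The total complex of the two quadrants\<close>

context bicomplex
begin

definition tot :: "int \<Rightarrow> (int \<Rightarrow> 'r) set" where
  "tot n = {z. (\<forall>i\<in>Ix n. z i \<in> V i (jx n i)) \<and> (\<forall>i. i \<notin> Ix n \<longrightarrow> z i = \<zero>)}"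

text \<open>Elements of \<open>tot\<close> vanish off the antidiagonal, so its ends need no formula
  of their own. In degree 0 the map goes from \<open>(0, 0)\<close> to \<open>(-1, -1)\<close>
  through \<open>(-1, 0)\<close>, a position that belongs to neither quadrant.\<close>

definition dT :: "int \<Rightarrow> (int \<Rightarrow> 'r) \<Rightarrow> int \<Rightarrow> 'r" where
  "dT n z = (\<lambda>i. if i \<in> Ix (n - 1) then
     (if n = 0 then z 0 \<otimes> dx 0 0 \<otimes> dy (-1) 0
      else z (i + 1) \<otimes> dx (i + 1) (jx (n - 1) i) \<oplus> z i \<otimes> dy i (jx n i)) else \<zero>)"

lemma totD: "z \<in> tot n \<Longrightarrow> i \<in> Ix n \<Longrightarrow> z i \<in> V i (jx n i)"
  by (simp add: tot_def)

lemma totI: "(\<And>i. i \<in> Ix n \<Longrightarrow> z i \<in> V i (jx n i)) \<Longrightarrow> (\<lambda>i. if i \<in> Ix n then z i else \<zero>) \<in> tot n"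
  by (auto simp: tot_def)

lemma tot_exact_pos:
  assumes n: "1 \<le> n"
    and rows: "\<And>i j z. \<lbrakk>1 \<le> i; 0 \<le> j; z \<in> V i j; z \<otimes> dx i j = \<zero>\<rbrakk> \<Longrightarrow> \<exists>w\<in>V (i + 1) j. z = w \<otimes> dx (i + 1) j"
    and column: "\<And>j z u. \<lbrakk>1 \<le> j; z \<in> V 0 j; u \<in> V 1 (j - 1); z \<otimes> dy 0 j = u \<otimes> dx 1 (j - 1)\<rbrakk> \<Longrightarrow>
        \<exists>w\<in>V 0 (j + 1). \<exists>w'\<in>V 1 j. z = w' \<otimes> dx 1 j \<oplus> w \<otimes> dy 0 (j + 1)"
    and z: "z \<in> tot n" and cyc: "dT n z = (\<lambda>_. \<zero>)"
  shows "\<exists>w\<in>tot (n + 1). z = dT (n + 1) w"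
proof -
  have "\<exists>w. (\<forall>i. 0 \<le> i \<and> i \<le> n + 1 \<longrightarrow> w i \<in> V i (n + 1 - i)) \<and>
     (\<forall>i. 0 \<le> i \<and> i \<le> n \<longrightarrow> z i = w (i + 1) \<otimes> dx (i + 1) (n - i) \<oplus> w i \<otimes> dy i (n + 1 - i))"
  proof (rule first_quadrant_exact[OF n rows column])
    show "z i \<in> V i (n - i)" if "0 \<le> i" "i \<le> n" for i
      using z that n by (auto simp: tot_def Ix_def jx_def)
    show "z (i + 1) \<otimes> dx (i + 1) (n - 1 - i) \<oplus> z i \<otimes> dy i (n - i) = \<zero>" if "0 \<le> i" "i < n" for i
      using fun_cong[OF cyc, of i] that n by (simp add: dT_def Ix_def jx_def)
  qed auto
  then obtain w where w: "\<And>i. 0 \<le> i \<Longrightarrow> i \<le> n + 1 \<Longrightarrow> w i \<in> V i (n + 1 - i)"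
    "\<And>i. 0 \<le> i \<Longrightarrow> i \<le> n \<Longrightarrow> z i = w (i + 1) \<otimes> dx (i + 1) (n - i) \<oplus> w i \<otimes> dy i (n + 1 - i)" by blast
  define f where "f = (\<lambda>i. if i \<in> Ix (n + 1) then w i else \<zero>)"
  have "f \<in> tot (n + 1)" unfolding f_def by (rule totI) (use w(1) n in \<open>auto simp: Ix_def jx_def\<close>)
  moreover have "z = dT (n + 1) f"
  proof
    fix i
    show "z i = dT (n + 1) f i"
    proof (cases "0 \<le> i \<and> i \<le> n")
      case True
      then show ?thesis using w(2)[of i] n by (simp add: dT_def f_def Ix_def jx_def)
    next
      case False
      then show ?thesis using z n by (auto simp: dT_def tot_def Ix_def)
    qed
  qed
  ultimately show ?thesis by blast
qed

lemma tot_exact_neg: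
  assumes n: "n \<le> -2"
    and rows: "\<And>i j z. \<lbrakk>i \<le> -2; j \<le> -1; z \<in> V i j; z \<otimes> dx i j = \<zero>\<rbrakk> \<Longrightarrow> \<exists>w\<in>V (i + 1) j. z = w \<otimes> dx (i + 1) j"
    and column: "\<And>j z. \<lbrakk>j \<le> -2; z \<in> V (-1) j; z \<otimes> dx (-1) j = \<zero>; z \<otimes> dy (-1) j = \<zero>\<rbrakk> \<Longrightarrow>
        \<exists>w\<in>V (-1) (j + 1). w \<otimes> dx (-1) (j + 1) = \<zero> \<and> z = w \<otimes> dy (-1) (j + 1)"
    and z: "z \<in> tot n" and cyc: "dT n z = (\<lambda>_. \<zero>)"
  shows "\<exists>w\<in>tot (n + 1). z = dT (n + 1) w"
proof -
  define m where "m = - n"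
  have m: "2 \<le> m" "n = - m" using n by (auto simp: m_def)
  have out: "z i = \<zero>" if "i < - m \<or> -1 < i" for i using z that m by (auto simp: tot_def Ix_def)
  have zV: "z i \<in> V i (- m - 1 - i)" if "- m \<le> i" "i \<le> -1" for i
    using z that m by (auto simp: tot_def Ix_def jx_def)
  have c: "z (i + 1) \<otimes> dx (i + 1) (- m - 2 - i) \<oplus> z i \<otimes> dy i (- m - 1 - i) = \<zero>" if "- m - 1 \<le> i" "i \<le> -1" for i
  proof -
    have "jx (n - 1) i = - m - 2 - i" "jx n i = - m - 1 - i" using m by (auto simp: jx_def)
    then show ?thesis using fun_cong[OF cyc, of i] that m by (simp add: dT_def Ix_def)
  qed
  have "\<exists>w. (\<forall>i. - m + 1 \<le> i \<and> i \<le> -1 \<longrightarrow> w i \<in> V i (- m - i)) \<and>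
     z (- m) = w (- m + 1) \<otimes> dx (- m + 1) (-1) \<and> z (-1) = w (-1) \<otimes> dy (-1) (- m + 1) \<and>
     (\<forall>i. - m + 1 \<le> i \<and> i \<le> -2 \<longrightarrow> z i = w (i + 1) \<otimes> dx (i + 1) (- m - 1 - i) \<oplus> w i \<otimes> dy i (- m - i))"
  proof (rule third_quadrant_exact[OF m(1) rows column zV])
    show "z (i + 1) \<otimes> dx (i + 1) (- m - 2 - i) \<oplus> z i \<otimes> dy i (- m - 1 - i) = \<zero>" if "- m \<le> i" "i \<le> -2" for i
      using c[of i] that by simp
    \<comment> \<open>At either end one of the two terms refers to an index off the antidiagonal and
      vanishes; this yields the two separate cycle conditions.\<close>
    show "z (- m) \<otimes> dx (- m) (-1) = \<zero>" using c[of "- m - 1"] m out[of "- m - 1"] Vc[OF zV[of "- m"]] by simp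
    show "z (-1) \<otimes> dy (-1) (- m) = \<zero>" using c[of "-1"] m out[of 0] Vc[OF zV[of "-1"]] by simp
  qed auto
  then obtain w where w: "\<And>i. - m + 1 \<le> i \<Longrightarrow> i \<le> -1 \<Longrightarrow> w i \<in> V i (- m - i)"
    "z (- m) = w (- m + 1) \<otimes> dx (- m + 1) (-1)" "z (-1) = w (-1) \<otimes> dy (-1) (- m + 1)"
    "\<And>i. - m + 1 \<le> i \<Longrightarrow> i \<le> -2 \<Longrightarrow> z i = w (i + 1) \<otimes> dx (i + 1) (- m - 1 - i) \<oplus> w i \<otimes> dy i (- m - i)" by blast
  define f where "f = (\<lambda>i. if i \<in> Ix (n + 1) then w i else \<zero>)"
  have jj: "jx (n + 1) i = - m - i" "jx n i = - m - 1 - i" for i using m by (auto simp: jx_def)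
  have Ixn: "Ix (n + 1) = {- m + 1..-1}" "Ix n = {- m..-1}" using m by (auto simp: Ix_def)
  have "f \<in> tot (n + 1)" unfolding f_def by (rule totI) (use w(1) in \<open>auto simp: Ixn jj\<close>)
  moreover have "z = dT (n + 1) f"
  proof
    fix i
    have fin: "f i = (if - m + 1 \<le> i \<and> i \<le> -1 then w i else \<zero>)" for i by (auto simp: f_def Ixn)
    have d: "dT (n + 1) f i = (if - m \<le> i \<and> i \<le> -1 then f (i + 1) \<otimes> dx (i + 1) (- m - 1 - i) \<oplus> f i \<otimes> dy i (- m - i) else \<zero>)"
      using n by (simp add: dT_def jj Ixn)
    consider "i < - m \<or> -1 < i" | "i = - m" | "i = -1" | "- m + 1 \<le> i" "i \<le> -2" by linarith
    then show "z i = dT (n + 1) f i"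
    proof cases
      case 1
      then have "dT (n + 1) f i = \<zero>" unfolding d by auto
      then show ?thesis using out[OF 1] by simp
    next
      case 2
      then show ?thesis using w(2) m Vc[OF w(1)[of "- m + 1"]] unfolding d fin by simp
    next
      case 3
      then show ?thesis using w(3) m Vc[OF w(1)[of "-1"]] unfolding d fin by simp
    next
      case 4
      then show ?thesis using w(4)[of i] m unfolding d fin by simp
    qed
  qed
  ultimately show ?thesis by blast
qed

lemma tot_exact_0:
  assumes glue: "\<And>z. \<lbrakk>z \<in> V 0 0; z \<otimes> dx 0 0 \<otimes> dy (-1) 0 = \<zero>\<rbrakk> \<Longrightarrow> \<exists>w\<in>V 0 1. \<exists>w'\<in>V 1 0. z = w' \<otimes> dx 1 0 \<oplus> w \<otimes> dy 0 1"
    and z: "z \<in> tot 0" and cyc: "dT 0 z = (\<lambda>_. \<zero>)"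
  shows "\<exists>w\<in>tot 1. z = dT 1 w"
proof -
  have "z 0 \<in> V 0 0" "z 0 \<otimes> dx 0 0 \<otimes> dy (-1) 0 = \<zero>"
    using z fun_cong[OF cyc, of "-1"] by (auto simp: tot_def Ix_def jx_def dT_def)
  from glue[OF this] obtain w w' where w: "w \<in> V 0 1" "w' \<in> V 1 0" "z 0 = w' \<otimes> dx 1 0 \<oplus> w \<otimes> dy 0 1" by blast
  define f where "f = (\<lambda>i::int. if i \<in> Ix 1 then (if i = 0 then w else w') else \<zero>)"
  have "f \<in> tot 1" unfolding f_def
  proof (rule totI)
    fix i assume "i \<in> Ix 1"
    then have "i = 0 \<or> i = 1" by (auto simp: Ix_def)
    then show "(if i = 0 then w else w') \<in> V i (jx 1 i)" using w by (auto simp: jx_def)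
  qed
  moreover have "z = dT 1 f"
    using w z by (auto simp: fun_eq_iff dT_def f_def Ix_def jx_def tot_def)
  ultimately show ?thesis by blast
qed

lemma tot_exact_minus1:
  assumes glue: "\<And>z. \<lbrakk>z \<in> V (-1) (-1); z \<otimes> dx (-1) (-1) = \<zero>; z \<otimes> dy (-1) (-1) = \<zero>\<rbrakk> \<Longrightarrow> \<exists>w\<in>V 0 0. z = w \<otimes> dx 0 0 \<otimes> dy (-1) 0"
    and z: "z \<in> tot (-1)" and cyc: "dT (-1) z = (\<lambda>_. \<zero>)"
  shows "\<exists>w\<in>tot 0. z = dT 0 w"
proof -
  have z1: "z (-1) \<in> V (-1) (-1)" and z0: "\<And>i. i \<noteq> -1 \<Longrightarrow> z i = \<zero>" using z by (auto simp: tot_def Ix_def jx_def)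
  have "z (-1) \<otimes> dx (-1) (-1) = \<zero>" "z (-1) \<otimes> dy (-1) (-1) = \<zero>"
    using fun_cong[OF cyc, of "-1"] fun_cong[OF cyc, of "-2"] z0[of 0] z0[of "-2"] Vc[OF z1]
    by (simp_all add: dT_def Ix_def jx_def)
  from glue[OF z1 this] obtain w where w: "w \<in> V 0 0" "z (-1) = w \<otimes> dx 0 0 \<otimes> dy (-1) 0" by blast
  define f where "f = (\<lambda>i::int. if i \<in> Ix 0 then w else \<zero>)"
  have "f \<in> tot 0" unfolding f_def by (rule totI) (use w in \<open>auto simp: Ix_def jx_def\<close>)
  moreover have "z = dT 0 f"
    using w z0 by (auto simp: fun_eq_iff dT_def f_def Ix_def)
  ultimately show ?thesis by blast
qed

lemma dT_tot: assumes z: "z \<in> tot n" shows "dT n z \<in> tot (n - 1)"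
proof -
  have "dT n z i \<in> V i (jx (n - 1) i)" if i: "i \<in> Ix (n - 1)" for i
  proof -
    consider "n = 0" | "1 \<le> n" | "n \<le> -1" by linarith
    then show ?thesis
    proof cases
      case 1
      then have "i = -1" using i by (simp add: Ix_def)
      then show ?thesis using 1 i z V_dy[OF V_dx[of "z 0" 0 0]] by (simp add: dT_def tot_def Ix_def jx_def)
    next
      case 2
      have ii: "0 \<le> i" "i \<le> n - 1" using i 2 by (auto simp: Ix_def)
      have zz: "z k \<in> V k (n - k)" if "0 \<le> k" "k \<le> n" for k using z 2 that by (auto simp: tot_def Ix_def jx_def)
      have e: "n - (i + 1) = n - 1 - i" "i + 1 - 1 = i" "n - i - 1 = n - 1 - i" by auto
      have "z (i + 1) \<in> V (i + 1) (n - 1 - i)" "z i \<in> V i (n - i)" using zz[of "i + 1", unfolded e] zz[of i] ii by auto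
      from V_add[OF V_dx[OF this(1), unfolded e] V_dy[OF this(2), unfolded e]] show ?thesis using 2 i
        by (simp add: dT_def jx_def)
    next
      case 3
      have jj: "jx (n - 1) i = n - 2 - i" "jx n i = n - 1 - i" using 3 by (auto simp: jx_def)
      have zz: "z i \<in> V i (n - 1 - i)" if "n \<le> i" "i \<le> -1" for i using z 3 that by (auto simp: tot_def Ix_def jx_def)
      have z0: "z i = \<zero>" if "i < n \<or> -1 < i" for i using z 3 that by (auto simp: tot_def Ix_def)
      have e: "n - 1 - i - 1 = n - 2 - i" by simp
      have A: "z i \<otimes> dy i (n - 1 - i) \<in> V i (n - 2 - i)" if "n \<le> i" "i \<le> -1"
        using V_dy[OF zz[OF that], unfolded e] .
      have e': "n - 1 - (i + 1) = n - 2 - i" by simp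
      have B: "z (i + 1) \<otimes> dx (i + 1) (n - 2 - i) \<in> V i (n - 2 - i)" if "n \<le> i + 1" "i + 1 \<le> -1"
        using V_dx[OF zz[OF that, unfolded e']] by simp
      have d: "dT n z i = z (i + 1) \<otimes> dx (i + 1) (n - 2 - i) \<oplus> z i \<otimes> dy i (n - 1 - i)"
        using 3 i by (simp add: dT_def jj)
      have ii: "n - 1 \<le> i" "i \<le> -1" using i 3 by (auto simp: Ix_def)
      show ?thesis
      proof (cases "i = -1")
        case True
        then show ?thesis unfolding jj d using A z0[of "i + 1"] 3 Vc[OF A] ii by simp
      next
        case F: False
        show ?thesis
        proof (cases "i = n - 1")
          case True
          then show ?thesis unfolding jj d using B z0[of i] F Vc[OF B] ii by simp
        next
          case False
          then show ?thesis unfolding jj d using A B V_add F ii by simp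
        qed
      qed
    qed
  qed
  then show ?thesis by (auto simp: tot_def) (simp add: dT_def)
qed

text \<open>Away from the junction the mixed terms cancel in pairs. Next to it, the joining map is
  annihilated on both sides, since anticommutativity brings the required factor next to its
  complement.\<close>

lemma dT_dT: assumes z: "z \<in> tot (n + 1)" shows "dT n (dT (n + 1) z) = (\<lambda>_. \<zero>)"
proof
  fix i
  have sum0: "(p \<oplus> r) \<oplus> (s \<oplus> t) = \<zero>" if "p \<in> carrier R" "r \<in> carrier R" "s \<in> carrier R" "t \<in> carrier R" "p = \<zero>" "t = \<zero>" "s \<oplus> r = \<zero>" for p r s t
    using that by (simp add: a_comm)
  show "dT n (dT (n + 1) z) i = \<zero>"
  proof (cases "i \<in> Ix (n - 1)")
    case i: True
    consider "n = 0" | "n = -1" | "1 \<le> n" | "n \<le> -2" by linarith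
    then show ?thesis
    proof cases
      case 1
      have z0: "z 0 \<in> V 0 1" and z1: "z 1 \<in> V 1 0"
        using totD[OF z, of 0] totD[OF z, of 1] 1 by (simp_all add: Ix_def jx_def)
      have "z 1 \<otimes> dx 1 0 \<otimes> dx 0 0 = \<zero>" using dxdx[OF z1] by simp
      moreover have "z 0 \<otimes> dy 0 1 \<otimes> dx 0 0 \<otimes> dy (-1) 0 = \<zero>"
      proof -
        have "z 0 \<otimes> dy 0 1 \<otimes> dx 0 0 = \<ominus> (z 0 \<otimes> dx 0 1 \<otimes> dy (-1) 1)"
          using anti[OF z0] minus_equality[of "z 0 \<otimes> dy 0 1 \<otimes> dx 0 0" "z 0 \<otimes> dx 0 1 \<otimes> dy (-1) 1"] Vc[OF z0] by (simp add: a_comm)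
        then show ?thesis using dydy[OF V_dx[OF z0]] Vc[OF z0] by (simp add: l_minus)
      qed
      ultimately show ?thesis using 1 Vc[OF z0] Vc[OF z1] by (simp add: dT_def Ix_def jx_def l_distr)
    next
      case 2
      have z0: "z 0 \<in> V 0 0" using z 2 by (auto simp: tot_def Ix_def jx_def)
      have "z 0 \<otimes> dx 0 0 \<otimes> dy (-1) 0 \<otimes> dy (-1) (-1) = \<zero>" using dydy[OF V_dx[OF z0]] by simp
      moreover have "z 0 \<otimes> dx 0 0 \<otimes> dy (-1) 0 \<otimes> dx (-1) (-1) = \<zero>"
        using anti'[OF V_dx[OF z0]] dxdx[OF z0] Vc[OF z0] anti[OF V_dx[OF z0]] by simp
      moreover have "i = -1 \<or> i = -2" using i 2 by (auto simp: Ix_def)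
      ultimately show ?thesis using 2 Vc[OF z0] by (auto simp: dT_def Ix_def jx_def)
    next
      case 3
      have ii: "0 \<le> i" "i \<le> n - 1" using i 3 by (auto simp: Ix_def)
      have zz: "z k \<in> V k (n + 1 - k)" if "0 \<le> k" "k \<le> n + 1" for k using z 3 that by (auto simp: tot_def Ix_def jx_def)
      have ez: "n + 1 - (i + 2) = n - 1 - i" "n + 1 - (i + 1) = n - i" by auto
      have za: "z (i + 2) \<in> V (i + 2) (n - 1 - i)" and zb: "z (i + 1) \<in> V (i + 1) (n - i)" and zc: "z i \<in> V i (n + 1 - i)"
        using zz[of "i + 2", unfolded ez] zz[of "i + 1", unfolded ez] zz[of i] ii by auto
      have e: "n - (i + 1) = n - 1 - i" "i + 1 + 1 = i + 2" "n + 1 - (i + 1) = n - i" by auto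
      have d1: "dT (n + 1) z (i + 1) = z (i + 2) \<otimes> dx (i + 2) (n - 1 - i) \<oplus> z (i + 1) \<otimes> dy (i + 1) (n - i)"
        using 3 ii by (simp add: dT_def Ix_def jx_def e)
      have d2: "dT (n + 1) z i = z (i + 1) \<otimes> dx (i + 1) (n - i) \<oplus> z i \<otimes> dy i (n + 1 - i)"
        using 3 ii by (simp add: dT_def Ix_def jx_def)
      have "dT n (dT (n + 1) z) i = dT (n + 1) z (i + 1) \<otimes> dx (i + 1) (n - 1 - i) \<oplus> dT (n + 1) z i \<otimes> dy i (n - i)"
        using 3 ii by (simp add: dT_def[of n] Ix_def jx_def)
      also have "\<dots> = (z (i + 2) \<otimes> dx (i + 2) (n - 1 - i) \<otimes> dx (i + 1) (n - 1 - i) \<oplus> z (i + 1) \<otimes> dy (i + 1) (n - i) \<otimes> dx (i + 1) (n - 1 - i))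
         \<oplus> (z (i + 1) \<otimes> dx (i + 1) (n - i) \<otimes> dy i (n - i) \<oplus> z i \<otimes> dy i (n + 1 - i) \<otimes> dy i (n - i))"
        unfolding d1 d2 using Vc[OF za] Vc[OF zb] Vc[OF zc] by (simp add: l_distr)
      also have "\<dots> = \<zero>"
      proof (rule sum0)
        have e': "i + 2 - 1 = i + 1" "n + 1 - i - 1 = n - i" "i + 1 - 1 = i" "n - i - 1 = n - 1 - i" by auto
        show "z (i + 2) \<otimes> dx (i + 2) (n - 1 - i) \<otimes> dx (i + 1) (n - 1 - i) = \<zero>" using dxdx[OF za, unfolded e'] .
        show "z i \<otimes> dy i (n + 1 - i) \<otimes> dy i (n - i) = \<zero>" using dydy[OF zc, unfolded e'] .
        show "z (i + 1) \<otimes> dx (i + 1) (n - i) \<otimes> dy i (n - i) \<oplus> z (i + 1) \<otimes> dy (i + 1) (n - i) \<otimes> dx (i + 1) (n - 1 - i) = \<zero>"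
          using anti[OF zb, unfolded e'] .
      qed (use Vc[OF za] Vc[OF zb] Vc[OF zc] in auto)
      finally show ?thesis .
    next
      case 4
      have ii: "n - 1 \<le> i" "i \<le> -1" using i 4 by (auto simp: Ix_def)
      have zz: "z k \<in> V k (n - k) \<or> z k = \<zero>" for k using z 4 by (cases "n + 1 \<le> k \<and> k \<le> -1") (auto simp: tot_def Ix_def jx_def)
      have zc: "z k \<in> carrier R" for k using zz[of k] by auto
      have out: "z k = \<zero>" if "k < n + 1 \<or> -1 < k" for k using z 4 that by (auto simp: tot_def Ix_def)
      have e: "n - (i + 2) = n - 2 - i" "n - (i + 1) = n - 1 - i" "n - i - 1 = n - 1 - i" "n - 1 - i - 1 = n - 2 - i"
        "i + 2 - 1 = i + 1" "i + 1 - 1 = i" by auto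
      have dz: "dT (n + 1) z k = (if n \<le> k \<and> k \<le> -1 then z (k + 1) \<otimes> dx (k + 1) (n - 1 - k) \<oplus> z k \<otimes> dy k (n - k) else \<zero>)" for k
        using 4 by (simp add: dT_def Ix_def jx_def)
      have dz': "dT (n + 1) z k = z (k + 1) \<otimes> dx (k + 1) (n - 1 - k) \<oplus> z k \<otimes> dy k (n - k)" if "k \<le> -1" for k
        unfolding dz using that out[of k] out[of "k + 1"] by auto
      have a0: "z (i + 2) \<otimes> dx (i + 2) (n - 2 - i) \<otimes> dx (i + 1) (n - 2 - i) = \<zero>"
        using zz[of "i + 2", unfolded e] dxdx[of "z (i + 2)" "i + 2" "n - 2 - i", unfolded e] by auto
      have c0: "z i \<otimes> dy i (n - i) \<otimes> dy i (n - 1 - i) = \<zero>"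
        using zz[of i] dydy[of "z i" i "n - i", unfolded e] by auto
      have b0: "z (i + 1) \<otimes> dx (i + 1) (n - 1 - i) \<otimes> dy i (n - 1 - i) \<oplus> z (i + 1) \<otimes> dy (i + 1) (n - 1 - i) \<otimes> dx (i + 1) (n - 2 - i) = \<zero>"
        using zz[of "i + 1", unfolded e] anti[of "z (i + 1)" "i + 1" "n - 1 - i", unfolded e] by auto
      have "dT n (dT (n + 1) z) i = dT (n + 1) z (i + 1) \<otimes> dx (i + 1) (n - 2 - i) \<oplus> dT (n + 1) z i \<otimes> dy i (n - 1 - i)"
        using 4 i by (simp add: dT_def[of n] jx_def)
      also have "\<dots> = \<zero>"
      proof (cases "i = -1")
        case True
        have "dT (n + 1) z (i + 1) = \<zero>" unfolding dz using True by simp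
        moreover have "z (i + 1) = \<zero>" using out True by simp
        ultimately show ?thesis using dz'[of i] True zc[of i] c0 by simp
      next
        case False
        have e2: "i + 1 + 1 = i + 2" "n - 1 - (i + 1) = n - 2 - i" by auto
        have d1: "dT (n + 1) z (i + 1) = z (i + 2) \<otimes> dx (i + 2) (n - 2 - i) \<oplus> z (i + 1) \<otimes> dy (i + 1) (n - 1 - i)"
          using dz'[of "i + 1", unfolded e2 e] False ii by simp
        have "(z (i + 2) \<otimes> dx (i + 2) (n - 2 - i) \<otimes> dx (i + 1) (n - 2 - i) \<oplus> z (i + 1) \<otimes> dy (i + 1) (n - 1 - i) \<otimes> dx (i + 1) (n - 2 - i))
         \<oplus> (z (i + 1) \<otimes> dx (i + 1) (n - 1 - i) \<otimes> dy i (n - 1 - i) \<oplus> z i \<otimes> dy i (n - i) \<otimes> dy i (n - 1 - i)) = \<zero>"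
          by (rule sum0) (use a0 b0 c0 zc in auto)
        then show ?thesis unfolding d1 dz'[OF ii(2)] using zc by (simp add: l_distr)
      qed
      finally show ?thesis .
    qed
  qed (simp add: dT_def)
qed

end

section \<open>Left modules and dimension shifting\<close>

lemma module_homI:
  assumes "\<And>x. x \<in> carrier M \<Longrightarrow> f x \<in> carrier N"
    and "\<And>x y. x \<in> carrier M \<Longrightarrow> y \<in> carrier M \<Longrightarrow> f (x \<oplus>\<^bsub>M\<^esub> y) = f x \<oplus>\<^bsub>N\<^esub> f y"
    and "\<And>r x. r \<in> carrier R \<Longrightarrow> x \<in> carrier M \<Longrightarrow> f (r \<odot>\<^bsub>M\<^esub> x) = r \<odot>\<^bsub>N\<^esub> f x"
  shows "f \<in> module_hom R M N"
  using assms by (auto simp: module_hom_def)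

lemma module_homD:
  assumes "f \<in> module_hom R M N"
  shows "x \<in> carrier M \<Longrightarrow> f x \<in> carrier N"
    "x \<in> carrier M \<Longrightarrow> y \<in> carrier M \<Longrightarrow> f (x \<oplus>\<^bsub>M\<^esub> y) = f x \<oplus>\<^bsub>N\<^esub> f y"
    "r \<in> carrier R \<Longrightarrow> x \<in> carrier M \<Longrightarrow> f (r \<odot>\<^bsub>M\<^esub> x) = r \<odot>\<^bsub>N\<^esub> f x"
  using assms by (auto simp: module_hom_def)

lemma left_moduleI:
  assumes "ring R" "abelian_group M"
    and "\<And>r x. r \<in> carrier R \<Longrightarrow> x \<in> carrier M \<Longrightarrow> r \<odot>\<^bsub>M\<^esub> x \<in> carrier M"
    and "\<And>r s x. r \<in> carrier R \<Longrightarrow> s \<in> carrier R \<Longrightarrow> x \<in> carrier M \<Longrightarrow> (r \<oplus>\<^bsub>R\<^esub> s) \<odot>\<^bsub>M\<^esub> x = r \<odot>\<^bsub>M\<^esub> x \<oplus>\<^bsub>M\<^esub> s \<odot>\<^bsub>M\<^esub> x"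
    and "\<And>r x y. r \<in> carrier R \<Longrightarrow> x \<in> carrier M \<Longrightarrow> y \<in> carrier M \<Longrightarrow> r \<odot>\<^bsub>M\<^esub> (x \<oplus>\<^bsub>M\<^esub> y) = r \<odot>\<^bsub>M\<^esub> x \<oplus>\<^bsub>M\<^esub> r \<odot>\<^bsub>M\<^esub> y"
    and "\<And>r s x. r \<in> carrier R \<Longrightarrow> s \<in> carrier R \<Longrightarrow> x \<in> carrier M \<Longrightarrow> (r \<otimes>\<^bsub>R\<^esub> s) \<odot>\<^bsub>M\<^esub> x = r \<odot>\<^bsub>M\<^esub> (s \<odot>\<^bsub>M\<^esub> x)"
    and "\<And>x. x \<in> carrier M \<Longrightarrow> \<one>\<^bsub>R\<^esub> \<odot>\<^bsub>M\<^esub> x = x"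
  shows "left_module R M"
  using assms by (intro left_module.intro left_module_axioms.intro) auto

context left_module
begin

lemma smult_l_zero: assumes "x \<in> carrier M" shows "\<zero> \<odot>\<^bsub>M\<^esub> x = \<zero>\<^bsub>M\<^esub>"
proof -
  have "\<zero> \<odot>\<^bsub>M\<^esub> x \<oplus>\<^bsub>M\<^esub> \<zero> \<odot>\<^bsub>M\<^esub> x = \<zero> \<odot>\<^bsub>M\<^esub> x" using assms smult_l_distr[of \<zero> \<zero> x] by simp
  then show ?thesis using assms M.add.l_cancel_one smult_closed by simp
qed

lemma smult_r_zero: assumes "r \<in> carrier R" shows "r \<odot>\<^bsub>M\<^esub> \<zero>\<^bsub>M\<^esub> = \<zero>\<^bsub>M\<^esub>"
proof -
  have "r \<odot>\<^bsub>M\<^esub> \<zero>\<^bsub>M\<^esub> \<oplus>\<^bsub>M\<^esub> r \<odot>\<^bsub>M\<^esub> \<zero>\<^bsub>M\<^esub> = r \<odot>\<^bsub>M\<^esub> \<zero>\<^bsub>M\<^esub>" using assms smult_r_distr[of r "\<zero>\<^bsub>M\<^esub>" "\<zero>\<^bsub>M\<^esub>"] by simp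
  then show ?thesis using assms M.add.l_cancel_one smult_closed by simp
qed

lemma smult_r_minus: assumes "r \<in> carrier R" "x \<in> carrier M" shows "r \<odot>\<^bsub>M\<^esub> (\<ominus>\<^bsub>M\<^esub> x) = \<ominus>\<^bsub>M\<^esub> (r \<odot>\<^bsub>M\<^esub> x)"
proof -
  have "r \<odot>\<^bsub>M\<^esub> (\<ominus>\<^bsub>M\<^esub> x) \<oplus>\<^bsub>M\<^esub> r \<odot>\<^bsub>M\<^esub> x = \<zero>\<^bsub>M\<^esub>"
    using assms smult_r_zero[OF assms(1)] M.l_neg[OF assms(2)] smult_r_distr[of r "\<ominus>\<^bsub>M\<^esub> x" x] by simp
  then show ?thesis using assms smult_closed M.minus_equality by simp
qed

lemma smult_l_minus: assumes "r \<in> carrier R" "x \<in> carrier M" shows "(\<ominus> r) \<odot>\<^bsub>M\<^esub> x = \<ominus>\<^bsub>M\<^esub> (r \<odot>\<^bsub>M\<^esub> x)"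
proof -
  have "(\<ominus> r) \<odot>\<^bsub>M\<^esub> x \<oplus>\<^bsub>M\<^esub> r \<odot>\<^bsub>M\<^esub> x = \<zero>\<^bsub>M\<^esub>"
    using assms smult_l_zero[OF assms(2)] R.l_neg[OF assms(1)] smult_l_distr[of "\<ominus> r" r x] by simp
  then show ?thesis using assms smult_closed M.minus_equality by simp
qed

end

lemma module_hom_map_zero:
  assumes "left_module R M" "left_module R N" "f \<in> module_hom R M N" shows "f \<zero>\<^bsub>M\<^esub> = \<zero>\<^bsub>N\<^esub>"
proof -
  interpret M: left_module R M by fact
  interpret N: left_module R N by fact
  have "f (\<zero>\<^bsub>R\<^esub> \<odot>\<^bsub>M\<^esub> \<zero>\<^bsub>M\<^esub>) = \<zero>\<^bsub>N\<^esub>"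
    using module_homD[OF assms(3)] by (simp add: N.smult_l_zero)
  then show ?thesis by (simp add: M.smult_l_zero)
qed

lemma module_hom_uminus:
  assumes "left_module R M" "left_module R N" "f \<in> module_hom R M N" "x \<in> carrier M" shows "f (\<ominus>\<^bsub>M\<^esub> x) = \<ominus>\<^bsub>N\<^esub> f x"
proof -
  interpret M: left_module R M by fact
  interpret N: left_module R N by fact
  have "f (\<ominus>\<^bsub>M\<^esub> x) \<oplus>\<^bsub>N\<^esub> f x = \<zero>\<^bsub>N\<^esub>"
    using module_homD(2)[OF assms(3), of "\<ominus>\<^bsub>M\<^esub> x" x] assms module_hom_map_zero[OF assms(1-3)] by (simp add: M.M.l_neg)
  then show ?thesis using module_homD(1)[OF assms(3)] assms by (simp add: N.M.minus_equality)
qed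

lemma module_hom_minus:
  assumes "left_module R M" "left_module R N" "f \<in> module_hom R M N" "x \<in> carrier M" "y \<in> carrier M"
  shows "f (x \<ominus>\<^bsub>M\<^esub> y) = f x \<ominus>\<^bsub>N\<^esub> f y"
proof -
  interpret M: left_module R M by fact
  show ?thesis using module_homD(2)[OF assms(3)] module_hom_uminus[OF assms(1-3)] assms(4,5) by (simp add: a_minus_def)
qed

lemma module_hom_add_fun:
  assumes "left_module R N" "f \<in> module_hom R M N" "g \<in> module_hom R M N"
  shows "(\<lambda>x. f x \<oplus>\<^bsub>N\<^esub> g x) \<in> module_hom R M N"
proof -
  interpret N: left_module R N by fact
  show ?thesis
    by (rule module_homI) (simp_all add: module_homD[OF assms(2)] module_homD[OF assms(3)] N.smult_r_distr N.M.a_ac)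
qed

lemma module_hom_minus_fun:
  assumes "left_module R N" "f \<in> module_hom R M N" "g \<in> module_hom R M N"
  shows "(\<lambda>x. f x \<ominus>\<^bsub>N\<^esub> g x) \<in> module_hom R M N"
proof -
  interpret N: left_module R N by fact
  show ?thesis
    by (rule module_homI)
      (simp_all add: module_homD[OF assms(2)] module_homD[OF assms(3)] N.smult_r_distr N.smult_r_minus N.M.minus_eq N.M.minus_add N.M.a_ac)
qed

lemma module_hom_comp:
  "f \<in> module_hom R M N \<Longrightarrow> g \<in> module_hom R N P \<Longrightarrow> (\<lambda>x. g (f x)) \<in> module_hom R M P"
  by (rule module_homI) (auto simp: module_homD)

lemma module_hom_cong:
  assumes "left_module R M" "f \<in> module_hom R M N" "\<And>x. x \<in> carrier M \<Longrightarrow> g x = f x"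
  shows "g \<in> module_hom R M N"
proof -
  interpret M: left_module R M by fact
  show ?thesis by (rule module_homI) (auto simp: assms(3) module_homD[OF assms(2)] M.smult_closed)
qed

lemma regular_simps:
  "carrier (regular_module R) = carrier R" "zero (regular_module R) = zero R" "add (regular_module R) = add R" "smult (regular_module R) = mult R"
  by (simp_all add: regular_module_def)

lemma free_simps:
  "zero (free_module R I) = (\<lambda>i. \<zero>\<^bsub>R\<^esub>)" "add (free_module R I) f g = (\<lambda>i. f i \<oplus>\<^bsub>R\<^esub> g i)"
  "smult (free_module R I) r f = (\<lambda>i. r \<otimes>\<^bsub>R\<^esub> f i)"
  by (simp_all add: free_module_def)

lemma free_carrier: "f \<in> carrier (free_module R I) \<longleftrightarrow> (\<forall>i. f i \<in> carrier R) \<and> (\<forall>i. i \<notin> I \<longrightarrow> f i = \<zero>\<^bsub>R\<^esub>) \<and> finite (supp R f)"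
  by (auto simp: free_module_def supp_def)

lemma free_left_module:
  fixes R :: "('a, 'z) ring_scheme" and I :: "'b set"
  assumes "ring R" shows "left_module R (free_module R I)"
proof -
  interpret R: ring R by fact
  let ?F = "free_module R I"
  have sa: "supp R (\<lambda>i. f i \<oplus>\<^bsub>R\<^esub> g i) \<subseteq> supp R f \<union> supp R g" for f g :: "'b \<Rightarrow> 'a" by (auto simp: supp_def)
  have ss: "supp R (\<lambda>i. r \<otimes>\<^bsub>R\<^esub> f i) \<subseteq> supp R f" if "r \<in> carrier R" for r and f :: "'b \<Rightarrow> 'a" using that by (auto simp: supp_def)
  have ac: "(\<lambda>i. f i \<oplus>\<^bsub>R\<^esub> g i) \<in> carrier ?F" if "f \<in> carrier ?F" "g \<in> carrier ?F" for f g
    using that finite_subset[OF sa[of f g]] by (auto simp: free_carrier)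
  have sc: "(\<lambda>i. r \<otimes>\<^bsub>R\<^esub> f i) \<in> carrier ?F" if "r \<in> carrier R" "f \<in> carrier ?F" for f r
    using that finite_subset[OF ss[of r f]] by (auto simp: free_carrier)
  show ?thesis
  proof (rule left_moduleI[OF assms])
    show "abelian_group ?F"
    proof (rule abelian_groupI)
      show "\<exists>y\<in>carrier ?F. y \<oplus>\<^bsub>?F\<^esub> x = \<zero>\<^bsub>?F\<^esub>" if "x \<in> carrier ?F" for x
        using sc[of "\<ominus>\<^bsub>R\<^esub> \<one>\<^bsub>R\<^esub>" x] that
        by (intro bexI[of _ "\<lambda>i. (\<ominus>\<^bsub>R\<^esub> \<one>\<^bsub>R\<^esub>) \<otimes>\<^bsub>R\<^esub> x i"]) (auto simp: free_simps free_carrier R.l_minus R.l_neg)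
    qed (auto simp: free_simps ac free_carrier[of "\<lambda>_. \<zero>\<^bsub>R\<^esub>"] supp_def fun_eq_iff, auto simp: free_carrier R.a_ac)
  qed (auto simp: free_simps sc, auto simp: free_carrier R.l_distr R.r_distr R.m_assoc)
qed

lemma free_induct [consumes 2, case_names zero add]:
  assumes R: "ring R" and f: "f \<in> carrier (free_module R I)" and z: "P (\<lambda>_. \<zero>\<^bsub>R\<^esub>)"
    and s: "\<And>c i h. c \<in> carrier R \<Longrightarrow> i \<in> I \<Longrightarrow> h \<in> carrier (free_module R I) \<Longrightarrow> P h \<Longrightarrow>
       P (c \<odot>\<^bsub>free_module R I\<^esub> basis_elt R i \<oplus>\<^bsub>free_module R I\<^esub> h)"
  shows "P f"
  using f
proof (induction "card (supp R f)" arbitrary: f)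
  case 0
  then have "supp R f = {}" by (simp add: free_carrier)
  then have "f = (\<lambda>_. \<zero>\<^bsub>R\<^esub>)" by (auto simp: supp_def)
  then show ?case using z by simp
next
  case (Suc n)
  interpret R: ring R by fact
  obtain g where g: "g \<in> supp R f" using Suc.hyps(2) by (metis card.empty equals0I nat.distinct(1))
  have fin: "finite (supp R f)" and fc: "f i \<in> carrier R" for i using Suc.prems by (auto simp: free_carrier)
  define h where "h = f(g := \<zero>\<^bsub>R\<^esub>)"
  have sh: "supp R h = supp R f - {g}" by (auto simp: h_def supp_def)
  have hF: "h \<in> carrier (free_module R I)" using Suc.prems sh fin by (auto simp: free_carrier h_def)
  have "f = f g \<odot>\<^bsub>free_module R I\<^esub> basis_elt R g \<oplus>\<^bsub>free_module R I\<^esub> h"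
    using fc by (auto simp: free_simps h_def basis_elt_def fun_eq_iff)
  moreover have "P h" by (rule Suc.hyps(1)[OF _ hF]) (use Suc.hyps(2) sh g fin in auto)
  moreover have "g \<in> I" using g Suc.prems by (auto simp: free_carrier supp_def)
  ultimately show ?case using s[of "f g" g h] fc hF by simp
qed

lemma free_universal:
  fixes R :: "('a, 'z) ring_scheme" and I :: "'c set"
  assumes R: "ring R" and N: "left_module R N" and c: "\<And>i. i \<in> I \<Longrightarrow> c i \<in> carrier N"
  shows "\<exists>G\<in>module_hom R (free_module R I) N. \<forall>i\<in>I. G (basis_elt R i) = c i"
proof -
  interpret N: left_module R N by fact
  let ?F = "free_module R I"
  define G where "G f = (\<Oplus>\<^bsub>N\<^esub>i\<in>supp R f. f i \<odot>\<^bsub>N\<^esub> c i)" for f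
  have si: "supp R f \<subseteq> I" "finite (supp R f)" "\<And>i. f i \<in> carrier R" if "f \<in> carrier ?F" for f
    using that by (auto simp: free_carrier supp_def)
  have tc: "f i \<odot>\<^bsub>N\<^esub> c i \<in> carrier N" if "f \<in> carrier ?F" "i \<in> I" for f i
    using si(3)[OF that(1)] c[OF that(2)] by (rule N.smult_closed)
  have sup: "G f = (\<Oplus>\<^bsub>N\<^esub>i\<in>B. f i \<odot>\<^bsub>N\<^esub> c i)" if f: "f \<in> carrier ?F" and B: "supp R f \<subseteq> B" "finite B" "B \<subseteq> I" for f B
    unfolding G_def
    by (rule N.M.add.finprod_mono_neutral_cong_left)
      (use B tc[OF f] c in \<open>auto simp: supp_def N.smult_l_zero\<close>)
  interpret F: left_module R ?F by (rule free_left_module[OF R])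
  have "G \<in> module_hom R ?F N"
  proof (rule module_homI)
    show "G f \<in> carrier N" if "f \<in> carrier ?F" for f
      unfolding G_def by (rule N.M.finsum_closed) (use tc[OF that] si[OF that] in blast)
    show "G (f \<oplus>\<^bsub>?F\<^esub> g) = G f \<oplus>\<^bsub>N\<^esub> G g" if f: "f \<in> carrier ?F" and g: "g \<in> carrier ?F" for f g
    proof -
      let ?B = "supp R f \<union> supp R g"
      have B: "finite ?B" "?B \<subseteq> I" using si[OF f] si[OF g] by auto
      have "G (f \<oplus>\<^bsub>?F\<^esub> g) = (\<Oplus>\<^bsub>N\<^esub>i\<in>?B. (f \<oplus>\<^bsub>?F\<^esub> g) i \<odot>\<^bsub>N\<^esub> c i)"
        by (rule sup[OF F.M.add.m_closed[OF f g] _ B]) (auto simp: free_simps supp_def)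
      also have "\<dots> = (\<Oplus>\<^bsub>N\<^esub>i\<in>?B. f i \<odot>\<^bsub>N\<^esub> c i \<oplus>\<^bsub>N\<^esub> g i \<odot>\<^bsub>N\<^esub> c i)"
        by (rule N.M.finsum_cong')
          (use B tc[OF f] tc[OF g] si(3)[OF f] si(3)[OF g] c in \<open>auto simp: free_simps N.smult_l_distr subset_iff\<close>)
      also have "\<dots> = (\<Oplus>\<^bsub>N\<^esub>i\<in>?B. f i \<odot>\<^bsub>N\<^esub> c i) \<oplus>\<^bsub>N\<^esub> (\<Oplus>\<^bsub>N\<^esub>i\<in>?B. g i \<odot>\<^bsub>N\<^esub> c i)"
        by (rule N.M.finsum_addf) (use B tc[OF f] tc[OF g] in blast)+
      also have "\<dots> = G f \<oplus>\<^bsub>N\<^esub> G g" using sup[OF f, of ?B] sup[OF g, of ?B] B by simp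
      finally show ?thesis .
    qed
    show "G (r \<odot>\<^bsub>?F\<^esub> f) = r \<odot>\<^bsub>N\<^esub> G f" if r: "r \<in> carrier R" and f: "f \<in> carrier ?F" for r f
    proof -
      have fs: "r \<odot>\<^bsub>N\<^esub> (\<Oplus>\<^bsub>N\<^esub>i\<in>B. u i) = (\<Oplus>\<^bsub>N\<^esub>i\<in>B. r \<odot>\<^bsub>N\<^esub> u i)" if "u \<in> B \<rightarrow> carrier N" for u and B :: "'c set"
        using that
      proof (induction B rule: infinite_finite_induct)
        case (insert p B)
        then have "u p \<in> carrier N" "u \<in> B \<rightarrow> carrier N" "(\<lambda>p. r \<odot>\<^bsub>N\<^esub> u p) \<in> B \<rightarrow> carrier N" using r N.smult_closed by auto
        then show ?case using insert r N.smult_closed by (simp add: N.M.finsum_insert N.smult_r_distr)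
      qed (use r N.smult_r_zero in auto)
      have "G (r \<odot>\<^bsub>?F\<^esub> f) = (\<Oplus>\<^bsub>N\<^esub>i\<in>supp R f. (r \<odot>\<^bsub>?F\<^esub> f) i \<odot>\<^bsub>N\<^esub> c i)"
        by (rule sup[OF F.smult_closed[OF r f] _ si(2,1)[OF f]]) (use r in \<open>auto simp: free_simps supp_def\<close>)
      also have "\<dots> = (\<Oplus>\<^bsub>N\<^esub>i\<in>supp R f. r \<odot>\<^bsub>N\<^esub> (f i \<odot>\<^bsub>N\<^esub> c i))"
        by (rule N.M.finsum_cong')
          (use si[OF f] tc[OF f] r c N.smult_closed in \<open>auto simp: free_simps N.smult_assoc subset_iff\<close>)
      also have "\<dots> = r \<odot>\<^bsub>N\<^esub> G f" unfolding G_def by (rule fs[symmetric]) (use tc[OF f] si[OF f] in blast)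
      finally show ?thesis .
    qed
  qed
  moreover have "G (basis_elt R i) = c i" if "i \<in> I" for i
  proof (cases "\<one>\<^bsub>R\<^esub> = \<zero>\<^bsub>R\<^esub>")
    case True
    then have "supp R (basis_elt R i) = {}" by (auto simp: supp_def basis_elt_def)
    moreover have "c i = \<zero>\<^bsub>N\<^esub>" using N.smult_one[OF c[OF that]] N.smult_l_zero[OF c[OF that]] True by simp
    ultimately show ?thesis by (simp add: G_def)
  next
    case False
    then have "supp R (basis_elt R i) = {i}" by (auto simp: supp_def basis_elt_def)
    then show ?thesis using c[OF that] by (simp add: G_def basis_elt_def N.M.finsum_insert N.smult_one)
  qed
  ultimately show ?thesis by blast
qed

text \<open>The images of the free generators are lifted one by one, extended linearly, and pulled
  back along the splitting \<open>s\<close>.\<close>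

lemma projective_lift:
  fixes P :: "('r, 'm) module"
  assumes P: "projective_module R P" and F: "left_module R F" and N: "left_module R N"
    and p: "\<pi> \<in> module_hom R F N" and sur: "\<pi> ` carrier F = carrier N" and f: "f \<in> module_hom R P N"
  shows "\<exists>g\<in>module_hom R P F. \<forall>x\<in>carrier P. \<pi> (g x) = f x"
proof -
  interpret N: left_module R N by fact
  interpret F: left_module R F by fact
  obtain I :: "'m set" and s t where s: "s \<in> module_hom R P (free_module R I)" and t: "t \<in> module_hom R (free_module R I) P"
    and ts: "\<And>x. x \<in> carrier P \<Longrightarrow> t (s x) = x" using P by (auto simp: projective_module_def)
  interpret P: left_module R P using P by (simp add: projective_module_def)
  have R: "ring R" by (rule N.R.ring_axioms)
  let ?F = "free_module R I"
  interpret Fr: left_module R ?F by (rule free_left_module[OF R])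
  have be: "basis_elt R i \<in> carrier ?F" if "i \<in> I" for i
    using that finite_subset[of "supp R (basis_elt R i)" "{i}"] by (auto simp: free_carrier basis_elt_def supp_def)
  have "\<exists>c. \<forall>i\<in>I. c i \<in> carrier F \<and> \<pi> (c i) = f (t (basis_elt R i))"
  proof (rule bchoice, rule ballI)
    fix i assume "i \<in> I"
    then have "f (t (basis_elt R i)) \<in> \<pi> ` carrier F" unfolding sur using module_homD(1)[OF f] module_homD(1)[OF t] be by auto
    then show "\<exists>c. c \<in> carrier F \<and> \<pi> c = f (t (basis_elt R i))" by force
  qed
  then obtain c where c: "\<And>i. i \<in> I \<Longrightarrow> c i \<in> carrier F" "\<And>i. i \<in> I \<Longrightarrow> \<pi> (c i) = f (t (basis_elt R i))" by blast
  obtain G where G: "G \<in> module_hom R ?F F" "\<And>i. i \<in> I \<Longrightarrow> G (basis_elt R i) = c i"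
    using free_universal[OF R F, of I c] c(1) by blast
  have e: "\<pi> (G \<phi>) = f (t \<phi>)" if "\<phi> \<in> carrier ?F" for \<phi>
    using R that
  proof (induction \<phi> rule: free_induct)
    case zero
    have "\<pi> (G \<zero>\<^bsub>?F\<^esub>) = f (t \<zero>\<^bsub>?F\<^esub>)"
      using module_hom_map_zero[OF Fr.left_module_axioms F G(1)] module_hom_map_zero[OF F N p]
        module_hom_map_zero[OF Fr.left_module_axioms P.left_module_axioms t] module_hom_map_zero[OF P.left_module_axioms N f] by simp
    then show ?case by (simp add: free_simps)
  next
    case (add r i h)
    then show ?case
      using be Fr.smult_closed module_homD[OF G(1)] module_homD[OF p] module_homD[OF t] module_homD[OF f] P.smult_closed F.smult_closed
      by (simp add: G(2) c)
  qed
  show ?thesis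
    by (rule bexI[OF _ module_hom_comp[OF s G(1)]]) (use e ts module_homD(1)[OF s] in auto)
qed

lemma submodule_left_module:
  assumes N: "left_module R N" and Z: "Z \<subseteq> carrier N" "\<zero>\<^bsub>N\<^esub> \<in> Z"
    "\<And>x y. x \<in> Z \<Longrightarrow> y \<in> Z \<Longrightarrow> x \<oplus>\<^bsub>N\<^esub> y \<in> Z" "\<And>r x. r \<in> carrier R \<Longrightarrow> x \<in> Z \<Longrightarrow> r \<odot>\<^bsub>N\<^esub> x \<in> Z"
  shows "left_module R (N\<lparr>carrier := Z\<rparr>)"
proof -
  interpret N: left_module R N by fact
  have z: "x \<in> carrier N" if "x \<in> Z" for x using that Z by auto
  show ?thesis
  proof (rule left_moduleI[OF N.R.ring_axioms])
    show "abelian_group (N\<lparr>carrier := Z\<rparr>)"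
    proof (rule abelian_groupI)
      fix x assume x: "x \<in> carrier (N\<lparr>carrier := Z\<rparr>)"
      then have "(\<ominus>\<^bsub>R\<^esub> \<one>\<^bsub>R\<^esub>) \<odot>\<^bsub>N\<^esub> x \<in> Z" using Z by simp
      moreover have "(\<ominus>\<^bsub>R\<^esub> \<one>\<^bsub>R\<^esub>) \<odot>\<^bsub>N\<^esub> x \<oplus>\<^bsub>N\<^esub> x = \<zero>\<^bsub>N\<^esub>"
        using x z by (simp add: N.smult_l_minus N.smult_one N.M.l_neg)
      ultimately show "\<exists>y\<in>carrier (N\<lparr>carrier := Z\<rparr>). y \<oplus>\<^bsub>N\<lparr>carrier := Z\<rparr>\<^esub> x = \<zero>\<^bsub>N\<lparr>carrier := Z\<rparr>\<^esub>" by auto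
    qed (use Z z in \<open>auto simp: N.M.a_ac\<close>)
  qed (use Z z in \<open>auto simp: N.smult_l_distr N.smult_r_distr N.smult_assoc N.smult_one\<close>)
qed

lemma kernel_left_module:
  assumes F: "left_module R F" and N: "left_module R N" and p: "\<pi> \<in> module_hom R F N"
  shows "left_module R (F\<lparr>carrier := {x \<in> carrier F. \<pi> x = \<zero>\<^bsub>N\<^esub>}\<rparr>)"
proof -
  interpret N: left_module R N by fact
  interpret F: left_module R F by fact
  show ?thesis
    by (rule submodule_left_module[OF F])
       (auto simp: module_homD[OF p] module_hom_map_zero[OF F N p] N.smult_r_zero F.smult_closed)
qed

text \<open>Linear relations, total on both sides, replace isomorphisms of \<open>V\<close> modulo \<open>B\<close> with \<open>V'\<close> modulo \<open>B'\<close>: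
  no quotients are formed and no map has to be well defined.\<close>

definition lin_corr :: "('k, 'z) ring_scheme \<Rightarrow> ('k, 'v) module \<Rightarrow> 'v set \<Rightarrow> ('k, 'w) module \<Rightarrow> 'w set \<Rightarrow> bool" where
  "lin_corr K V B V' B' \<longleftrightarrow> (\<exists>\<rho>. \<rho> \<subseteq> carrier V \<times> carrier V' \<and>
     (\<forall>v\<in>carrier V. \<exists>v'. (v, v') \<in> \<rho>) \<and> (\<forall>v'\<in>carrier V'. \<exists>v. (v, v') \<in> \<rho>) \<and>
     (\<forall>u u' v v'. (u, u') \<in> \<rho> \<longrightarrow> (v, v') \<in> \<rho> \<longrightarrow> (u \<oplus>\<^bsub>V\<^esub> v, u' \<oplus>\<^bsub>V'\<^esub> v') \<in> \<rho>) \<and>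
     (\<forall>c\<in>carrier K. \<forall>v v'. (v, v') \<in> \<rho> \<longrightarrow> (c \<odot>\<^bsub>V\<^esub> v, c \<odot>\<^bsub>V'\<^esub> v') \<in> \<rho>) \<and>
     (\<forall>v v'. (v, v') \<in> \<rho> \<longrightarrow> (v \<in> B \<longleftrightarrow> v' \<in> B')))"

lemma lin_corrI:
  assumes "\<And>v v'. P v v' \<Longrightarrow> v \<in> carrier V \<and> v' \<in> carrier V'"
    and "\<And>v. v \<in> carrier V \<Longrightarrow> \<exists>v'. P v v'" and "\<And>v'. v' \<in> carrier V' \<Longrightarrow> \<exists>v. P v v'"
    and "\<And>u u' v v'. P u u' \<Longrightarrow> P v v' \<Longrightarrow> P (u \<oplus>\<^bsub>V\<^esub> v) (u' \<oplus>\<^bsub>V'\<^esub> v')"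
    and "\<And>c v v'. c \<in> carrier K \<Longrightarrow> P v v' \<Longrightarrow> P (c \<odot>\<^bsub>V\<^esub> v) (c \<odot>\<^bsub>V'\<^esub> v')"
    and "\<And>v v'. P v v' \<Longrightarrow> v \<in> B \<longleftrightarrow> v' \<in> B'"
  shows "lin_corr K V B V' B'"
  unfolding lin_corr_def by (rule exI[of _ "{(v, v'). P v v'}"]) (use assms in auto)

lemma lin_corrE:
  assumes "lin_corr K V B V' B'"
  obtains P where "\<And>v v'. P v v' \<Longrightarrow> v \<in> carrier V \<and> v' \<in> carrier V'"
    and "\<And>v. v \<in> carrier V \<Longrightarrow> \<exists>v'. P v v'" and "\<And>v'. v' \<in> carrier V' \<Longrightarrow> \<exists>v. P v v'"
    and "\<And>u u' v v'. P u u' \<Longrightarrow> P v v' \<Longrightarrow> P (u \<oplus>\<^bsub>V\<^esub> v) (u' \<oplus>\<^bsub>V'\<^esub> v')"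
    and "\<And>c v v'. c \<in> carrier K \<Longrightarrow> P v v' \<Longrightarrow> P (c \<odot>\<^bsub>V\<^esub> v) (c \<odot>\<^bsub>V'\<^esub> v')"
    and "\<And>v v'. P v v' \<Longrightarrow> v \<in> B \<longleftrightarrow> v' \<in> B'"
proof -
  obtain \<rho> where r: "\<rho> \<subseteq> carrier V \<times> carrier V'"
    "\<forall>v\<in>carrier V. \<exists>v'. (v, v') \<in> \<rho>" "\<forall>v'\<in>carrier V'. \<exists>v. (v, v') \<in> \<rho>"
    "\<forall>u u' v v'. (u, u') \<in> \<rho> \<longrightarrow> (v, v') \<in> \<rho> \<longrightarrow> (u \<oplus>\<^bsub>V\<^esub> v, u' \<oplus>\<^bsub>V'\<^esub> v') \<in> \<rho>"
    "\<forall>c\<in>carrier K. \<forall>v v'. (v, v') \<in> \<rho> \<longrightarrow> (c \<odot>\<^bsub>V\<^esub> v, c \<odot>\<^bsub>V'\<^esub> v') \<in> \<rho>"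
    "\<forall>v v'. (v, v') \<in> \<rho> \<longrightarrow> (v \<in> B \<longleftrightarrow> v' \<in> B')"
    using assms unfolding lin_corr_def by blast
  show ?thesis by (rule that[of "\<lambda>v v'. (v, v') \<in> \<rho>"]) (use r in blast)+
qed

lemma lin_corr_sym: assumes "lin_corr K V B V' B'" shows "lin_corr K V' B' V B"
proof -
  from lin_corrE[OF assms] obtain P where P: "\<And>v v'. P v v' \<Longrightarrow> v \<in> carrier V \<and> v' \<in> carrier V'"
    "\<And>v. v \<in> carrier V \<Longrightarrow> \<exists>v'. P v v'" "\<And>v'. v' \<in> carrier V' \<Longrightarrow> \<exists>v. P v v'"
    "\<And>u u' v v'. P u u' \<Longrightarrow> P v v' \<Longrightarrow> P (u \<oplus>\<^bsub>V\<^esub> v) (u' \<oplus>\<^bsub>V'\<^esub> v')"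
    "\<And>c v v'. c \<in> carrier K \<Longrightarrow> P v v' \<Longrightarrow> P (c \<odot>\<^bsub>V\<^esub> v) (c \<odot>\<^bsub>V'\<^esub> v')"
    "\<And>v v'. P v v' \<Longrightarrow> v \<in> B \<longleftrightarrow> v' \<in> B'" by blast
  show ?thesis
  proof (rule lin_corrI[where P = "\<lambda>x y. P y x"])
    show "v \<in> carrier V' \<and> v' \<in> carrier V" if "P v' v" for v v' using P(1)[OF that] by simp
    show "(v \<in> B') = (v' \<in> B)" if "P v' v" for v v' using P(6)[OF that] by simp
  qed (rule P(3) P(2) P(4) P(5); assumption)+
qed

lemma lin_corr_trans: assumes "lin_corr K V B V' B'" "lin_corr K V' B' V'' B''" shows "lin_corr K V B V'' B''"
proof -
  from lin_corrE[OF assms(1)] obtain P where P: "\<And>v v'. P v v' \<Longrightarrow> v \<in> carrier V \<and> v' \<in> carrier V'"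
    "\<And>v. v \<in> carrier V \<Longrightarrow> \<exists>v'. P v v'" "\<And>v'. v' \<in> carrier V' \<Longrightarrow> \<exists>v. P v v'"
    "\<And>u u' v v'. P u u' \<Longrightarrow> P v v' \<Longrightarrow> P (u \<oplus>\<^bsub>V\<^esub> v) (u' \<oplus>\<^bsub>V'\<^esub> v')"
    "\<And>c v v'. c \<in> carrier K \<Longrightarrow> P v v' \<Longrightarrow> P (c \<odot>\<^bsub>V\<^esub> v) (c \<odot>\<^bsub>V'\<^esub> v')"
    "\<And>v v'. P v v' \<Longrightarrow> v \<in> B \<longleftrightarrow> v' \<in> B'" by blast
  from lin_corrE[OF assms(2)] obtain P' where P': "\<And>v v'. P' v v' \<Longrightarrow> v \<in> carrier V' \<and> v' \<in> carrier V''"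
    "\<And>v. v \<in> carrier V' \<Longrightarrow> \<exists>v'. P' v v'" "\<And>v'. v' \<in> carrier V'' \<Longrightarrow> \<exists>v. P' v v'"
    "\<And>u u' v v'. P' u u' \<Longrightarrow> P' v v' \<Longrightarrow> P' (u \<oplus>\<^bsub>V'\<^esub> v) (u' \<oplus>\<^bsub>V''\<^esub> v')"
    "\<And>c v v'. c \<in> carrier K \<Longrightarrow> P' v v' \<Longrightarrow> P' (c \<odot>\<^bsub>V'\<^esub> v) (c \<odot>\<^bsub>V''\<^esub> v')"
    "\<And>v v'. P' v v' \<Longrightarrow> v \<in> B' \<longleftrightarrow> v' \<in> B''" by blast
  show ?thesis
  proof (rule lin_corrI[where P = "\<lambda>x z. \<exists>y. P x y \<and> P' y z"])
    show "\<exists>z y. P v y \<and> P' y z" if "v \<in> carrier V" for v using P(1,2) P'(2) that by meson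
    show "\<exists>v y. P v y \<and> P' y z" if "z \<in> carrier V''" for z using P(3) P'(1,3) that by meson
    show "v \<in> carrier V \<and> v' \<in> carrier V''" if "\<exists>y. P v y \<and> P' y v'" for v v' using P(1) P'(1) that by meson
    show "\<exists>y. P (u \<oplus>\<^bsub>V\<^esub> v) y \<and> P' y (u' \<oplus>\<^bsub>V''\<^esub> v')" if "\<exists>y. P u y \<and> P' y u'" "\<exists>y. P v y \<and> P' y v'" for u u' v v'
      using P(4) P'(4) that by meson
    show "\<exists>y. P (c \<odot>\<^bsub>V\<^esub> v) y \<and> P' y (c \<odot>\<^bsub>V''\<^esub> v')" if "c \<in> carrier K" "\<exists>y. P v y \<and> P' y v'" for c v v'
      using P(5)[OF that(1)] P'(5)[OF that(1)] that(2) by meson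
    show "(v \<in> B) = (v' \<in> B'')" if "\<exists>y. P v y \<and> P' y v'" for v v' using P(6) P'(6) that by blast
  qed
qed

section \<open>Cocycles on a complete resolution and dimension shifting\<close>

locale tate = kalgebra K R
  for K :: "('k, 'z) ring_scheme" (structure) and R :: "('k, 'r) module" (structure) +
  fixes T :: "int \<Rightarrow> ('r, 'm) module" and d :: "int \<Rightarrow> 'm \<Rightarrow> 'm"
  assumes T_mod: "left_module R (T n)" and T_proj: "projective_module R (T n)"
    and d_hom: "d n \<in> module_hom R (T n) (T (n - 1))"
    and dd: "x \<in> carrier (T (n + 1)) \<Longrightarrow> d n (d (n + 1) x) = \<zero>\<^bsub>T (n - 1)\<^esub>"
    and T_dual: "Hom_cocycles R T d (regular_module R) n \<subseteq> Hom_coboundaries R T d (regular_module R) n"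
begin

abbreviation \<iota> where "\<iota> c \<equiv> c \<odot>\<^bsub>R\<^esub> \<one>\<^bsub>R\<^esub>"

lemma \<iota>_central: "c \<in> carrier K \<Longrightarrow> r \<in> carrier R \<Longrightarrow> \<iota> c \<otimes>\<^bsub>R\<^esub> r = r \<otimes>\<^bsub>R\<^esub> \<iota> c"
  by (simp add: sc_lmult sc_rmult)

definition coc where "coc n N = (Hom_space R (T n) N)\<lparr>carrier := Hom_cocycles R T d N n\<rparr>"

lemma coc_simps:
  "carrier (coc n N) = Hom_cocycles R T d N n"
  "f \<oplus>\<^bsub>coc n N\<^esub> g = (\<lambda>x\<in>carrier (T n). f x \<oplus>\<^bsub>N\<^esub> g x)"
  "c \<odot>\<^bsub>coc n N\<^esub> f = (\<lambda>x\<in>carrier (T n). \<iota> c \<odot>\<^bsub>N\<^esub> f x)"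
  by (simp_all add: coc_def Hom_space_def)

lemma d_c: "x \<in> carrier (T n) \<Longrightarrow> d n x \<in> carrier (T (n - 1))"
  by (rule module_homD(1)[OF d_hom])

lemma d_c': "x \<in> carrier (T (n + 1)) \<Longrightarrow> d (n + 1) x \<in> carrier (T n)"
  using d_c[of x "n + 1"] by simp

lemma d_hom': "d (n + 1) \<in> module_hom R (T (n + 1)) (T n)"
  using d_hom[of "n + 1"] by simp

lemma cocI:
  assumes "f \<in> module_hom R (T n) N" "\<And>x. x \<in> carrier (T (n + 1)) \<Longrightarrow> f (d (n + 1) x) = \<zero>\<^bsub>N\<^esub>"
  shows "restrict f (carrier (T n)) \<in> Hom_cocycles R T d N n"
proof -
  have "restrict f (carrier (T n)) \<in> module_hom R (T n) N"
    by (rule module_hom_cong[OF T_mod assms(1)]) simp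
  then show ?thesis using assms(2) d_c' by (simp add: Hom_cocycles_def Hom_set_def)
qed

lemma cocD:
  assumes "f \<in> Hom_cocycles R T d N n"
  shows "f \<in> module_hom R (T n) N" "x \<in> carrier (T (n + 1)) \<Longrightarrow> f (d (n + 1) x) = \<zero>\<^bsub>N\<^esub>" "f \<in> extensional (carrier (T n))"
  using assms by (auto simp: Hom_cocycles_def Hom_set_def)

lemma cobI:
  assumes f: "f \<in> extensional (carrier (T n))" and g: "g \<in> module_hom R (T (n - 1)) N"
    and e: "\<And>x. x \<in> carrier (T n) \<Longrightarrow> f x = g (d n x)"
  shows "f \<in> Hom_coboundaries R T d N n"
proof -
  have "restrict g (carrier (T (n - 1))) \<in> module_hom R (T (n - 1)) N"
    by (rule module_hom_cong[OF T_mod g]) simp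
  then have "restrict g (carrier (T (n - 1))) \<in> Hom_set R (T (n - 1)) N" by (simp add: Hom_set_def)
  moreover have "f = compose (carrier (T n)) (restrict g (carrier (T (n - 1)))) (d n)"
    using f e d_c by (auto simp: compose_def extensional_def fun_eq_iff)
  ultimately show ?thesis unfolding Hom_coboundaries_def by blast
qed

lemma cobD:
  assumes "f \<in> Hom_coboundaries R T d N n"
  shows "\<exists>g\<in>module_hom R (T (n - 1)) N. \<forall>x\<in>carrier (T n). f x = g (d n x)"
proof -
  obtain g where g: "g \<in> Hom_set R (T (n - 1)) N" "f = compose (carrier (T n)) g (d n)"
    using assms unfolding Hom_coboundaries_def by blast
  show ?thesis by (rule bexI[of _ g]) (use g in \<open>simp_all add: Hom_set_def compose_def\<close>)
qed

definition acyc :: "('r, 'f) module \<Rightarrow> bool" where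
  "acyc F \<longleftrightarrow> left_module R F \<and> (\<forall>n. Hom_cocycles R T d F n \<subseteq> Hom_coboundaries R T d F n)"

lemma acycD:
  assumes "acyc F" "f \<in> module_hom R (T n) F" "\<And>x. x \<in> carrier (T (n + 1)) \<Longrightarrow> f (d (n + 1) x) = \<zero>\<^bsub>F\<^esub>"
  shows "\<exists>g\<in>module_hom R (T (n - 1)) F. \<forall>x\<in>carrier (T n). f x = g (d n x)"
proof -
  have "restrict f (carrier (T n)) \<in> Hom_coboundaries R T d F n"
    using cocI[OF assms(2,3)] assms(1) unfolding acyc_def by blast
  from cobD[OF this] show ?thesis by simp
qed

text \<open>A homomorphism into a free module is a family of homomorphisms into the ring, each of
  which has a primitive by acyclicity of the dual complex. Finiteness of \<open>I\<close> makes the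
  family of primitives a map into the free module again.\<close>

lemma acyc_free: assumes "finite I" shows "acyc (free_module R I)"
  unfolding acyc_def
proof (intro conjI allI subsetI)
  show "left_module R (free_module R I)" by (rule free_left_module[OF A.ring_axioms])
  fix n f assume f: "f \<in> Hom_cocycles R T d (free_module R I) n"
  note fh = cocD(1)[OF f]
  have fc: "f x i \<in> carrier R" if "x \<in> carrier (T n)" for x i
    using module_homD(1)[OF fh that] unfolding free_carrier by blast
  have fi: "(\<lambda>x. f x i) \<in> module_hom R (T n) (regular_module R)" for i
    by (rule module_homI) (simp_all add: module_homD(2,3)[OF fh] free_simps regular_simps fc)
  have "\<exists>g. g \<in> module_hom R (T (n - 1)) (regular_module R) \<and> (\<forall>x\<in>carrier (T n). f x i = g (d n x))" for i
  proof -
    have "restrict (\<lambda>x. f x i) (carrier (T n)) \<in> Hom_cocycles R T d (regular_module R) n"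
      by (rule cocI[OF fi]) (simp add: cocD(2)[OF f] free_simps regular_simps)
    then have "restrict (\<lambda>x. f x i) (carrier (T n)) \<in> Hom_coboundaries R T d (regular_module R) n" using T_dual by blast
    from cobD[OF this] show ?thesis by auto
  qed
  then have "\<forall>i. \<exists>g. g \<in> module_hom R (T (n - 1)) (regular_module R) \<and> (\<forall>x\<in>carrier (T n). f x i = g (d n x))" by blast
  from choice[OF this] obtain g where g: "\<And>i. g i \<in> module_hom R (T (n - 1)) (regular_module R)" "\<And>i x. x \<in> carrier (T n) \<Longrightarrow> f x i = g i (d n x)" by blast
  \<comment> \<open>Outside \<open>I\<close> the components are set to zero instead of being taken
    from the choice, so that \<open>G y\<close> is supported in \<open>I\<close>.\<close>
  define G where "G = (\<lambda>y i. if i \<in> I then g i y else \<zero>\<^bsub>R\<^esub>)"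
  show "f \<in> Hom_coboundaries R T d (free_module R I) n"
  proof (rule cobI[OF cocD(3)[OF f]])
    show "G \<in> module_hom R (T (n - 1)) (free_module R I)"
    proof (rule module_homI)
      show "G y \<in> carrier (free_module R I)" if "y \<in> carrier (T (n - 1))" for y
      proof -
        have "finite (supp R (G y))" by (rule finite_subset[OF _ assms]) (auto simp: supp_def G_def)
        then show ?thesis using module_homD(1)[OF g(1) that] by (auto simp: free_carrier G_def regular_simps)
      qed
    qed (use module_homD[OF g(1)] in \<open>auto simp: G_def free_simps regular_simps fun_eq_iff\<close>)
    show "f x = G (d n x)" if "x \<in> carrier (T n)" for x
    proof
      fix i
      show "f x i = G (d n x) i"
        using g(2)[OF that] module_homD(1)[OF fh that] by (auto simp: G_def free_carrier)
    qed
  qed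
qed

definition ker_mod where "ker_mod F \<pi> N = F\<lparr>carrier := {x \<in> carrier F. \<pi> x = \<zero>\<^bsub>N\<^esub>}\<rparr>"

lemma ker_simps: "carrier (ker_mod F \<pi> N) = {x \<in> carrier F. \<pi> x = \<zero>\<^bsub>N\<^esub>}" "zero (ker_mod F \<pi> N) = zero F"
  "add (ker_mod F \<pi> N) = add F" "smult (ker_mod F \<pi> N) = smult F"
  by (simp_all add: ker_mod_def)

lemma hom_ker: "f \<in> module_hom R M (ker_mod F \<pi> N) \<Longrightarrow> f \<in> module_hom R M F"
  by (auto simp: module_hom_def ker_simps)

lemma hom_kerI: "f \<in> module_hom R M F \<Longrightarrow> (\<And>x. x \<in> carrier M \<Longrightarrow> \<pi> (f x) = \<zero>\<^bsub>N\<^esub>) \<Longrightarrow> f \<in> module_hom R M (ker_mod F \<pi> N)"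
  by (auto simp: module_hom_def ker_simps)

lemma hom_scale: assumes N: "left_module R N" and g: "g \<in> module_hom R M N" and c: "c \<in> carrier K"
  shows "(\<lambda>x. \<iota> c \<odot>\<^bsub>N\<^esub> g x) \<in> module_hom R M N"
proof -
  interpret N: left_module R N by fact
  have "\<iota> c \<odot>\<^bsub>N\<^esub> (r \<odot>\<^bsub>N\<^esub> y) = r \<odot>\<^bsub>N\<^esub> (\<iota> c \<odot>\<^bsub>N\<^esub> y)" if "r \<in> carrier R" "y \<in> carrier N" for r y
    using that c \<iota>_central[OF c that(1)] N.smult_assoc[of "\<iota> c" r y] N.smult_assoc[of r "\<iota> c" y] by simp
  then show ?thesis
    by (intro module_homI) (auto simp: module_homD[OF g] N.smult_r_distr c N.smult_closed)
qed

text \<open>Dimension shifting along \<open>0 \<rightarrow> ker \<pi> \<rightarrow> F \<rightarrow> N \<rightarrow> 0\<close>, as a linear correspondence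
  instead of a connecting homomorphism.\<close>

lemma shift:
  assumes F: "acyc F" and N: "left_module R N" and p: "\<pi> \<in> module_hom R F N" and sur: "\<pi> ` carrier F = carrier N"
  shows "lin_corr K (coc n N) (Hom_coboundaries R T d N n)
    (coc (n + 1) (ker_mod F \<pi> N)) (Hom_coboundaries R T d (ker_mod F \<pi> N) (n + 1))"
proof -
  let ?Z = "ker_mod F \<pi> N"
  have Fm: "left_module R F" using F by (simp add: acyc_def)
  have Zm: "left_module R ?Z" unfolding ker_mod_def by (rule kernel_left_module[OF Fm N p])
  interpret N: left_module R N by fact
  interpret F: left_module R F by fact
  \<comment> \<open>The zigzag behind the connecting homomorphism with the lift \<open>g\<close>
    left unchosen. Starting from \<open>f\<close>, projectivity of \<open>T n\<close> provides it;
    starting from \<open>h\<close>, acyclicity of Hom(T, F) does.\<close>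
  define P where "P f h \<longleftrightarrow> f \<in> Hom_cocycles R T d N n \<and> h \<in> Hom_cocycles R T d ?Z (n + 1) \<and>
    (\<exists>g\<in>module_hom R (T n) F. (\<forall>x\<in>carrier (T n). \<pi> (g x) = f x) \<and> (\<forall>x\<in>carrier (T (n + 1)). h x = g (d (n + 1) x)))" for f h
  show ?thesis
  proof (rule lin_corrI[where P = P])
    show "v \<in> carrier (coc n N) \<and> v' \<in> carrier (coc (n + 1) ?Z)" if "P v v'" for v v'
      using that by (simp add: P_def coc_simps)
    show "\<exists>h. P f h" if "f \<in> carrier (coc n N)" for f
    proof -
      have f: "f \<in> Hom_cocycles R T d N n" using that by (simp add: coc_simps)
      obtain g where g: "g \<in> module_hom R (T n) F" "\<And>x. x \<in> carrier (T n) \<Longrightarrow> \<pi> (g x) = f x"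
        using projective_lift[OF T_proj Fm N p sur cocD(1)[OF f]] by blast
      have "(\<lambda>x. g (d (n + 1) x)) \<in> module_hom R (T (n + 1)) ?Z"
        by (rule hom_kerI[OF module_hom_comp[OF d_hom' g(1)]]) (use g(2) d_c' cocD(2)[OF f] in auto)
      then have "restrict (\<lambda>x. g (d (n + 1) x)) (carrier (T (n + 1))) \<in> Hom_cocycles R T d ?Z (n + 1)"
      proof (rule cocI)
        fix x assume x: "x \<in> carrier (T (n + 1 + 1))"
        show "g (d (n + 1) (d (n + 1 + 1) x)) = \<zero>\<^bsub>?Z\<^esub>"
          using dd[OF x] module_hom_map_zero[OF T_mod Fm g(1)] by (simp add: ker_simps)
      qed
      then show ?thesis using f g unfolding P_def
        by (intro exI[of _ "restrict (\<lambda>x. g (d (n + 1) x)) (carrier (T (n + 1)))"]) auto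
    qed
    show "\<exists>f. P f h" if "h \<in> carrier (coc (n + 1) ?Z)" for h
    proof -
      have h: "h \<in> Hom_cocycles R T d ?Z (n + 1)" using that by (simp add: coc_simps)
      have "h (d (n + 1 + 1) x) = \<zero>\<^bsub>F\<^esub>" if "x \<in> carrier (T (n + 1 + 1))" for x
        using cocD(2)[OF h that] by (simp add: ker_simps)
      from acycD[OF F hom_ker[OF cocD(1)[OF h]] this]
      have "\<exists>g\<in>module_hom R (T n) F. \<forall>x\<in>carrier (T (n + 1)). h x = g (d (n + 1) x)" by simp
      then obtain g where g: "g \<in> module_hom R (T n) F" "\<And>x. x \<in> carrier (T (n + 1)) \<Longrightarrow> h x = g (d (n + 1) x)" by blast
      have "restrict (\<lambda>x. \<pi> (g x)) (carrier (T n)) \<in> Hom_cocycles R T d N n"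
      proof (rule cocI[OF module_hom_comp[OF g(1) p]])
        fix x assume x: "x \<in> carrier (T (n + 1))"
        show "\<pi> (g (d (n + 1) x)) = \<zero>\<^bsub>N\<^esub>" using g(2)[OF x] module_homD(1)[OF cocD(1)[OF h] x] by (simp add: ker_simps)
      qed
      then show ?thesis using h g unfolding P_def
        by (intro exI[of _ "restrict (\<lambda>x. \<pi> (g x)) (carrier (T n))"]) auto
    qed
    show "P (u \<oplus>\<^bsub>coc n N\<^esub> v) (u' \<oplus>\<^bsub>coc (n + 1) ?Z\<^esub> v')" if uP: "P u u'" and vP: "P v v'" for u u' v v'
    proof -
      obtain g where g: "g \<in> module_hom R (T n) F" "\<And>x. x \<in> carrier (T n) \<Longrightarrow> \<pi> (g x) = u x" "\<And>x. x \<in> carrier (T (n + 1)) \<Longrightarrow> u' x = g (d (n + 1) x)"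
        using uP unfolding P_def by blast
      obtain k where k: "k \<in> module_hom R (T n) F" "\<And>x. x \<in> carrier (T n) \<Longrightarrow> \<pi> (k x) = v x" "\<And>x. x \<in> carrier (T (n + 1)) \<Longrightarrow> v' x = k (d (n + 1) x)"
        using vP unfolding P_def by blast
      have uv: "u \<in> Hom_cocycles R T d N n" "v \<in> Hom_cocycles R T d N n" "u' \<in> Hom_cocycles R T d ?Z (n + 1)" "v' \<in> Hom_cocycles R T d ?Z (n + 1)"
        using uP vP by (auto simp: P_def)
      have 1: "u \<oplus>\<^bsub>coc n N\<^esub> v \<in> Hom_cocycles R T d N n" unfolding coc_simps
        by (rule cocI[OF module_hom_add_fun[OF N cocD(1)[OF uv(1)] cocD(1)[OF uv(2)]]]) (simp add: cocD(2)[OF uv(1)] cocD(2)[OF uv(2)])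
      have 2: "u' \<oplus>\<^bsub>coc (n + 1) ?Z\<^esub> v' \<in> Hom_cocycles R T d ?Z (n + 1)" unfolding coc_simps
        by (rule cocI[OF module_hom_add_fun[OF Zm cocD(1)[OF uv(3)] cocD(1)[OF uv(4)]]])
           (simp only: cocD(2)[OF uv(3)] cocD(2)[OF uv(4)], simp add: ker_simps)
      show ?thesis unfolding P_def
      proof (intro conjI 1 2 bexI[of _ "\<lambda>x. g x \<oplus>\<^bsub>F\<^esub> k x"] ballI)
        show "(\<lambda>x. g x \<oplus>\<^bsub>F\<^esub> k x) \<in> module_hom R (T n) F" by (rule module_hom_add_fun[OF Fm g(1) k(1)])
        show "\<pi> (g x \<oplus>\<^bsub>F\<^esub> k x) = (u \<oplus>\<^bsub>coc n N\<^esub> v) x" if "x \<in> carrier (T n)" for x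
          using that g k by (simp add: coc_simps module_homD[OF p] module_homD(1)[OF g(1)] module_homD(1)[OF k(1)])
        show "(u' \<oplus>\<^bsub>coc (n + 1) ?Z\<^esub> v') x = g (d (n + 1) x) \<oplus>\<^bsub>F\<^esub> k (d (n + 1) x)" if "x \<in> carrier (T (n + 1))" for x
          using that g k by (simp add: coc_simps ker_simps)
      qed
    qed
    show "P (c \<odot>\<^bsub>coc n N\<^esub> v) (c \<odot>\<^bsub>coc (n + 1) ?Z\<^esub> v')" if c: "c \<in> carrier K" and vP: "P v v'" for c v v'
    proof -
      obtain k where k: "k \<in> module_hom R (T n) F" "\<And>x. x \<in> carrier (T n) \<Longrightarrow> \<pi> (k x) = v x" "\<And>x. x \<in> carrier (T (n + 1)) \<Longrightarrow> v' x = k (d (n + 1) x)"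
        using vP unfolding P_def by blast
      have uv: "v \<in> Hom_cocycles R T d N n" "v' \<in> Hom_cocycles R T d ?Z (n + 1)"
        using vP by (auto simp: P_def)
      have 1: "c \<odot>\<^bsub>coc n N\<^esub> v \<in> Hom_cocycles R T d N n" unfolding coc_simps
        by (rule cocI[OF hom_scale[OF N cocD(1)[OF uv(1)] c]]) (simp add: cocD(2)[OF uv(1)] N.smult_r_zero c)
      have 2: "c \<odot>\<^bsub>coc (n + 1) ?Z\<^esub> v' \<in> Hom_cocycles R T d ?Z (n + 1)" unfolding coc_simps
        by (rule cocI[OF hom_scale[OF Zm cocD(1)[OF uv(2)] c]])
           (simp only: cocD(2)[OF uv(2)], simp add: ker_simps F.smult_r_zero c)
      show ?thesis unfolding P_def
      proof (intro conjI 1 2 bexI[of _ "\<lambda>x. \<iota> c \<odot>\<^bsub>F\<^esub> k x"] ballI)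
        show "(\<lambda>x. \<iota> c \<odot>\<^bsub>F\<^esub> k x) \<in> module_hom R (T n) F" by (rule hom_scale[OF Fm k(1) c])
        show "\<pi> (\<iota> c \<odot>\<^bsub>F\<^esub> k x) = (c \<odot>\<^bsub>coc n N\<^esub> v) x" if "x \<in> carrier (T n)" for x
          using that k c by (simp add: coc_simps module_homD[OF p] module_homD(1)[OF k(1)])
        show "(c \<odot>\<^bsub>coc (n + 1) ?Z\<^esub> v') x = \<iota> c \<odot>\<^bsub>F\<^esub> k (d (n + 1) x)" if "x \<in> carrier (T (n + 1))" for x
          using that k by (simp add: coc_simps ker_simps)
      qed
    qed
    show "f \<in> Hom_coboundaries R T d N n \<longleftrightarrow> h \<in> Hom_coboundaries R T d ?Z (n + 1)" if Pfh: "P f h" for f h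
    proof -
      obtain g where g: "g \<in> module_hom R (T n) F" "\<And>x. x \<in> carrier (T n) \<Longrightarrow> \<pi> (g x) = f x" "\<And>x. x \<in> carrier (T (n + 1)) \<Longrightarrow> h x = g (d (n + 1) x)"
        using Pfh unfolding P_def by blast
      have fh: "f \<in> Hom_cocycles R T d N n" "h \<in> Hom_cocycles R T d ?Z (n + 1)" using Pfh by (auto simp: P_def)
      show ?thesis
      proof
        assume "f \<in> Hom_coboundaries R T d N n"
        then obtain f' where f': "f' \<in> module_hom R (T (n - 1)) N" "\<And>x. x \<in> carrier (T n) \<Longrightarrow> f x = f' (d n x)" using cobD by blast
        obtain g' where g': "g' \<in> module_hom R (T (n - 1)) F" "\<And>x. x \<in> carrier (T (n - 1)) \<Longrightarrow> \<pi> (g' x) = f' x"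
          using projective_lift[OF T_proj Fm N p sur f'(1)] by blast
        \<comment> \<open>The lift of \<open>f\<close> is changed by a lift of the primitive
          \<open>f'\<close>, pulled back along the differential. The difference takes values in the
          kernel and still restricts to \<open>h\<close>.\<close>
        let ?k = "\<lambda>x. g x \<ominus>\<^bsub>F\<^esub> g' (d n x)"
        have kh: "?k \<in> module_hom R (T n) F" by (rule module_hom_minus_fun[OF Fm g(1) module_hom_comp[OF d_hom g'(1)]])
        have "?k \<in> module_hom R (T n) ?Z"
        proof (rule hom_kerI[OF kh])
          fix x assume x: "x \<in> carrier (T n)"
          have "\<pi> (?k x) = f x \<ominus>\<^bsub>N\<^esub> f' (d n x)"
            using module_hom_minus[OF Fm N p] module_homD(1)[OF g(1) x] module_homD(1)[OF g'(1) d_c[OF x]] g(2)[OF x] g'(2)[OF d_c[OF x]] by simp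
          then show "\<pi> (?k x) = \<zero>\<^bsub>N\<^esub>" using f'(2)[OF x] module_homD(1)[OF f'(1) d_c[OF x]] by (simp add: N.M.minus_eq N.M.r_neg)
        qed
        then have k: "?k \<in> module_hom R (T (n + 1 - 1)) ?Z" by simp
        show "h \<in> Hom_coboundaries R T d ?Z (n + 1)"
        proof (rule cobI[OF cocD(3)[OF fh(2)] k])
          fix x assume x: "x \<in> carrier (T (n + 1))"
          show "h x = g (d (n + 1) x) \<ominus>\<^bsub>F\<^esub> g' (d n (d (n + 1) x))"
            using g(3)[OF x] dd[OF x] module_hom_map_zero[OF T_mod Fm g'(1)] module_homD(1)[OF g(1) d_c'[OF x]] by (simp add: F.M.minus_eq)
        qed
      next
        assume "h \<in> Hom_coboundaries R T d ?Z (n + 1)"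
        from cobD[OF this] have "\<exists>g\<in>module_hom R (T n) ?Z. \<forall>x\<in>carrier (T (n + 1)). h x = g (d (n + 1) x)" by simp
        then obtain h' where h': "h' \<in> module_hom R (T n) ?Z" "\<And>x. x \<in> carrier (T (n + 1)) \<Longrightarrow> h x = h' (d (n + 1) x)" by blast
        \<comment> \<open>Conversely \<open>g - h'\<close> is a cocycle with values in
          \<open>F\<close>; a primitive of it projects to a primitive of \<open>f\<close>.\<close>
        let ?k = "\<lambda>x. g x \<ominus>\<^bsub>F\<^esub> h' x"
        have kh: "?k \<in> module_hom R (T n) F" by (rule module_hom_minus_fun[OF Fm g(1) hom_ker[OF h'(1)]])
        have k0: "?k (d (n + 1) x) = \<zero>\<^bsub>F\<^esub>" if x: "x \<in> carrier (T (n + 1))" for x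
          using g(3)[OF x] h'(2)[OF x] module_homD(1)[OF g(1) d_c'[OF x]] by (simp add: F.M.minus_eq F.M.r_neg)
        obtain g'' where g'': "g'' \<in> module_hom R (T (n - 1)) F" "\<And>x. x \<in> carrier (T n) \<Longrightarrow> ?k x = g'' (d n x)"
          using acycD[OF F kh k0] by blast
        show "f \<in> Hom_coboundaries R T d N n"
        proof (rule cobI[OF cocD(3)[OF fh(1)] module_hom_comp[OF g''(1) p]])
          fix x assume x: "x \<in> carrier (T n)"
          have hx: "h' x \<in> carrier F" "\<pi> (h' x) = \<zero>\<^bsub>N\<^esub>" using module_homD(1)[OF h'(1) x] by (auto simp: ker_simps)
          have "\<pi> (?k x) = f x" using module_hom_minus[OF Fm N p] module_homD(1)[OF g(1) x] hx g(2)[OF x]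
              module_homD(1)[OF cocD(1)[OF fh(1)] x] by (simp add: N.M.minus_eq)
          then show "f x = \<pi> (g'' (d n x))" using g''(2)[OF x] by simp
        qed
      qed
    qed
  qed
qed

text \<open>When \<open>m0\<close> generates \<open>M\<close>, this is Hom(M, N), each homomorphism
  being recorded by the image of the generator.\<close>

definition inv_set :: "('r, 'a) module \<Rightarrow> 'a \<Rightarrow> ('r, 'f) module \<Rightarrow> 'f set" where
  "inv_set M m0 N = {z \<in> carrier N. \<forall>r\<in>carrier R. r \<odot>\<^bsub>M\<^esub> m0 = \<zero>\<^bsub>M\<^esub> \<longrightarrow> r \<odot>\<^bsub>N\<^esub> z = \<zero>\<^bsub>N\<^esub>}"

definition inv_space :: "('r, 'a) module \<Rightarrow> 'a \<Rightarrow> ('r, 'f) module \<Rightarrow> ('k, 'f) module" where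
  "inv_space M m0 N = \<lparr>carrier = inv_set M m0 N, mult = undefined, one = undefined, zero = zero N, add = add N,
     smult = (\<lambda>c z. \<iota> c \<odot>\<^bsub>N\<^esub> z)\<rparr>"

lemma inv_simps: "carrier (inv_space M m0 N) = inv_set M m0 N" "add (inv_space M m0 N) = add N" "c \<odot>\<^bsub>inv_space M m0 N\<^esub> z = \<iota> c \<odot>\<^bsub>N\<^esub> z"
  by (simp_all add: inv_space_def)

text \<open>In degree \<open>0\<close> a cocycle factors through the cokernel \<open>M\<close> of \<open>d 1\<close>, hence is given by the
  image of the generator \<open>m0\<close> of \<open>M\<close>.\<close>

lemma degree_zero:
  fixes F N :: "('r, 'f) module" and M :: "('r, 'a) module"
  assumes M: "left_module R M" and m0: "m0 \<in> carrier M" and gen: "\<And>x. x \<in> carrier M \<Longrightarrow> \<exists>r\<in>carrier R. x = r \<odot>\<^bsub>M\<^esub> m0"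
    and eta: "\<eta> \<in> module_hom R (T 0) M" and eta_sur: "\<eta> ` carrier (T 0) = carrier M"
    and eta_ker: "{x \<in> carrier (T 0). \<eta> x = \<zero>\<^bsub>M\<^esub>} = d 1 ` carrier (T 1)"
    and F: "acyc F" and N: "left_module R N" and p: "\<pi> \<in> module_hom R F N" and sur: "\<pi> ` carrier F = carrier N"
  shows "lin_corr K (coc 0 N) (Hom_coboundaries R T d N 0) (inv_space M m0 N) (\<pi> ` inv_set M m0 F)"
proof -
  interpret M: left_module R M by fact
  interpret N: left_module R N by fact
  have Fm: "left_module R F" using F by (simp add: acyc_def)
  interpret F: left_module R F by fact
  interpret T0: left_module R "T 0" by (rule T_mod)
  \<comment> \<open>The target \<open>L\<close> is kept variable because the correspondence is used
    both for \<open>N\<close> and for \<open>F\<close>.\<close>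
  define P where "P L f z \<longleftrightarrow> f \<in> Hom_cocycles R T d L 0 \<and> z \<in> inv_set M m0 L \<and>
     (\<forall>x\<in>carrier (T 0). \<forall>r\<in>carrier R. \<eta> x = r \<odot>\<^bsub>M\<^esub> m0 \<longrightarrow> f x = r \<odot>\<^bsub>L\<^esub> z)" for L :: "('r, 'f) module" and f z
  obtain t0 where t0: "t0 \<in> carrier (T 0)" "\<eta> t0 = m0" using eta_sur m0 by (metis imageE)
  have kill: "f x = \<zero>\<^bsub>L\<^esub>" if k: "f \<in> Hom_cocycles R T d L 0" "x \<in> carrier (T 0)" "\<eta> x = \<zero>\<^bsub>M\<^esub>" for L :: "('r, 'f) module" and f x
  proof -
    obtain y where "y \<in> carrier (T (0 + 1))" "x = d (0 + 1) y" using eta_ker k(2,3) by auto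
    then show ?thesis using cocD(2)[OF k(1)] by simp
  qed
  have ext1: "P L f (f t0)" if L: "left_module R L" and f: "f \<in> Hom_cocycles R T d L 0" for L :: "('r, 'f) module" and f
  proof -
    interpret L: left_module R L by fact
    note fh = cocD(1)[OF f]
    have inv: "r \<odot>\<^bsub>L\<^esub> f t0 = \<zero>\<^bsub>L\<^esub>" if r: "r \<in> carrier R" "r \<odot>\<^bsub>M\<^esub> m0 = \<zero>\<^bsub>M\<^esub>" for r
      using kill[OF f T0.smult_closed[OF r(1) t0(1)]] module_homD(3)[OF eta r(1) t0(1)] module_homD(3)[OF fh r(1) t0(1)] r t0 by simp
    have "f x = r \<odot>\<^bsub>L\<^esub> f t0" if x: "x \<in> carrier (T 0)" and r: "r \<in> carrier R" "\<eta> x = r \<odot>\<^bsub>M\<^esub> m0" for x r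
    proof -
      have rt: "r \<odot>\<^bsub>T 0\<^esub> t0 \<in> carrier (T 0)" using r t0 by (simp add: T0.smult_closed)
      have xm: "x \<ominus>\<^bsub>T 0\<^esub> r \<odot>\<^bsub>T 0\<^esub> t0 \<in> carrier (T 0)" using x rt by (rule T0.M.minus_closed)
      have "\<eta> (r \<odot>\<^bsub>T 0\<^esub> t0) = \<eta> x" using module_homD(3)[OF eta r(1) t0(1)] r t0 by simp
      then have "\<eta> (x \<ominus>\<^bsub>T 0\<^esub> r \<odot>\<^bsub>T 0\<^esub> t0) = \<zero>\<^bsub>M\<^esub>"
        using module_hom_minus[OF T_mod M eta x rt] module_homD(1)[OF eta x] by (simp add: M.M.minus_eq M.M.r_neg)
      from kill[OF f xm this] have "f x \<ominus>\<^bsub>L\<^esub> f (r \<odot>\<^bsub>T 0\<^esub> t0) = \<zero>\<^bsub>L\<^esub>"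
        unfolding module_hom_minus[OF T_mod L fh x rt] .
      then have "f x = f (r \<odot>\<^bsub>T 0\<^esub> t0)" 
        by (rule L.M.minus_eq_zeroD[OF module_homD(1)[OF fh x] module_homD(1)[OF fh rt]])
      then show ?thesis using module_homD(3)[OF fh r(1) t0(1)] by simp
    qed
    then show ?thesis using f inv module_homD(1)[OF fh t0(1)] by (auto simp: P_def inv_set_def)
  qed
  have ext2: "\<exists>f. P L f z" if L: "left_module R L" and z: "z \<in> inv_set M m0 L" for L :: "('r, 'f) module" and z
  proof -
    interpret L: left_module R L by fact
    have zc: "z \<in> carrier L" using z by (simp add: inv_set_def)
    have wd: "r \<odot>\<^bsub>L\<^esub> z = s \<odot>\<^bsub>L\<^esub> z" if rs: "r \<in> carrier R" "s \<in> carrier R" "r \<odot>\<^bsub>M\<^esub> m0 = s \<odot>\<^bsub>M\<^esub> m0" for r s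
    proof -
      have rs': "\<ominus>\<^bsub>R\<^esub> s \<in> carrier R" "r \<ominus>\<^bsub>R\<^esub> s \<in> carrier R" using rs by auto
      have "(r \<ominus>\<^bsub>R\<^esub> s) \<odot>\<^bsub>M\<^esub> m0 = r \<odot>\<^bsub>M\<^esub> m0 \<oplus>\<^bsub>M\<^esub> \<ominus>\<^bsub>M\<^esub> (s \<odot>\<^bsub>M\<^esub> m0)"
        unfolding A.minus_eq M.smult_l_distr[OF rs(1) rs'(1) m0] M.smult_l_minus[OF rs(2) m0] ..
      also have "\<dots> = \<zero>\<^bsub>M\<^esub>" unfolding rs(3) by (rule M.M.r_neg[OF M.smult_closed[OF rs(2) m0]])
      finally have "(r \<ominus>\<^bsub>R\<^esub> s) \<odot>\<^bsub>L\<^esub> z = \<zero>\<^bsub>L\<^esub>" using z rs'(2) unfolding inv_set_def by blast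
      moreover have "(r \<ominus>\<^bsub>R\<^esub> s) \<odot>\<^bsub>L\<^esub> z = r \<odot>\<^bsub>L\<^esub> z \<ominus>\<^bsub>L\<^esub> s \<odot>\<^bsub>L\<^esub> z"
        unfolding A.minus_eq L.M.minus_eq L.smult_l_distr[OF rs(1) rs'(1) zc] L.smult_l_minus[OF rs(2) zc] ..
      ultimately have "r \<odot>\<^bsub>L\<^esub> z \<ominus>\<^bsub>L\<^esub> s \<odot>\<^bsub>L\<^esub> z = \<zero>\<^bsub>L\<^esub>" by simp
      then show ?thesis by (rule L.M.minus_eq_zeroD[OF L.smult_closed[OF rs(1) zc] L.smult_closed[OF rs(2) zc]])
    qed
    define \<rho> where "\<rho> x = (SOME r. r \<in> carrier R \<and> \<eta> x = r \<odot>\<^bsub>M\<^esub> m0)" for x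
    have rho: "\<rho> x \<in> carrier R" "\<eta> x = \<rho> x \<odot>\<^bsub>M\<^esub> m0" if "x \<in> carrier (T 0)" for x
      using someI_ex[of "\<lambda>r. r \<in> carrier R \<and> \<eta> x = r \<odot>\<^bsub>M\<^esub> m0"] gen[OF module_homD(1)[OF eta that]] by (auto simp: \<rho>_def)
    let ?f = "\<lambda>x. \<rho> x \<odot>\<^bsub>L\<^esub> z"
    have val: "?f x = r \<odot>\<^bsub>L\<^esub> z" if "x \<in> carrier (T 0)" "r \<in> carrier R" "\<eta> x = r \<odot>\<^bsub>M\<^esub> m0" for x r
      using wd[OF rho(1)[OF that(1)] that(2)] rho(2)[OF that(1)] that(3) by simp
    have fh: "?f \<in> module_hom R (T 0) L"
    proof (rule module_homI)
      show "?f x \<in> carrier L" if "x \<in> carrier (T 0)" for x using rho(1)[OF that] zc L.smult_closed by simp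
      show "?f (x \<oplus>\<^bsub>T 0\<^esub> y) = ?f x \<oplus>\<^bsub>L\<^esub> ?f y" if x: "x \<in> carrier (T 0)" and y: "y \<in> carrier (T 0)" for x y
        using val[of "x \<oplus>\<^bsub>T 0\<^esub> y" "\<rho> x \<oplus>\<^bsub>R\<^esub> \<rho> y"] x y rho[OF x] rho[OF y] m0 zc module_homD(2)[OF eta x y]
        by (simp add: M.smult_l_distr L.smult_l_distr)
      show "?f (r \<odot>\<^bsub>T 0\<^esub> x) = r \<odot>\<^bsub>L\<^esub> ?f x" if r: "r \<in> carrier R" and x: "x \<in> carrier (T 0)" for r x
        using val[of "r \<odot>\<^bsub>T 0\<^esub> x" "r \<otimes>\<^bsub>R\<^esub> \<rho> x"] x r rho[OF x] m0 zc module_homD(3)[OF eta r x] T0.smult_closed[OF r x]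
        by (simp add: M.smult_assoc L.smult_assoc)
    qed
    have "restrict ?f (carrier (T 0)) \<in> Hom_cocycles R T d L 0"
    proof (rule cocI[OF fh])
      fix x assume x: "x \<in> carrier (T (0 + 1))"
      then have "d (0 + 1) x \<in> {x \<in> carrier (T 0). \<eta> x = \<zero>\<^bsub>M\<^esub>}" using eta_ker by auto
      then show "?f (d (0 + 1) x) = \<zero>\<^bsub>L\<^esub>" using val[of "d (0 + 1) x" "\<zero>\<^bsub>R\<^esub>"] m0 zc by (simp add: M.smult_l_zero L.smult_l_zero)
    qed
    then show ?thesis using z val by (intro exI[of _ "restrict ?f (carrier (T 0))"]) (auto simp: P_def)
  qed
  show ?thesis
  proof (rule lin_corrI[where P = "P N"])
    show "v \<in> carrier (coc 0 N) \<and> v' \<in> carrier (inv_space M m0 N)" if "P N v v'" for v v'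
      using that by (simp add: P_def coc_simps inv_simps)
    show "\<exists>z. P N f z" if "f \<in> carrier (coc 0 N)" for f using ext1[OF N] that by (auto simp: coc_simps)
    show "\<exists>f. P N f z" if "z \<in> carrier (inv_space M m0 N)" for z using ext2[OF N] that by (auto simp: inv_simps)
    show "P N (u \<oplus>\<^bsub>coc 0 N\<^esub> v) (u' \<oplus>\<^bsub>inv_space M m0 N\<^esub> v')" if uP: "P N u u'" and vP: "P N v v'" for u u' v v'
    proof -
      have u: "u \<in> Hom_cocycles R T d N 0" "u' \<in> inv_set M m0 N" and v: "v \<in> Hom_cocycles R T d N 0" "v' \<in> inv_set M m0 N"
        using uP vP by (auto simp: P_def)
      have 1: "u \<oplus>\<^bsub>coc 0 N\<^esub> v \<in> Hom_cocycles R T d N 0" unfolding coc_simps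
        by (rule cocI[OF module_hom_add_fun[OF N cocD(1)[OF u(1)] cocD(1)[OF v(1)]]])
          (use cocD(2)[OF u(1)] cocD(2)[OF v(1)] in simp)
      have 2: "u' \<oplus>\<^bsub>N\<^esub> v' \<in> inv_set M m0 N" using u v by (auto simp: inv_set_def N.smult_r_distr)
      show ?thesis unfolding P_def inv_simps using 1 2 uP vP u v
        by (auto simp: P_def coc_simps inv_set_def N.smult_r_distr)
    qed
    show "P N (c \<odot>\<^bsub>coc 0 N\<^esub> v) (c \<odot>\<^bsub>inv_space M m0 N\<^esub> v')" if c: "c \<in> carrier K" and vP: "P N v v'" for c v v'
    proof -
      have v: "v \<in> Hom_cocycles R T d N 0" "v' \<in> inv_set M m0 N" using vP by (auto simp: P_def)
      have vc: "v' \<in> carrier N" using v by (simp add: inv_set_def)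
      have 1: "c \<odot>\<^bsub>coc 0 N\<^esub> v \<in> Hom_cocycles R T d N 0" unfolding coc_simps
        by (rule cocI[OF hom_scale[OF N cocD(1)[OF v(1)] c]]) (use cocD(2)[OF v(1)] N.smult_r_zero c in simp)
      have sw: "\<iota> c \<odot>\<^bsub>N\<^esub> (r \<odot>\<^bsub>N\<^esub> v') = r \<odot>\<^bsub>N\<^esub> (\<iota> c \<odot>\<^bsub>N\<^esub> v')" if "r \<in> carrier R" for r
        using that c vc \<iota>_central[OF c that] N.smult_assoc[of "\<iota> c" r v'] N.smult_assoc[of r "\<iota> c" v'] by simp
      have 2: "\<iota> c \<odot>\<^bsub>N\<^esub> v' \<in> inv_set M m0 N"
        using v c vc sw N.smult_r_zero[of "\<iota> c"] by (auto simp: inv_set_def N.smult_closed simp flip: sw)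
      have "(c \<odot>\<^bsub>coc 0 N\<^esub> v) x = r \<odot>\<^bsub>N\<^esub> (\<iota> c \<odot>\<^bsub>N\<^esub> v')" if "x \<in> carrier (T 0)" "r \<in> carrier R" "\<eta> x = r \<odot>\<^bsub>M\<^esub> m0" for x r
        using vP that sw[OF that(2)] by (simp add: P_def coc_simps)
      then show ?thesis unfolding P_def inv_simps using 1 2 by auto
    qed
    \<comment> \<open>As every cocycle with values in \<open>F\<close> is a coboundary, a cocycle
      with values in \<open>N\<close> is a coboundary exactly if it lifts to a cocycle in
      \<open>F\<close>. So cohomology in degree 0 is Hom(M, N) modulo the homomorphisms that lift
      along \<open>\<pi>\<close>.\<close>
    show "f \<in> Hom_coboundaries R T d N 0 \<longleftrightarrow> z \<in> \<pi> ` inv_set M m0 F" if Pfz: "P N f z" for f z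
    proof
      have f: "f \<in> Hom_cocycles R T d N 0" and z: "z \<in> inv_set M m0 N" using Pfz by (auto simp: P_def)
      have zc: "z \<in> carrier N" using z by (simp add: inv_set_def)
      have ft0: "f t0 = z" using Pfz t0 m0 zc by (auto simp: P_def M.smult_one N.smult_one dest!: bspec[of _ _ t0] bspec[of _ _ "\<one>\<^bsub>R\<^esub>"])
      {
        assume "f \<in> Hom_coboundaries R T d N 0"
        then obtain f' where f': "f' \<in> module_hom R (T (0 - 1)) N" "\<And>x. x \<in> carrier (T 0) \<Longrightarrow> f x = f' (d 0 x)" using cobD by blast
        obtain g' where g': "g' \<in> module_hom R (T (0 - 1)) F" "\<And>x. x \<in> carrier (T (0 - 1)) \<Longrightarrow> \<pi> (g' x) = f' x"
          using projective_lift[OF T_proj Fm N p sur f'(1)] by blast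
        have "restrict (\<lambda>x. g' (d 0 x)) (carrier (T 0)) \<in> Hom_cocycles R T d F 0"
        proof (rule cocI[OF module_hom_comp[OF d_hom g'(1)]])
          fix x assume "x \<in> carrier (T (0 + 1))"
          from dd[OF this] show "g' (d 0 (d (0 + 1) x)) = \<zero>\<^bsub>F\<^esub>" using module_hom_map_zero[OF T_mod Fm g'(1)] by simp
        qed
        from ext1[OF Fm this] have "g' (d 0 t0) \<in> inv_set M m0 F" using t0 by (simp add: P_def)
        moreover have "\<pi> (g' (d 0 t0)) = z" using g'(2)[OF d_c[OF t0(1)]] f'(2)[OF t0(1)] ft0 by simp
        ultimately show "z \<in> \<pi> ` inv_set M m0 F" by blast
      }
      {
        assume "z \<in> \<pi> ` inv_set M m0 F"
        then obtain w where w: "w \<in> inv_set M m0 F" "z = \<pi> w" by blast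
        obtain g where g: "P F g w" using ext2[OF Fm w(1)] by blast
        have gc: "g \<in> Hom_cocycles R T d F 0" using g by (simp add: P_def)
        obtain h where h: "h \<in> module_hom R (T (0 - 1)) F" "\<And>x. x \<in> carrier (T 0) \<Longrightarrow> g x = h (d 0 x)"
          using acycD[OF F cocD(1)[OF gc] cocD(2)[OF gc]] by blast
        show "f \<in> Hom_coboundaries R T d N 0"
        proof (rule cobI[OF cocD(3)[OF f] module_hom_comp[OF h(1) p]])
          fix x assume x: "x \<in> carrier (T 0)"
          obtain r where r: "r \<in> carrier R" "\<eta> x = r \<odot>\<^bsub>M\<^esub> m0" using gen[OF module_homD(1)[OF eta x]] by blast
          have "f x = r \<odot>\<^bsub>N\<^esub> z" "g x = r \<odot>\<^bsub>F\<^esub> w" using Pfz g x r by (auto simp: P_def)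
          then show "f x = \<pi> (h (d 0 x))" using h(2)[OF x] module_homD(3)[OF p r(1)] w by (simp add: inv_set_def)
        qed
      }
    qed
  qed
qed

end

section \<open>Homology of the invariants\<close>

context kalgebra
begin

text \<open>The sum of \<open>v^t u^(e-t)\<close>, the scalar counterpart of
  \<open>hom_sum\<close>.\<close>

primrec gs :: "nat \<Rightarrow> 'k \<Rightarrow> 'k \<Rightarrow> 'k" where
  "gs 0 u v = \<one>"
| "gs (Suc e) u v = gs e u v \<otimes> u \<oplus> v [^] Suc e"

lemma gs_c [simp]: "u \<in> carrier K \<Longrightarrow> v \<in> carrier K \<Longrightarrow> gs e u v \<in> carrier K"
  by (induction e) auto

lemma gs_telescope: assumes u: "u \<in> carrier K" and v: "v \<in> carrier K"
  shows "gs e u v \<otimes> u \<oplus> v [^] Suc e = u [^] Suc e \<oplus> gs e u v \<otimes> v"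
proof (induction e)
  case 0
  then show ?case using u v by (simp add: K.a_comm)
next
  case (Suc e)
  let ?s = "gs e u v"
  have "gs (Suc e) u v \<otimes> u \<oplus> v [^] Suc (Suc e)
      = (?s \<otimes> u \<oplus> v [^] Suc e) \<otimes> u \<oplus> v [^] Suc e \<otimes> v" by simp
  also have "\<dots> = (u [^] Suc e \<oplus> ?s \<otimes> v) \<otimes> u \<oplus> v [^] Suc e \<otimes> v" unfolding Suc.IH ..
  also have "\<dots> = u [^] Suc (Suc e) \<oplus> (?s \<otimes> u \<oplus> v [^] Suc e) \<otimes> v"
    using u v by (simp add: K.l_distr K.r_distr K.a_ac K.m_ac)
  finally show ?case by simp
qed

text \<open>Telescoping, without a division by \<open>u - v\<close>. There is no converse in
  general: for \<open>u = v\<close> the sum is \<open>e + 1\<close> times a power of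
  \<open>u\<close>, and whether this vanishes depends on the characteristic.\<close>

lemma gs_zero: assumes "u \<in> carrier K" "v \<in> carrier K" "gs e u v = \<zero>"
  shows "v [^] Suc e = u [^] Suc e"
  using gs_telescope[OF assms(1,2), of e] K.nat_pow_closed[OF assms(1), of "Suc e"] K.nat_pow_closed[OF assms(2), of "Suc e"]
  unfolding assms(3) using assms(1,2) by (simp only: K.l_null K.l_zero K.r_zero)

text \<open>On coordinates that \<open>X\<close> and \<open>X'\<close> both shift by one place, the
  two differ only by the scalars \<open>u\<close> and \<open>v\<close>. A homogeneous sum of degree
  \<open>e\<close> therefore becomes the e-fold shift times a geometric sum in \<open>u\<close> and
  \<open>c v\<close>. The set \<open>U\<close> is where the shift rules hold, later the
  invariants.\<close>

lemma coord_hom_sum: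
  assumes X: "X \<in> carrier A" "X' \<in> carrier A" and c: "c \<in> carrier K" and u: "u \<in> carrier K" and v: "v \<in> carrier K"
    and f: "\<And>k. k < n \<Longrightarrow> lin (f k)" and U: "U \<subseteq> carrier A" "\<And>w r. w \<in> U \<Longrightarrow> r \<in> carrier A \<Longrightarrow> w \<otimes>\<^bsub>A\<^esub> r \<in> U"
    and fX: "\<And>k w. k < n \<Longrightarrow> w \<in> U \<Longrightarrow> f k (w \<otimes>\<^bsub>A\<^esub> X) = (if k = 0 then \<zero> else u \<otimes> f (k - 1) w)"
    and fX': "\<And>k w. k < n \<Longrightarrow> w \<in> U \<Longrightarrow> f k (w \<otimes>\<^bsub>A\<^esub> X') = (if k = 0 then \<zero> else v \<otimes> f (k - 1) w)"
    and k: "k < n" and w: "w \<in> U"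
  shows "f k (w \<otimes>\<^bsub>A\<^esub> hom_sum X X' e c) = (if k < e then \<zero> else gs e u (c \<otimes> v) \<otimes> f (k - e) w)"
  using k
proof (induction e arbitrary: k)
  case 0
  have wA: "w \<in> carrier A" using U w by blast
  show ?case using wA linD(1)[OF f[OF 0] wA] by simp
next
  case (Suc e)
  have wA: "w \<in> carrier A" using U(1) w by blast
  have fc: "f k w \<in> carrier K" if "k < n" for k using linD(1)[OF f[OF that] wA] .
  have pw: "f k (w \<otimes>\<^bsub>A\<^esub> X' [^]\<^bsub>A\<^esub> m) = (if k < m then \<zero> else v [^] m \<otimes> f (k - m) w)" if "k < n" for k m
    using that
  proof (induction m arbitrary: k)
    case 0
    then show ?case using wA fc by simp
  next
    case (Suc m)
    have e: "w \<otimes>\<^bsub>A\<^esub> X' [^]\<^bsub>A\<^esub> Suc m = w \<otimes>\<^bsub>A\<^esub> X' [^]\<^bsub>A\<^esub> m \<otimes>\<^bsub>A\<^esub> X'" using wA X by (simp add: A.m_assoc)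
    have "w \<otimes>\<^bsub>A\<^esub> X' [^]\<^bsub>A\<^esub> m \<in> U" using U(2)[OF w] X by simp
    from fX'[OF Suc.prems this] show ?case unfolding e using Suc.IH[of "k - 1"] Suc.prems fc[of "k - Suc m"] v
      by (auto simp: K.m_assoc K.m_comm K.m_lcomm)
  qed
  let ?h = "hom_sum X X' e c"
  have h: "?h \<in> carrier A" using X c by simp
  have wh: "w \<otimes>\<^bsub>A\<^esub> ?h \<in> U" using U(2)[OF w h] .
  have e: "w \<otimes>\<^bsub>A\<^esub> hom_sum X X' (Suc e) c = w \<otimes>\<^bsub>A\<^esub> ?h \<otimes>\<^bsub>A\<^esub> X \<oplus>\<^bsub>A\<^esub> c [^] Suc e \<odot>\<^bsub>A\<^esub> (w \<otimes>\<^bsub>A\<^esub> X' [^]\<^bsub>A\<^esub> Suc e)"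
    using wA X c h by (simp add: A.r_distr sc_rmult A.m_assoc del: nat_pow_Suc A.nat_pow_Suc K.nat_pow_Suc)
  have "f k (w \<otimes>\<^bsub>A\<^esub> hom_sum X X' (Suc e) c) = f k (w \<otimes>\<^bsub>A\<^esub> ?h \<otimes>\<^bsub>A\<^esub> X) \<oplus> c [^] Suc e \<otimes> f k (w \<otimes>\<^bsub>A\<^esub> X' [^]\<^bsub>A\<^esub> Suc e)"
    unfolding e using wA X c h by (subst linD(2)[OF f[OF Suc.prems]], simp, simp, subst linD(3)[OF f[OF Suc.prems]]) simp_all
  also have "f k (w \<otimes>\<^bsub>A\<^esub> ?h \<otimes>\<^bsub>A\<^esub> X) = (if k = 0 then \<zero> else u \<otimes> f (k - 1) (w \<otimes>\<^bsub>A\<^esub> ?h))" by (rule fX[OF Suc.prems wh])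
  finally have E: "f k (w \<otimes>\<^bsub>A\<^esub> hom_sum X X' (Suc e) c) = (if k = 0 then \<zero> else u \<otimes> f (k - 1) (w \<otimes>\<^bsub>A\<^esub> ?h))
      \<oplus> c [^] Suc e \<otimes> (if k < Suc e then \<zero> else v [^] Suc e \<otimes> f (k - Suc e) w)"
    unfolding pw[OF Suc.prems] .
  have cS: "c [^] Suc e \<in> carrier K" "v [^] Suc e \<in> carrier K" using c v by (simp_all del: K.nat_pow_Suc)
  show ?case
  proof (cases "k < Suc e")
    case True
    then have "k = 0 \<or> f (k - 1) (w \<otimes>\<^bsub>A\<^esub> ?h) = \<zero>" using Suc.IH[of "k - 1"] Suc.prems by auto
    then show ?thesis unfolding E using True u cS by auto
  next
    case False
    have fk: "f (k - Suc e) w \<in> carrier K" using fc Suc.prems by simp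
    have "f (k - 1) (w \<otimes>\<^bsub>A\<^esub> ?h) = gs e u (c \<otimes> v) \<otimes> f (k - Suc e) w" using Suc.IH[of "k - 1"] Suc.prems False by auto
    then have "f k (w \<otimes>\<^bsub>A\<^esub> hom_sum X X' (Suc e) c) = u \<otimes> (gs e u (c \<otimes> v) \<otimes> f (k - Suc e) w)
      \<oplus> c [^] Suc e \<otimes> (v [^] Suc e \<otimes> f (k - Suc e) w)" unfolding E using False by simp
    also have "\<dots> = (gs e u (c \<otimes> v) \<otimes> u \<oplus> (c \<otimes> v) [^] Suc e) \<otimes> f (k - Suc e) w"
      unfolding K.nat_pow_distrib[OF c v] using u v c cS fk by (simp add: K.l_distr K.r_distr K.m_ac del: K.nat_pow_Suc)
    finally show ?thesis using False by (simp del: K.nat_pow_Suc hom_sum.simps)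
  qed
qed

end

text \<open>The coordinates at which the scalars \<open>al\<close> and \<open>ga\<close> of the differentials vanish.\<close>

definition bad :: "int \<Rightarrow> nat \<Rightarrow> bool" where "bad j l \<longleftrightarrow> (j = -1 \<and> l = 0) \<or> (j = -2 \<and> l = 1)"

text \<open>The equation says that the two exponents of q in a scalar \<open>al\<close> or
  \<open>ga\<close> agree. As \<open>0 \<le> l < n\<close>, the multiple of \<open>n\<close>
  contained in \<open>dg n j\<close> must be \<open>- n\<close>, and the parity of \<open>j\<close>
  then leaves two solutions.\<close>

lemma dg_bad: assumes n: "2 \<le> n" and l: "l < n"
  shows "dg n j + int l = 1 - int n \<longleftrightarrow> bad j l"
proof
  assume e: "dg n j + int l = 1 - int n"
  define p where "p = j div 2"
  have m: "j mod 2 = 0 \<or> j mod 2 = 1" by auto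
  have j: "j = 2 * p + j mod 2" by (simp add: p_def)
  have e': "int n * (p + 1) = 1 - j mod 2 - int l" using e by (simp add: dg_def p_def algebra_simps)
  have "int n * (p + 1) > - int n" using e' m l by auto
  then have p1: "p + 1 > -1" using n by (metis mult.right_neutral mult_minus_right mult_less_cancel_left_pos of_nat_0_less_iff less_le_trans pos2)
  have "int n * (p + 1) < int n * 1" using e' m n by auto
  then have p2: "p + 1 < 1" using n by (simp add: mult_less_cancel_left)
  have "p = -1" using p1 p2 by simp
  then show "bad j l" using e' j m by (auto simp: bad_def)
next
  assume "bad j l"
  then show "dg n j + int l = 1 - int n" by (auto simp: bad_def dg_def)
qed

lemma stp_sum: "1 \<le> n \<Longrightarrow> stp n i + stp n (i + 1) = n" by (auto simp: stp_def)

section \<open>The invariants of the enveloping algebra in coordinates\<close>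

locale qring_free = qring K R a b q X Y X' Y' co
  for K :: "('k, 'z) ring_scheme" (structure) and R :: "('k, 'r) module" (structure)
    and a b :: nat and q :: 'k and X Y X' Y' :: 'r and co :: "nat \<Rightarrow> nat \<Rightarrow> nat \<Rightarrow> nat \<Rightarrow> 'r \<Rightarrow> 'k" +
  assumes q_free: "0 < (n::nat) \<Longrightarrow> q [^]\<^bsub>K\<^esub> n \<noteq> \<one>\<^bsub>K\<^esub>"
begin

lemma Qz_inj: assumes "Qz m = Qz n" shows "m = n"
proof -
  have *: "m \<le> n" if "Qz m = Qz n" for m n
  proof (rule ccontr)
    assume "\<not> m \<le> n"
    then have mn: "n < m" by simp
    have "Qz (m - n) = Qz m \<otimes> Qz (- n)" using Qz_add[of m "- n"] by simp
    also have "\<dots> = \<one>" using that Qz_add[of n "- n"] by simp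
    finally show False using q_free[of "nat (m - n)"] Qz_nat[of "nat (m - n)"] mn by simp
  qed
  show ?thesis using *[OF assms] *[OF assms[symmetric]] by simp
qed

lemma Qz_pow: "Qz m [^] (n::nat) = Qz (m * int n)"
  by (induction n) (simp_all add: Qz_add[symmetric] algebra_simps)

text \<open>For odd \<open>i\<close> the sum is a difference of two powers of q; for even
  \<open>i\<close> its vanishing gives equality of n-th powers. Since q has infinite order, the
  exponents agree in both cases.\<close>

lemma gs_stp_nz: assumes n: "1 \<le> n" and z: "gs (stp n i) (Qz m) (sgK i \<otimes> Qz m') = \<zero>" shows "m = m'"
proof (cases "odd i")
  case True
  then have "Qz m \<oplus> \<ominus> Qz m' = \<zero>" using z by (simp add: stp_def sgK_def K.l_minus)
  then have "Qz m = Qz m'" by (rule K.minus_eq_zeroD[OF Qz_c Qz_c, unfolded K.minus_eq])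
  then show ?thesis by (rule Qz_inj)
next
  case False
  then have "Qz m' [^] n = Qz m [^] n" using gs_zero[OF _ _ z] n by (simp add: stp_def sgK_def del: K.nat_pow_Suc nat_pow_Suc)
  then have "m' * int n = m * int n" unfolding Qz_pow by (rule Qz_inj)
  then show ?thesis using n by simp
qed

text \<open>Confined to odd \<open>i\<close>: for even \<open>i\<close> the sum with equal exponents
  is \<open>n\<close> times a power of q and may survive.\<close>

lemma gs_stp_z: "odd i \<Longrightarrow> gs (stp n i) (Qz m) (sgK i \<otimes> Qz m) = \<zero>"
  by (simp add: stp_def sgK_def K.l_minus K.r_neg)

text \<open>The elements \<open>w\<close> with \<open>a w = w a\<close> for the outer bimodule
  structure, that is, Hom(A, R). They form a right ideal, so the differentials, being right
  multiplications, act on them.\<close>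

definition W where "W = {w \<in> carrier R. X \<otimes>\<^bsub>R\<^esub> w = X' \<otimes>\<^bsub>R\<^esub> w \<and> Y \<otimes>\<^bsub>R\<^esub> w = Y' \<otimes>\<^bsub>R\<^esub> w}"

lemma W_c: "w \<in> W \<Longrightarrow> w \<in> carrier R" by (simp add: W_def)

lemma W_mult: "w \<in> W \<Longrightarrow> r \<in> carrier R \<Longrightarrow> w \<otimes>\<^bsub>R\<^esub> r \<in> W"
  using A.m_assoc[of X w r] A.m_assoc[of X' w r] A.m_assoc[of Y w r] A.m_assoc[of Y' w r] by (simp add: W_def)

lemma W_add: "w \<in> W \<Longrightarrow> v \<in> W \<Longrightarrow> w \<oplus>\<^bsub>R\<^esub> v \<in> W" by (auto simp: W_def A.r_distr)

lemma W_neg: "w \<in> W \<Longrightarrow> \<ominus>\<^bsub>R\<^esub> w \<in> W" by (auto simp: W_def A.r_minus)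

lemma W_zero: "\<zero>\<^bsub>R\<^esub> \<in> W" by (simp add: W_def)

lemma W_sc: "w \<in> W \<Longrightarrow> c \<in> carrier K \<Longrightarrow> c \<odot>\<^bsub>R\<^esub> w \<in> W" by (auto simp: W_def sc_rmult)

lemma WD: "w \<in> W \<Longrightarrow> X \<otimes>\<^bsub>R\<^esub> w = X' \<otimes>\<^bsub>R\<^esub> w" "w \<in> W \<Longrightarrow> Y \<otimes>\<^bsub>R\<^esub> w = Y' \<otimes>\<^bsub>R\<^esub> w" by (simp_all add: W_def)

declare W_c [simp]

text \<open>The left tensor factor is evaluated at the socle monomial
  \<open>y^(b-1) x^(a-1)\<close>, which is a Frobenius form on A.\<close>

definition ps :: "nat \<Rightarrow> nat \<Rightarrow> 'r \<Rightarrow> 'k" where "ps k l w = co (a - 1) (b - 1) k l w"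

lemma ab: "a - 1 < a" "b - 1 < b" "0 < a" "0 < b" using a2 b2 by auto

lemma ps_lin: "k < a \<Longrightarrow> l < b \<Longrightarrow> lin (ps k l)" unfolding ps_def by (rule co_lin[OF ab(1,2)])

lemma ps_c [simp]: "k < a \<Longrightarrow> l < b \<Longrightarrow> w \<in> carrier R \<Longrightarrow> ps k l w \<in> carrier K" using linD(1)[OF ps_lin] by blast
lemma ps_add: "k < a \<Longrightarrow> l < b \<Longrightarrow> w \<in> carrier R \<Longrightarrow> v \<in> carrier R \<Longrightarrow> ps k l (w \<oplus>\<^bsub>R\<^esub> v) = ps k l w \<oplus> ps k l v" using linD(2)[OF ps_lin] by blast
lemma ps_sc: "k < a \<Longrightarrow> l < b \<Longrightarrow> w \<in> carrier R \<Longrightarrow> c \<in> carrier K \<Longrightarrow> ps k l (c \<odot>\<^bsub>R\<^esub> w) = c \<otimes> ps k l w" using linD(3)[OF ps_lin] by blast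
lemma ps_zero: "k < a \<Longrightarrow> l < b \<Longrightarrow> ps k l \<zero>\<^bsub>R\<^esub> = \<zero>" using linD(4)[OF ps_lin] by blast
lemma ps_neg: "k < a \<Longrightarrow> l < b \<Longrightarrow> w \<in> carrier R \<Longrightarrow> ps k l (\<ominus>\<^bsub>R\<^esub> w) = \<ominus> ps k l w"
  using ps_sc[of k l w "\<ominus> \<one>"] by (simp add: sc_minus K.l_minus)

lemma W_co:
  assumes w: "w \<in> W" and i: "i < a" and j: "j < b" and k: "k < a" and l: "l < b"
  shows "0 < i \<Longrightarrow> q [^] j \<otimes> co (i - 1) j k l w = (if k = 0 then \<zero> else co i j (k - 1) l w)"
    and "0 < j \<Longrightarrow> co i (j - 1) k l w = (if l = 0 then \<zero> else q [^] k \<otimes> co i j k (l - 1) w)"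
proof -
  have e: "X \<otimes>\<^bsub>R\<^esub> w = X' \<otimes>\<^bsub>R\<^esub> w" "Y \<otimes>\<^bsub>R\<^esub> w = Y' \<otimes>\<^bsub>R\<^esub> w" "w \<in> carrier R" using WD[OF w] W_c[OF w] by auto
  show "0 < i \<Longrightarrow> q [^] j \<otimes> co (i - 1) j k l w = (if k = 0 then \<zero> else co i j (k - 1) l w)"
    using co_lX[OF i j k l e(3)] co_lX'[OF i j k l e(3)] e(1) by simp
  show "0 < j \<Longrightarrow> co i (j - 1) k l w = (if l = 0 then \<zero> else q [^] k \<otimes> co i j k (l - 1) w)"
    using co_lY[OF i j k l e(3)] co_lY'[OF i j k l e(3)] e(2) by simp
qed

text \<open>Invariance expresses a coordinate with smaller left indices by one with larger left
  indices. Everything descends from the socle slice: along x while \<open>j = b - 1\<close>, then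
  along y for every \<open>i\<close>.\<close>

lemma W_ext0: assumes w: "w \<in> W" and z: "\<And>k l. k < a \<Longrightarrow> l < b \<Longrightarrow> ps k l w = \<zero>" shows "w = \<zero>\<^bsub>R\<^esub>"
proof -
  have wR: "w \<in> carrier R" using w by simp
  have 1: "co (a - 1 - m) (b - 1) k l w = \<zero>" if "k < a" "l < b" for k l m
    using that
  proof (induction m arbitrary: k)
    case 0
    then show ?case using z by (simp add: ps_def)
  next
    case (Suc m)
    show ?case
    proof (cases "a - 1 - m = 0")
      case True
      then show ?thesis using Suc.IH[OF Suc.prems] by simp
    next
      case False
      have "q [^] (b - 1) \<otimes> co (a - 1 - m - 1) (b - 1) k l w = \<zero>"
        using W_co(1)[OF w _ ab(2) Suc.prems, of "a - 1 - m"] Suc.IH[of "k - 1"] Suc.prems False ab by auto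
      moreover have "q [^] (b - 1) \<noteq> \<zero>" using Qz_nat[of "b - 1"] Qz_nz by metis
      ultimately show ?thesis using K.integral[of "q [^] (b - 1)" "co (a - 1 - m - 1) (b - 1) k l w"] wR Suc.prems ab by simp
    qed
  qed
  have 2: "co i (b - 1 - m) k l w = \<zero>" if "i < a" "k < a" "l < b" for i k l m
    using that
  proof (induction m arbitrary: l)
    case 0
    then show ?case using 1[of k l "a - 1 - i"] by simp
  next
    case (Suc m)
    show ?case
    proof (cases "b - 1 - m = 0")
      case True
      then show ?thesis using Suc.IH[OF Suc.prems] by simp
    next
      case False
      then show ?thesis
        using W_co(2)[OF w Suc.prems(1) _ Suc.prems(2,3), of "b - 1 - m"] Suc.IH[of "l - 1"] Suc.prems ab by auto
    qed
  qed
  show ?thesis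
  proof (rule co_ext[OF wR A.zero_closed])
    fix i j k l assume h: "i < a" "j < b" "k < a" "l < b"
    show "co i j k l w = co i j k l \<zero>\<^bsub>R\<^esub>" using 2[of i k l "b - 1 - j"] h co_zero[OF h] by simp
  qed
qed

lemma W_ext: assumes "w \<in> W" "v \<in> W" "\<And>k l. k < a \<Longrightarrow> l < b \<Longrightarrow> ps k l w = ps k l v" shows "w = v"
proof -
  have "w \<ominus>\<^bsub>R\<^esub> v = \<zero>\<^bsub>R\<^esub>"
  proof (rule W_ext0)
    show "w \<ominus>\<^bsub>R\<^esub> v \<in> W" using assms W_add W_neg by (simp add: A.minus_eq)
    show "ps k l (w \<ominus>\<^bsub>R\<^esub> v) = \<zero>" if "k < a" "l < b" for k l
      using that assms by (simp add: A.minus_eq ps_add ps_neg K.r_neg)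
  qed
  then show ?thesis by (rule A.minus_eq_zeroD[OF W_c[OF assms(1)] W_c[OF assms(2)]])
qed

lemma W_ex: assumes c: "\<And>k l. k < a \<Longrightarrow> l < b \<Longrightarrow> c k l \<in> carrier K"
  shows "\<exists>w\<in>W. \<forall>k l. k < a \<longrightarrow> l < b \<longrightarrow> ps k l w = c k l"
proof -
  \<comment> \<open>The solution of the invariance recursion. Raising \<open>i\<close> to
    \<open>a - 1\<close> costs \<open>q^(-j)\<close> at each step and lowers \<open>k\<close> by one
    each time; then raising \<open>j\<close> to \<open>b - 1\<close> costs q to the \<open>k\<close>
    reached at each step and lowers \<open>l\<close>. If \<open>k\<close> or \<open>l\<close> would
    become negative on the way, the value is zero.\<close>
  define C where "C i j k l = (if a - 1 \<le> k + i \<and> b - 1 \<le> l + j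
    then Qz ((int k + int i + 1 - int a) * (int b - 1 - int j) - int j * (int a - 1 - int i)) \<otimes> c (k + i - (a - 1)) (l + j - (b - 1))
    else \<zero>)" for i j k l
  have Cc: "C i j k l \<in> carrier K" if "i < a" "j < b" "k < a" "l < b" for i j k l
    using c that by (auto simp: C_def)
  obtain w where w: "w \<in> carrier R" "\<And>i j k l. i < a \<Longrightarrow> j < b \<Longrightarrow> k < a \<Longrightarrow> l < b \<Longrightarrow> co i j k l w = C i j k l"
    using co_ex[of C] Cc by blast
  have "X \<otimes>\<^bsub>R\<^esub> w = X' \<otimes>\<^bsub>R\<^esub> w"
  proof (rule co_ext)
    fix i j k l assume h: "i < a" "j < b" "k < a" "l < b"
    show "co i j k l (X \<otimes>\<^bsub>R\<^esub> w) = co i j k l (X' \<otimes>\<^bsub>R\<^esub> w)"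
    proof (cases "0 < i \<and> 0 < k \<and> a \<le> k + i \<and> b - 1 \<le> l + j")
      case True
      have i1: "int (i - 1) = int i - 1" "int (k - 1) = int k - 1" using True by auto
      have k1: "k + (i - 1) = k + i - 1" "k - 1 + i = k + i - 1" "a - 1 \<le> k + i - 1" using True by auto
      define c0 where "c0 = c (k + i - 1 - (a - 1)) (l + j - (b - 1))"
      have c0: "c0 \<in> carrier K" unfolding c0_def by (rule c) (use True h in auto)
      have "q [^] j \<otimes> co (i - 1) j k l w
          = Qz (int j) \<otimes> (Qz ((int k + (int i - 1) + 1 - int a) * (int b - 1 - int j) - int j * (int a - 1 - (int i - 1))) \<otimes> c0)"
        using w(2)[of "i - 1" j k l] h True k1 unfolding C_def c0_def Qz_nat i1 by auto
      also have "\<dots> = Qz (int j + ((int k + (int i - 1) + 1 - int a) * (int b - 1 - int j) - int j * (int a - 1 - (int i - 1)))) \<otimes> c0"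
        unfolding Qz_add[of "int j"] using c0 by (simp add: K.m_assoc)
      also have "int j + ((int k + (int i - 1) + 1 - int a) * (int b - 1 - int j) - int j * (int a - 1 - (int i - 1)))
         = (int k - 1 + int i + 1 - int a) * (int b - 1 - int j) - int j * (int a - 1 - int i)" by (simp add: algebra_simps)
      also have "Qz \<dots> \<otimes> c0 = co i j (k - 1) l w"
        using w(2)[of i j "k - 1" l] h True k1 unfolding C_def c0_def i1 by auto
      finally show ?thesis using co_lX[OF h w(1)] co_lX'[OF h w(1)] True by simp
    next
      case False
      have 1: "co (i - 1) j k l w = \<zero>" if "0 < i" using w(2)[of "i - 1" j k l] h False that by (auto simp: C_def)
      have 2: "co i j (k - 1) l w = \<zero>" if "0 < k" using w(2)[of i j "k - 1" l] h False that by (auto simp: C_def)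
      have "co i j k l (X \<otimes>\<^bsub>R\<^esub> w) = \<zero>" using 1 co_lX[OF h w(1)] by (cases "i = 0") simp_all
      moreover have "co i j k l (X' \<otimes>\<^bsub>R\<^esub> w) = \<zero>" using 2 co_lX'[OF h w(1)] by (cases "k = 0") simp_all
      ultimately show ?thesis by simp
    qed
  qed (use w in simp_all)
  moreover have "Y \<otimes>\<^bsub>R\<^esub> w = Y' \<otimes>\<^bsub>R\<^esub> w"
  proof (rule co_ext)
    fix i j k l assume h: "i < a" "j < b" "k < a" "l < b"
    show "co i j k l (Y \<otimes>\<^bsub>R\<^esub> w) = co i j k l (Y' \<otimes>\<^bsub>R\<^esub> w)"
    proof (cases "0 < j \<and> 0 < l \<and> a - 1 \<le> k + i \<and> b \<le> l + j")
      case True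
      have i1: "int (j - 1) = int j - 1" "int (l - 1) = int l - 1" using True by auto
      have k1: "l + (j - 1) = l + j - 1" "l - 1 + j = l + j - 1" "b - 1 \<le> l + j - 1" using True by auto
      define c0 where "c0 = c (k + i - (a - 1)) (l + j - 1 - (b - 1))"
      have c0: "c0 \<in> carrier K" unfolding c0_def by (rule c) (use True h in auto)
      have "q [^] k \<otimes> co i j k (l - 1) w
          = Qz (int k) \<otimes> (Qz ((int k + int i + 1 - int a) * (int b - 1 - int j) - int j * (int a - 1 - int i)) \<otimes> c0)"
        using w(2)[of i j k "l - 1"] h True k1 unfolding C_def c0_def Qz_nat i1 by auto
      also have "\<dots> = Qz (int k + ((int k + int i + 1 - int a) * (int b - 1 - int j) - int j * (int a - 1 - int i))) \<otimes> c0"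
        unfolding Qz_add[of "int k"] using c0 by (simp add: K.m_assoc)
      also have "int k + ((int k + int i + 1 - int a) * (int b - 1 - int j) - int j * (int a - 1 - int i))
         = (int k + int i + 1 - int a) * (int b - 1 - (int j - 1)) - (int j - 1) * (int a - 1 - int i)" by (simp add: algebra_simps)
      also have "Qz \<dots> \<otimes> c0 = co i (j - 1) k l w"
        using w(2)[of i "j - 1" k l] h True k1 unfolding C_def c0_def i1 by auto
      finally show ?thesis using co_lY[OF h w(1)] co_lY'[OF h w(1)] True by simp
    next
      case False
      have 1: "co i (j - 1) k l w = \<zero>" if "0 < j" using w(2)[of i "j - 1" k l] h False that by (auto simp: C_def)
      have 2: "co i j k (l - 1) w = \<zero>" if "0 < l" using w(2)[of i j k "l - 1"] h False that by (auto simp: C_def)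
      have "co i j k l (Y \<otimes>\<^bsub>R\<^esub> w) = \<zero>" using 1 co_lY[OF h w(1)] by (cases "j = 0") simp_all
      moreover have "co i j k l (Y' \<otimes>\<^bsub>R\<^esub> w) = \<zero>" using 2 co_lY'[OF h w(1)] by (cases "l = 0") simp_all
      ultimately show ?thesis by simp
    qed
  qed (use w in simp_all)
  ultimately have "w \<in> W" using w(1) unfolding W_def by blast
  moreover have "ps k l w = c k l" if "k < a" "l < b" for k l
  proof -
    have "int (a - 1) = int a - 1" "int (b - 1) = int b - 1" using ab by auto
    then have "(int k + int (a - 1) + 1 - int a) * (int b - 1 - int (b - 1)) - int (b - 1) * (int a - 1 - int (a - 1)) = 0" by simp
    then have "C (a - 1) (b - 1) k l = Qz 0 \<otimes> c k l" unfolding C_def by simp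
    then show ?thesis using w(2)[OF ab(1,2) that] c[OF that] unfolding ps_def by simp
  qed
  ultimately show ?thesis by blast
qed

text \<open>Right multiplication by \<open>X\<close> takes the left index one below the socle, and
  invariance moves the defect to the right factor at the cost \<open>q^(1-b)\<close>. On invariants
  \<open>X\<close> and \<open>X'\<close> are thus the same shift with different powers of q.\<close>

lemma ps_X: assumes w: "w \<in> W" and k: "k < a" and l: "l < b"
  shows "ps k l (w \<otimes>\<^bsub>R\<^esub> X) = (if k = 0 then \<zero> else Qz (1 - int b) \<otimes> ps (k - 1) l w)"
    and "ps k l (w \<otimes>\<^bsub>R\<^esub> X') = (if k = 0 then \<zero> else Qz (int l) \<otimes> ps (k - 1) l w)"
proof -
  have wR: "w \<in> carrier R" using w by simp
  have e: "Qz (int b - 1) \<otimes> co (a - 1 - 1) (b - 1) k l w = (if k = 0 then \<zero> else ps (k - 1) l w)"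
    using W_co(1)[OF w ab(1,2) k l] a2 b2 Qz_nat[of "b - 1"] unfolding ps_def by (simp add: of_nat_diff)
  have cc: "co (a - 1 - 1) (b - 1) k l w \<in> carrier K" using wR k l ab by simp
  have "co (a - 1 - 1) (b - 1) k l w = Qz (1 - int b) \<otimes> (Qz (int b - 1) \<otimes> co (a - 1 - 1) (b - 1) k l w)"
    unfolding K.m_assoc[OF Qz_c Qz_c cc, symmetric] Qz_add[symmetric] using cc by simp
  then show "ps k l (w \<otimes>\<^bsub>R\<^esub> X) = (if k = 0 then \<zero> else Qz (1 - int b) \<otimes> ps (k - 1) l w)"
    using co_rX[OF ab(1,2) k l wR] a2 unfolding e by (simp add: ps_def)
  show "ps k l (w \<otimes>\<^bsub>R\<^esub> X') = (if k = 0 then \<zero> else Qz (int l) \<otimes> ps (k - 1) l w)"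
    using co_rX'[OF ab(1,2) k l wR] by (simp add: ps_def Qz_nat)
qed

text \<open>As for \<open>X\<close>: here \<open>q^(a-1)\<close> comes from moving y past
  \<open>x^(a-1)\<close> in the left factor and \<open>q^k\<close> from invariance.\<close>

lemma ps_Y: assumes w: "w \<in> W" and k: "k < a" and l: "l < b"
  shows "ps k l (w \<otimes>\<^bsub>R\<^esub> Y) = (if l = 0 then \<zero> else Qz (int a - 1 + int k) \<otimes> ps k (l - 1) w)"
    and "ps k l (w \<otimes>\<^bsub>R\<^esub> Y') = (if l = 0 then \<zero> else \<one> \<otimes> ps k (l - 1) w)"
proof -
  have wR: "w \<in> carrier R" using w by simp
  have e: "co (a - 1) (b - 1 - 1) k l w = (if l = 0 then \<zero> else Qz (int k) \<otimes> ps k (l - 1) w)"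
    using W_co(2)[OF w ab(1,2) k l] b2 unfolding ps_def Qz_nat by simp
  have qa: "q [^] (a - 1) = Qz (int a - 1)" using Qz_nat[of "a - 1"] a2 by (simp add: of_nat_diff)
  have Y: "ps k l (w \<otimes>\<^bsub>R\<^esub> Y) = Qz (int a - 1) \<otimes> co (a - 1) (b - 1 - 1) k l w"
    using co_rY[OF ab(1,2) k l wR] b2 unfolding ps_def qa by simp
  show "ps k l (w \<otimes>\<^bsub>R\<^esub> Y) = (if l = 0 then \<zero> else Qz (int a - 1 + int k) \<otimes> ps k (l - 1) w)"
  proof (cases "l = 0")
    case True
    then show ?thesis using Y e by simp
  next
    case False
    have p: "ps k (l - 1) w \<in> carrier K" using wR k l by simp
    show ?thesis using Y e False unfolding Qz_add K.m_assoc[OF Qz_c Qz_c p] by simp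
  qed
  show "ps k l (w \<otimes>\<^bsub>R\<^esub> Y') = (if l = 0 then \<zero> else \<one> \<otimes> ps k (l - 1) w)"
    using co_rY'[OF ab(1,2) k l wR] wR k l ab by (simp add: ps_def)
qed

text \<open>The scalar with which \<open>dx i j\<close> shifts the first index. It depends on the
  second index \<open>l\<close> only, as a shift in x leaves the powers of q from
  \<open>ps_X\<close> unchanged; the scalar \<open>ga\<close> of \<open>dy\<close> depends on the
  first index only.\<close>

definition al :: "int \<Rightarrow> int \<Rightarrow> nat \<Rightarrow> 'k" where
  "al i j l = gs (stp a i) (Qz (1 - int b)) (sgK i \<otimes> Qz (dg b j + int l))"
definition ga :: "int \<Rightarrow> int \<Rightarrow> nat \<Rightarrow> 'k" where
  "ga i j k = (sgK i \<otimes> Qz (dg a i * int (stp b j))) \<otimes> gs (stp b j) (Qz (int a - 1 + int k)) (sgK j \<otimes> Qz (- dg a i))"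

lemma al_ga_c [simp]: "al i j l \<in> carrier K" "ga i j l \<in> carrier K" by (simp_all add: al_def ga_def)

lemma sgK_nz: "sgK i \<noteq> \<zero>" by (auto simp: sgK_def)

lemma al_zero: "l < b \<Longrightarrow> al i j l = \<zero> \<Longrightarrow> bad j l"
  using gs_stp_nz[of a i "1 - int b" "dg b j + int l"] dg_bad[OF b2, of l j] a2 by (simp add: al_def)

lemma al_bad: "odd i \<Longrightarrow> l < b \<Longrightarrow> bad j l \<Longrightarrow> al i j l = \<zero>"
  using dg_bad[OF b2, of l j] by (simp add: al_def gs_stp_z)

lemma ga_zero: assumes "k < a" "ga i j k = \<zero>" shows "bad i k"
proof -
  have "sgK i \<otimes> Qz (dg a i * int (stp b j)) \<noteq> \<zero>" using K.integral_iff[of "sgK i"] sgK_nz Qz_nz by simp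
  then have "gs (stp b j) (Qz (int a - 1 + int k)) (sgK j \<otimes> Qz (- dg a i)) = \<zero>"
    using assms(2) K.integral_iff unfolding ga_def by simp
  from gs_stp_nz[OF _ this] have "dg a i + int k = 1 - int a" using b2 by simp
  then show ?thesis using dg_bad[OF a2 assms(1)] by simp
qed

lemma ga_bad: assumes "odd j" "k < a" "bad i k" shows "ga i j k = \<zero>"
proof -
  have "int a - 1 + int k = - dg a i" using dg_bad[OF a2 assms(2), of i] assms(3) by simp
  then show ?thesis using assms(1) by (simp add: ga_def gs_stp_z)
qed

lemma ps_dx: assumes w: "w \<in> W" and k: "k < a" and l: "l < b"
  shows "ps k l (w \<otimes>\<^bsub>R\<^esub> dx i j) = (if k < stp a i then \<zero> else al i j l \<otimes> ps (k - stp a i) l w)"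
  unfolding dx_def
  by (subst coord_hom_sum[where n = a and U = W and u = "Qz (1 - int b)" and v = "Qz (int l)" and f = "\<lambda>k. ps k l"])
    (use w k l ps_lin ps_X W_mult in \<open>auto simp: al_def Qz_add K.m_assoc\<close>)

lemma ps_dy: assumes w: "w \<in> W" and k: "k < a" and l: "l < b"
  shows "ps k l (w \<otimes>\<^bsub>R\<^esub> dy i j) = (if l < stp b j then \<zero> else ga i j k \<otimes> ps k (l - stp b j) w)"
proof -
  define c where "c = sgK i \<otimes> Qz (dg a i * int (stp b j))"
  have c: "c \<in> carrier K" by (simp add: c_def)
  have wR: "w \<in> carrier R" using w by simp
  let ?h = "hom_sum Y Y' (stp b j) (sgK j \<otimes> Qz (- dg a i))"
  have "ps k l (w \<otimes>\<^bsub>R\<^esub> dy i j) = c \<otimes> ps k l (w \<otimes>\<^bsub>R\<^esub> ?h)"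
    unfolding dy_def c_def[symmetric] using c wR k l by (simp add: sc_rmult ps_sc)
  also have "ps k l (w \<otimes>\<^bsub>R\<^esub> ?h) = (if l < stp b j then \<zero> else gs (stp b j) (Qz (int a - 1 + int k)) (sgK j \<otimes> Qz (- dg a i) \<otimes> \<one>) \<otimes> ps k (l - stp b j) w)"
    by (rule coord_hom_sum[where n = b and U = W and f = "\<lambda>l. ps k l"]) (use w k l ps_lin ps_Y W_mult in auto)
  finally show ?thesis using c wR k l by (simp add: ga_def c_def[symmetric] K.m_assoc)
qed

text \<open>A coordinate that the shift keeps in range reappears in the product with a nonzero
  scalar. The bound is the complementary step because two consecutive step lengths add up to
  \<open>a\<close>.\<close>

lemma dx_ker: assumes w: "w \<in> W" and 0: "w \<otimes>\<^bsub>R\<^esub> dx i j = \<zero>\<^bsub>R\<^esub>" and k: "k < stp a (i + 1)" and l: "l < b" and nb: "\<not> bad j l"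
  shows "ps k l w = \<zero>"
proof -
  have k': "k + stp a i < a" "k < a" using k stp_sum[of a i] a2 by auto
  have "al i j l \<otimes> ps k l w = \<zero>" using ps_dx[OF w k'(1) l, of i j] ps_zero[OF k'(1) l] unfolding 0 by simp
  from K.integral[OF this al_ga_c(1) ps_c[OF k'(2) l W_c[OF w]]] show ?thesis using al_zero[OF l] nb by blast
qed

lemma dy_ker: assumes w: "w \<in> W" and 0: "w \<otimes>\<^bsub>R\<^esub> dy i j = \<zero>\<^bsub>R\<^esub>" and k: "k < a" and l: "l < stp b (j + 1)" and nb: "\<not> bad i k"
  shows "ps k l w = \<zero>"
proof -
  have l': "l + stp b j < b" "l < b" using l stp_sum[of b j] b2 by auto
  have "ga i j k \<otimes> ps k l w = \<zero>" using ps_dy[OF w k l'(1), of i j] ps_zero[OF k l'(1)] unfolding 0 by simp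
  from K.integral[OF this al_ga_c(2) ps_c[OF k l'(2) W_c[OF w]]] show ?thesis using ga_zero[OF k] nb by blast
qed

text \<open>The shift is inverted and the scalar divided out, which is possible away from bad
  \<open>l\<close>. Control of the support of the preimage is part of the conclusion because the
  chases need to know that no bad coordinate is created.\<close>

lemma dx_im: assumes z: "z \<in> W" and s: "\<And>k l. \<lbrakk>k < a; l < b; ps k l z \<noteq> \<zero>\<rbrakk> \<Longrightarrow> stp a i \<le> k \<and> \<not> bad j l"
  shows "\<exists>w\<in>W. z = w \<otimes>\<^bsub>R\<^esub> dx i j \<and> (\<forall>k l. k < a \<longrightarrow> l < b \<longrightarrow> ps k l w \<noteq> \<zero> \<longrightarrow> k + stp a i < a \<and> ps (k + stp a i) l z \<noteq> \<zero>)"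
proof -
  define e where "e = stp a i"
  define c where "c k l = (if k + e < a \<and> \<not> bad j l then inv (al i j l) \<otimes> ps (k + e) l z else \<zero>)" for k l
  have u: "al i j l \<in> Units K" if "\<not> bad j l" "l < b" for l using al_zero[OF that(2), of i j] that(1) K.field_Units by auto
  have cc: "c k l \<in> carrier K" if "k < a" "l < b" for k l using that u z by (simp add: c_def)
  obtain w where w: "w \<in> W" "\<And>k l. k < a \<Longrightarrow> l < b \<Longrightarrow> ps k l w = c k l" using W_ex[of c] cc by blast
  have "z = w \<otimes>\<^bsub>R\<^esub> dx i j"
  proof (rule W_ext[OF z W_mult[OF w(1)]])
    fix k l assume k: "k < a" and l: "l < b"
    show "ps k l z = ps k l (w \<otimes>\<^bsub>R\<^esub> dx i j)"
    proof (cases "e \<le> k \<and> \<not> bad j l")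
      case True
      have "al i j l \<otimes> (inv (al i j l) \<otimes> ps k l z) = ps k l z"
        using u[OF _ l] True z k l by (simp add: K.m_assoc[symmetric])
      then show ?thesis using ps_dx[OF w(1) k l, of i j] w(2)[of "k - e" l] True k l unfolding e_def[symmetric] by (simp add: c_def)
    next
      case False
      then have "ps k l z = \<zero>" using s[OF k l] e_def by auto
      moreover have "e \<le> k \<Longrightarrow> ps (k - e) l w = \<zero>" using w(2)[of "k - e" l] False k l by (simp add: c_def)
      ultimately show ?thesis using ps_dx[OF w(1) k l, of i j] unfolding e_def[symmetric] by simp
    qed
  qed simp
  moreover have "k + e < a \<and> ps (k + e) l z \<noteq> \<zero>" if "k < a" "l < b" "ps k l w \<noteq> \<zero>" for k l
    using that w(2)[OF that(1,2)] u[OF _ that(2)] by (auto simp: c_def split: if_splits)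
  ultimately show ?thesis using w(1) unfolding e_def by blast
qed

lemma dy_im: assumes z: "z \<in> W" and s: "\<And>k l. \<lbrakk>k < a; l < b; ps k l z \<noteq> \<zero>\<rbrakk> \<Longrightarrow> stp b j \<le> l \<and> \<not> bad i k"
  shows "\<exists>w\<in>W. z = w \<otimes>\<^bsub>R\<^esub> dy i j \<and> (\<forall>k l. k < a \<longrightarrow> l < b \<longrightarrow> ps k l w \<noteq> \<zero> \<longrightarrow> l + stp b j < b \<and> ps k (l + stp b j) z \<noteq> \<zero>)"
proof -
  define e where "e = stp b j"
  define c where "c k l = (if l + e < b \<and> \<not> bad i k then inv (ga i j k) \<otimes> ps k (l + e) z else \<zero>)" for k l
  have u: "ga i j k \<in> Units K" if "\<not> bad i k" "k < a" for k using ga_zero[OF that(2), of i j] that(1) K.field_Units by auto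
  have cc: "c k l \<in> carrier K" if "k < a" "l < b" for k l using that u z by (simp add: c_def)
  obtain w where w: "w \<in> W" "\<And>k l. k < a \<Longrightarrow> l < b \<Longrightarrow> ps k l w = c k l" using W_ex[of c] cc by blast
  have "z = w \<otimes>\<^bsub>R\<^esub> dy i j"
  proof (rule W_ext[OF z W_mult[OF w(1)]])
    fix k l assume k: "k < a" and l: "l < b"
    show "ps k l z = ps k l (w \<otimes>\<^bsub>R\<^esub> dy i j)"
    proof (cases "e \<le> l \<and> \<not> bad i k")
      case True
      have "ga i j k \<otimes> (inv (ga i j k) \<otimes> ps k l z) = ps k l z"
        using u[OF _ k] True z k l by (simp add: K.m_assoc[symmetric])
      then show ?thesis using ps_dy[OF w(1) k l, of i j] w(2)[of k "l - e"] True k l unfolding e_def[symmetric] by (simp add: c_def)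
    next
      case False
      then have "ps k l z = \<zero>" using s[OF k l] e_def by auto
      moreover have "e \<le> l \<Longrightarrow> ps k (l - e) w = \<zero>" using w(2)[of k "l - e"] False k l by (simp add: c_def)
      ultimately show ?thesis using ps_dy[OF w(1) k l, of i j] unfolding e_def[symmetric] by simp
    qed
  qed simp
  moreover have "l + e < b \<and> ps k (l + e) z \<noteq> \<zero>" if "k < a" "l < b" "ps k l w \<noteq> \<zero>" for k l
    using that w(2)[OF that(1,2)] u[OF _ that(1)] by (auto simp: c_def split: if_splits)
  ultimately show ?thesis using w(1) unfolding e_def by blast
qed

end

context bicomplex
begin

lemma dT_add: assumes "\<And>i. z i \<in> carrier R" "\<And>i. w i \<in> carrier R"
  shows "dT n (\<lambda>i. z i \<oplus> w i) = (\<lambda>i. dT n z i \<oplus> dT n w i)"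
proof
  fix i
  have s: "(x \<oplus> y) \<oplus> (x' \<oplus> y') = (x \<oplus> x') \<oplus> (y \<oplus> y')" if "x \<in> carrier R" "y \<in> carrier R" "x' \<in> carrier R" "y' \<in> carrier R" for x y x' y'
    using that by (simp add: a_ac)
  show "dT n (\<lambda>i. z i \<oplus> w i) i = dT n z i \<oplus> dT n w i"
    using assms by (simp add: dT_def l_distr s)
qed

lemma dT_lmult: assumes "\<And>i. z i \<in> carrier R" "r \<in> carrier R"
  shows "dT n (\<lambda>i. r \<otimes> z i) = (\<lambda>i. r \<otimes> dT n z i)"
  using assms by (auto simp: dT_def fun_eq_iff r_distr m_assoc)

lemma dT_zero: "dT n (\<lambda>_. \<zero>) = (\<lambda>_. \<zero>)" by (auto simp: dT_def)

end

text \<open>The positions of degree \<open>m\<close> in the third quadrant whose row and column both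
  contain a bad coordinate.\<close>

definition Dm :: "int \<Rightarrow> int set" where "Dm m = {i \<in> {-1, -2}. m - 1 - i \<in> {-1, -2}}"

section \<open>Homology of the total complex of invariants\<close>

context qring_free
begin

sublocale WC: bicomplex R "\<lambda>_ _. W" dx dy
  by unfold_locales (auto simp: W_mult W_add W_neg RC.dxdx RC.dydy RC.anti)

text \<open>Without the coordinates in the rows through bad positions, all rows of the third quadrant are exact.\<close>

definition Wb :: "int \<Rightarrow> 'r set" where "Wb j = {w \<in> W. \<forall>k l. k < a \<longrightarrow> l < b \<longrightarrow> bad j l \<longrightarrow> ps k l w = \<zero>}"

lemma WbI: "w \<in> W \<Longrightarrow> (\<And>k l. k < a \<Longrightarrow> l < b \<Longrightarrow> bad j l \<Longrightarrow> ps k l w = \<zero>) \<Longrightarrow> w \<in> Wb j" by (simp add: Wb_def)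

lemma Wb_W: "w \<in> Wb j \<Longrightarrow> w \<in> W" and Wb_ps: "w \<in> Wb j \<Longrightarrow> k < a \<Longrightarrow> l < b \<Longrightarrow> bad j l \<Longrightarrow> ps k l w = \<zero>"
  by (simp_all add: Wb_def)

lemma Wb_c: "w \<in> Wb j \<Longrightarrow> w \<in> carrier R" using W_c[OF Wb_W] .

lemma bad_neg: "bad j l \<Longrightarrow> j \<le> -1" by (auto simp: bad_def)

lemma Wb_eq: "0 \<le> j \<Longrightarrow> Wb j = W" using bad_neg[of j] by (auto simp: Wb_def)

sublocale WB: bicomplex R "\<lambda>_ j. Wb j" dx dy
proof unfold_locales
  fix i j z assume z: "z \<in> Wb j"
  show "z \<otimes>\<^bsub>R\<^esub> dx i j \<in> Wb j"
  proof (rule WbI[OF W_mult[OF Wb_W[OF z] d_c(1)]])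
    fix k l assume h: "k < a" "l < b" "bad j l"
    show "ps k l (z \<otimes>\<^bsub>R\<^esub> dx i j) = \<zero>"
      using ps_dx[OF Wb_W[OF z] h(1,2), of i j] Wb_ps[OF z, of "k - stp a i" l] h by simp
  qed
  show "z \<otimes>\<^bsub>R\<^esub> dy i j \<in> Wb (j - 1)"
  proof (rule WbI[OF W_mult[OF Wb_W[OF z] d_c(2)]])
    fix k l assume h: "k < a" "l < b" "bad (j - 1) l"
    \<comment> \<open>The bad \<open>l\<close> of row -2 is reached only from the bad
      \<open>l\<close> of row -1, by a step of length 1. Row -1 is entered from row 0 by a step of
      length \<open>b - 1\<close>, which skips \<open>l = 0\<close>.\<close>
    have "l < stp b j \<or> bad j (l - stp b j)" using h(3) b2 by (auto simp: bad_def stp_def)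
    then show "ps k l (z \<otimes>\<^bsub>R\<^esub> dy i j) = \<zero>"
      using ps_dy[OF Wb_W[OF z] h(1,2), of i j] Wb_ps[OF z, of k "l - stp b j"] h by auto
  qed
  show "\<ominus>\<^bsub>R\<^esub> z \<in> Wb j" using z by (auto simp: Wb_def W_neg ps_neg)
  show "z \<otimes>\<^bsub>R\<^esub> dx i j \<otimes>\<^bsub>R\<^esub> dx (i - 1) j = \<zero>\<^bsub>R\<^esub>" "z \<otimes>\<^bsub>R\<^esub> dy i j \<otimes>\<^bsub>R\<^esub> dy i (j - 1) = \<zero>\<^bsub>R\<^esub>"
    "z \<otimes>\<^bsub>R\<^esub> dx i j \<otimes>\<^bsub>R\<^esub> dy (i - 1) j \<oplus>\<^bsub>R\<^esub> z \<otimes>\<^bsub>R\<^esub> dy i j \<otimes>\<^bsub>R\<^esub> dx i (j - 1) = \<zero>\<^bsub>R\<^esub>"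
    using RC.dxdx[OF Wb_c[OF z]] RC.dydy[OF Wb_c[OF z]] RC.anti[OF Wb_c[OF z]] by blast+
next
  show "u \<oplus>\<^bsub>R\<^esub> v \<in> Wb j" if "u \<in> Wb j" "v \<in> Wb j" for u v j
    using that by (auto simp: Wb_def W_add ps_add)
  show "Wb j \<subseteq> carrier R" for j using Wb_c by blast
qed simp_all

text \<open>A row cycle without bad coordinates is supported where \<open>k\<close> is at least the
  next step length, which is exactly the range of the next shift, and all scalars there are
  invertible.\<close>

lemma rowsW: assumes z: "z \<in> Wb j" and 0: "z \<otimes>\<^bsub>R\<^esub> dx i j = \<zero>\<^bsub>R\<^esub>" shows "\<exists>w\<in>Wb j. z = w \<otimes>\<^bsub>R\<^esub> dx (i + 1) j"
proof -
  have s: "stp a (i + 1) \<le> k \<and> \<not> bad j l" if "k < a" "l < b" "ps k l z \<noteq> \<zero>" for k l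
    using dx_ker[OF Wb_W[OF z] 0 _ that(2), of k] Wb_ps[OF z that(1,2)] that(3) by fastforce
  obtain w where w: "w \<in> W" "z = w \<otimes>\<^bsub>R\<^esub> dx (i + 1) j"
    "\<And>k l. k < a \<Longrightarrow> l < b \<Longrightarrow> ps k l w \<noteq> \<zero> \<Longrightarrow> k + stp a (i + 1) < a \<and> ps (k + stp a (i + 1)) l z \<noteq> \<zero>"
    using dx_im[OF Wb_W[OF z] s] by blast
  have "w \<in> Wb j" by (rule WbI[OF w(1)]) (use w(3) Wb_ps[OF z] in blast)
  then show ?thesis using w(2) by blast
qed

text \<open>The element is split by \<open>k\<close>: the part with \<open>k = 0\<close> has to be
  divided by \<open>dy\<close>, whereas \<open>k > 0\<close> is always divisible by
  \<open>dx 1 j\<close>. No bad coordinate interferes, since row \<open>j\<close> and column 0 have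
  nonnegative index.\<close>

lemma splitW: assumes z: "z \<in> W" and j: "0 \<le> j" and 0: "\<And>l. l < stp b (j + 1) \<Longrightarrow> ps 0 l z = \<zero>"
  shows "\<exists>w\<in>W. \<exists>w'\<in>W. z = w' \<otimes>\<^bsub>R\<^esub> dx 1 j \<oplus>\<^bsub>R\<^esub> w \<otimes>\<^bsub>R\<^esub> dy 0 (j + 1)"
proof -
  have "\<exists>z0\<in>W. \<forall>k l. k < a \<longrightarrow> l < b \<longrightarrow> ps k l z0 = (if k = 0 then ps 0 l z else \<zero>)"
    by (rule W_ex) (use z in simp)
  then obtain z0 where z0: "z0 \<in> W" "\<And>k l. k < a \<Longrightarrow> l < b \<Longrightarrow> ps k l z0 = (if k = 0 then ps 0 l z else \<zero>)" by blast
  have "stp b (j + 1) \<le> l \<and> \<not> bad 0 k" if "k < a" "l < b" "ps k l z0 \<noteq> \<zero>" for k l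
    using z0(2)[OF that(1,2)] that(3) 0[of l] bad_neg[of 0 k] by (auto split: if_splits simp: not_less[symmetric])
  from dy_im[OF z0(1) this] obtain w where w: "w \<in> W" "z0 = w \<otimes>\<^bsub>R\<^esub> dy 0 (j + 1)" by blast
  define z1 where "z1 = z \<ominus>\<^bsub>R\<^esub> z0"
  have z1: "z1 \<in> W" using z z0 W_add W_neg by (simp add: z1_def A.minus_eq)
  have "stp a 1 \<le> k \<and> \<not> bad j l" if "k < a" "l < b" "ps k l z1 \<noteq> \<zero>" for k l
  proof -
    have "ps k l z1 = ps k l z \<oplus> \<ominus> ps k l z0" using that(1,2) z z0(1) by (simp add: z1_def A.minus_eq ps_add ps_neg)
    moreover have "ps k l z \<in> carrier K" using that(1,2) z by simp
    ultimately have "k \<noteq> 0" using that(3) z0(2)[OF that(1,2)] by (metis K.r_neg)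
    then show ?thesis using bad_neg[of j l] j by (auto simp: stp_def)
  qed
  from dx_im[OF z1 this] obtain w' where w': "w' \<in> W" "z1 = w' \<otimes>\<^bsub>R\<^esub> dx 1 j" by blast
  have zc: "z \<in> carrier R" "z0 \<in> carrier R" using z z0 by simp_all
  have "z = z1 \<oplus>\<^bsub>R\<^esub> z0" using zc by (simp add: z1_def A.minus_eq A.a_assoc A.l_neg)
  then show ?thesis unfolding w'(2) w(2) using w(1) w'(1) by blast
qed

text \<open>Every multiple of \<open>dx 1 (j - 1)\<close> has zero coordinates at
  \<open>k = 0\<close>, so the hypothesis forces the coordinates required by \<open>splitW\<close>
  to vanish.\<close>

lemma columnW: assumes j: "1 \<le> j" and z: "z \<in> W" and u: "u \<in> W" and e: "z \<otimes>\<^bsub>R\<^esub> dy 0 j = u \<otimes>\<^bsub>R\<^esub> dx 1 (j - 1)"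
  shows "\<exists>w\<in>W. \<exists>w'\<in>W. z = w' \<otimes>\<^bsub>R\<^esub> dx 1 j \<oplus>\<^bsub>R\<^esub> w \<otimes>\<^bsub>R\<^esub> dy 0 (j + 1)"
proof (rule splitW[OF z])
  show "0 \<le> j" using j by simp
  fix l assume l: "l < stp b (j + 1)"
  then have l': "l + stp b j < b" "l < b" using stp_sum[of b j] b2 by auto
  have "ps 0 (l + stp b j) (z \<otimes>\<^bsub>R\<^esub> dy 0 j) = \<zero>"
    unfolding e using ps_dx[OF u ab(3) l'(1), of 1 "j - 1"] by (simp add: stp_def)
  then have "ga 0 j 0 \<otimes> ps 0 l z = \<zero>" using ps_dy[OF z ab(3) l'(1), of 0 j] by simp
  from K.integral[OF this al_ga_c(2) ps_c[OF ab(3) l'(2) W_c[OF z]]]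
  show "ps 0 l z = \<zero>" using ga_zero[OF ab(3), of 0 j] bad_neg[of 0 0] by auto
qed

text \<open>Only the coordinate \<open>(0, 0)\<close> stays in range under the two long shifts, by
  \<open>a - 1\<close> and \<open>b - 1\<close>, and both scalars met on the way are nonzero. Hence
  that coordinate vanishes.\<close>

lemma glueW: assumes z: "z \<in> W" and e: "z \<otimes>\<^bsub>R\<^esub> dx 0 0 \<otimes>\<^bsub>R\<^esub> dy (-1) 0 = \<zero>\<^bsub>R\<^esub>"
  shows "\<exists>w\<in>W. \<exists>w'\<in>W. z = w' \<otimes>\<^bsub>R\<^esub> dx 1 0 \<oplus>\<^bsub>R\<^esub> w \<otimes>\<^bsub>R\<^esub> dy 0 1"
proof -
  let ?v = "z \<otimes>\<^bsub>R\<^esub> dx 0 0"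
  have v: "?v \<in> W" by (rule W_mult[OF z d_c(1)])
  have s: "stp a 0 = a - 1" "stp b 0 = b - 1" by (simp_all add: stp_def)
  have nb: "\<not> bad (-1) (a - 1)" "\<not> bad 0 0" using a2 by (auto simp: bad_def)
  have "ga (-1) 0 (a - 1) \<otimes> ps (a - 1) 0 ?v = \<zero>"
    using ps_dy[OF v ab(1,2), of "-1" 0] ps_zero[OF ab(1,2)] unfolding e s by simp
  from K.integral[OF this al_ga_c(2) ps_c[OF ab(1,4) W_c[OF v]]]
  have "ps (a - 1) 0 ?v = \<zero>" using ga_zero[OF ab(1)] nb by blast
  then have "al 0 0 0 \<otimes> ps 0 0 z = \<zero>" using ps_dx[OF z ab(1,4), of 0 0] unfolding s by simp
  from K.integral[OF this al_ga_c(1) ps_c[OF ab(3,4) W_c[OF z]]]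
  have "ps 0 0 z = \<zero>" using al_zero[OF ab(4)] nb by blast
  then show ?thesis using splitW[OF z, of 0] by (simp add: stp_def)
qed

text \<open>A row cycle in column -1 without bad coordinates sits at \<open>k = a - 1\<close>, which
  is not bad for this column because \<open>a \<ge> 2\<close>. Preimages under \<open>dy\<close>
  keep this support, so they are row cycles as well.\<close>

lemma columnB: assumes j: "j \<le> -2" and z: "z \<in> Wb j" and 0: "z \<otimes>\<^bsub>R\<^esub> dx (-1) j = \<zero>\<^bsub>R\<^esub>" "z \<otimes>\<^bsub>R\<^esub> dy (-1) j = \<zero>\<^bsub>R\<^esub>"
  shows "\<exists>w\<in>Wb (j + 1). w \<otimes>\<^bsub>R\<^esub> dx (-1) (j + 1) = \<zero>\<^bsub>R\<^esub> \<and> z = w \<otimes>\<^bsub>R\<^esub> dy (-1) (j + 1)"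
proof -
  have zW: "z \<in> W" using Wb_W[OF z] .
  have k1: "a - 1 \<le> k \<and> \<not> bad j l" if "k < a" "l < b" "ps k l z \<noteq> \<zero>" for k l
    using dx_ker[OF zW 0(1) _ that(2), of k] Wb_ps[OF z that(1,2)] that(3) by (fastforce simp: stp_def)
  have "stp b (j + 1) \<le> l \<and> \<not> bad (-1) k" if h: "k < a" "l < b" "ps k l z \<noteq> \<zero>" for k l
  proof -
    have nb: "\<not> bad (-1) k" using k1[OF h] a2 by (auto simp: bad_def)
    then show ?thesis using dy_ker[OF zW 0(2) h(1) _ nb, of l] h(3) by fastforce
  qed
  from dy_im[OF zW this] obtain w where w: "w \<in> W" "z = w \<otimes>\<^bsub>R\<^esub> dy (-1) (j + 1)"
    "\<And>k l. k < a \<Longrightarrow> l < b \<Longrightarrow> ps k l w \<noteq> \<zero> \<Longrightarrow> l + stp b (j + 1) < b \<and> ps k (l + stp b (j + 1)) z \<noteq> \<zero>" by blast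
  have "w \<otimes>\<^bsub>R\<^esub> dx (-1) (j + 1) = \<zero>\<^bsub>R\<^esub>"
  proof (rule W_ext0[OF W_mult[OF w(1) d_c(1)]])
    fix k l assume h: "k < a" "l < b"
    have "ps (k - 1) l w = \<zero>" if "0 < k"
    proof (rule ccontr)
      assume "ps (k - 1) l w \<noteq> \<zero>"
      then have "l + stp b (j + 1) < b" "ps (k - 1) (l + stp b (j + 1)) z \<noteq> \<zero>" using w(3)[of "k - 1" l] h by auto
      then have "a - 1 \<le> k - 1" using k1[of "k - 1" "l + stp b (j + 1)"] h by auto
      then show False using h that by simp
    qed
    then show "ps k l (w \<otimes>\<^bsub>R\<^esub> dx (-1) (j + 1)) = \<zero>" using ps_dx[OF w(1) h, of "-1" "j + 1"] by (auto simp: stp_def)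
  qed
  moreover have "w \<in> Wb (j + 1)"
  proof (rule WbI[OF w(1)], rule ccontr)
    fix k l assume h: "k < a" "l < b" "bad (j + 1) l" "ps k l w \<noteq> \<zero>"
    have 1: "l + stp b (j + 1) < b" "ps k (l + stp b (j + 1)) z \<noteq> \<zero>" using w(3)[OF h(1,2,4)] by auto
    have 2: "\<not> bad j (l + stp b (j + 1))" using k1[OF h(1) 1] by simp
    \<comment> \<open>A bad coordinate of \<open>w\<close> in row -1 would produce a bad one of
      \<open>z\<close> in row -2; one in row -2 would be shifted out of range.\<close>
    consider "j = -2" "l = 0" | "j = -3" "l = 1" using h(3) by (auto simp: bad_def)
    then show False
    proof cases
      case 1
      then show ?thesis using 2 by (simp add: bad_def stp_def)
    next
      case c: 2
      then show ?thesis using 1(1) by (simp add: stp_def)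
    qed
  qed
  ultimately show ?thesis using w(2) by blast
qed

text \<open>As in \<open>columnB\<close>, everything sits at \<open>k = a - 1\<close>, the image of
  the long shift \<open>dx 0 0\<close>; the intermediate row 0 has no bad coordinates, so the second
  division succeeds as well.\<close>

lemma glueB: assumes z: "z \<in> Wb (-1)" and 0: "z \<otimes>\<^bsub>R\<^esub> dx (-1) (-1) = \<zero>\<^bsub>R\<^esub>" "z \<otimes>\<^bsub>R\<^esub> dy (-1) (-1) = \<zero>\<^bsub>R\<^esub>"
  shows "\<exists>w\<in>Wb 0. z = w \<otimes>\<^bsub>R\<^esub> dx 0 0 \<otimes>\<^bsub>R\<^esub> dy (-1) 0"
proof -
  have zW: "z \<in> W" using Wb_W[OF z] .
  have k1: "a - 1 \<le> k" if "k < a" "l < b" "ps k l z \<noteq> \<zero>" for k l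
    using dx_ker[OF zW 0(1) _ that(2), of k] Wb_ps[OF z that(1,2)] that(3) by (fastforce simp: stp_def)
  have "stp b 0 \<le> l \<and> \<not> bad (-1) k" if h: "k < a" "l < b" "ps k l z \<noteq> \<zero>" for k l
  proof -
    have nb: "\<not> bad (-1) k" using k1[OF h] a2 by (auto simp: bad_def)
    then show ?thesis using dy_ker[OF zW 0(2) h(1) _ nb, of l] h(3) by fastforce
  qed
  from dy_im[OF zW this] obtain v where v: "v \<in> W" "z = v \<otimes>\<^bsub>R\<^esub> dy (-1) 0"
    "\<And>k l. k < a \<Longrightarrow> l < b \<Longrightarrow> ps k l v \<noteq> \<zero> \<Longrightarrow> l + stp b 0 < b \<and> ps k (l + stp b 0) z \<noteq> \<zero>" by blast
  have "stp a 0 \<le> k \<and> \<not> bad 0 l" if h: "k < a" "l < b" "ps k l v \<noteq> \<zero>" for k l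
  proof -
    have "l + stp b 0 < b" "ps k (l + stp b 0) z \<noteq> \<zero>" using v(3)[OF h] by auto
    from k1[OF h(1) this] show ?thesis by (simp add: stp_def bad_def)
  qed
  from dx_im[OF v(1) this] obtain w where w: "w \<in> W" "v = w \<otimes>\<^bsub>R\<^esub> dx 0 0" by blast
  have "Wb 0 = W" using Wb_eq[of 0] by simp
  then show ?thesis using w v(2) by blast
qed

lemma exactW_nonneg: assumes m: "0 \<le> m" and z: "z \<in> WC.tot m" "WC.dT m z = (\<lambda>_. \<zero>\<^bsub>R\<^esub>)"
  shows "\<exists>w\<in>WC.tot (m + 1). z = WC.dT (m + 1) w"
proof (cases "m = 0")
  case True
  have "\<exists>w\<in>WC.tot 1. z = WC.dT 1 w"
    by (rule WC.tot_exact_0) (use glueW z True in simp_all)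
  then show ?thesis using True by simp
next
  case False
  show ?thesis
  proof (rule WC.tot_exact_pos)
    show "\<exists>w\<in>W. z = w \<otimes>\<^bsub>R\<^esub> dx (i + 1) j" if "1 \<le> i" "0 \<le> j" "z \<in> W" "z \<otimes>\<^bsub>R\<^esub> dx i j = \<zero>\<^bsub>R\<^esub>" for i j z
      using rowsW[of z j i] Wb_eq[OF that(2)] that(3,4) by simp
    show "\<exists>w\<in>W. \<exists>w'\<in>W. z = w' \<otimes>\<^bsub>R\<^esub> dx 1 j \<oplus>\<^bsub>R\<^esub> w \<otimes>\<^bsub>R\<^esub> dy 0 (j + 1)"
      if "1 \<le> j" "z \<in> W" "u \<in> W" "z \<otimes>\<^bsub>R\<^esub> dy 0 j = u \<otimes>\<^bsub>R\<^esub> dx 1 (j - 1)" for j z u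
      by (rule columnW[OF that])
  qed (use m False z in simp_all)
qed

lemma exactB_neg: assumes m: "m \<le> -1" and z: "z \<in> WB.tot m" "WB.dT m z = (\<lambda>_. \<zero>\<^bsub>R\<^esub>)"
  shows "\<exists>w\<in>WB.tot (m + 1). z = WB.dT (m + 1) w"
proof (cases "m = -1")
  case True
  have "\<exists>w\<in>WB.tot 0. z = WB.dT 0 w"
    by (rule WB.tot_exact_minus1) (use glueB z True in simp_all)
  then show ?thesis using True by simp
next
  case False
  show ?thesis
  proof (rule WB.tot_exact_neg)
    show "\<exists>w\<in>Wb j. z = w \<otimes>\<^bsub>R\<^esub> dx (i + 1) j" if "z \<in> Wb j" "z \<otimes>\<^bsub>R\<^esub> dx i j = \<zero>\<^bsub>R\<^esub>" for i j z
      by (rule rowsW[OF that])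
    show "\<exists>w\<in>Wb (j + 1). w \<otimes>\<^bsub>R\<^esub> dx (-1) (j + 1) = \<zero>\<^bsub>R\<^esub> \<and> z = w \<otimes>\<^bsub>R\<^esub> dy (-1) (j + 1)"
      if "j \<le> -2" "z \<in> Wb j" "z \<otimes>\<^bsub>R\<^esub> dx (-1) j = \<zero>\<^bsub>R\<^esub>" "z \<otimes>\<^bsub>R\<^esub> dy (-1) j = \<zero>\<^bsub>R\<^esub>" for j z
      by (rule columnB[OF that])
  qed (use m False z in simp_all)
qed

text \<open>The values at the doubly bad coordinates. In degree \<open>m\<close> position
  \<open>i\<close> lies in row \<open>m - 1 - i\<close>, and an index -1 or -2 has bad coordinate 0
  or 1; this gives \<open>k = -1 - i\<close> and \<open>l = i - m\<close>. These values are a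
  complete invariant of the homology class.\<close>

definition bc :: "int \<Rightarrow> (int \<Rightarrow> 'r) \<Rightarrow> int \<Rightarrow> 'k" where
  "bc m z = (\<lambda>i. if i \<in> Dm m then ps (nat (-1 - i)) (nat (i - m)) (z i) else \<zero>)"

lemma DmD: assumes "i \<in> Dm m"
  shows "bad i (nat (-1 - i))" "bad (m - 1 - i) (nat (i - m))" "i \<in> Ix m" "m \<le> -1" "jx m i = m - 1 - i" "nat (-1 - i) < a" "nat (i - m) < b"
proof -
  have h: "i = -1 \<or> i = -2" "m = i \<or> m = i - 1" using assms by (auto simp: Dm_def)
  then show "bad i (nat (-1 - i))" "bad (m - 1 - i) (nat (i - m))" "i \<in> Ix m" "m \<le> -1" "jx m i = m - 1 - i" "nat (-1 - i) < a" "nat (i - m) < b"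
    using a2 b2 by (auto simp: bad_def Ix_def jx_def)
qed

lemma bad_Dm: "bad i k \<Longrightarrow> bad (m - 1 - i) l \<Longrightarrow> i \<in> Dm m \<and> k = nat (-1 - i) \<and> l = nat (i - m)"
  by (auto simp: bad_def Dm_def)

text \<open>An incoming long shift skips coordinate 0, and an incoming short one arrives with scalar
  zero because the other coordinate is bad too.\<close>

lemma bnd_bad: assumes w: "w \<in> W" and k: "k < a" and l: "l < b" and bd: "bad i k" "bad j l"
  shows "ps k l (w \<otimes>\<^bsub>R\<^esub> dx (i + 1) j) = \<zero>" "ps k l (w \<otimes>\<^bsub>R\<^esub> dy i (j + 1)) = \<zero>"
proof -
  have "k < stp a (i + 1) \<or> al (i + 1) j l = \<zero>"
    using bd(1) al_bad[of "i + 1" l j] l bd(2) a2 by (auto simp: bad_def[of i] stp_def)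
  then show "ps k l (w \<otimes>\<^bsub>R\<^esub> dx (i + 1) j) = \<zero>" using ps_dx[OF w k l, of "i + 1" j] w k l by auto
  have "l < stp b (j + 1) \<or> ga i (j + 1) k = \<zero>"
    using bd(2) ga_bad[of "j + 1" k i] k bd(1) b2 by (auto simp: bad_def[of j] stp_def)
  then show "ps k l (w \<otimes>\<^bsub>R\<^esub> dy i (j + 1)) = \<zero>" using ps_dy[OF w k l, of i "j + 1"] w k l by auto
qed

lemma bad_mult: assumes w: "w \<in> W" and s: "\<And>k l. k < a \<Longrightarrow> l < b \<Longrightarrow> ps k l w \<noteq> \<zero> \<Longrightarrow> bad i k \<and> bad j l"
  shows "w \<otimes>\<^bsub>R\<^esub> dx i j = \<zero>\<^bsub>R\<^esub>" "w \<otimes>\<^bsub>R\<^esub> dy i j = \<zero>\<^bsub>R\<^esub>"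
proof -
  show "w \<otimes>\<^bsub>R\<^esub> dx i j = \<zero>\<^bsub>R\<^esub>"
  proof (rule W_ext0[OF W_mult[OF w d_c(1)]])
    fix k l assume h: "k < a" "l < b"
    have "al i j l = \<zero> \<or> ps (k - stp a i) l w = \<zero>" if "\<not> k < stp a i"
      using s[of "k - stp a i" l] h that al_bad[of i l j] by (auto simp: bad_def[of i] stp_def)
    then show "ps k l (w \<otimes>\<^bsub>R\<^esub> dx i j) = \<zero>" using ps_dx[OF w h, of i j] w h by auto
  qed
  show "w \<otimes>\<^bsub>R\<^esub> dy i j = \<zero>\<^bsub>R\<^esub>"
  proof (rule W_ext0[OF W_mult[OF w d_c(2)]])
    fix k l assume h: "k < a" "l < b"
    have "ga i j k = \<zero> \<or> ps k (l - stp b j) w = \<zero>" if "\<not> l < stp b j"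
      using s[of k "l - stp b j"] h that ga_bad[of j k i] by (auto simp: bad_def[of j] stp_def)
    then show "ps k l (w \<otimes>\<^bsub>R\<^esub> dy i j) = \<zero>" using ps_dy[OF w h, of i j] w h by auto
  qed
qed

lemma totW: "z \<in> WC.tot m \<Longrightarrow> z i \<in> W"
  using W_zero by (cases "i \<in> Ix m") (auto simp: WC.tot_def)

lemma tot_add: "z \<in> WC.tot m \<Longrightarrow> w \<in> WC.tot m \<Longrightarrow> (\<lambda>i. z i \<oplus>\<^bsub>R\<^esub> w i) \<in> WC.tot m"
  by (auto simp: WC.tot_def W_add)

lemma bc_add: "z \<in> WC.tot m \<Longrightarrow> w \<in> WC.tot m \<Longrightarrow> bc m (\<lambda>i. z i \<oplus>\<^bsub>R\<^esub> w i) = (\<lambda>i. bc m z i \<oplus> bc m w i)"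
  using DmD(6,7) totW by (auto simp: bc_def ps_add)

lemma bc_sc: "z \<in> WC.tot m \<Longrightarrow> c \<in> carrier K \<Longrightarrow> bc m (\<lambda>i. c \<odot>\<^bsub>R\<^esub> z i) = (\<lambda>i. c \<otimes> bc m z i)"
  using DmD(6,7) totW by (auto simp: bc_def ps_sc)

lemma bc_c: "z \<in> WC.tot m \<Longrightarrow> bc m z i \<in> carrier K"
  using DmD(6,7) totW by (auto simp: bc_def)

lemma bc_dT: assumes w: "w \<in> WC.tot (m + 1)" shows "bc m (WC.dT (m + 1) w) = (\<lambda>_. \<zero>)"
proof
  fix i
  show "bc m (WC.dT (m + 1) w) i = \<zero>"
  proof (cases "i \<in> Dm m")
    case True
    note D = DmD[OF True]
    let ?k = "nat (-1 - i)" and ?l = "nat (i - m)"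
    have "ps ?k ?l (WC.dT (m + 1) w i) = \<zero>"
    proof (cases "m = -1")
      case m: True
      then have i: "i = -1" using True by (auto simp: Dm_def)
      have "ps 0 0 (w 0 \<otimes>\<^bsub>R\<^esub> dx 0 0 \<otimes>\<^bsub>R\<^esub> dy (-1) 0) = \<zero>"
        using bnd_bad(2)[OF W_mult[OF totW[OF w] d_c(1)] ab(3,4), of "-1" "-1"] by (simp add: bad_def)
      then show ?thesis using m i by (simp add: WC.dT_def Ix_def)
    next
      case False
      then have m: "m + 1 < 0" using D(4) by simp
      have e: "jx (m + 1) i = (m - 1 - i) + 1" using m by (simp add: jx_def)
      have "WC.dT (m + 1) w i = w (i + 1) \<otimes>\<^bsub>R\<^esub> dx (i + 1) (m - 1 - i) \<oplus>\<^bsub>R\<^esub> w i \<otimes>\<^bsub>R\<^esub> dy i ((m - 1 - i) + 1)"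
        using m D(3,5) unfolding e[symmetric] by (simp add: WC.dT_def)
      then show ?thesis using bnd_bad[OF totW[OF w] D(6,7,1,2)] totW[OF w] D(6,7) by (simp add: ps_add)
    qed
    then show ?thesis using True by (simp add: bc_def)
  qed (simp add: bc_def)
qed

text \<open>An element supported at doubly bad coordinates is a cycle component by component, since
  each differential kills each component separately.\<close>

lemma bc_surj: assumes c: "\<And>i. i \<in> Dm m \<Longrightarrow> c i \<in> carrier K"
  shows "\<exists>z\<in>WC.tot m. WC.dT m z = (\<lambda>_. \<zero>\<^bsub>R\<^esub>) \<and> (\<forall>i\<in>Dm m. bc m z i = c i)"
proof -
  have "\<forall>i\<in>Dm m. \<exists>w. w \<in> W \<and> (\<forall>k l. k < a \<longrightarrow> l < b \<longrightarrow> ps k l w = (if k = nat (-1 - i) \<and> l = nat (i - m) then c i else \<zero>))"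
  proof
    fix i assume "i \<in> Dm m"
    then have "\<exists>w\<in>W. \<forall>k l. k < a \<longrightarrow> l < b \<longrightarrow> ps k l w = (if k = nat (-1 - i) \<and> l = nat (i - m) then c i else \<zero>)"
      using c by (intro W_ex) simp
    then show "\<exists>w. w \<in> W \<and> (\<forall>k l. k < a \<longrightarrow> l < b \<longrightarrow> ps k l w = (if k = nat (-1 - i) \<and> l = nat (i - m) then c i else \<zero>))" by blast
  qed
  from bchoice[OF this] obtain f where f: "\<And>i. i \<in> Dm m \<Longrightarrow> f i \<in> W"
    "\<And>i k l. i \<in> Dm m \<Longrightarrow> k < a \<Longrightarrow> l < b \<Longrightarrow> ps k l (f i) = (if k = nat (-1 - i) \<and> l = nat (i - m) then c i else \<zero>)" by blast
  define z where "z i = (if i \<in> Dm m then f i else \<zero>\<^bsub>R\<^esub>)" for i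
  have z: "z \<in> WC.tot m" using f(1) DmD(3) W_zero by (auto simp: WC.tot_def z_def)
  have m0: "z i \<otimes>\<^bsub>R\<^esub> dx i (m - 1 - i) = \<zero>\<^bsub>R\<^esub>" "z i \<otimes>\<^bsub>R\<^esub> dy i (m - 1 - i) = \<zero>\<^bsub>R\<^esub>" for i
  proof -
    have s: "bad i k \<and> bad (m - 1 - i) l" if "k < a" "l < b" "ps k l (z i) \<noteq> \<zero>" for k l
      using that f(2)[of i k l] DmD(1,2)[of i m] by (auto simp: z_def ps_zero split: if_splits)
    show "z i \<otimes>\<^bsub>R\<^esub> dx i (m - 1 - i) = \<zero>\<^bsub>R\<^esub>" by (rule bad_mult(1)[OF totW[OF z] s])
    show "z i \<otimes>\<^bsub>R\<^esub> dy i (m - 1 - i) = \<zero>\<^bsub>R\<^esub>" by (rule bad_mult(2)[OF totW[OF z] s])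
  qed
  have "WC.dT m z i = \<zero>\<^bsub>R\<^esub>" for i
  proof (cases "0 \<le> m")
    case True
    then have "Dm m = {}" by (auto simp: Dm_def)
    then have "z = (\<lambda>_. \<zero>\<^bsub>R\<^esub>)" by (simp add: z_def fun_eq_iff)
    then show ?thesis by (simp add: WC.dT_zero)
  next
    case False
    have e: "m - 1 - (i + 1) = m - 2 - i" by simp
    have "jx (m - 1) i = m - 2 - i" "jx m i = m - 1 - i" using False by (auto simp: jx_def)
    then show ?thesis using m0(1)[of "i + 1", unfolded e] m0(2)[of i] False by (simp add: WC.dT_def)
  qed
  moreover have "bc m z i = c i" if "i \<in> Dm m" for i
    using f(2)[OF that DmD(6,7)[OF that]] that by (simp add: bc_def z_def)
  ultimately show ?thesis using z by blast
qed

text \<open>Once row -2 has no coordinate \<open>l = 1\<close>, the cycle equation in that row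
  isolates the coordinates \<open>l = 0\<close> of row -1, multiplied by \<open>ga\<close>. This
  scalar is nonzero except at a doubly bad coordinate, where \<open>bc\<close> vanishes by
  hypothesis.\<close>

lemma tot_Wb: assumes m: "m \<le> -1" and z: "z \<in> WC.tot m" "WC.dT m z = (\<lambda>_. \<zero>\<^bsub>R\<^esub>)" and b0: "bc m z = (\<lambda>_. \<zero>)"
    and r: "\<And>k. k < a \<Longrightarrow> ps k 1 (z (m + 1)) = \<zero>"
  shows "z \<in> WB.tot m"
proof -
  note zW = totW[OF z(1)]
  have b1: "1 < b" using b2 by simp
  have m0: "ps k 0 (z m) = \<zero>" if k: "k < a" for k
  proof (cases "bad m k")
    case True
    then have "m \<in> Dm m \<and> k = nat (-1 - m) \<and> 0 = nat (m - m)" by (intro bad_Dm) (auto simp: bad_def)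
    then show ?thesis using fun_cong[OF b0, of m] by (simp add: bc_def)
  next
    case False
    have j: "jx (m - 1) m = -2" "jx m m = -1" "m \<in> Ix (m - 1)" using m by (auto simp: jx_def Ix_def)
    have "WC.dT m z m = z (m + 1) \<otimes>\<^bsub>R\<^esub> dx (m + 1) (-2) \<oplus>\<^bsub>R\<^esub> z m \<otimes>\<^bsub>R\<^esub> dy m (-1)" using m j by (simp add: WC.dT_def)
    then have "z (m + 1) \<otimes>\<^bsub>R\<^esub> dx (m + 1) (-2) \<oplus>\<^bsub>R\<^esub> z m \<otimes>\<^bsub>R\<^esub> dy m (-1) = \<zero>\<^bsub>R\<^esub>" using z(2) by simp
    then have "ps k 1 (z (m + 1) \<otimes>\<^bsub>R\<^esub> dx (m + 1) (-2)) \<oplus> ps k 1 (z m \<otimes>\<^bsub>R\<^esub> dy m (-1)) = \<zero>"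
      using ps_add[OF k b1, of "z (m + 1) \<otimes>\<^bsub>R\<^esub> dx (m + 1) (-2)" "z m \<otimes>\<^bsub>R\<^esub> dy m (-1)"] ps_zero[OF k b1] zW by simp
    moreover have "ps k 1 (z (m + 1) \<otimes>\<^bsub>R\<^esub> dx (m + 1) (-2)) = \<zero>"
      using ps_dx[OF zW k b1, of "m + 1" "m + 1" "-2"] r[of "k - stp a (m + 1)"] k by auto
    moreover have "ps k 1 (z m \<otimes>\<^bsub>R\<^esub> dy m (-1)) = ga m (-1) k \<otimes> ps k 0 (z m)"
      using ps_dy[OF zW k b1, of m m "-1"] by (simp add: stp_def)
    ultimately have "ga m (-1) k \<otimes> ps k 0 (z m) = \<zero>" using zW k ab by simp
    from K.integral[OF this al_ga_c(2) ps_c[OF k ab(4) W_c[OF zW]]] show ?thesis using ga_zero[OF k] False by blast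
  qed
  have "z i \<in> Wb (jx m i)" if i: "i \<in> Ix m" for i
  proof (rule WbI[OF zW])
    fix k l assume h: "k < a" "l < b" "bad (jx m i) l"
    have "jx m i = m - 1 - i" using m by (simp add: jx_def)
    then consider "i = m" "l = 0" | "i = m + 1" "l = 1" using h(3) by (auto simp: bad_def)
    then show "ps k l (z i) = \<zero>" by cases (use m0 r h(1) in simp_all)
  qed
  then show ?thesis using z(1) by (simp add: WB.tot_def WC.tot_def)
qed

text \<open>The bad coordinates of row -2 that are not doubly bad form a vertical boundary coming
  from row -1. Subtracting it leaves a cycle of the subcomplex \<open>Wb\<close>, which is exact in
  negative degrees.\<close>

lemma bc_kernel: assumes z: "z \<in> WC.tot m" "WC.dT m z = (\<lambda>_. \<zero>\<^bsub>R\<^esub>)" and b0: "bc m z = (\<lambda>_. \<zero>)"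
  shows "\<exists>w\<in>WC.tot (m + 1). z = WC.dT (m + 1) w"
proof (cases "0 \<le> m")
  case True
  then show ?thesis using exactW_nonneg z by blast
next
  case m: False
  note zW = totW[OF z(1)]
  have b1: "1 < b" using b2 by simp
  have "\<exists>w\<in>WC.tot (m + 1). \<forall>k<a. ps k 1 (z (m + 1) \<oplus>\<^bsub>R\<^esub> WC.dT (m + 1) w (m + 1)) = \<zero>"
  proof (cases "m = -1")
    \<comment> \<open>In degree -1 the antidiagonal does not meet row -2, so there is nothing to
      remove.\<close>
    case True
    then have "z (m + 1) = \<zero>\<^bsub>R\<^esub>" using z(1) by (simp add: WC.tot_def Ix_def)
    moreover have "(\<lambda>_. \<zero>\<^bsub>R\<^esub>) \<in> WC.tot (m + 1)" by (simp add: WC.tot_def W_zero)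
    ultimately show ?thesis using b1 by (intro bexI[of _ "\<lambda>_. \<zero>\<^bsub>R\<^esub>"]) (simp_all add: WC.dT_zero ps_zero)
  next
    case False
    then have m2: "m + 1 < 0" using m by simp
    have "\<exists>z1\<in>W. \<forall>k l. k < a \<longrightarrow> l < b \<longrightarrow> ps k l z1 = (if l = 1 then ps k 1 (z (m + 1)) else \<zero>)"
      by (rule W_ex) (use zW b1 in simp)
    then obtain z1 where z1: "z1 \<in> W" "\<And>k l. k < a \<Longrightarrow> l < b \<Longrightarrow> ps k l z1 = (if l = 1 then ps k 1 (z (m + 1)) else \<zero>)" by blast
    have "stp b (-1) \<le> l \<and> \<not> bad (m + 1) k" if h: "k < a" "l < b" "ps k l z1 \<noteq> \<zero>" for k l
    proof -
      have l: "l = 1" "ps k 1 (z (m + 1)) \<noteq> \<zero>" using z1(2)[OF h(1,2)] h(3) by (auto split: if_splits)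
      have "\<not> bad (m + 1) k"
      proof
        assume "bad (m + 1) k"
        moreover have "bad (m - 1 - (m + 1)) 1" by (simp add: bad_def)
        ultimately have "m + 1 \<in> Dm m \<and> k = nat (-1 - (m + 1)) \<and> 1 = nat ((m + 1) - m)" by (rule bad_Dm)
        then show False using fun_cong[OF b0, of "m + 1"] l(2) by (simp add: bc_def)
      qed
      then show ?thesis using l by (simp add: stp_def)
    qed
    from dy_im[OF z1(1) this] obtain w0 where w0: "w0 \<in> W" "z1 = w0 \<otimes>\<^bsub>R\<^esub> dy (m + 1) (-1)" by blast
    \<comment> \<open>The boundary of \<open>w\<close> may alter \<open>z\<close> at the
      neighbouring position as well; only the coordinates \<open>l = 1\<close> at position
      \<open>m + 1\<close> have to be controlled.\<close>
    define w where "w = (\<lambda>i. if i = m + 1 then \<ominus>\<^bsub>R\<^esub> w0 else \<zero>\<^bsub>R\<^esub>)"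
    have "w \<in> WC.tot (m + 1)" using w0(1) m2 by (auto simp: WC.tot_def w_def W_neg W_zero Ix_def)
    moreover have "WC.dT (m + 1) w (m + 1) = \<ominus>\<^bsub>R\<^esub> z1"
    proof -
      have "jx (m + 1) (m + 1) = -1" "m + 1 \<in> Ix (m + 1 - 1)" using m2 by (auto simp: jx_def Ix_def)
      then show ?thesis using m2 W_c[OF w0(1)] unfolding w0(2) by (simp add: WC.dT_def w_def A.l_minus)
    qed
    moreover have "ps k 1 (z (m + 1) \<oplus>\<^bsub>R\<^esub> \<ominus>\<^bsub>R\<^esub> z1) = \<zero>" if "k < a" for k
      using that b1 zW z1(1) z1(2)[OF that b1] by (simp add: ps_add ps_neg K.r_neg)
    ultimately show ?thesis by (intro bexI[of _ w]) simp_all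
  qed
  then obtain w where w: "w \<in> WC.tot (m + 1)" "\<And>k. k < a \<Longrightarrow> ps k 1 (z (m + 1) \<oplus>\<^bsub>R\<^esub> WC.dT (m + 1) w (m + 1)) = \<zero>" by blast
  have dw: "WC.dT (m + 1) w \<in> WC.tot m" using WC.dT_tot[OF w(1)] by simp
  define z' where "z' = (\<lambda>i. z i \<oplus>\<^bsub>R\<^esub> WC.dT (m + 1) w i)"
  have z': "z' \<in> WC.tot m" unfolding z'_def by (rule tot_add[OF z(1) dw])
  have cR: "z i \<in> carrier R" "WC.dT (m + 1) w i \<in> carrier R" "w i \<in> carrier R" for i
    using totW[OF z(1)] totW[OF dw] totW[OF w(1)] by simp_all
  have dz': "WC.dT m z' = (\<lambda>_. \<zero>\<^bsub>R\<^esub>)"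
    unfolding z'_def WC.dT_add[OF cR(1,2)] z(2) WC.dT_dT[OF w(1)] by simp
  have "bc m z' = (\<lambda>_. \<zero>)" unfolding z'_def bc_add[OF z(1) dw] b0 bc_dT[OF w(1)] by simp
  from tot_Wb[OF _ z' dz' this] w(2) m have "z' \<in> WB.tot m" by (simp add: z'_def)
  then obtain v where v: "v \<in> WB.tot (m + 1)" "z' = WC.dT (m + 1) v" using exactB_neg[of m z'] dz' m by auto
  have vW: "v \<in> WC.tot (m + 1)" using v(1) Wb_W unfolding WB.tot_def WC.tot_def by blast
  have vR: "v i \<in> carrier R" for i using totW[OF vW] by simp
  let ?e = "\<ominus>\<^bsub>R\<^esub> \<one>\<^bsub>R\<^esub>"
  have eR: "?e \<in> carrier R" "?e \<otimes>\<^bsub>R\<^esub> w i \<in> carrier R" for i using cR by simp_all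
  have nw: "(\<lambda>i. ?e \<otimes>\<^bsub>R\<^esub> w i) \<in> WC.tot (m + 1)"
    using w(1) W_neg totW[OF w(1)] by (auto simp: WC.tot_def A.l_minus)
  have "WC.dT (m + 1) (\<lambda>i. v i \<oplus>\<^bsub>R\<^esub> ?e \<otimes>\<^bsub>R\<^esub> w i) = (\<lambda>i. z' i \<oplus>\<^bsub>R\<^esub> ?e \<otimes>\<^bsub>R\<^esub> WC.dT (m + 1) w i)"
    unfolding WC.dT_add[OF vR eR(2)] WC.dT_lmult[OF cR(3) eR(1)] v(2) ..
  also have "\<dots> = z" using cR by (auto simp: z'_def A.l_minus A.a_assoc A.r_neg)
  finally show ?thesis using tot_add[OF vW nw] by metis
qed

end

section \<open>Reduction to the invariants\<close>

text \<open>\<open>M\<close> stands for the algebra as a bimodule, kept abstract: a cyclic module on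
  whose generator the two actions agree, and into which \<open>Sy\<close>, the copy
  \<open>1 \<otimes> A\<close> of the algebra, embeds by acting on the generator.\<close>

locale tate_qring = qring_free K R a b q X Y X' Y' co + tt: tate K R T d + mm: left_module R M
  for K :: "('k, 'z) ring_scheme" (structure) and R :: "('k, 'r) module" (structure)
    and a b :: nat and q :: 'k and X Y X' Y' :: 'r and co :: "nat \<Rightarrow> nat \<Rightarrow> nat \<Rightarrow> nat \<Rightarrow> 'r \<Rightarrow> 'k"
    and T :: "int \<Rightarrow> ('r, 'm) module" and d :: "int \<Rightarrow> 'm \<Rightarrow> 'm" and M :: "('r, 'a) module" +
  fixes m0 :: 'a and \<eta> :: "'m \<Rightarrow> 'a"
  assumes m0: "m0 \<in> carrier M" and gen: "x \<in> carrier M \<Longrightarrow> \<exists>r\<in>carrier R. x = r \<odot>\<^bsub>M\<^esub> m0"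
    and Xm0: "X \<odot>\<^bsub>M\<^esub> m0 = X' \<odot>\<^bsub>M\<^esub> m0" and Ym0: "Y \<odot>\<^bsub>M\<^esub> m0 = Y' \<odot>\<^bsub>M\<^esub> m0"
    and Sy_inj: "u \<in> Sy \<Longrightarrow> u \<odot>\<^bsub>M\<^esub> m0 = \<zero>\<^bsub>M\<^esub> \<Longrightarrow> u = \<zero>\<^bsub>R\<^esub>"
    and eta: "\<eta> \<in> module_hom R (T 0) M" and eta_sur: "\<eta> ` carrier (T 0) = carrier M"
    and eta_ker: "{x \<in> carrier (T 0). \<eta> x = \<zero>\<^bsub>M\<^esub>} = d 1 ` carrier (T 1)"
begin

section \<open>The explicit acyclic complex as a complex of free modules, and its syzygies\<close>

abbreviation C :: "int \<Rightarrow> ('r, int \<Rightarrow> 'r) module" where "C m \<equiv> free_module R (Ix m)"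
abbreviation Z :: "int \<Rightarrow> ('r, int \<Rightarrow> 'r) module" where "Z m \<equiv> tt.ker_mod (C m) (RC.dT m) (C (m - 1))"

lemma C_tot: "carrier (C m) = RC.tot m"
proof (rule Set.set_eqI)
  fix z
  show "z \<in> carrier (C m) \<longleftrightarrow> z \<in> RC.tot m"
  proof
    show "z \<in> carrier (C m) \<Longrightarrow> z \<in> RC.tot m" by (simp add: free_carrier RC.tot_def)
    assume "z \<in> RC.tot m"
    then have z: "\<And>i. i \<in> Ix m \<Longrightarrow> z i \<in> carrier R" "\<And>i. i \<notin> Ix m \<Longrightarrow> z i = \<zero>\<^bsub>R\<^esub>" by (auto simp: RC.tot_def)
    have "z i \<in> carrier R" for i using z by (cases "i \<in> Ix m") simp_all
    moreover have "supp R z \<subseteq> Ix m" using z(2) by (auto simp: supp_def)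
    then have "finite (supp R z)" by (rule finite_subset[OF _ finite_Ix])
    ultimately show "z \<in> carrier (C m)" using z(2) by (simp add: free_carrier)
  qed
qed

lemma C_mod: "left_module R (C m)" by (rule free_left_module[OF A.ring_axioms])

lemma dC_hom: "RC.dT m \<in> module_hom R (C m) (C (m - 1))"
proof (rule module_homI)
  show "RC.dT m z \<in> carrier (C (m - 1))" if "z \<in> carrier (C m)" for z using RC.dT_tot that by (simp add: C_tot)
  show "RC.dT m (z \<oplus>\<^bsub>C m\<^esub> w) = RC.dT m z \<oplus>\<^bsub>C (m - 1)\<^esub> RC.dT m w" if z: "z \<in> carrier (C m)" and w: "w \<in> carrier (C m)" for z w
    unfolding free_simps by (rule RC.dT_add) (use z w in \<open>simp_all add: free_carrier\<close>)
  show "RC.dT m (r \<odot>\<^bsub>C m\<^esub> z) = r \<odot>\<^bsub>C (m - 1)\<^esub> RC.dT m z" if r: "r \<in> carrier R" and z: "z \<in> carrier (C m)" for r z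
    unfolding free_simps by (rule RC.dT_lmult) (use r z in \<open>simp_all add: free_carrier\<close>)
qed

lemma dC_hom': "RC.dT (m + 1) \<in> module_hom R (C (m + 1)) (C m)" using dC_hom[of "m + 1"] by simp

lemma Z_mod: "left_module R (Z m)"
  unfolding tt.ker_mod_def by (rule kernel_left_module[OF C_mod C_mod dC_hom])

lemma Z_simps: "carrier (Z m) = {z \<in> RC.tot m. RC.dT m z = (\<lambda>_. \<zero>\<^bsub>R\<^esub>)}" "zero (Z m) = (\<lambda>_. \<zero>\<^bsub>R\<^esub>)"
  "z \<oplus>\<^bsub>Z m\<^esub> w = (\<lambda>i. z i \<oplus>\<^bsub>R\<^esub> w i)" "r \<odot>\<^bsub>Z m\<^esub> z = (\<lambda>i. r \<otimes>\<^bsub>R\<^esub> z i)"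
  by (simp_all add: tt.ker_simps C_tot free_simps)

text \<open>Exchanging the two factors makes \<open>z dy 0 0\<close> a row cycle at the auxiliary
  position \<open>(0, -1)\<close>. Rows are exact there as well, and \<open>column_exact\<close>
  with \<open>j = 0\<close> finishes.\<close>

lemma glue_0: assumes z: "z \<in> carrier R" and e: "z \<otimes>\<^bsub>R\<^esub> dx 0 0 \<otimes>\<^bsub>R\<^esub> dy (-1) 0 = \<zero>\<^bsub>R\<^esub>"
  shows "\<exists>w\<in>carrier R. \<exists>w'\<in>carrier R. z = w' \<otimes>\<^bsub>R\<^esub> dx 1 0 \<oplus>\<^bsub>R\<^esub> w \<otimes>\<^bsub>R\<^esub> dy 0 1"
proof -
  have 1: "z \<otimes>\<^bsub>R\<^esub> dy 0 0 \<in> carrier R" using z by simp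
  have "z \<otimes>\<^bsub>R\<^esub> dy 0 0 \<otimes>\<^bsub>R\<^esub> dx 0 (-1) = \<zero>\<^bsub>R\<^esub>" using RC.anti[OF z, of 0 0] e z by simp
  then obtain u where u: "u \<in> carrier R" "z \<otimes>\<^bsub>R\<^esub> dy 0 0 = u \<otimes>\<^bsub>R\<^esub> dx 1 (-1)"
    using rows_exact[OF 1, of 0 "-1"] by auto
  have "z \<otimes>\<^bsub>R\<^esub> dy 0 0 = u \<otimes>\<^bsub>R\<^esub> dx 1 (0 - 1)" using u(2) by simp
  from column_exact[OF z u(1) this] show ?thesis by simp
qed

lemma C_exact: assumes z: "z \<in> RC.tot m" "RC.dT m z = (\<lambda>_. \<zero>\<^bsub>R\<^esub>)"
  shows "\<exists>w\<in>RC.tot (m + 1). z = RC.dT (m + 1) w"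
proof -
  consider "1 \<le> m" | "m = 0" | "m = -1" | "m \<le> -2" by linarith
  then show ?thesis
  proof cases
    case 1
    show ?thesis by (rule RC.tot_exact_pos[OF 1 rows_exact column_exact z])
  next
    case 2
    have "\<exists>w\<in>RC.tot 1. z = RC.dT 1 w" by (rule RC.tot_exact_0[OF glue_0]) (use z 2 in simp_all)
    then show ?thesis using 2 by simp
  next
    case 3
    have g: "\<exists>w\<in>carrier R. z = w \<otimes>\<^bsub>R\<^esub> dx 0 0 \<otimes>\<^bsub>R\<^esub> dy (-1) 0"
      if zc: "z \<in> carrier R" "z \<otimes>\<^bsub>R\<^esub> dx (-1) (-1) = \<zero>\<^bsub>R\<^esub>" "z \<otimes>\<^bsub>R\<^esub> dy (-1) (-1) = \<zero>\<^bsub>R\<^esub>" for z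
    proof -
      obtain w where w: "w \<in> carrier R" "z = w \<otimes>\<^bsub>R\<^esub> dy 0 0 \<otimes>\<^bsub>R\<^esub> dx 0 (-1)" using column3_exact[OF zc] by auto
      have "z = (\<ominus>\<^bsub>R\<^esub> w) \<otimes>\<^bsub>R\<^esub> dx 0 0 \<otimes>\<^bsub>R\<^esub> dy (-1) 0"
        using RC.anti'[OF w(1), of 0 0] w by (simp add: A.l_minus)
      then show ?thesis using w(1) by blast
    qed
    have "\<exists>w\<in>RC.tot 0. z = RC.dT 0 w" by (rule RC.tot_exact_minus1[OF g]) (use z 3 in simp_all)
    then show ?thesis using 3 by simp
  next
    case 4
    show ?thesis by (rule RC.tot_exact_neg[OF 4 rows_exact column3_exact' z])
  qed
qed

lemma dC_sur: "RC.dT (m + 1) ` carrier (C (m + 1)) = carrier (Z m)"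
proof
  show "RC.dT (m + 1) ` carrier (C (m + 1)) \<subseteq> carrier (Z m)"
    using RC.dT_tot[of _ "m + 1"] RC.dT_dT[of _ m] by (auto simp: Z_simps C_tot)
  show "carrier (Z m) \<subseteq> RC.dT (m + 1) ` carrier (C (m + 1))"
    using C_exact by (auto simp: Z_simps C_tot)
qed

lemma dC_homZ: "RC.dT (m + 1) \<in> module_hom R (C (m + 1)) (Z m)"
proof (rule tt.hom_kerI[OF dC_hom'])
  fix z assume "z \<in> carrier (C (m + 1))"
  then show "RC.dT m (RC.dT (m + 1) z) = \<zero>\<^bsub>C (m - 1)\<^esub>" using RC.dT_dT by (simp add: C_tot free_simps)
qed

lemma dx10: "dx 1 0 = X \<ominus>\<^bsub>R\<^esub> X'" and dy01: "dy 0 1 = Y \<ominus>\<^bsub>R\<^esub> Y'"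
  using dx_odd[of 1 0] dy0_odd[of 1] by (simp_all add: HX.D_def HY.D_def)

lemma d_m0: "dx 1 0 \<odot>\<^bsub>M\<^esub> m0 = \<zero>\<^bsub>M\<^esub>" "dy 0 1 \<odot>\<^bsub>M\<^esub> m0 = \<zero>\<^bsub>M\<^esub>"
proof -
  have *: "(r \<ominus>\<^bsub>R\<^esub> s) \<odot>\<^bsub>M\<^esub> m0 = \<zero>\<^bsub>M\<^esub>" if "r \<in> carrier R" "s \<in> carrier R" "r \<odot>\<^bsub>M\<^esub> m0 = s \<odot>\<^bsub>M\<^esub> m0" for r s
    unfolding A.minus_eq mm.smult_l_distr[OF that(1) A.a_inv_closed[OF that(2)] m0] mm.smult_l_minus[OF that(2) m0] that(3)
    by (rule mm.M.r_neg[OF mm.smult_closed[OF that(2) m0]])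
  show "dx 1 0 \<odot>\<^bsub>M\<^esub> m0 = \<zero>\<^bsub>M\<^esub>" "dy 0 1 \<odot>\<^bsub>M\<^esub> m0 = \<zero>\<^bsub>M\<^esub>"
    unfolding dx10 dy01 by (rule * gens Xm0 Ym0)+
qed

text \<open>Dividing by \<open>X - X'\<close> and the remainder by \<open>Y - Y'\<close> reduces
  \<open>r\<close> to an element of \<open>Sy\<close>, and \<open>Sy_inj\<close> forces it to
  vanish.\<close>

lemma ann_m0: assumes r: "r \<in> carrier R"
  shows "r \<odot>\<^bsub>M\<^esub> m0 = \<zero>\<^bsub>M\<^esub> \<longleftrightarrow> (\<exists>w\<in>carrier R. \<exists>w'\<in>carrier R. r = w' \<otimes>\<^bsub>R\<^esub> dx 1 0 \<oplus>\<^bsub>R\<^esub> w \<otimes>\<^bsub>R\<^esub> dy 0 1)"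
proof
  have k: "(w' \<otimes>\<^bsub>R\<^esub> dx 1 0 \<oplus>\<^bsub>R\<^esub> w \<otimes>\<^bsub>R\<^esub> dy 0 1) \<odot>\<^bsub>M\<^esub> m0 = \<zero>\<^bsub>M\<^esub>" if w: "w \<in> carrier R" "w' \<in> carrier R" for w w'
    using w m0 by (simp add: mm.smult_l_distr mm.smult_assoc d_m0 mm.smult_r_zero)
  then show "\<exists>w\<in>carrier R. \<exists>w'\<in>carrier R. r = w' \<otimes>\<^bsub>R\<^esub> dx 1 0 \<oplus>\<^bsub>R\<^esub> w \<otimes>\<^bsub>R\<^esub> dy 0 1 \<Longrightarrow> r \<odot>\<^bsub>M\<^esub> m0 = \<zero>\<^bsub>M\<^esub>" by blast
  assume 0: "r \<odot>\<^bsub>M\<^esub> m0 = \<zero>\<^bsub>M\<^esub>"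
  obtain s w' where s: "s \<in> Sx" "w' \<in> carrier R" "r = s \<oplus>\<^bsub>R\<^esub> w' \<otimes>\<^bsub>R\<^esub> dx 1 0"
    using HX.mod_D[OF r, of "Qz (dg b 0)"] by (auto simp: dx_odd)
  obtain u w where u: "u \<in> Sy" "w \<in> Sx" "s = u \<oplus>\<^bsub>R\<^esub> w \<otimes>\<^bsub>R\<^esub> dy 0 1"
    using HY.mod_D[OF s(1), of "\<one>"] by (auto simp: dy0_odd)
  have c: "u \<in> carrier R" "w \<in> carrier R" "s \<in> carrier R" using SyD(1)[OF u(1)] SxD(1)[OF u(2)] SxD(1)[OF s(1)] by simp_all
  have re: "r = u \<oplus>\<^bsub>R\<^esub> (w' \<otimes>\<^bsub>R\<^esub> dx 1 0 \<oplus>\<^bsub>R\<^esub> w \<otimes>\<^bsub>R\<^esub> dy 0 1)" unfolding s(3) u(3) using c s(2) by (simp add: A.a_ac)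
  have "r \<odot>\<^bsub>M\<^esub> m0 = u \<odot>\<^bsub>M\<^esub> m0 \<oplus>\<^bsub>M\<^esub> (w' \<otimes>\<^bsub>R\<^esub> dx 1 0 \<oplus>\<^bsub>R\<^esub> w \<otimes>\<^bsub>R\<^esub> dy 0 1) \<odot>\<^bsub>M\<^esub> m0"
    unfolding re using c s(2) m0 by (intro mm.smult_l_distr) simp_all
  then have "u \<odot>\<^bsub>M\<^esub> m0 = \<zero>\<^bsub>M\<^esub>" unfolding 0 k[OF c(2) s(2)] using mm.smult_closed[OF c(1) m0] by simp
  then have "u = \<zero>\<^bsub>R\<^esub>" by (rule Sy_inj[OF u(1)])
  then show "\<exists>w\<in>carrier R. \<exists>w'\<in>carrier R. r = w' \<otimes>\<^bsub>R\<^esub> dx 1 0 \<oplus>\<^bsub>R\<^esub> w \<otimes>\<^bsub>R\<^esub> dy 0 1" using re c s(2) by (intro bexI[of _ w] bexI[of _ w']) simp_all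
qed

definition aug :: "(int \<Rightarrow> 'r) \<Rightarrow> 'a" where "aug z = z 0 \<odot>\<^bsub>M\<^esub> m0"

lemma aug_hom: "aug \<in> module_hom R (C 0) M"
  by (rule module_homI) (simp_all add: aug_def free_carrier free_simps m0 mm.smult_closed mm.smult_l_distr mm.smult_assoc)

lemma aug_sur: "aug ` carrier (C 0) = carrier M"
proof
  show "aug ` carrier (C 0) \<subseteq> carrier M" using module_homD(1)[OF aug_hom] by blast
  show "carrier M \<subseteq> aug ` carrier (C 0)"
  proof
    fix x assume "x \<in> carrier M"
    then obtain r where r: "r \<in> carrier R" "x = r \<odot>\<^bsub>M\<^esub> m0" using gen by blast
    have "(\<lambda>i. if i = 0 then r else \<zero>\<^bsub>R\<^esub>) \<in> carrier (C 0)" using r(1) unfolding C_tot unfolding RC.tot_def Ix_def by simp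
    moreover have "x = aug (\<lambda>i. if i = 0 then r else \<zero>\<^bsub>R\<^esub>)" using r(2) by (simp add: aug_def)
    ultimately show "x \<in> aug ` carrier (C 0)" by blast
  qed
qed

text \<open>Both kernels are the left ideal generated by \<open>X - X'\<close> and
  \<open>Y - Y'\<close>, by \<open>ann_m0\<close> for the augmentation and by \<open>glue_0\<close>
  for the joining map. So the syzygy \<open>Z 0\<close> is also the kernel of the augmentation,
  which starts the shifting at \<open>M\<close>.\<close>

lemma aug_ker: assumes z: "z \<in> carrier (C 0)" shows "aug z = \<zero>\<^bsub>M\<^esub> \<longleftrightarrow> RC.dT 0 z = (\<lambda>_. \<zero>\<^bsub>R\<^esub>)"
proof -
  have z0: "z 0 \<in> carrier R" using z by (simp add: free_carrier)
  have "RC.dT 0 z = (\<lambda>_. \<zero>\<^bsub>R\<^esub>) \<longleftrightarrow> z 0 \<otimes>\<^bsub>R\<^esub> dx 0 0 \<otimes>\<^bsub>R\<^esub> dy (-1) 0 = \<zero>\<^bsub>R\<^esub>"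
    unfolding RC.dT_def fun_eq_iff by (simp add: Ix_def)
  also have "\<dots> \<longleftrightarrow> (\<exists>w\<in>carrier R. \<exists>w'\<in>carrier R. z 0 = w' \<otimes>\<^bsub>R\<^esub> dx 1 0 \<oplus>\<^bsub>R\<^esub> w \<otimes>\<^bsub>R\<^esub> dy 0 1)"
  proof
    assume "\<exists>w\<in>carrier R. \<exists>w'\<in>carrier R. z 0 = w' \<otimes>\<^bsub>R\<^esub> dx 1 0 \<oplus>\<^bsub>R\<^esub> w \<otimes>\<^bsub>R\<^esub> dy 0 1"
    then obtain w w' where w: "w \<in> carrier R" "w' \<in> carrier R" "z 0 = w' \<otimes>\<^bsub>R\<^esub> dx 1 0 \<oplus>\<^bsub>R\<^esub> w \<otimes>\<^bsub>R\<^esub> dy 0 1" by blast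
    have 1: "w' \<otimes>\<^bsub>R\<^esub> dx 1 0 \<otimes>\<^bsub>R\<^esub> dx 0 0 = \<zero>\<^bsub>R\<^esub>" using RC.dxdx[OF w(2), of 1 0] by simp
    have w1: "w \<otimes>\<^bsub>R\<^esub> dx 0 1 \<in> carrier R" using w by simp
    have "w \<otimes>\<^bsub>R\<^esub> dx 0 1 \<otimes>\<^bsub>R\<^esub> dy (-1) 1 \<oplus>\<^bsub>R\<^esub> w \<otimes>\<^bsub>R\<^esub> dy 0 1 \<otimes>\<^bsub>R\<^esub> dx 0 0 = \<zero>\<^bsub>R\<^esub>" using RC.anti[OF w(1), of 0 1] by simp
    then have 2: "w \<otimes>\<^bsub>R\<^esub> dy 0 1 \<otimes>\<^bsub>R\<^esub> dx 0 0 = \<ominus>\<^bsub>R\<^esub> (w \<otimes>\<^bsub>R\<^esub> dx 0 1 \<otimes>\<^bsub>R\<^esub> dy (-1) 1)"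
      using A.minus_equality[of "w \<otimes>\<^bsub>R\<^esub> dy 0 1 \<otimes>\<^bsub>R\<^esub> dx 0 0" "w \<otimes>\<^bsub>R\<^esub> dx 0 1 \<otimes>\<^bsub>R\<^esub> dy (-1) 1"] w by (simp add: A.a_comm)
    have 3: "w \<otimes>\<^bsub>R\<^esub> dx 0 1 \<otimes>\<^bsub>R\<^esub> dy (-1) 1 \<otimes>\<^bsub>R\<^esub> dy (-1) 0 = \<zero>\<^bsub>R\<^esub>" using RC.dydy[OF w1, of "-1" 1] by simp
    have "z 0 \<otimes>\<^bsub>R\<^esub> dx 0 0 = \<ominus>\<^bsub>R\<^esub> (w \<otimes>\<^bsub>R\<^esub> dx 0 1 \<otimes>\<^bsub>R\<^esub> dy (-1) 1)" unfolding w(3) 2[symmetric] using w 1 by (simp add: A.l_distr)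
    then show "z 0 \<otimes>\<^bsub>R\<^esub> dx 0 0 \<otimes>\<^bsub>R\<^esub> dy (-1) 0 = \<zero>\<^bsub>R\<^esub>" using 3 w by (simp add: A.l_minus)
  qed (rule glue_0[OF z0])
  finally show ?thesis using ann_m0[OF z0] by (simp add: aug_def)
qed

lemma shift_M: "lin_corr K (tt.coc n M) (Hom_coboundaries R T d M n) (tt.coc (n + 1) (Z 0)) (Hom_coboundaries R T d (Z 0) (n + 1))"
proof -
  have "tt.ker_mod (C 0) aug M = Z 0"
    unfolding tt.ker_mod_def using aug_ker by (auto simp: free_simps cong: conj_cong)
  then show ?thesis using tt.shift[OF tt.acyc_free[OF finite_Ix] mm.left_module_axioms aug_hom aug_sur, of n] by simp
qed

lemma shift_Z: "lin_corr K (tt.coc n (Z m)) (Hom_coboundaries R T d (Z m) n) (tt.coc (n + 1) (Z (m + 1))) (Hom_coboundaries R T d (Z (m + 1)) (n + 1))"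
proof -
  have "tt.ker_mod (C (m + 1)) (RC.dT (m + 1)) (Z m) = Z (m + 1)"
    unfolding tt.ker_mod_def[of "C (m + 1)"] by (simp add: tt.ker_simps free_simps)
  then show ?thesis using tt.shift[OF tt.acyc_free[OF finite_Ix] Z_mod dC_homZ dC_sur, of n m] by simp
qed

lemma shifts_Z: "lin_corr K (tt.coc n (Z m)) (Hom_coboundaries R T d (Z m) n)
   (tt.coc (n + int (Suc k)) (Z (m + int (Suc k)))) (Hom_coboundaries R T d (Z (m + int (Suc k))) (n + int (Suc k)))"
proof (induction k)
  case 0
  then show ?case using shift_Z[of n m] by simp
next
  case (Suc k)
  have e: "x + int (Suc k) + 1 = x + int (Suc (Suc k))" for x by simp
  show ?case using lin_corr_trans[OF Suc shift_Z[of "n + int (Suc k)" "m + int (Suc k)"]] unfolding e .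
qed

text \<open>Cohomological degree and index of the syzygy rise together, so \<open>Z 0\<close> in
  degree \<open>n + 1\<close> is linked to \<open>Z (- n - 1)\<close> in degree 0. For
  \<open>n \<ge> 0\<close> the shifts are run backwards, through syzygies of negative index.\<close>

lemma to_degree_0: "lin_corr K (tt.coc n M) (Hom_coboundaries R T d M n) (tt.coc 0 (Z (- n - 1))) (Hom_coboundaries R T d (Z (- n - 1)) 0)"
proof -
  consider "n + 1 = 0" | "n + 1 < 0" | "0 < n + 1" by linarith
  then show ?thesis
  proof cases
    case 1
    then have "n + 1 = 0" "- n - 1 = 0" by auto
    then show ?thesis using shift_M[of n] by simp
  next
    case 2
    define k where "k = nat (- n - 2)"
    have e: "n + 1 + int (Suc k) = 0" "0 + int (Suc k) = - n - 1" using 2 by (auto simp: k_def)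
    show ?thesis using lin_corr_trans[OF shift_M shifts_Z[of "n + 1" 0 k]] unfolding e .
  next
    case 3
    define k where "k = nat n"
    have e: "0 + int (Suc k) = n + 1" "- n - 1 + int (Suc k) = 0" using 3 by (auto simp: k_def)
    show ?thesis using lin_corr_trans[OF shift_M lin_corr_sym[OF shifts_Z[of 0 "- n - 1" k, unfolded e]]] .
  qed
qed

text \<open>The annihilator of the generator is generated by the two commutators, so invariance can
  be tested on these, in each component separately.\<close>

lemma inv_C: "tt.inv_set M m0 (C m) = WC.tot m"
proof (rule Set.set_eqI)
  fix z
  have in_W: "w \<in> W \<longleftrightarrow> (\<forall>r\<in>carrier R. r \<odot>\<^bsub>M\<^esub> m0 = \<zero>\<^bsub>M\<^esub> \<longrightarrow> r \<otimes>\<^bsub>R\<^esub> w = \<zero>\<^bsub>R\<^esub>)" if w: "w \<in> carrier R" for w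
  proof
    assume wW: "w \<in> W"
    have 0: "dx 1 0 \<otimes>\<^bsub>R\<^esub> w = \<zero>\<^bsub>R\<^esub>" "dy 0 1 \<otimes>\<^bsub>R\<^esub> w = \<zero>\<^bsub>R\<^esub>"
      using WD[OF wW] w by (simp_all add: dx10 dy01 A.minus_eq A.l_distr A.l_minus A.r_neg)
    show "\<forall>r\<in>carrier R. r \<odot>\<^bsub>M\<^esub> m0 = \<zero>\<^bsub>M\<^esub> \<longrightarrow> r \<otimes>\<^bsub>R\<^esub> w = \<zero>\<^bsub>R\<^esub>"
    proof (intro ballI impI)
      fix r assume "r \<in> carrier R" "r \<odot>\<^bsub>M\<^esub> m0 = \<zero>\<^bsub>M\<^esub>"
      then obtain u u' where u: "u \<in> carrier R" "u' \<in> carrier R" "r = u' \<otimes>\<^bsub>R\<^esub> dx 1 0 \<oplus>\<^bsub>R\<^esub> u \<otimes>\<^bsub>R\<^esub> dy 0 1" using ann_m0 by blast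
      show "r \<otimes>\<^bsub>R\<^esub> w = \<zero>\<^bsub>R\<^esub>" unfolding u(3) using u w by (simp add: A.l_distr A.m_assoc 0)
    qed
  next
    assume h: "\<forall>r\<in>carrier R. r \<odot>\<^bsub>M\<^esub> m0 = \<zero>\<^bsub>M\<^esub> \<longrightarrow> r \<otimes>\<^bsub>R\<^esub> w = \<zero>\<^bsub>R\<^esub>"
    then have "dx 1 0 \<otimes>\<^bsub>R\<^esub> w = \<zero>\<^bsub>R\<^esub>" "dy 0 1 \<otimes>\<^bsub>R\<^esub> w = \<zero>\<^bsub>R\<^esub>" using d_m0 d_c by blast+
    then have "X \<otimes>\<^bsub>R\<^esub> w \<ominus>\<^bsub>R\<^esub> X' \<otimes>\<^bsub>R\<^esub> w = \<zero>\<^bsub>R\<^esub>" "Y \<otimes>\<^bsub>R\<^esub> w \<ominus>\<^bsub>R\<^esub> Y' \<otimes>\<^bsub>R\<^esub> w = \<zero>\<^bsub>R\<^esub>"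
      using w by (simp_all add: dx10 dy01 A.minus_eq A.l_distr A.l_minus)
    then have "X \<otimes>\<^bsub>R\<^esub> w = X' \<otimes>\<^bsub>R\<^esub> w" "Y \<otimes>\<^bsub>R\<^esub> w = Y' \<otimes>\<^bsub>R\<^esub> w" using w by (auto intro!: A.minus_eq_zeroD)
    then show "w \<in> W" using w unfolding W_def by blast
  qed
  have "z \<in> tt.inv_set M m0 (C m) \<longleftrightarrow> z \<in> carrier (C m) \<and> (\<forall>i. z i \<in> W)"
  proof -
    have "(\<forall>r\<in>carrier R. r \<odot>\<^bsub>M\<^esub> m0 = \<zero>\<^bsub>M\<^esub> \<longrightarrow> (\<lambda>i. r \<otimes>\<^bsub>R\<^esub> z i) = (\<lambda>i. \<zero>\<^bsub>R\<^esub>)) \<longleftrightarrow> (\<forall>i. z i \<in> W)" if "z \<in> carrier (C m)"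
      using in_W[of "z i" for i] that unfolding free_carrier fun_eq_iff by blast
    then show ?thesis by (auto simp: tt.inv_set_def free_simps)
  qed
  also have "\<dots> \<longleftrightarrow> z \<in> WC.tot m"
    using totW[of z m] W_c by (auto simp: C_tot RC.tot_def WC.tot_def)
  finally show "z \<in> tt.inv_set M m0 (C m) \<longleftrightarrow> z \<in> WC.tot m" .
qed

lemma inv_Z: "tt.inv_set M m0 (Z m) = {z \<in> WC.tot m. WC.dT m z = (\<lambda>_. \<zero>\<^bsub>R\<^esub>)}"
  unfolding inv_C[symmetric] tt.inv_set_def tt.ker_simps by (auto simp: free_simps)

text \<open>The correspondence is the graph of \<open>bc\<close>, which is linear, onto by
  \<open>bc_surj\<close>, and has precisely the boundaries as kernel by \<open>bc_dT\<close> and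
  \<open>bc_kernel\<close>.\<close>

lemma corr_bc: "lin_corr K (tt.inv_space M m0 (Z m)) (RC.dT (m + 1) ` tt.inv_set M m0 (C (m + 1))) (free_module K (Dm m)) {\<lambda>_. \<zero>}"
proof (rule lin_corrI[where P = "\<lambda>z y. z \<in> tt.inv_set M m0 (Z m) \<and> y = bc m z"])
  have fin: "finite (Dm m)" by (simp add: Dm_def)
  have bf: "bc m z \<in> carrier (free_module K (Dm m))" if "z \<in> tt.inv_set M m0 (Z m)" for z
  proof -
    have "finite (supp K (bc m z))" by (rule finite_subset[OF _ fin]) (auto simp: supp_def bc_def)
    then show ?thesis using that bc_c[of z m] by (simp add: free_carrier inv_Z) (simp add: bc_def)
  qed
  show "v \<in> carrier (tt.inv_space M m0 (Z m)) \<and> v' \<in> carrier (free_module K (Dm m))" if "v \<in> tt.inv_set M m0 (Z m) \<and> v' = bc m v" for v v'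
    using that bf by (simp add: tt.inv_simps)
  show "\<exists>v'. v \<in> tt.inv_set M m0 (Z m) \<and> v' = bc m v" if "v \<in> carrier (tt.inv_space M m0 (Z m))" for v
    using that by (simp add: tt.inv_simps)
  show "\<exists>v. v \<in> tt.inv_set M m0 (Z m) \<and> v' = bc m v" if "v' \<in> carrier (free_module K (Dm m))" for v'
  proof -
    have v': "\<And>i. v' i \<in> carrier K" "\<And>i. i \<notin> Dm m \<Longrightarrow> v' i = \<zero>" using that by (auto simp: free_carrier)
    obtain z where z: "z \<in> WC.tot m" "WC.dT m z = (\<lambda>_. \<zero>\<^bsub>R\<^esub>)" "\<And>i. i \<in> Dm m \<Longrightarrow> bc m z i = v' i"
      using bc_surj[of m v'] v'(1) by blast
    have "v' = bc m z"
    proof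
      fix i show "v' i = bc m z i" using z(3)[of i] v'(2)[of i] by (cases "i \<in> Dm m") (simp_all add: bc_def)
    qed
    then show ?thesis using z(1,2) by (auto simp: inv_Z)
  qed
  show "u \<oplus>\<^bsub>tt.inv_space M m0 (Z m)\<^esub> v \<in> tt.inv_set M m0 (Z m) \<and> u' \<oplus>\<^bsub>free_module K (Dm m)\<^esub> v' = bc m (u \<oplus>\<^bsub>tt.inv_space M m0 (Z m)\<^esub> v)"
    if "u \<in> tt.inv_set M m0 (Z m) \<and> u' = bc m u" "v \<in> tt.inv_set M m0 (Z m) \<and> v' = bc m v" for u u' v v'
  proof -
    have u: "u \<in> WC.tot m" "WC.dT m u = (\<lambda>_. \<zero>\<^bsub>R\<^esub>)" and v: "v \<in> WC.tot m" "WC.dT m v = (\<lambda>_. \<zero>\<^bsub>R\<^esub>)" using that by (auto simp: inv_Z)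
    have "WC.dT m (\<lambda>i. u i \<oplus>\<^bsub>R\<^esub> v i) = (\<lambda>_. \<zero>\<^bsub>R\<^esub>)"
      using WC.dT_add[of u v m] W_c[OF totW[OF u(1)]] W_c[OF totW[OF v(1)]] u(2) v(2) by simp
    then show ?thesis using that bc_add[OF u(1) v(1)] tot_add[OF u(1) v(1)] by (simp add: tt.inv_simps Z_simps inv_Z free_simps)
  qed
  show "c \<odot>\<^bsub>tt.inv_space M m0 (Z m)\<^esub> v \<in> tt.inv_set M m0 (Z m) \<and> c \<odot>\<^bsub>free_module K (Dm m)\<^esub> v' = bc m (c \<odot>\<^bsub>tt.inv_space M m0 (Z m)\<^esub> v)"
    if c: "c \<in> carrier K" and "v \<in> tt.inv_set M m0 (Z m) \<and> v' = bc m v" for c v v'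
  proof -
    have v: "v \<in> WC.tot m" "WC.dT m v = (\<lambda>_. \<zero>\<^bsub>R\<^esub>)" "v' = bc m v" using that by (auto simp: inv_Z)
    note vR = W_c[OF totW[OF v(1)]]
    have cc: "(c \<odot>\<^bsub>R\<^esub> \<one>\<^bsub>R\<^esub>) \<otimes>\<^bsub>R\<^esub> v i = c \<odot>\<^bsub>R\<^esub> v i" for i using c vR by (simp add: sc_lmult)
    have "WC.dT m (\<lambda>i. (c \<odot>\<^bsub>R\<^esub> \<one>\<^bsub>R\<^esub>) \<otimes>\<^bsub>R\<^esub> v i) = (\<lambda>_. \<zero>\<^bsub>R\<^esub>)"
      using WC.dT_lmult[of v "c \<odot>\<^bsub>R\<^esub> \<one>\<^bsub>R\<^esub>" m] c vR v(2) by simp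
    moreover have "(\<lambda>i. c \<odot>\<^bsub>R\<^esub> v i) \<in> WC.tot m" using v(1) c W_sc by (auto simp: WC.tot_def)
    ultimately show ?thesis using bc_sc[OF v(1) c] v(3) by (simp add: tt.inv_simps Z_simps inv_Z free_simps cc)
  qed
  show "v \<in> RC.dT (m + 1) ` tt.inv_set M m0 (C (m + 1)) \<longleftrightarrow> v' \<in> {\<lambda>_. \<zero>}" if "v \<in> tt.inv_set M m0 (Z m) \<and> v' = bc m v" for v v'
  proof -
    have v: "v \<in> WC.tot m" "WC.dT m v = (\<lambda>_. \<zero>\<^bsub>R\<^esub>)" "v' = bc m v" using that by (auto simp: inv_Z)
    show ?thesis unfolding inv_C v(3) using bc_kernel[OF v(1,2)] bc_dT by blast
  qed
qed

theorem corr_main: "lin_corr K (tt.coc n M) (Hom_coboundaries R T d M n) (free_module K (Dm (- n - 1))) {\<lambda>_. \<zero>}"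
proof -
  have "lin_corr K (tt.coc 0 (Z (- n - 1))) (Hom_coboundaries R T d (Z (- n - 1)) 0)
     (tt.inv_space M m0 (Z (- n - 1))) (RC.dT (- n - 1 + 1) ` tt.inv_set M m0 (C (- n - 1 + 1)))"
    by (rule tt.degree_zero[OF mm.left_module_axioms m0 gen eta eta_sur eta_ker tt.acyc_free[OF finite_Ix] Z_mod dC_homZ dC_sur])
  from lin_corr_trans[OF lin_corr_trans[OF to_degree_0 this] corr_bc] show ?thesis .
qed

end

section \<open>Dimensions\<close>

text \<open>The module laws travel along a surjection that respects the operations. This spares
  checking them on cosets, and later gives them for the regular bimodule as the target of the
  augmentation.\<close>

lemma image_left_module:
  assumes F: "left_module R F" and sur: "h ` carrier F = carrier Q"
    and add: "\<And>x y. x \<in> carrier F \<Longrightarrow> y \<in> carrier F \<Longrightarrow> h (x \<oplus>\<^bsub>F\<^esub> y) = h x \<oplus>\<^bsub>Q\<^esub> h y"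
    and sm: "\<And>r x. r \<in> carrier R \<Longrightarrow> x \<in> carrier F \<Longrightarrow> h (r \<odot>\<^bsub>F\<^esub> x) = r \<odot>\<^bsub>Q\<^esub> h x"
    and zero: "h \<zero>\<^bsub>F\<^esub> = \<zero>\<^bsub>Q\<^esub>"
  shows "left_module R Q"
proof -
  interpret F: left_module R F by fact
  have hc: "h x \<in> carrier Q" if "x \<in> carrier F" for x using sur that by blast
  have ex: "\<exists>x\<in>carrier F. y = h x" if "y \<in> carrier Q" for y using sur that by blast
  have ag: "abelian_group Q"
  proof (rule abelian_groupI)
    show "x \<oplus>\<^bsub>Q\<^esub> y \<in> carrier Q" if xy: "x \<in> carrier Q" "y \<in> carrier Q" for x y
    proof -
      obtain u v where uv: "u \<in> carrier F" "x = h u" "v \<in> carrier F" "y = h v" using ex xy by metis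
      then show ?thesis using hc[of "u \<oplus>\<^bsub>F\<^esub> v"] by (simp add: add)
    qed
    show "\<zero>\<^bsub>Q\<^esub> \<in> carrier Q" using hc[OF F.M.zero_closed] zero by simp
    show "x \<oplus>\<^bsub>Q\<^esub> y \<oplus>\<^bsub>Q\<^esub> z = x \<oplus>\<^bsub>Q\<^esub> (y \<oplus>\<^bsub>Q\<^esub> z)" if xyz: "x \<in> carrier Q" "y \<in> carrier Q" "z \<in> carrier Q" for x y z
    proof -
      obtain u v w where uv: "u \<in> carrier F" "x = h u" "v \<in> carrier F" "y = h v" "w \<in> carrier F" "z = h w" using ex xyz by metis
      then show ?thesis using arg_cong[OF F.M.a_assoc[OF uv(1,3,5)], of h] by (simp add: add)
    qed
    show "x \<oplus>\<^bsub>Q\<^esub> y = y \<oplus>\<^bsub>Q\<^esub> x" if xy: "x \<in> carrier Q" "y \<in> carrier Q" for x y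
    proof -
      obtain u v where uv: "u \<in> carrier F" "x = h u" "v \<in> carrier F" "y = h v" using ex xy by metis
      then show ?thesis using arg_cong[OF F.M.a_comm[OF uv(1,3)], of h] by (simp add: add)
    qed
    show "\<zero>\<^bsub>Q\<^esub> \<oplus>\<^bsub>Q\<^esub> x = x" if x: "x \<in> carrier Q" for x
    proof -
      obtain u where u: "u \<in> carrier F" "x = h u" using ex[OF x] by blast
      then show ?thesis using arg_cong[OF F.M.l_zero[OF u(1)], of h] add[OF F.M.zero_closed u(1)] zero by simp
    qed
    show "\<exists>y\<in>carrier Q. y \<oplus>\<^bsub>Q\<^esub> x = \<zero>\<^bsub>Q\<^esub>" if x: "x \<in> carrier Q" for x
    proof -
      obtain u where u: "u \<in> carrier F" "x = h u" using ex[OF x] by blast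
      have "h (\<ominus>\<^bsub>F\<^esub> u) \<oplus>\<^bsub>Q\<^esub> x = \<zero>\<^bsub>Q\<^esub>"
        using arg_cong[OF F.M.l_neg[OF u(1)], of h] add[OF F.M.a_inv_closed[OF u(1)] u(1)] zero u by simp
      then show ?thesis using hc[OF F.M.a_inv_closed[OF u(1)]] by blast
    qed
  qed
  show ?thesis
  proof (rule left_moduleI[OF F.R.ring_axioms ag])
    fix r s x y assume r: "r \<in> carrier R" and s: "s \<in> carrier R" and x: "x \<in> carrier Q" and y: "y \<in> carrier Q"
    obtain u where u: "u \<in> carrier F" "x = h u" using ex[OF x] by blast
    obtain v where v: "v \<in> carrier F" "y = h v" using ex[OF y] by blast
    note c = F.smult_closed[OF r u(1)] F.smult_closed[OF s u(1)] F.smult_closed[OF r v(1)]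
    show "r \<odot>\<^bsub>Q\<^esub> x \<in> carrier Q" using hc[OF c(1)] r u by (simp add: sm)
    show "(r \<oplus>\<^bsub>R\<^esub> s) \<odot>\<^bsub>Q\<^esub> x = r \<odot>\<^bsub>Q\<^esub> x \<oplus>\<^bsub>Q\<^esub> s \<odot>\<^bsub>Q\<^esub> x"
      using arg_cong[OF F.smult_l_distr[OF r s u(1)], of h] r s u c by (simp add: sm add)
    show "r \<odot>\<^bsub>Q\<^esub> (x \<oplus>\<^bsub>Q\<^esub> y) = r \<odot>\<^bsub>Q\<^esub> x \<oplus>\<^bsub>Q\<^esub> r \<odot>\<^bsub>Q\<^esub> y"
      using arg_cong[OF F.smult_r_distr[OF r u(1) v(1)], of h] r u v c by (simp add: sm add)
    show "(r \<otimes>\<^bsub>R\<^esub> s) \<odot>\<^bsub>Q\<^esub> x = r \<odot>\<^bsub>Q\<^esub> (s \<odot>\<^bsub>Q\<^esub> x)"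
      using arg_cong[OF F.smult_assoc[OF r s u(1)], of h] r s u c by (simp add: sm)
  next
    fix x assume "x \<in> carrier Q"
    then obtain u where u: "u \<in> carrier F" "x = h u" using ex by blast
    show "\<one>\<^bsub>R\<^esub> \<odot>\<^bsub>Q\<^esub> x = x" using arg_cong[OF F.smult_one[OF u(1)], of h] u by (simp add: sm)
  qed
qed

lemma left_module_vectorspace: assumes "field K" "left_module K V" shows "vectorspace K V"
proof -
  interpret K: field K by fact
  interpret V: left_module K V by fact
  show ?thesis
    by (intro vectorspace.intro moduleI K.is_cring K.field_axioms V.M.abelian_group_axioms)
      (auto simp: V.smult_closed V.smult_l_distr V.smult_r_distr V.smult_assoc V.smult_one)
qed

lemma free_module_dim:
  fixes K :: "('k, 'z) ring_scheme" and D :: "'i set"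
  assumes K: "field K" and D: "finite D"
  shows "vectorspace.fin_dim K (free_module K D)" "vectorspace.dim K (free_module K D) = card D"
proof -
  interpret K: field K by fact
  let ?F = "free_module K D"
  have lm: "left_module K ?F" by (rule free_left_module[OF K.ring_axioms])
  interpret V: vectorspace K ?F by (rule left_module_vectorspace[OF K lm])
  let ?b = "basis_elt K :: 'i \<Rightarrow> 'i \<Rightarrow> 'k"
  have inj: "inj_on ?b D" by (auto simp: inj_on_def basis_elt_def fun_eq_iff split: if_splits)
  have bF: "?b i \<in> carrier ?F" if "i \<in> D" for i
    using that finite_subset[of "supp K (?b i)" "{i}"] by (auto simp: free_carrier basis_elt_def supp_def)
  have lc: "(\<Oplus>\<^bsub>?F\<^esub>v\<in>?b ` E. u v \<odot>\<^bsub>?F\<^esub> v) = (\<lambda>i. if i \<in> E then u (?b i) else \<zero>\<^bsub>K\<^esub>)"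
    if "E \<subseteq> D" "u \<in> ?b ` D \<rightarrow> carrier K" for E u
    using finite_subset[OF that(1) D] that(1)
  proof (induction E)
    case empty
    then show ?case by (simp add: free_simps)
  next
    case (insert i E)
    have uc: "u (?b j) \<in> carrier K" if "j \<in> D" for j using \<open>u \<in> ?b ` D \<rightarrow> carrier K\<close> that by blast
    have tc: "u v \<odot>\<^bsub>?F\<^esub> v \<in> carrier ?F" if "v \<in> ?b ` D" for v using that bF uc by auto
    have ni: "?b i \<notin> ?b ` E" using insert.hyps(2) insert.prems inj by (auto simp: inj_on_def)
    have "(\<Oplus>\<^bsub>?F\<^esub>v\<in>?b ` insert i E. u v \<odot>\<^bsub>?F\<^esub> v) = u (?b i) \<odot>\<^bsub>?F\<^esub> ?b i \<oplus>\<^bsub>?F\<^esub> (\<Oplus>\<^bsub>?F\<^esub>v\<in>?b ` E. u v \<odot>\<^bsub>?F\<^esub> v)"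
      unfolding image_insert
      by (rule V.finsum_insert) (use insert.hyps insert.prems ni tc in auto)
    also have "(\<Oplus>\<^bsub>?F\<^esub>v\<in>?b ` E. u v \<odot>\<^bsub>?F\<^esub> v) = (\<lambda>i. if i \<in> E then u (?b i) else \<zero>\<^bsub>K\<^esub>)" using insert by simp
    finally show ?case using insert.hyps(2) insert.prems uc by (auto simp: free_simps basis_elt_def fun_eq_iff)
  qed
  have AC: "?b ` D \<subseteq> carrier ?F" using bF by blast
  have fin: "finite (?b ` D)" using D by simp
  have li: "V.lin_indpt (?b ` D)"
  proof (rule V.finite_lin_indpt2[OF fin AC], rule ballI)
    fix u v assume u: "u \<in> ?b ` D \<rightarrow> carrier K" and 0: "V.lincomb u (?b ` D) = \<zero>\<^bsub>?F\<^esub>" and v: "v \<in> ?b ` D"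
    obtain i where i: "i \<in> D" "v = ?b i" using v by blast
    show "u v = \<zero>\<^bsub>K\<^esub>" using fun_cong[OF 0, of i] lc[OF subset_refl u] i by (simp add: V.lincomb_def free_simps)
  qed
  have gen: "V.span (?b ` D) = carrier ?F"
  proof
    show "V.span (?b ` D) \<subseteq> carrier ?F" by (rule V.span_is_subset2[OF AC])
    show "carrier ?F \<subseteq> V.span (?b ` D)"
    proof
      fix f assume f: "f \<in> carrier ?F"
      define u where "u = (\<lambda>v. f (the_inv_into D ?b v))"
      have ub: "u (?b i) = f i" if "i \<in> D" for i using the_inv_into_f_f[OF inj that] by (simp add: u_def)
      have u: "u \<in> ?b ` D \<rightarrow> carrier K" using ub f by (auto simp: free_carrier)
      have "f = V.lincomb u (?b ` D)" using lc[OF subset_refl u] ub f by (auto simp: V.lincomb_def free_carrier fun_eq_iff)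
      then show "f \<in> V.span (?b ` D)" using u fin unfolding V.span_def by blast
    qed
  qed
  show "V.fin_dim" using gen fin AC unfolding V.fin_dim_def by blast
  show "V.dim = card D" using V.dim_basis[OF fin] li gen AC card_image[OF inj] unfolding V.basis_def by simp
qed

text \<open>The fibres of the correspondence over the vectors of the free module are exactly the
  cosets of \<open>B\<close>, so taking fibres is a linear bijection onto the quotient.\<close>

lemma lin_corr_dim:
  fixes K :: "('k, 'z) ring_scheme" and V :: "('k, 'v) module" and D :: "'i set"
  assumes K: "field K" and V: "left_module K V" and BV: "B \<subseteq> carrier V" and D: "finite D"
    and corr: "lin_corr K V B (free_module K D) {\<lambda>_. \<zero>\<^bsub>K\<^esub>}"
  shows "has_dimension K (quot_module V B) (card D)"
proof -
  interpret K: field K by fact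
  interpret V: left_module K V by fact
  let ?F = "free_module K D"
  have lm: "left_module K ?F" by (rule free_left_module[OF K.ring_axioms])
  interpret F: left_module K ?F by fact
  from lin_corrE[OF corr] obtain P where P: "\<And>v v'. P v v' \<Longrightarrow> v \<in> carrier V \<and> v' \<in> carrier ?F"
    "\<And>v. v \<in> carrier V \<Longrightarrow> \<exists>v'. P v v'" "\<And>v'. v' \<in> carrier ?F \<Longrightarrow> \<exists>v. P v v'"
    "\<And>u u' v v'. P u u' \<Longrightarrow> P v v' \<Longrightarrow> P (u \<oplus>\<^bsub>V\<^esub> v) (u' \<oplus>\<^bsub>?F\<^esub> v')"
    "\<And>c v v'. c \<in> carrier K \<Longrightarrow> P v v' \<Longrightarrow> P (c \<odot>\<^bsub>V\<^esub> v) (c \<odot>\<^bsub>?F\<^esub> v')"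
    "\<And>v v'. P v v' \<Longrightarrow> v \<in> B \<longleftrightarrow> v' \<in> {\<lambda>_. \<zero>\<^bsub>K\<^esub>}" by blast
  have z: "\<zero>\<^bsub>?F\<^esub> = (\<lambda>_. \<zero>\<^bsub>K\<^esub>)" by (simp add: free_simps)
  have B0: "v \<in> B \<longleftrightarrow> v' = \<zero>\<^bsub>?F\<^esub>" if "P v v'" for v v' using P(6)[OF that] z by simp
  have P0: "P \<zero>\<^bsub>V\<^esub> \<zero>\<^bsub>?F\<^esub>"
  proof -
    obtain y where y: "P \<zero>\<^bsub>V\<^esub> y" using P(2)[OF V.M.zero_closed] by blast
    from P(5)[OF K.zero_closed this] show ?thesis using P(1)[OF y] by (simp add: V.smult_l_zero F.smult_l_zero)
  qed
  have diff: "P (u \<ominus>\<^bsub>V\<^esub> v) (u' \<ominus>\<^bsub>?F\<^esub> v')" if "P u u'" "P v v'" for u u' v v'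
  proof -
    have 1: "\<ominus>\<^bsub>K\<^esub> \<one>\<^bsub>K\<^esub> \<in> carrier K" by simp
    have "(\<ominus>\<^bsub>K\<^esub> \<one>\<^bsub>K\<^esub>) \<odot>\<^bsub>V\<^esub> v = \<ominus>\<^bsub>V\<^esub> v" "(\<ominus>\<^bsub>K\<^esub> \<one>\<^bsub>K\<^esub>) \<odot>\<^bsub>?F\<^esub> v' = \<ominus>\<^bsub>?F\<^esub> v'"
      using P(1)[OF that(2)] by (simp_all add: V.smult_l_minus V.smult_one F.smult_l_minus F.smult_one)
    then show ?thesis using P(4)[OF that(1) P(5)[OF 1 that(2)]] by (simp add: V.M.minus_eq F.M.minus_eq)
  qed
  \<comment> \<open>In this direction the relation is a function: on the side of the free module,
    only zero corresponds to elements of \<open>B\<close>.\<close>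
  have uniq: "y = y'" if "P v y" "P v y'" for v y y'
  proof -
    have "v \<ominus>\<^bsub>V\<^esub> v = \<zero>\<^bsub>V\<^esub>" using P(1)[OF that(1)] by (simp add: V.M.minus_eq V.M.r_neg)
    then have "y \<ominus>\<^bsub>?F\<^esub> y' = \<zero>\<^bsub>?F\<^esub>" using B0[OF diff[OF that]] B0[OF P0] by simp
    then show ?thesis by (rule F.M.minus_eq_zeroD[OF conjunct2[OF P(1)[OF that(1)]] conjunct2[OF P(1)[OF that(2)]]])
  qed
  define fib where "fib y = {v. P v y}" for y
  have ne: "\<exists>v. v \<in> fib y" if "y \<in> carrier ?F" for y using P(3)[OF that] by (simp add: fib_def)
  have coset: "B +>\<^bsub>V\<^esub> v = fib y" if vy: "P v y" for v y
  proof -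
    have vc: "v \<in> carrier V" "y \<in> carrier ?F" using P(1)[OF vy] by auto
    have "x \<in> fib y \<longleftrightarrow> (\<exists>w\<in>B. x = w \<oplus>\<^bsub>V\<^esub> v)" for x
    proof
      assume "x \<in> fib y"
      then have x: "P x y" by (simp add: fib_def)
      have xc: "x \<in> carrier V" using P(1)[OF x] by simp
      have "y \<ominus>\<^bsub>?F\<^esub> y = \<zero>\<^bsub>?F\<^esub>" using vc by (simp add: F.M.minus_eq F.M.r_neg)
      then have "x \<ominus>\<^bsub>V\<^esub> v \<in> B" using B0[OF diff[OF x vy]] by simp
      moreover have "x = (x \<ominus>\<^bsub>V\<^esub> v) \<oplus>\<^bsub>V\<^esub> v" using xc vc by (simp add: V.M.minus_eq V.M.a_assoc V.M.l_neg)
      ultimately show "\<exists>w\<in>B. x = w \<oplus>\<^bsub>V\<^esub> v" by blast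
    next
      assume "\<exists>w\<in>B. x = w \<oplus>\<^bsub>V\<^esub> v"
      then obtain w where w: "w \<in> B" "x = w \<oplus>\<^bsub>V\<^esub> v" by blast
      obtain w' where w': "P w w'" using P(2) BV w(1) by blast
      then have "w' = \<zero>\<^bsub>?F\<^esub>" using B0 w(1) by blast
      then show "x \<in> fib y" using P(4)[OF w' vy] w(2) vc by (simp add: fib_def)
    qed
    then show ?thesis unfolding a_r_coset_def' by blast
  qed
  let ?Q = "quot_module V B"
  have carQ: "carrier ?Q = fib ` carrier ?F"
  proof -
    have "carrier ?Q = {B +>\<^bsub>V\<^esub> v | v. v \<in> carrier V}"
      by (auto simp: quot_module_def FactRing_def A_RCOSETS_def')
    also have "\<dots> = fib ` carrier ?F"
    proof
      show "{B +>\<^bsub>V\<^esub> v | v. v \<in> carrier V} \<subseteq> fib ` carrier ?F"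
      proof clarify
        fix v assume "v \<in> carrier V"
        then obtain y where y: "P v y" using P(2) by blast
        show "B +>\<^bsub>V\<^esub> v \<in> fib ` carrier ?F" unfolding coset[OF y] using P(1)[OF y] by blast
      qed
      show "fib ` carrier ?F \<subseteq> {B +>\<^bsub>V\<^esub> v | v. v \<in> carrier V}"
      proof clarify
        fix y assume "y \<in> carrier ?F"
        then obtain v where v: "P v y" using P(3) by blast
        show "\<exists>v. fib y = B +>\<^bsub>V\<^esub> v \<and> v \<in> carrier V" using coset[OF v] P(1)[OF v] by blast
      qed
    qed
    finally show ?thesis .
  qed
  have zeroQ: "fib \<zero>\<^bsub>?F\<^esub> = \<zero>\<^bsub>?Q\<^esub>"
  proof -
    have "x \<in> fib \<zero>\<^bsub>?F\<^esub> \<longleftrightarrow> x \<in> B" for x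
      using B0 P(2) BV unfolding fib_def by blast
    then show ?thesis by (auto simp: quot_module_def FactRing_def)
  qed
  have addQ: "fib (y \<oplus>\<^bsub>?F\<^esub> y') = fib y \<oplus>\<^bsub>?Q\<^esub> fib y'" if y: "y \<in> carrier ?F" "y' \<in> carrier ?F" for y y'
  proof -
    have "x \<in> fib (y \<oplus>\<^bsub>?F\<^esub> y') \<longleftrightarrow> (\<exists>u\<in>fib y. \<exists>v\<in>fib y'. x = u \<oplus>\<^bsub>V\<^esub> v)" for x
    proof
      assume "x \<in> fib (y \<oplus>\<^bsub>?F\<^esub> y')"
      then have x: "P x (y \<oplus>\<^bsub>?F\<^esub> y')" by (simp add: fib_def)
      obtain v where v: "P v y'" using P(3)[OF y(2)] by blast
      have c: "x \<in> carrier V" "v \<in> carrier V" using P(1)[OF x] P(1)[OF v] by auto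
      have "(y \<oplus>\<^bsub>?F\<^esub> y') \<ominus>\<^bsub>?F\<^esub> y' = y" using y by (simp add: F.M.minus_eq F.M.a_assoc F.M.r_neg)
      then have "x \<ominus>\<^bsub>V\<^esub> v \<in> fib y" using diff[OF x v] by (simp add: fib_def)
      moreover have "x = (x \<ominus>\<^bsub>V\<^esub> v) \<oplus>\<^bsub>V\<^esub> v" using c by (simp add: V.M.minus_eq V.M.a_assoc V.M.l_neg)
      moreover have "v \<in> fib y'" using v by (simp add: fib_def)
      ultimately show "\<exists>u\<in>fib y. \<exists>v\<in>fib y'. x = u \<oplus>\<^bsub>V\<^esub> v" by blast
    next
      assume "\<exists>u\<in>fib y. \<exists>v\<in>fib y'. x = u \<oplus>\<^bsub>V\<^esub> v"
      then show "x \<in> fib (y \<oplus>\<^bsub>?F\<^esub> y')" using P(4) unfolding fib_def by blast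
    qed
    moreover have "fib y \<oplus>\<^bsub>?Q\<^esub> fib y' = (\<Union>u\<in>fib y. \<Union>v\<in>fib y'. {u \<oplus>\<^bsub>V\<^esub> v})"
      by (simp add: quot_module_def FactRing_def set_add_def')
    ultimately show ?thesis by blast
  qed
  have smQ: "fib (c \<odot>\<^bsub>?F\<^esub> y) = c \<odot>\<^bsub>?Q\<^esub> fib y" if c: "c \<in> carrier K" and y: "y \<in> carrier ?F" for c y
  proof -
    have "B +>\<^bsub>V\<^esub> (c \<odot>\<^bsub>V\<^esub> v) = fib (c \<odot>\<^bsub>?F\<^esub> y)" if "v \<in> fib y" for v
      using coset[OF P(5)[OF c]] that unfolding fib_def by blast
    moreover have "c \<odot>\<^bsub>?Q\<^esub> fib y = (\<Union>v\<in>fib y. B +>\<^bsub>V\<^esub> (c \<odot>\<^bsub>V\<^esub> v))" by (simp add: quot_module_def)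
    ultimately show ?thesis using ne[OF y] by auto
  qed
  have Q: "left_module K ?Q" 
  proof (rule image_left_module[where h = fib and F = ?F])
    show "left_module K ?F" by (rule lm)
    show "fib ` carrier ?F = carrier ?Q" by (rule carQ[symmetric])
    show "fib \<zero>\<^bsub>?F\<^esub> = \<zero>\<^bsub>?Q\<^esub>" by (rule zeroQ)
  qed (rule addQ smQ; assumption)+
  have vF: "vectorspace K ?F" and vQ: "vectorspace K ?Q" by (rule left_module_vectorspace[OF K lm], rule left_module_vectorspace[OF K Q])
  have hom: "fib \<in> module_hom K ?F ?Q" by (rule module_homI) (use carQ addQ smQ in auto)
  interpret L: linear_map K ?F ?Q fib
    using vF vQ hom unfolding linear_map_def mod_hom_def mod_hom_axioms_def vectorspace_def by blast
  have inj: "inj_on fib (carrier ?F)"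
  proof (rule inj_onI)
    fix y y' assume y: "y \<in> carrier ?F" "fib y = fib y'"
    obtain v where "v \<in> fib y" using ne[OF y(1)] by blast
    then show "y = y'" using y(2) uniq unfolding fib_def by blast
  qed
  note fd = free_module_dim[OF K D]
  show ?thesis
    unfolding has_dimension_def
    using vQ L.surj_fin_dim[OF fd(1) carQ[symmetric]] L.dim_eq[OF fd(1) inj carQ[symmetric]] fd(2) by simp
qed

section \<open>The cohomology groups as vector spaces\<close>

context tate
begin

lemma cob_sub:
  assumes N: "left_module R N" shows "Hom_coboundaries R T d N n \<subseteq> Hom_cocycles R T d N n"
proof
  fix f assume f: "f \<in> Hom_coboundaries R T d N n"
  obtain g where g: "g \<in> module_hom R (T (n - 1)) N" "\<And>x. x \<in> carrier (T n) \<Longrightarrow> f x = g (d n x)" using cobD[OF f] by blast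
  have fe: "f = restrict f (carrier (T n))" using f unfolding Hom_coboundaries_def by (auto simp: compose_def)
  have "restrict f (carrier (T n)) \<in> Hom_cocycles R T d N n"
  proof (rule cocI)
    show "f \<in> module_hom R (T n) N"
      by (rule module_hom_cong[OF T_mod module_hom_comp[OF d_hom g(1)]]) (rule g(2))
    show "f (d (n + 1) x) = \<zero>\<^bsub>N\<^esub>" if "x \<in> carrier (T (n + 1))" for x
      using g(2)[OF d_c'[OF that]] dd[OF that] module_hom_map_zero[OF T_mod N g(1)] by simp
  qed
  then show "f \<in> Hom_cocycles R T d N n" using fe by simp
qed

lemma coc_left_module: assumes N: "left_module R N" shows "left_module K (coc n N)"
proof -
  interpret N: left_module R N by fact
  have fc: "f x \<in> carrier N" if "f \<in> Hom_cocycles R T d N n" "x \<in> carrier (T n)" for f x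
    using module_homD(1)[OF cocD(1)[OF that(1)] that(2)] .
  have ext: "f = g" if f: "f \<in> Hom_cocycles R T d N n" and g: "g \<in> Hom_cocycles R T d N n" and e: "\<And>x. x \<in> carrier (T n) \<Longrightarrow> f x = g x" for f g
    using extensionalityI[OF cocD(3)[OF f] cocD(3)[OF g] e] .
  have ac: "f \<oplus>\<^bsub>coc n N\<^esub> g \<in> Hom_cocycles R T d N n" if f: "f \<in> Hom_cocycles R T d N n" and g: "g \<in> Hom_cocycles R T d N n" for f g
    unfolding coc_simps
    by (rule cocI[OF module_hom_add_fun[OF N cocD(1)[OF f] cocD(1)[OF g]]]) (simp add: cocD(2)[OF f] cocD(2)[OF g])
  have sc: "c \<odot>\<^bsub>coc n N\<^esub> f \<in> Hom_cocycles R T d N n" if c: "c \<in> carrier K" and f: "f \<in> Hom_cocycles R T d N n" for c f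
    unfolding coc_simps
    by (rule cocI[OF hom_scale[OF N cocD(1)[OF f] c]]) (simp add: cocD(2)[OF f] N.smult_r_zero c)
  have zz: "\<zero>\<^bsub>coc n N\<^esub> = restrict (\<lambda>_. \<zero>\<^bsub>N\<^esub>) (carrier (T n))" by (simp add: coc_def Hom_space_def)
  have zc: "\<zero>\<^bsub>coc n N\<^esub> \<in> Hom_cocycles R T d N n"
    unfolding zz by (rule cocI) (auto intro!: module_homI simp: N.smult_r_zero)
  have \<iota>c: "\<iota> c \<in> carrier R" if "c \<in> carrier K" for c using that by simp
  have \<iota>a: "\<iota> (c \<oplus> e) = \<iota> c \<oplus>\<^bsub>R\<^esub> \<iota> e" if "c \<in> carrier K" "e \<in> carrier K" for c e using that by (simp add: sc_ladd)
  have \<iota>m: "\<iota> (c \<otimes> e) = \<iota> c \<otimes>\<^bsub>R\<^esub> \<iota> e" if "c \<in> carrier K" "e \<in> carrier K" for c e using that by (simp add: sc_assoc sc_lmult)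
  have \<iota>1: "\<iota> \<one> = \<one>\<^bsub>R\<^esub>" by simp
  show ?thesis
  proof (rule left_moduleI[OF K.ring_axioms])
    show "abelian_group (coc n N)"
    proof (rule abelian_groupI, unfold coc_simps(1))
      show "f \<oplus>\<^bsub>coc n N\<^esub> g \<in> Hom_cocycles R T d N n" if "f \<in> Hom_cocycles R T d N n" "g \<in> Hom_cocycles R T d N n" for f g by (rule ac[OF that])
      show "\<zero>\<^bsub>coc n N\<^esub> \<in> Hom_cocycles R T d N n" by (rule zc)
      show "f \<oplus>\<^bsub>coc n N\<^esub> g \<oplus>\<^bsub>coc n N\<^esub> h = f \<oplus>\<^bsub>coc n N\<^esub> (g \<oplus>\<^bsub>coc n N\<^esub> h)"
        if f: "f \<in> Hom_cocycles R T d N n" and g: "g \<in> Hom_cocycles R T d N n" and h: "h \<in> Hom_cocycles R T d N n" for f g h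
        by (rule ext[OF ac[OF ac[OF f g] h] ac[OF f ac[OF g h]]]) (simp add: coc_simps(2) fc[OF f] fc[OF g] fc[OF h] N.M.a_assoc)
      show "f \<oplus>\<^bsub>coc n N\<^esub> g = g \<oplus>\<^bsub>coc n N\<^esub> f" if f: "f \<in> Hom_cocycles R T d N n" and g: "g \<in> Hom_cocycles R T d N n" for f g
        by (rule ext[OF ac[OF f g] ac[OF g f]]) (simp add: coc_simps(2) fc[OF f] fc[OF g] N.M.a_comm)
      show "\<zero>\<^bsub>coc n N\<^esub> \<oplus>\<^bsub>coc n N\<^esub> f = f" if "f \<in> Hom_cocycles R T d N n" for f
        by (rule ext[OF ac[OF zc that] that]) (use fc[OF that] in \<open>simp add: coc_simps(2) zz\<close>)
      show "\<exists>g\<in>Hom_cocycles R T d N n. g \<oplus>\<^bsub>coc n N\<^esub> f = \<zero>\<^bsub>coc n N\<^esub>" if f: "f \<in> Hom_cocycles R T d N n" for f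
      proof
        let ?g = "(\<ominus> \<one>) \<odot>\<^bsub>coc n N\<^esub> f"
        have m1: "\<ominus> \<one> \<in> carrier K" by simp
        show g: "?g \<in> Hom_cocycles R T d N n" by (rule sc[OF m1 f])
        have "\<iota> (\<ominus> \<one>) = \<ominus>\<^bsub>R\<^esub> \<one>\<^bsub>R\<^esub>"
        proof -
          have "\<iota> (\<ominus> \<one>) \<oplus>\<^bsub>R\<^esub> \<one>\<^bsub>R\<^esub> = \<zero>\<^bsub>R\<^esub>" using \<iota>a[OF m1 K.one_closed] by (simp add: K.l_neg)
          then show ?thesis using A.minus_equality[of "\<iota> (\<ominus> \<one>)" "\<one>\<^bsub>R\<^esub>"] \<iota>c[OF m1] by simp
        qed
        then show "?g \<oplus>\<^bsub>coc n N\<^esub> f = \<zero>\<^bsub>coc n N\<^esub>"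
          by (intro ext[OF ac[OF g f] zc]) (use fc[OF f] in \<open>simp add: coc_simps(2,3) zz N.smult_l_minus N.smult_one N.M.l_neg\<close>)
      qed
    qed
  next
    fix c e f g assume c: "c \<in> carrier K" and e: "e \<in> carrier K" and f: "f \<in> carrier (coc n N)" and g: "g \<in> carrier (coc n N)"
    have fg: "f \<in> Hom_cocycles R T d N n" "g \<in> Hom_cocycles R T d N n" using f g by (simp_all add: coc_simps(1))
    show "c \<odot>\<^bsub>coc n N\<^esub> f \<in> carrier (coc n N)" using sc[OF c fg(1)] by (simp add: coc_simps(1))
    show "(c \<oplus> e) \<odot>\<^bsub>coc n N\<^esub> f = c \<odot>\<^bsub>coc n N\<^esub> f \<oplus>\<^bsub>coc n N\<^esub> e \<odot>\<^bsub>coc n N\<^esub> f"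
      by (rule ext[OF sc[OF K.a_closed[OF c e] fg(1)] ac[OF sc[OF c fg(1)] sc[OF e fg(1)]]])
        (use fc[OF fg(1)] c e in \<open>simp add: coc_simps(2,3) \<iota>a \<iota>c N.smult_l_distr\<close>)
    show "c \<odot>\<^bsub>coc n N\<^esub> (f \<oplus>\<^bsub>coc n N\<^esub> g) = c \<odot>\<^bsub>coc n N\<^esub> f \<oplus>\<^bsub>coc n N\<^esub> c \<odot>\<^bsub>coc n N\<^esub> g"
      by (rule ext[OF sc[OF c ac[OF fg]] ac[OF sc[OF c fg(1)] sc[OF c fg(2)]]])
        (use fc[OF fg(1)] fc[OF fg(2)] c in \<open>simp add: coc_simps(2,3) \<iota>c N.smult_r_distr\<close>)
    show "(c \<otimes> e) \<odot>\<^bsub>coc n N\<^esub> f = c \<odot>\<^bsub>coc n N\<^esub> (e \<odot>\<^bsub>coc n N\<^esub> f)"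
      by (rule ext[OF sc[OF K.m_closed[OF c e] fg(1)] sc[OF c sc[OF e fg(1)]]])
        (use fc[OF fg(1)] c e in \<open>simp add: coc_simps(3) \<iota>m \<iota>c N.smult_assoc\<close>)
  next
    fix f assume "f \<in> carrier (coc n N)"
    then have fg: "f \<in> Hom_cocycles R T d N n" by (simp add: coc_simps(1))
    show "\<one> \<odot>\<^bsub>coc n N\<^esub> f = f"
      by (rule ext[OF sc[OF K.one_closed fg] fg]) (use fc[OF fg] in \<open>simp add: coc_simps(3) \<iota>1 N.smult_one\<close>)
  qed
qed

lemma cohomology_dim:
  assumes N: "left_module R N" and D: "finite D"
    and corr: "lin_corr K (coc n N) (Hom_coboundaries R T d N n) (free_module K D) {\<lambda>_. \<zero>}"
  shows "has_dimension K (Hom_cohomology R T d N n) (card D)"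
  using lin_corr_dim[OF K.field_axioms coc_left_module[OF N] _ D corr] cob_sub[OF N]
  by (simp add: Hom_cohomology_def coc_def)

end

section \<open>Tate-Hochschild cohomology of the quantum complete intersection\<close>

locale qci_env = qci_alg K a b q for K :: "('k, 'z) ring_scheme" (structure) and a b :: nat and q :: 'k +
  assumes a2: "2 \<le> a" and b2: "2 \<le> b" and q0: "q \<noteq> \<zero>\<^bsub>K\<^esub>"
    and q_free: "0 < (n::nat) \<Longrightarrow> q [^]\<^bsub>K\<^esub> n \<noteq> \<one>\<^bsub>K\<^esub>"
begin

sublocale E: enveloping K Q "{..<a} \<times> {..<b}" "\<lambda>p. coA (fst p) (snd p)" "\<lambda>p. mon (fst p) (snd p)"
  by (rule enveloping.intro) (rule AB.basis_algebra_axioms)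

section \<open>Coordinates on the enveloping algebra and verification of the shift rules\<close>

definition cR :: "nat \<Rightarrow> nat \<Rightarrow> nat \<Rightarrow> nat \<Rightarrow> ((qci_var list \<Rightarrow> 'k) set \<times> (qci_var list \<Rightarrow> 'k) set \<Rightarrow> 'k) set \<Rightarrow> 'k" where
  "cR i j k l = E.chi2 ((i, j), (k, l))"

abbreviation Xr where "Xr \<equiv> E.tens x \<one>\<^bsub>Q\<^esub>"
abbreviation Yr where "Yr \<equiv> E.tens y \<one>\<^bsub>Q\<^esub>"
abbreviation Xl where "Xl \<equiv> E.tens \<one>\<^bsub>Q\<^esub> x"
abbreviation Yl where "Yl \<equiv> E.tens \<one>\<^bsub>Q\<^esub> y"

lemma cR_lin: "\<lbrakk>i < a; j < b; k < a; l < b\<rbrakk> \<Longrightarrow> E.R.lin (cR i j k l)"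
  unfolding cR_def by (rule E.chi2_lin) auto

lemma cR_tens: "\<lbrakk>i < a; j < b; k < a; l < b; s \<in> carrier Q; t \<in> carrier Q\<rbrakk> \<Longrightarrow> cR i j k l (E.tens s t) = coA i j s \<otimes> coA k l t"
  unfolding cR_def by (subst E.chi2_tens) auto

lemma coA_c: "i < a \<Longrightarrow> j < b \<Longrightarrow> s \<in> carrier Q \<Longrightarrow> coA i j s \<in> carrier K"
  by (rule A.linD(1)[OF coA_lin])

text \<open>Both sides are linear in \<open>r\<close>, so a rule has to be verified on pure tensors
  only. The flag \<open>B\<close> is false when an index would become negative; then the value is
  zero and no bound on the new indices is required.\<close>

lemma cR_shift:
  assumes ij: "i < a" "j < b" "k < a" "l < b" and r: "r \<in> carrier E.Q" and z: "z \<in> carrier E.Q" and c: "c \<in> carrier K"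
    and ij': "B \<Longrightarrow> i' < a" "B \<Longrightarrow> j' < b" "B \<Longrightarrow> k' < a" "B \<Longrightarrow> l' < b"
  shows "(\<And>s t. s \<in> carrier Q \<Longrightarrow> t \<in> carrier Q \<Longrightarrow> cR i j k l (E.tens s t \<otimes>\<^bsub>E.Q\<^esub> z) = (if B then c \<otimes> cR i' j' k' l' (E.tens s t) else \<zero>))
      \<Longrightarrow> cR i j k l (r \<otimes>\<^bsub>E.Q\<^esub> z) = (if B then c \<otimes> cR i' j' k' l' r else \<zero>)"
    and "(\<And>s t. s \<in> carrier Q \<Longrightarrow> t \<in> carrier Q \<Longrightarrow> cR i j k l (z \<otimes>\<^bsub>E.Q\<^esub> E.tens s t) = (if B then c \<otimes> cR i' j' k' l' (E.tens s t) else \<zero>))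
      \<Longrightarrow> cR i j k l (z \<otimes>\<^bsub>E.Q\<^esub> r) = (if B then c \<otimes> cR i' j' k' l' r else \<zero>)"
proof -
  have L: "E.R.lin (\<lambda>r. if B then c \<otimes> cR i' j' k' l' r else \<zero>)"
    using E.lin_scale[OF cR_lin[of i' j' k' l'] c] ij' E.lin_null by (cases B) simp_all
  show "(\<And>s t. s \<in> carrier Q \<Longrightarrow> t \<in> carrier Q \<Longrightarrow> cR i j k l (E.tens s t \<otimes>\<^bsub>E.Q\<^esub> z) = (if B then c \<otimes> cR i' j' k' l' (E.tens s t) else \<zero>))
      \<Longrightarrow> cR i j k l (r \<otimes>\<^bsub>E.Q\<^esub> z) = (if B then c \<otimes> cR i' j' k' l' r else \<zero>)"
    by (rule E.lin_cong_tens[OF E.lin_mult(1)[OF cR_lin[OF ij] z] L _ r])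
  show "(\<And>s t. s \<in> carrier Q \<Longrightarrow> t \<in> carrier Q \<Longrightarrow> cR i j k l (z \<otimes>\<^bsub>E.Q\<^esub> E.tens s t) = (if B then c \<otimes> cR i' j' k' l' (E.tens s t) else \<zero>))
      \<Longrightarrow> cR i j k l (z \<otimes>\<^bsub>E.Q\<^esub> r) = (if B then c \<otimes> cR i' j' k' l' r else \<zero>)"
    by (rule E.lin_cong_tens[OF E.lin_mult(2)[OF cR_lin[OF ij] z] L _ r])
qed

lemma q_pow_c: "q [^] (n::nat) \<in> carrier K" using qK by simp

text \<open>The second tensor factor multiplies in reverse order: right multiplication by
  \<open>1 \<otimes> x\<close> is left multiplication by x on that factor. This is why the powers of
  q in the primed rules sit on the opposite side from those in the unprimed ones.\<close>

lemma env_qring: "qring_free K E.Q a b q Xr Yr Xl Yl cR"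
proof (intro qring_free.intro qring.intro qring_axioms.intro qring_free_axioms.intro E.R.kalgebra_axioms a2 b2 qK q0 q_free)
  show "Xr \<in> carrier E.Q" "Yr \<in> carrier E.Q" "Xl \<in> carrier E.Q" "Yl \<in> carrier E.Q" by simp_all
  note g = this
  show "E.R.lin (cR i j k l)" if "i < a" "j < b" "k < a" "l < b" for i j k l by (rule cR_lin[OF that])
  show "r = s" if r: "r \<in> carrier E.Q" "s \<in> carrier E.Q"
    and e: "\<And>i j k l. i < a \<Longrightarrow> j < b \<Longrightarrow> k < a \<Longrightarrow> l < b \<Longrightarrow> cR i j k l r = cR i j k l s" for r s
    by (rule E.RB.coord_eqI[OF r]) (use e in \<open>auto simp: cR_def\<close>)
  show "\<exists>r\<in>carrier E.Q. \<forall>i j k l. i < a \<longrightarrow> j < b \<longrightarrow> k < a \<longrightarrow> l < b \<longrightarrow> cR i j k l r = c i j k l"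
    if c: "\<And>i j k l. i < a \<Longrightarrow> j < b \<Longrightarrow> k < a \<Longrightarrow> l < b \<Longrightarrow> c i j k l \<in> carrier K" for c
  proof -
    show ?thesis
    proof (rule E.RB.coord_exists[of "\<lambda>p. c (fst (fst p)) (snd (fst p)) (fst (snd p)) (snd (snd p))"])
      show "c (fst (fst p)) (snd (fst p)) (fst (snd p)) (snd (snd p)) \<in> carrier K"
        if "p \<in> ({..<a} \<times> {..<b}) \<times> {..<a} \<times> {..<b}" for p using that by (intro c) auto
      fix r assume "r \<in> carrier E.Q" and e: "\<And>p. p \<in> ({..<a} \<times> {..<b}) \<times> {..<a} \<times> {..<b} \<Longrightarrow>
        E.chi2 p r = c (fst (fst p)) (snd (fst p)) (fst (snd p)) (snd (snd p))"
      moreover have "cR i j k l r = c i j k l" if "i < a" "j < b" "k < a" "l < b" for i j k l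
        using e[of "((i, j), (k, l))"] that by (simp add: cR_def)
      ultimately show ?thesis by blast
    qed
  qed
  fix i j k l r assume h: "i < a" "j < b" "k < a" "l < b" and r: "r \<in> carrier E.Q"
  have cc: "coA i j s \<in> carrier K" if "i < a" "j < b" "s \<in> carrier Q" for i j s by (rule coA_c[OF that])
  note ts = E.tens_mult cR_tens coA_x_right coA_y_right coA_x_left coA_y_left K.m_ac cc q_pow_c
  show "cR i j k l (r \<otimes>\<^bsub>E.Q\<^esub> Xr) = (if i = 0 then \<zero> else cR (i - 1) j k l r)"
    using cR_shift(1)[OF h r g(1) K.one_closed, of "i \<noteq> 0" "i - 1" j k l] h E.R.linD(1)[OF cR_lin r, of "i - 1" j k l] by (simp add: ts)
  show "cR i j k l (r \<otimes>\<^bsub>E.Q\<^esub> Xl) = (if k = 0 then \<zero> else q [^] l \<otimes> cR i j (k - 1) l r)"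
    using cR_shift(1)[OF h r g(3) q_pow_c, of "k \<noteq> 0" i j "k - 1" l l] h by (simp add: ts)
  show "cR i j k l (r \<otimes>\<^bsub>E.Q\<^esub> Yr) = (if j = 0 then \<zero> else q [^] i \<otimes> cR i (j - 1) k l r)"
    using cR_shift(1)[OF h r g(2) q_pow_c, of "j \<noteq> 0" i "j - 1" k l i] h by (simp add: ts)
  show "cR i j k l (r \<otimes>\<^bsub>E.Q\<^esub> Yl) = (if l = 0 then \<zero> else cR i j k (l - 1) r)"
    using cR_shift(1)[OF h r g(4) K.one_closed, of "l \<noteq> 0" i j k "l - 1"] h E.R.linD(1)[OF cR_lin r, of i j k "l - 1"] by (simp add: ts)
  show "cR i j k l (Xr \<otimes>\<^bsub>E.Q\<^esub> r) = (if i = 0 then \<zero> else q [^] j \<otimes> cR (i - 1) j k l r)"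
    using cR_shift(2)[OF h r g(1) q_pow_c, of "i \<noteq> 0" "i - 1" j k l j] h by (simp add: ts)
  show "cR i j k l (Xl \<otimes>\<^bsub>E.Q\<^esub> r) = (if k = 0 then \<zero> else cR i j (k - 1) l r)"
    using cR_shift(2)[OF h r g(3) K.one_closed, of "k \<noteq> 0" i j "k - 1" l] h E.R.linD(1)[OF cR_lin r, of i j "k - 1" l] by (simp add: ts)
  show "cR i j k l (Yr \<otimes>\<^bsub>E.Q\<^esub> r) = (if j = 0 then \<zero> else cR i (j - 1) k l r)"
    using cR_shift(2)[OF h r g(2) K.one_closed, of "j \<noteq> 0" i "j - 1" k l] h E.R.linD(1)[OF cR_lin r, of i "j - 1" k l] by (simp add: ts)
  show "cR i j k l (Yl \<otimes>\<^bsub>E.Q\<^esub> r) = (if l = 0 then \<zero> else q [^] k \<otimes> cR i j k (l - 1) r)"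
    using cR_shift(2)[OF h r g(4) q_pow_c, of "l \<noteq> 0" i j k "l - 1" k] h by (simp add: ts)
qed

sublocale W: qring_free K E.Q a b q Xr Yr Xl Yl cR by (rule env_qring)

lemma coA_one: "k < a \<Longrightarrow> l < b \<Longrightarrow> coA k l \<one>\<^bsub>Q\<^esub> = (if k = 0 \<and> l = 0 then \<one> else \<zero>)"
proof -
  have "\<one>\<^bsub>Q\<^esub> = mon 0 0" using cls_one by (simp add: mon_def fm)
  then show "k < a \<Longrightarrow> l < b \<Longrightarrow> coA k l \<one>\<^bsub>Q\<^esub> = (if k = 0 \<and> l = 0 then \<one> else \<zero>)" using coA_mon by auto
qed

text \<open>An element of \<open>Sy\<close> has the form \<open>1 \<otimes> v\<close>, and it sends
  the identity to \<open>v\<close>.\<close>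

lemma coA_prod_one:
  assumes u: "u \<in> W.Sy" and k: "k < a" and l: "l < b"
  shows "coA k l (u \<odot>\<^bsub>E.M\<^esub> \<one>\<^bsub>Q\<^esub>) = cR 0 0 k l u"
proof -
  have uR: "u \<in> carrier E.Q" using W.SyD(1)[OF u] .
  obtain v where v: "v \<in> carrier Q" "\<And>k l. k < a \<Longrightarrow> l < b \<Longrightarrow> coA k l v = cR 0 0 k l u"
  proof -
    show ?thesis
    proof (rule AB.coord_exists[of "\<lambda>p. cR 0 0 (fst p) (snd p) u"])
      show "cR 0 0 (fst p) (snd p) u \<in> carrier K" if "p \<in> {..<a} \<times> {..<b}" for p
        using that a2 b2 by (intro E.R.linD(1)[OF cR_lin uR]) auto
      fix v assume v: "v \<in> carrier Q" and e: "\<And>p. p \<in> {..<a} \<times> {..<b} \<Longrightarrow> coA (fst p) (snd p) v = cR 0 0 (fst p) (snd p) u"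
      have "coA k l v = cR 0 0 k l u" if "k < a" "l < b" for k l using e[of "(k, l)"] that by simp
      then show ?thesis using v that by blast
    qed
  qed
  have "u = E.tens \<one>\<^bsub>Q\<^esub> v"
  proof (rule W.co_ext[OF uR])
    show "E.tens \<one>\<^bsub>Q\<^esub> v \<in> carrier E.Q" using v by simp
    fix i j k l assume h: "i < a" "j < b" "k < a" "l < b"
    have "cR i j k l u = (if i = 0 \<and> j = 0 then cR 0 0 k l u else \<zero>)"
      using W.SxD(2)[OF W.SyD(2)[OF u], of i j k l] W.SyD(3)[OF u, of j k l] h by auto
    then show "cR i j k l u = cR i j k l (E.tens \<one>\<^bsub>Q\<^esub> v)"
      using v(2)[OF h(3,4)] coA_c[OF h(3,4) v(1)] h by (simp add: cR_tens v(1) coA_one)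
  qed
  then have "u \<odot>\<^bsub>E.M\<^esub> \<one>\<^bsub>Q\<^esub> = v" using E.smult_tens[of "\<one>\<^bsub>Q\<^esub>" v "\<one>\<^bsub>Q\<^esub>"] v(1) by simp
  then show ?thesis using v(2)[OF k l] by simp
qed

text \<open>The augmentation of \<open>T\<close> is \<open>\<epsilon>\<close> composed with
  \<open>f 0\<close>. Since \<open>f\<close> is bijective in degrees 0 and 1 and commutes with the
  differentials, the kernel of this augmentation is the image of \<open>d 1\<close>, and all that
  \<open>tate_qring\<close> asks of \<open>T\<close> is available.\<close>

theorem tate_dim:
  fixes T :: "int \<Rightarrow> (((qci_var list \<Rightarrow> 'k) set \<times> (qci_var list \<Rightarrow> 'k) set \<Rightarrow> 'k) set, 'm) module"
  assumes res: "complete_resolution E.Q E.M T d"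
  shows "has_dimension K (Hom_cohomology E.Q T d E.M n) (card (Dm (- n - 1)))"
proof -
  note r = res[unfolded complete_resolution_def]
  have Tc: "module_complex E.Q T d" by (rule conjunct1[OF r])
  have Tp: "projective_module E.Q (T n)" for n using conjunct1[OF conjunct2[OF r]] by simp
  have Td: "Hom_coboundaries E.Q T d (regular_module E.Q) n = Hom_cocycles E.Q T d (regular_module E.Q) n" for n
    using conjunct1[OF conjunct2[OF conjunct2[OF conjunct2[OF r]]]] by (rule spec)
  obtain P :: "int \<Rightarrow> (((qci_var list \<Rightarrow> 'k) set \<times> (qci_var list \<Rightarrow> 'k) set \<Rightarrow> 'k) set, 'm) module" and e \<epsilon> f
    where Pall: "projective_resolution E.Q E.M P e \<epsilon> \<and> (\<forall>n. f n \<in> module_hom E.Q (T n) (P n)) \<and>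
      (\<forall>n. \<forall>x\<in>carrier (T n). f (n - 1) (d n x) = e n (f n x)) \<and> (\<forall>n\<ge>0. bij_betw (f n) (carrier (T n)) (carrier (P n)))"
    using conjunct2[OF conjunct2[OF conjunct2[OF conjunct2[OF r]]]] by (elim exE) rule
  note pr = conjunct1[OF Pall, unfolded projective_resolution_def]
  have fh: "f n \<in> module_hom E.Q (T n) (P n)" for n using conjunct1[OF conjunct2[OF Pall]] by (rule spec)
  have fc: "f (n - 1) (d n x) = e n (f n x)" if "x \<in> carrier (T n)" for n x
    using conjunct1[OF conjunct2[OF conjunct2[OF Pall]]] that by simp
  have fb: "bij_betw (f n) (carrier (T n)) (carrier (P n))" if "0 \<le> n" for n
    using conjunct2[OF conjunct2[OF conjunct2[OF Pall]]] that by simp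
  have eh: "\<epsilon> \<in> module_hom E.Q (P 0) E.M" using pr by (elim conjE)
  have es: "\<epsilon> ` carrier (P 0) = carrier E.M" using pr by (elim conjE)
  have ek: "e 1 ` carrier (P 1) = {x \<in> carrier (P 0). \<epsilon> x = \<zero>\<^bsub>E.M\<^esub>}" using pr by (elim conjE)
  note Pc = conjunct1[OF pr, unfolded module_complex_def] and Tc' = Tc[unfolded module_complex_def]
  have Pm: "left_module E.Q (P n)" for n using conjunct1[OF Pc] by (rule spec)
  have ehom: "e n \<in> module_hom E.Q (P n) (P (n - 1))" for n using conjunct1[OF conjunct2[OF Pc]] by (rule spec)
  have Tm: "left_module E.Q (T n)" for n using conjunct1[OF Tc'] by (rule spec)
  have dh: "d n \<in> module_hom E.Q (T n) (T (n - 1))" for n using conjunct1[OF conjunct2[OF Tc']] by (rule spec)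
  have dd: "d n (d (n + 1) x) = \<zero>\<^bsub>T (n - 1)\<^esub>" if "x \<in> carrier (T (n + 1))" for n x
    using conjunct2[OF conjunct2[OF Tc']] that by simp
  note P0 = Pm[of 0] and T0 = Tm[of 0]
  interpret P0: left_module E.Q "P 0" by (rule P0)
  \<comment> \<open>Zero is in the image of \<open>e 1\<close>, which is the kernel of
    \<open>\<epsilon>\<close>. The usual argument would presuppose the module laws of the bimodule,
    which are obtained only afterwards, by transport along \<open>\<epsilon>\<close>.\<close>
  have e0: "\<epsilon> \<zero>\<^bsub>P 0\<^esub> = \<zero>\<^bsub>E.M\<^esub>"
  proof -
    interpret P1: left_module E.Q "P 1" by (rule Pm)
    have z1: "\<zero>\<^bsub>P 1\<^esub> \<in> carrier (P 1)" by (rule P1.M.zero_closed)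
    have "e 1 \<in> module_hom E.Q (P 1) (P 0)" using ehom[of 1] by simp
    from module_hom_map_zero[OF Pm Pm this] have "\<zero>\<^bsub>P 0\<^esub> = e 1 \<zero>\<^bsub>P 1\<^esub>" by simp
    then have "\<zero>\<^bsub>P 0\<^esub> \<in> e 1 ` carrier (P 1)" using z1 by blast
    then show ?thesis unfolding ek by simp
  qed
  have M: "left_module E.Q E.M"
    by (rule image_left_module[where h = \<epsilon> and F = "P 0", OF P0 es _ _ e0]) (rule module_homD(2,3)[OF eh]; assumption)+
  define \<eta> where "\<eta> = (\<lambda>x. \<epsilon> (f 0 x))"
  have eta: "\<eta> \<in> module_hom E.Q (T 0) E.M" unfolding \<eta>_def by (rule module_hom_comp[OF fh eh])
  have f0: "f 0 ` carrier (T 0) = carrier (P 0)" "inj_on (f 0) (carrier (T 0))" and f1: "f 1 ` carrier (T 1) = carrier (P 1)"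
    using fb[of 0] fb[of 1] by (auto simp: bij_betw_def)
  have eta_sur: "\<eta> ` carrier (T 0) = carrier E.M"
    unfolding \<eta>_def image_image[of \<epsilon> "f 0", symmetric] f0(1) es ..
  have dc: "d 1 x \<in> carrier (T 0)" if "x \<in> carrier (T 1)" for x
    using module_homD(1)[OF dh[of 1] that] by simp
  have eta_ker: "{x \<in> carrier (T 0). \<eta> x = \<zero>\<^bsub>E.M\<^esub>} = d 1 ` carrier (T 1)"
  proof
    show "{x \<in> carrier (T 0). \<eta> x = \<zero>\<^bsub>E.M\<^esub>} \<subseteq> d 1 ` carrier (T 1)"
    proof clarify
      fix x assume x: "x \<in> carrier (T 0)" "\<eta> x = \<zero>\<^bsub>E.M\<^esub>"
      have "f 0 x \<in> e 1 ` carrier (P 1)" unfolding ek using x module_homD(1)[OF fh[of 0]] by (simp add: \<eta>_def)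
      then obtain t where t: "t \<in> carrier (T 1)" "f 0 x = e 1 (f 1 t)" unfolding f1[symmetric] by blast
      have "f 0 (d 1 t) = f 0 x" using fc[OF t(1)] t(2) by simp
      then have "d 1 t = x" using f0(2) dc[OF t(1)] x(1) by (simp add: inj_on_def)
      then show "x \<in> d 1 ` carrier (T 1)" using t(1) by blast
    qed
    show "d 1 ` carrier (T 1) \<subseteq> {x \<in> carrier (T 0). \<eta> x = \<zero>\<^bsub>E.M\<^esub>}"
    proof clarify
      fix t assume t: "t \<in> carrier (T 1)"
      have "f 0 (d 1 t) = e 1 (f 1 t)" using fc[OF t] by simp
      moreover have "e 1 (f 1 t) \<in> {x \<in> carrier (P 0). \<epsilon> x = \<zero>\<^bsub>E.M\<^esub>}" unfolding ek[symmetric] using f1 t by blast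
      ultimately show "d 1 t \<in> carrier (T 0) \<and> \<eta> (d 1 t) = \<zero>\<^bsub>E.M\<^esub>" using dc[OF t] by (simp add: \<eta>_def)
    qed
  qed
  have tt: "tate K E.Q T d"
    by (intro tate.intro tate_axioms.intro E.R.kalgebra_axioms Tm Tp dh dd) (simp_all add: Td)
  interpret TQ: tate_qring K E.Q a b q Xr Yr Xl Yl cR T d E.M "\<one>\<^bsub>Q\<^esub>" \<eta>
  proof (intro tate_qring.intro tate_qring_axioms.intro env_qring tt M eta eta_sur eta_ker)
    show "\<one>\<^bsub>Q\<^esub> \<in> carrier E.M" by (simp add: E.M_simps)
    show "\<exists>r\<in>carrier E.Q. v = r \<odot>\<^bsub>E.M\<^esub> \<one>\<^bsub>Q\<^esub>" if "v \<in> carrier E.M" for v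
      using that E.smult_tens[of v "\<one>\<^bsub>Q\<^esub>" "\<one>\<^bsub>Q\<^esub>"] by (intro bexI[of _ "E.tens v \<one>\<^bsub>Q\<^esub>"]) (simp_all add: E.M_simps)
    show "Xr \<odot>\<^bsub>E.M\<^esub> \<one>\<^bsub>Q\<^esub> = Xl \<odot>\<^bsub>E.M\<^esub> \<one>\<^bsub>Q\<^esub>" "Yr \<odot>\<^bsub>E.M\<^esub> \<one>\<^bsub>Q\<^esub> = Yl \<odot>\<^bsub>E.M\<^esub> \<one>\<^bsub>Q\<^esub>"
      by (simp_all add: E.smult_tens)
    show "u = \<zero>\<^bsub>E.Q\<^esub>" if u: "u \<in> W.Sy" and 0: "u \<odot>\<^bsub>E.M\<^esub> \<one>\<^bsub>Q\<^esub> = \<zero>\<^bsub>E.M\<^esub>" for u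
    proof (rule W.co_ext[OF W.SyD(1)[OF u] E.R.A.zero_closed])
      fix i j k l assume h: "i < a" "j < b" "k < a" "l < b"
      have "cR 0 0 k l u = \<zero>"
        using coA_prod_one[OF u h(3,4)] A.linD(4)[OF coA_lin[OF h(3,4)]] unfolding 0 by (simp add: E.M_simps)
      then have "cR i j k l u = \<zero>"
        using W.SxD(2)[OF W.SyD(2)[OF u], of i j k l] W.SyD(3)[OF u, of j k l] h by (cases "i = 0"; cases "j = 0") auto
      then show "cR i j k l u = cR i j k l \<zero>\<^bsub>E.Q\<^esub>" using W.co_zero[OF h] by simp
    qed
  qed
  have "finite (Dm (- n - 1))" by (simp add: Dm_def)
  from tate.cohomology_dim[OF tt M this TQ.corr_main] show ?thesis .
qed

end

text \<open>The antidiagonals of the square of positions with both indices -1 or -2 have one, two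
  and one elements.\<close>

lemma card_Dm: "card (Dm (- n - 1)) = (if n = 0 then 1 else if n = 1 then 2 else if n = 2 then 1 else 0)"
proof -
  have "Dm (- n - 1) = (if n = 0 then {-1} else if n = 1 then {-1, -2} else if n = 2 then {-2} else {})"
    by (auto simp: Dm_def)
  then show ?thesis by simp
qed

theorem theorem4p9:
  fixes K :: "('k, 'z) ring_scheme"
    and a b :: nat and q :: 'k and n :: int
    and A :: "('k, (qci_var list \<Rightarrow> 'k) set) module"
    and T :: "int \<Rightarrow>
      (((qci_var list \<Rightarrow> 'k) set \<times> (qci_var list \<Rightarrow> 'k) set \<Rightarrow> 'k) set, 'm) module"
    and d :: "int \<Rightarrow> 'm \<Rightarrow> 'm"
  assumes "field K"
    and "2 \<le> a" and "2 \<le> b"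
    and "q \<in> carrier K" and "q \<noteq> \<zero>\<^bsub>K\<^esub>"
    and "\<And>m::nat. m > 0 \<Longrightarrow> q [^]\<^bsub>K\<^esub> m \<noteq> \<one>\<^bsub>K\<^esub>"
    and "A = qci K a b q"
    and "complete_resolution (enveloping_algebra K A) (regular_bimodule K A) T d"
  shows "has_dimension K (tate_hochschild K A T d (regular_bimodule K A) n)
    (if n = 0 then 1 else if n = 1 then 2 else if n = 2 then 1 else 0)"
proof -
  interpret qci_env K a b q
    by (intro qci_env.intro qci_alg.intro qci_alg_axioms.intro qci_env_axioms.intro assms)
  have A: "A = Q" using assms(7) by (simp add: qci_eq)
  have "complete_resolution E.Q (regular_bimodule K Q) T d" using assms(8) unfolding A E.env_eq .
  from tate_dim[OF this, of n] show ?thesis unfolding card_Dm A tate_hochschild_def E.env_eq .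
qed

end
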